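(* Let $R$ be a commutative unital ring, let $\mathcal{M}=(C_1,C_2,C_3,q_1,q_2,q_3,m)$ be a composition of quadratic forms over $R$ of constant rank 8, and let $\Gamma=(\gamma_1,\gamma_2,\gamma_3)\in(R^* )^3$. The module $R^3\times C_1\times C_2\times C_3$ is a cubic norm structure with base point $e=\sum e_i$ and norm $N$ and adjoint map $\sharp$ defined, for $x=\sum\alpha_ie_i+\sum u_i[jl]$, by \[N(x)=\alpha_1\alpha_2\alpha_3+\gamma_1\gamma_2\gamma_3\langle m(u_3,u_2),u_1\rangle_1-\sum\gamma_j\gamma_l\alpha_iq_i(u_i)\] and \[x^\sharp=\sum(\alpha_j\alpha_l-\gamma_j\gamma_lq_i(u_i))e_i+\sum(\gamma_im_i(u_l,u_j)-\alpha_iu_i)[jl].\] Moreover, the bilinear trace $T$ of this cubic norm structure satisfies \[T(x,y)=\sum\alpha_i\beta_i+\sum\gamma_j\gamma_l\langle u_i,v_i\rangle_i,\] where $y=\sum\beta_ie_i+\sum v_i[jl]$. The cubic Jordan algebra of this cubic norm structure is an Albert algebra.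
   Context: An $R$-ring is a commutative associative unital $R$-algebra; an $R$-field is an $R$-ring that is a field. A composition of quadratic forms over $R$ is a heptuple $\mathcal{M}=(C_1,C_2,C_3,q_1,q_2,q_3,m)$ where $C_1,C_2,C_3$ are projective $R$-modules of the same rank (the rank of $\mathcal{M}$), $q_i$ is a nonsingular quadratic form on $C_i$ with polar form $\langle x,y\rangle_i=q_i(x+y)-q_i(x)-q_i(y)$, and $m:C_3\times C_2\to C_1$ is bilinear with $q_1(m(x,y))=q_3(x)q_2(y)$. In rank 8 the forms $\langle\,,\rangle_i$ are non-degenerate (induce isomorphisms $C_i\to C_i^*$). Put $m_1=m$, and define bilinear maps $m_2:C_1\times C_3\to C_2$, $m_3:C_2\times C_1\to C_3$ by $\langle m_2(x_1,x_3),x_2\rangle_2=\langle x_1,m(x_3,x_2)\rangle_1$ and $\langle x_3,m_3(x_2,x_1)\rangle_3=\langle m(x_3,x_2),x_1\rangle_1$. Elements $(\alpha_1,\alpha_2,\alpha_3,u_1,u_2,u_3)$ of $R^3\times C_1\times C_2\times C_3$ are written $\sum\alpha_ie_i+\sum u_i[jl]$; all sums run over the cyclic permutations $(i,j,l)$ of $(1,2,3)$. A cubic norm structure over $R$ is an $R$-module $A$ with a base point $1$, a cubic form $N:A\to R$ and a quadratic map $x\mapsto x^\sharp$ on $A$. Write $x\times y=(x+y)^\sharp-x^\sharp-y^\sharp$, let $N(x;y)$ be the coefficient of $t$ in $N(x+ty)$, $N(x,y,z)=N(x+y;z)-N(x;z)-N(y;z)$, and $T(y,z)=N(1;y)N(1;z)-N(1,y,z)$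 (the bilinear trace). It is required that, in all scalar extensions, $N(1)=1$, $1^\sharp=1$, $(x^\sharp)^\sharp=N(x)x$, $N(x;y)=T(x^\sharp,y)$ and $1\times x=T(x,1)1-x$. The associated cubic Jordan algebra is $A$ with unity $1$ and $U$-operator $U_xy=T(x,y)x-x^\sharp\times y$. An Albert algebra over $R$ is a cubic Jordan $R$-algebra $A$ (Jordan algebra of a cubic norm structure) whose underlying module is projective of constant rank 27 and such that the Jordan algebra $A\otimes_Rk$ is simple for every $R$-field $k$. *)

theory Defs
  imports "HOL-Algebra.Algebra"
begin

section \<open>Modules\<close>

text \<open>
  Only the fields \<open>carrier\<close>, \<open>zero\<close>, \<open>add\<close>, \<open>smult\<close> of a \<open>module\<close> record matter for a module;
  the inherited fields \<open>mult\<close> and \<open>one\<close> are left \<open>undefined\<close> below.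
\<close>

definition self_module :: "'r ring \<Rightarrow> ('r, 'r) module" where
  "self_module R =
     \<lparr>carrier = carrier R, monoid.mult = monoid.mult R, one = \<one>\<^bsub>R\<^esub>, ring.zero = \<zero>\<^bsub>R\<^esub>,
      add = add R, smult = monoid.mult R\<rparr>"

definition free_module :: "'r ring \<Rightarrow> nat \<Rightarrow> ('r, nat \<Rightarrow> 'r) module" where
  "free_module R n =
     \<lparr>carrier = {..<n} \<rightarrow>\<^sub>E carrier R, monoid.mult = undefined, one = undefined,
      ring.zero = (\<lambda>i\<in>{..<n}. \<zero>\<^bsub>R\<^esub>),
      add = (\<lambda>f g. \<lambda>i\<in>{..<n}. f i \<oplus>\<^bsub>R\<^esub> g i),
      smult = (\<lambda>r f. \<lambda>i\<in>{..<n}. r \<otimes>\<^bsub>R\<^esub> f i)\<rparr>"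

definition linear_maps :: "'r ring \<Rightarrow> ('r, 'a) module \<Rightarrow> ('r, 'b) module \<Rightarrow> ('a \<Rightarrow> 'b) set" where
  "linear_maps R M N =
     {f \<in> carrier M \<rightarrow> carrier N.
        (\<forall>x\<in>carrier M. \<forall>y\<in>carrier M. f (x \<oplus>\<^bsub>M\<^esub> y) = f x \<oplus>\<^bsub>N\<^esub> f y) \<and>
        (\<forall>r\<in>carrier R. \<forall>x\<in>carrier M. f (r \<odot>\<^bsub>M\<^esub> x) = r \<odot>\<^bsub>N\<^esub> f x)}"

definition bilinear_map ::
  "'r ring \<Rightarrow> ('r, 'a) module \<Rightarrow> ('r, 'b) module \<Rightarrow> ('r, 'c) module \<Rightarrow> ('a \<Rightarrow> 'b \<Rightarrow> 'c) \<Rightarrow> bool" where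
  "bilinear_map R M N P b \<longleftrightarrow>
     (\<forall>x\<in>carrier M. b x \<in> linear_maps R N P) \<and>
     (\<forall>y\<in>carrier N. (\<lambda>x. b x y) \<in> linear_maps R M P)"

text \<open>A retract of \<open>R\<^sup>n\<close>, that is, isomorphic to a direct summand of \<open>R\<^sup>n\<close> for some \<open>n\<close>.\<close>

definition fg_projective :: "'r ring \<Rightarrow> ('r, 'a) module \<Rightarrow> bool" where
  "fg_projective R M \<longleftrightarrow>
     module R M \<and>
     (\<exists>n. \<exists>s\<in>linear_maps R M (free_module R n). \<exists>p\<in>linear_maps R (free_module R n) M.
        \<forall>x\<in>carrier M. p (s x) = x)"

definition free_of_rank :: "'r ring \<Rightarrow> ('r, 'a) module \<Rightarrow> nat \<Rightarrow> bool" where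
  "free_of_rank R M n \<longleftrightarrow>
     (\<exists>f\<in>linear_maps R M (free_module R n). bij_betw f (carrier M) (carrier (free_module R n)))"


subsection \<open>Scalar extension\<close>

text \<open>
  An \<open>R\<close>-ring is a commutative ring \<open>S\<close> with a homomorphism \<open>\<phi>\<close> from \<open>R\<close>.  The tensor product of
  an \<open>R\<close>-module \<open>M\<close> with \<open>S\<close> is the free abelian group on \<open>M \<times> S\<close> modulo the usual relations,
  with \<open>S\<close> acting on the second factor.
\<close>

definition tensor_relations ::
  "'r ring \<Rightarrow> 's ring \<Rightarrow> ('r \<Rightarrow> 's) \<Rightarrow> ('r, 'a) module \<Rightarrow> ('a \<times> 's \<Rightarrow>\<^sub>0 int) set" where
  "tensor_relations R S \<phi> M =
     {frag_of (x \<oplus>\<^bsub>M\<^esub> y, s) - frag_of (x, s) - frag_of (y, s) | x y s.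
        x \<in> carrier M \<and> y \<in> carrier M \<and> s \<in> carrier S} \<union>
     {frag_of (x, s \<oplus>\<^bsub>S\<^esub> t) - frag_of (x, s) - frag_of (x, t) | x s t.
        x \<in> carrier M \<and> s \<in> carrier S \<and> t \<in> carrier S} \<union>
     {frag_of (r \<odot>\<^bsub>M\<^esub> x, s) - frag_of (x, \<phi> r \<otimes>\<^bsub>S\<^esub> s) | r x s.
        r \<in> carrier R \<and> x \<in> carrier M \<and> s \<in> carrier S}"

definition tensor_kernel ::
  "'r ring \<Rightarrow> 's ring \<Rightarrow> ('r \<Rightarrow> 's) \<Rightarrow> ('r, 'a) module \<Rightarrow> ('a \<times> 's \<Rightarrow>\<^sub>0 int) set" where
  "tensor_kernel R S \<phi> M =
     generate (free_Abelian_group (carrier M \<times> carrier S)) (tensor_relations R S \<phi> M)"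

definition tensor ::
  "'r ring \<Rightarrow> 's ring \<Rightarrow> ('r \<Rightarrow> 's) \<Rightarrow> ('r, 'a) module \<Rightarrow> ('s, ('a \<times> 's \<Rightarrow>\<^sub>0 int) set) module" where
  "tensor R S \<phi> M =
     (let F = free_Abelian_group (carrier M \<times> carrier S); K = tensor_kernel R S \<phi> M in
      \<lparr>carrier = carrier (F Mod K), monoid.mult = undefined, one = undefined,
       ring.zero = one (F Mod K), add = monoid.mult (F Mod K),
       smult = (\<lambda>t V. K <#>\<^bsub>F\<^esub> frag_extend (\<lambda>(x, s). frag_of (x, t \<otimes>\<^bsub>S\<^esub> s)) ` V)\<rparr>)"

definition pure_tensor ::
  "'r ring \<Rightarrow> 's ring \<Rightarrow> ('r \<Rightarrow> 's) \<Rightarrow> ('r, 'a) module \<Rightarrow> 'a \<Rightarrow> 's \<Rightarrow> ('a \<times> 's \<Rightarrow>\<^sub>0 int) set" where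
  "pure_tensor R S \<phi> M x s =
     tensor_kernel R S \<phi> M #>\<^bsub>free_Abelian_group (carrier M \<times> carrier S)\<^esub> frag_of (x, s)"


subsection \<open>Localization at a prime ideal and constant rank\<close>

definition loc_frac :: "'r ring \<Rightarrow> 'r set \<Rightarrow> 'r \<Rightarrow> 'r \<Rightarrow> ('r \<times> 'r) set" where
  "loc_frac R P a s =
     {(b, t). b \<in> carrier R \<and> t \<in> carrier R - P \<and>
        (\<exists>u\<in>carrier R - P. u \<otimes>\<^bsub>R\<^esub> (a \<otimes>\<^bsub>R\<^esub> t) = u \<otimes>\<^bsub>R\<^esub> (b \<otimes>\<^bsub>R\<^esub> s))}"

definition localization :: "'r ring \<Rightarrow> 'r set \<Rightarrow> ('r \<times> 'r) set ring" where
  "localization R P =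
     \<lparr>carrier = {loc_frac R P a s | a s. a \<in> carrier R \<and> s \<in> carrier R - P},
      monoid.mult = (\<lambda>V W. \<Union>{loc_frac R P (a \<otimes>\<^bsub>R\<^esub> b) (s \<otimes>\<^bsub>R\<^esub> t) | a s b t.
         (a, s) \<in> V \<and> (b, t) \<in> W}),
      one = loc_frac R P \<one>\<^bsub>R\<^esub> \<one>\<^bsub>R\<^esub>,
      ring.zero = loc_frac R P \<zero>\<^bsub>R\<^esub> \<one>\<^bsub>R\<^esub>,
      add = (\<lambda>V W. \<Union>{loc_frac R P (a \<otimes>\<^bsub>R\<^esub> t \<oplus>\<^bsub>R\<^esub> b \<otimes>\<^bsub>R\<^esub> s) (s \<otimes>\<^bsub>R\<^esub> t) | a s b t.
         (a, s) \<in> V \<and> (b, t) \<in> W})\<rparr>"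

definition constant_rank :: "'r ring \<Rightarrow> ('r, 'a) module \<Rightarrow> nat \<Rightarrow> bool" where
  "constant_rank R M n \<longleftrightarrow>
     (\<forall>P. primeideal P R \<longrightarrow>
        free_of_rank (localization R P)
          (tensor R (localization R P) (\<lambda>r. loc_frac R P r \<one>\<^bsub>R\<^esub>) M) n)"


section \<open>Quadratic maps and compositions of quadratic forms\<close>

definition polar ::
  "('r, 'a) module \<Rightarrow> ('b, 'z) ring_scheme \<Rightarrow> ('a \<Rightarrow> 'b) \<Rightarrow> 'a \<Rightarrow> 'a \<Rightarrow> 'b" where
  "polar M N q x y = q (x \<oplus>\<^bsub>M\<^esub> y) \<ominus>\<^bsub>N\<^esub> q x \<ominus>\<^bsub>N\<^esub> q y"

definition quadratic_map ::
  "'r ring \<Rightarrow> ('r, 'a) module \<Rightarrow> ('r, 'b) module \<Rightarrow> ('a \<Rightarrow> 'b) \<Rightarrow> bool" where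
  "quadratic_map R M N q \<longleftrightarrow>
     q \<in> carrier M \<rightarrow> carrier N \<and>
     (\<forall>r\<in>carrier R. \<forall>x\<in>carrier M. q (r \<odot>\<^bsub>M\<^esub> x) = (r \<otimes>\<^bsub>R\<^esub> r) \<odot>\<^bsub>N\<^esub> q x) \<and>
     bilinear_map R M M N (polar M N q)"

abbreviation quadratic_form :: "'r ring \<Rightarrow> ('r, 'a) module \<Rightarrow> ('a \<Rightarrow> 'r) \<Rightarrow> bool" where
  "quadratic_form R M q \<equiv> quadratic_map R M (self_module R) q"

text \<open>
  The polar form induces an isomorphism from \<open>M\<close> onto its dual.  On modules of constant even rank
  (the only case used here) this is what nonsingularity of \<open>q\<close> means.
\<close>

definition nonsingular :: "'r ring \<Rightarrow> ('r, 'a) module \<Rightarrow> ('a \<Rightarrow> 'r) \<Rightarrow> bool" where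
  "nonsingular R M q \<longleftrightarrow>
     (\<forall>f\<in>linear_maps R M (self_module R).
        \<exists>!x. x \<in> carrier M \<and> (\<forall>y\<in>carrier M. polar M R q x y = f y))"

record ('r, 'c1, 'c2, 'c3) composition =
  C1 :: "('r, 'c1) module"
  C2 :: "('r, 'c2) module"
  C3 :: "('r, 'c3) module"
  q1 :: "'c1 \<Rightarrow> 'r"
  q2 :: "'c2 \<Rightarrow> 'r"
  q3 :: "'c3 \<Rightarrow> 'r"
  mul :: "'c3 \<Rightarrow> 'c2 \<Rightarrow> 'c1"

definition composition_of_rank8 :: "'r ring \<Rightarrow> ('r, 'c1, 'c2, 'c3) composition \<Rightarrow> bool" where
  "composition_of_rank8 R \<M> \<longleftrightarrow>
     fg_projective R (C1 \<M>) \<and> constant_rank R (C1 \<M>) 8 \<and>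
     fg_projective R (C2 \<M>) \<and> constant_rank R (C2 \<M>) 8 \<and>
     fg_projective R (C3 \<M>) \<and> constant_rank R (C3 \<M>) 8 \<and>
     quadratic_form R (C1 \<M>) (q1 \<M>) \<and> nonsingular R (C1 \<M>) (q1 \<M>) \<and>
     quadratic_form R (C2 \<M>) (q2 \<M>) \<and> nonsingular R (C2 \<M>) (q2 \<M>) \<and>
     quadratic_form R (C3 \<M>) (q3 \<M>) \<and> nonsingular R (C3 \<M>) (q3 \<M>) \<and>
     bilinear_map R (C3 \<M>) (C2 \<M>) (C1 \<M>) (mul \<M>) \<and>
     (\<forall>x\<in>carrier (C3 \<M>). \<forall>y\<in>carrier (C2 \<M>).
        q1 \<M> (mul \<M> x y) = q3 \<M> x \<otimes>\<^bsub>R\<^esub> q2 \<M> y)"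

definition bil1 where "bil1 R \<M> = polar (C1 \<M>) R (q1 \<M>)"
definition bil2 where "bil2 R \<M> = polar (C2 \<M>) R (q2 \<M>)"
definition bil3 where "bil3 R \<M> = polar (C3 \<M>) R (q3 \<M>)"

definition mul2 :: "'r ring \<Rightarrow> ('r, 'c1, 'c2, 'c3) composition \<Rightarrow> 'c1 \<Rightarrow> 'c3 \<Rightarrow> 'c2" where
  "mul2 R \<M> x1 x3 =
     (THE z. z \<in> carrier (C2 \<M>) \<and>
        (\<forall>x2\<in>carrier (C2 \<M>). bil2 R \<M> z x2 = bil1 R \<M> x1 (mul \<M> x3 x2)))"

definition mul3 :: "'r ring \<Rightarrow> ('r, 'c1, 'c2, 'c3) composition \<Rightarrow> 'c2 \<Rightarrow> 'c1 \<Rightarrow> 'c3" where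
  "mul3 R \<M> x2 x1 =
     (THE z. z \<in> carrier (C3 \<M>) \<and>
        (\<forall>x3\<in>carrier (C3 \<M>). bil3 R \<M> x3 z = bil1 R \<M> (mul \<M> x3 x2) x1))"


section \<open>Cubic norm structures\<close>

text \<open>
  A cubic form on \<open>M\<close>, i.e. a homogeneous polynomial law of degree 3 from \<open>M\<close> to \<open>R\<close>, is not
  determined by its values on \<open>M\<close> alone, but it is determined by the pair of maps
  \<open>N\<close> and \<open>D\<close> with \<open>D x y = N(x;y)\<close>, the coefficient of \<open>t\<close> in \<open>N(x + ty)\<close>.  The pairs that
  arise in this way are those satisfying the following conditions.
\<close>

definition cubic_form ::
  "'r ring \<Rightarrow> ('r, 'a) module \<Rightarrow> ('a \<Rightarrow> 'r) \<Rightarrow> ('a \<Rightarrow> 'a \<Rightarrow> 'r) \<Rightarrow> bool" where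
  "cubic_form R M N D \<longleftrightarrow>
     N \<in> carrier M \<rightarrow> carrier R \<and>
     (\<forall>r\<in>carrier R. \<forall>x\<in>carrier M. N (r \<odot>\<^bsub>M\<^esub> x) = (r \<otimes>\<^bsub>R\<^esub> r \<otimes>\<^bsub>R\<^esub> r) \<otimes>\<^bsub>R\<^esub> N x) \<and>
     (\<forall>x\<in>carrier M. \<forall>y\<in>carrier M.
        N (x \<oplus>\<^bsub>M\<^esub> y) = N x \<oplus>\<^bsub>R\<^esub> D x y \<oplus>\<^bsub>R\<^esub> D y x \<oplus>\<^bsub>R\<^esub> N y) \<and>
     (\<forall>x\<in>carrier M. D x x = N x \<oplus>\<^bsub>R\<^esub> N x \<oplus>\<^bsub>R\<^esub> N x) \<and>
     (\<forall>x\<in>carrier M. D x \<in> linear_maps R M (self_module R)) \<and>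
     (\<forall>y\<in>carrier M. quadratic_form R M (\<lambda>x. D x y))"

text \<open>Over every scalar extension the pair has the defining property of \<open>N(x;y)\<close>:\<close>

lemma cubic_form_expand:
  assumes "cring R" "module R M" "cubic_form R M N D"
    and "x \<in> carrier M" "y \<in> carrier M" "t \<in> carrier R"
  shows "N (x \<oplus>\<^bsub>M\<^esub> t \<odot>\<^bsub>M\<^esub> y) =
    N x \<oplus>\<^bsub>R\<^esub> t \<otimes>\<^bsub>R\<^esub> D x y \<oplus>\<^bsub>R\<^esub> (t \<otimes>\<^bsub>R\<^esub> t) \<otimes>\<^bsub>R\<^esub> D y x \<oplus>\<^bsub>R\<^esub> (t \<otimes>\<^bsub>R\<^esub> t \<otimes>\<^bsub>R\<^esub> t) \<otimes>\<^bsub>R\<^esub> N y"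
proof -
  interpret module R M by fact
  show ?thesis
    using assms(3-6)
    unfolding cubic_form_def linear_maps_def quadratic_map_def self_module_def by auto
qed

definition bilinear_trace ::
  "'r ring \<Rightarrow> ('r, 'a) module \<Rightarrow> 'a \<Rightarrow> ('a \<Rightarrow> 'a \<Rightarrow> 'r) \<Rightarrow> 'a \<Rightarrow> 'a \<Rightarrow> 'r" where
  "bilinear_trace R M c D y z =
     D c y \<otimes>\<^bsub>R\<^esub> D c z \<ominus>\<^bsub>R\<^esub> (D (c \<oplus>\<^bsub>M\<^esub> y) z \<ominus>\<^bsub>R\<^esub> D c z \<ominus>\<^bsub>R\<^esub> D y z)"

text \<open>The identities required over one base ring, with base point \<open>c\<close> and adjoint map \<open>sh\<close>.\<close>

definition cubic_norm_identities ::
  "'r ring \<Rightarrow> ('r, 'a) module \<Rightarrow> 'a \<Rightarrow> ('a \<Rightarrow> 'r) \<Rightarrow> ('a \<Rightarrow> 'a \<Rightarrow> 'r) \<Rightarrow> ('a \<Rightarrow> 'a) \<Rightarrow> bool" where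
  "cubic_norm_identities R M c N D sh \<longleftrightarrow>
     N c = \<one>\<^bsub>R\<^esub> \<and> sh c = c \<and>
     (\<forall>x\<in>carrier M. sh (sh x) = N x \<odot>\<^bsub>M\<^esub> x) \<and>
     (\<forall>x\<in>carrier M. \<forall>y\<in>carrier M. D x y = bilinear_trace R M c D (sh x) y) \<and>
     (\<forall>x\<in>carrier M. polar M M sh c x = bilinear_trace R M c D x c \<odot>\<^bsub>M\<^esub> c \<ominus>\<^bsub>M\<^esub> x)"

text \<open>
  \<open>(N', D')\<close> and \<open>sh'\<close> are the scalar extensions to \<open>S\<close> of the cubic form \<open>(N, D)\<close> and of the
  quadratic map \<open>sh\<close>.  They are determined on the carrier of \<open>tensor R S \<phi> M\<close>, since it is
  spanned by the pure tensors \<open>x \<otimes> 1\<close>.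
\<close>

definition scalar_extension ::
  "'r ring \<Rightarrow> 's ring \<Rightarrow> ('r \<Rightarrow> 's) \<Rightarrow> ('r, 'a) module \<Rightarrow>
   ('a \<Rightarrow> 'r) \<Rightarrow> ('a \<Rightarrow> 'a \<Rightarrow> 'r) \<Rightarrow> ('a \<Rightarrow> 'a) \<Rightarrow>
   (('a \<times> 's \<Rightarrow>\<^sub>0 int) set \<Rightarrow> 's) \<Rightarrow>
   (('a \<times> 's \<Rightarrow>\<^sub>0 int) set \<Rightarrow> ('a \<times> 's \<Rightarrow>\<^sub>0 int) set \<Rightarrow> 's) \<Rightarrow>
   (('a \<times> 's \<Rightarrow>\<^sub>0 int) set \<Rightarrow> ('a \<times> 's \<Rightarrow>\<^sub>0 int) set) \<Rightarrow> bool" where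
  "scalar_extension R S \<phi> M N D sh N' D' sh' \<longleftrightarrow>
     (let M' = tensor R S \<phi> M; \<iota> = (\<lambda>x. pure_tensor R S \<phi> M x \<one>\<^bsub>S\<^esub>) in
      cubic_form S M' N' D' \<and> quadratic_map S M' M' sh' \<and>
      (\<forall>x\<in>carrier M. N' (\<iota> x) = \<phi> (N x)) \<and>
      (\<forall>x\<in>carrier M. \<forall>y\<in>carrier M. D' (\<iota> x) (\<iota> y) = \<phi> (D x y)) \<and>
      (\<forall>x\<in>carrier M. sh' (\<iota> x) = \<iota> (sh x)))"

text \<open>
  HOL cannot quantify over types inside a definition, so the type \<open>'s\<close> carrying the scalar
  extensions is a parameter.  Theorems are to be stated for arbitrary \<open>'s\<close>.
\<close>

definition cubic_norm_structure ::
  "'s itself \<Rightarrow> 'r ring \<Rightarrow> ('r, 'a) module \<Rightarrow>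
   'a \<Rightarrow> ('a \<Rightarrow> 'r) \<Rightarrow> ('a \<Rightarrow> 'a \<Rightarrow> 'r) \<Rightarrow> ('a \<Rightarrow> 'a) \<Rightarrow> bool" where
  "cubic_norm_structure (_ :: 's itself) R M c N D sh \<longleftrightarrow>
     module R M \<and> c \<in> carrier M \<and>
     cubic_form R M N D \<and> quadratic_map R M M sh \<and>
     cubic_norm_identities R M c N D sh \<and>
     (\<forall>(S :: 's ring) \<phi>. cring S \<and> \<phi> \<in> ring_hom R S \<longrightarrow>
        (\<exists>N' D' sh'. scalar_extension R S \<phi> M N D sh N' D' sh' \<and>
           cubic_norm_identities S (tensor R S \<phi> M) (pure_tensor R S \<phi> M c \<one>\<^bsub>S\<^esub>) N' D' sh'))"


section \<open>Cubic Jordan algebras and Albert algebras\<close>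

text \<open>The \<open>U\<close>-operator; the unit element of the cubic Jordan algebra is the base point \<open>c\<close>.\<close>

definition cubic_U ::
  "'r ring \<Rightarrow> ('r, 'a) module \<Rightarrow> 'a \<Rightarrow> ('a \<Rightarrow> 'a \<Rightarrow> 'r) \<Rightarrow> ('a \<Rightarrow> 'a) \<Rightarrow> 'a \<Rightarrow> 'a \<Rightarrow> 'a" where
  "cubic_U R M c D sh x y =
     bilinear_trace R M c D x y \<odot>\<^bsub>M\<^esub> x \<ominus>\<^bsub>M\<^esub> polar M M sh (sh x) y"

text \<open>An ideal \<open>I\<close> of a quadratic Jordan algebra \<open>J\<close>: \<open>U\<^sub>I J\<close>, \<open>U\<^sub>J I\<close> and \<open>{I J J}\<close> lie in \<open>I\<close>.\<close>

definition jordan_ideal ::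
  "'r ring \<Rightarrow> ('r, 'a) module \<Rightarrow> ('a \<Rightarrow> 'a \<Rightarrow> 'a) \<Rightarrow> 'a set \<Rightarrow> bool" where
  "jordan_ideal R M U I \<longleftrightarrow>
     submodule I R M \<and>
     (\<forall>x\<in>I. \<forall>y\<in>carrier M. U x y \<in> I \<and> U y x \<in> I) \<and>
     (\<forall>x\<in>I. \<forall>y\<in>carrier M. \<forall>z\<in>carrier M. polar M M (\<lambda>w. U w y) x z \<in> I)"

definition simple_jordan ::
  "'r ring \<Rightarrow> ('r, 'a) module \<Rightarrow> ('a \<Rightarrow> 'a \<Rightarrow> 'a) \<Rightarrow> bool" where
  "simple_jordan R M U \<longleftrightarrow>
     carrier M \<noteq> {\<zero>\<^bsub>M\<^esub>} \<and>
     (\<forall>I. jordan_ideal R M U I \<longrightarrow> I = {\<zero>\<^bsub>M\<^esub>} \<or> I = carrier M)"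

text \<open>
  The cubic Jordan algebra of \<open>(M, c, N, D, sh)\<close> is an Albert algebra.  As above, the scalar
  extensions and the \<open>R\<close>-fields range over the types \<open>'s\<close> and \<open>'k\<close>.
\<close>

definition albert_algebra ::
  "'s itself \<Rightarrow> 'k itself \<Rightarrow> 'r ring \<Rightarrow> ('r, 'a) module \<Rightarrow>
   'a \<Rightarrow> ('a \<Rightarrow> 'r) \<Rightarrow> ('a \<Rightarrow> 'a \<Rightarrow> 'r) \<Rightarrow> ('a \<Rightarrow> 'a) \<Rightarrow> bool" where
  "albert_algebra ts (_ :: 'k itself) R M c N D sh \<longleftrightarrow>
     cubic_norm_structure ts R M c N D sh \<and>
     fg_projective R M \<and> constant_rank R M 27 \<and>
     (\<forall>(K :: 'k ring) \<phi>. field K \<and> \<phi> \<in> ring_hom R K \<longrightarrow>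
        (\<exists>N' D' sh'. scalar_extension R K \<phi> M N D sh N' D' sh' \<and>
           simple_jordan K (tensor R K \<phi> M)
             (cubic_U K (tensor R K \<phi> M) (pure_tensor R K \<phi> M c \<one>\<^bsub>K\<^esub>) D' sh')))"


section \<open>The cubic norm structure of a composition\<close>

text \<open>
  \<open>(\<alpha>\<^sub>1, \<alpha>\<^sub>2, \<alpha>\<^sub>3, u\<^sub>1, u\<^sub>2, u\<^sub>3)\<close> stands for \<open>\<Sum> \<alpha>\<^sub>i e\<^sub>i + \<Sum> u\<^sub>i[jl]\<close>.
\<close>

type_synonym ('r, 'c1, 'c2, 'c3) comp_elt = "'r \<times> 'r \<times> 'r \<times> 'c1 \<times> 'c2 \<times> 'c3"

definition comp_module ::
  "'r ring \<Rightarrow> ('r, 'c1, 'c2, 'c3) composition \<Rightarrow> ('r, ('r, 'c1, 'c2, 'c3) comp_elt) module" where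
  "comp_module R \<M> =
     \<lparr>carrier = carrier R \<times> carrier R \<times> carrier R \<times>
                carrier (C1 \<M>) \<times> carrier (C2 \<M>) \<times> carrier (C3 \<M>),
      monoid.mult = undefined, one = undefined,
      ring.zero = (\<zero>\<^bsub>R\<^esub>, \<zero>\<^bsub>R\<^esub>, \<zero>\<^bsub>R\<^esub>, \<zero>\<^bsub>C1 \<M>\<^esub>, \<zero>\<^bsub>C2 \<M>\<^esub>, \<zero>\<^bsub>C3 \<M>\<^esub>),
      add = (\<lambda>(a1, a2, a3, u1, u2, u3) (b1, b2, b3, v1, v2, v3).
        (a1 \<oplus>\<^bsub>R\<^esub> b1, a2 \<oplus>\<^bsub>R\<^esub> b2, a3 \<oplus>\<^bsub>R\<^esub> b3,
         u1 \<oplus>\<^bsub>C1 \<M>\<^esub> v1, u2 \<oplus>\<^bsub>C2 \<M>\<^esub> v2, u3 \<oplus>\<^bsub>C3 \<M>\<^esub> v3)),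
      smult = (\<lambda>r (a1, a2, a3, u1, u2, u3).
        (r \<otimes>\<^bsub>R\<^esub> a1, r \<otimes>\<^bsub>R\<^esub> a2, r \<otimes>\<^bsub>R\<^esub> a3,
         r \<odot>\<^bsub>C1 \<M>\<^esub> u1, r \<odot>\<^bsub>C2 \<M>\<^esub> u2, r \<odot>\<^bsub>C3 \<M>\<^esub> u3))\<rparr>"

definition comp_base ::
  "'r ring \<Rightarrow> ('r, 'c1, 'c2, 'c3) composition \<Rightarrow> ('r, 'c1, 'c2, 'c3) comp_elt" where
  "comp_base R \<M> = (\<one>\<^bsub>R\<^esub>, \<one>\<^bsub>R\<^esub>, \<one>\<^bsub>R\<^esub>, \<zero>\<^bsub>C1 \<M>\<^esub>, \<zero>\<^bsub>C2 \<M>\<^esub>, \<zero>\<^bsub>C3 \<M>\<^esub>)"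

fun comp_norm ::
  "'r ring \<Rightarrow> ('r, 'c1, 'c2, 'c3) composition \<Rightarrow> 'r \<times> 'r \<times> 'r \<Rightarrow>
   ('r, 'c1, 'c2, 'c3) comp_elt \<Rightarrow> 'r" where
  "comp_norm R \<M> (g1, g2, g3) (a1, a2, a3, u1, u2, u3) =
     a1 \<otimes>\<^bsub>R\<^esub> a2 \<otimes>\<^bsub>R\<^esub> a3 \<oplus>\<^bsub>R\<^esub> g1 \<otimes>\<^bsub>R\<^esub> g2 \<otimes>\<^bsub>R\<^esub> g3 \<otimes>\<^bsub>R\<^esub> bil1 R \<M> (mul \<M> u3 u2) u1
     \<ominus>\<^bsub>R\<^esub> (g2 \<otimes>\<^bsub>R\<^esub> g3 \<otimes>\<^bsub>R\<^esub> a1 \<otimes>\<^bsub>R\<^esub> q1 \<M> u1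
         \<oplus>\<^bsub>R\<^esub> g3 \<otimes>\<^bsub>R\<^esub> g1 \<otimes>\<^bsub>R\<^esub> a2 \<otimes>\<^bsub>R\<^esub> q2 \<M> u2
         \<oplus>\<^bsub>R\<^esub> g1 \<otimes>\<^bsub>R\<^esub> g2 \<otimes>\<^bsub>R\<^esub> a3 \<otimes>\<^bsub>R\<^esub> q3 \<M> u3)"

text \<open>
  The coefficient of \<open>t\<close> in the formula for \<open>comp_norm\<close> at \<open>x + ty\<close>, by the product rule.
\<close>

fun comp_norm_deriv ::
  "'r ring \<Rightarrow> ('r, 'c1, 'c2, 'c3) composition \<Rightarrow> 'r \<times> 'r \<times> 'r \<Rightarrow>
   ('r, 'c1, 'c2, 'c3) comp_elt \<Rightarrow> ('r, 'c1, 'c2, 'c3) comp_elt \<Rightarrow> 'r" where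
  "comp_norm_deriv R \<M> (g1, g2, g3) (a1, a2, a3, u1, u2, u3) (b1, b2, b3, v1, v2, v3) =
     (b1 \<otimes>\<^bsub>R\<^esub> a2 \<otimes>\<^bsub>R\<^esub> a3 \<oplus>\<^bsub>R\<^esub> a1 \<otimes>\<^bsub>R\<^esub> b2 \<otimes>\<^bsub>R\<^esub> a3 \<oplus>\<^bsub>R\<^esub> a1 \<otimes>\<^bsub>R\<^esub> a2 \<otimes>\<^bsub>R\<^esub> b3)
     \<oplus>\<^bsub>R\<^esub> g1 \<otimes>\<^bsub>R\<^esub> g2 \<otimes>\<^bsub>R\<^esub> g3 \<otimes>\<^bsub>R\<^esub>
         (bil1 R \<M> (mul \<M> v3 u2) u1 \<oplus>\<^bsub>R\<^esub> bil1 R \<M> (mul \<M> u3 v2) u1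
          \<oplus>\<^bsub>R\<^esub> bil1 R \<M> (mul \<M> u3 u2) v1)
     \<ominus>\<^bsub>R\<^esub> (g2 \<otimes>\<^bsub>R\<^esub> g3 \<otimes>\<^bsub>R\<^esub> (b1 \<otimes>\<^bsub>R\<^esub> q1 \<M> u1 \<oplus>\<^bsub>R\<^esub> a1 \<otimes>\<^bsub>R\<^esub> bil1 R \<M> u1 v1)
         \<oplus>\<^bsub>R\<^esub> g3 \<otimes>\<^bsub>R\<^esub> g1 \<otimes>\<^bsub>R\<^esub> (b2 \<otimes>\<^bsub>R\<^esub> q2 \<M> u2 \<oplus>\<^bsub>R\<^esub> a2 \<otimes>\<^bsub>R\<^esub> bil2 R \<M> u2 v2)
         \<oplus>\<^bsub>R\<^esub> g1 \<otimes>\<^bsub>R\<^esub> g2 \<otimes>\<^bsub>R\<^esub> (b3 \<otimes>\<^bsub>R\<^esub> q3 \<M> u3 \<oplus>\<^bsub>R\<^esub> a3 \<otimes>\<^bsub>R\<^esub> bil3 R \<M> u3 v3))"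

fun comp_sharp ::
  "'r ring \<Rightarrow> ('r, 'c1, 'c2, 'c3) composition \<Rightarrow> 'r \<times> 'r \<times> 'r \<Rightarrow>
   ('r, 'c1, 'c2, 'c3) comp_elt \<Rightarrow> ('r, 'c1, 'c2, 'c3) comp_elt" where
  "comp_sharp R \<M> (g1, g2, g3) (a1, a2, a3, u1, u2, u3) =
     (a2 \<otimes>\<^bsub>R\<^esub> a3 \<ominus>\<^bsub>R\<^esub> g2 \<otimes>\<^bsub>R\<^esub> g3 \<otimes>\<^bsub>R\<^esub> q1 \<M> u1,
      a3 \<otimes>\<^bsub>R\<^esub> a1 \<ominus>\<^bsub>R\<^esub> g3 \<otimes>\<^bsub>R\<^esub> g1 \<otimes>\<^bsub>R\<^esub> q2 \<M> u2,
      a1 \<otimes>\<^bsub>R\<^esub> a2 \<ominus>\<^bsub>R\<^esub> g1 \<otimes>\<^bsub>R\<^esub> g2 \<otimes>\<^bsub>R\<^esub> q3 \<M> u3,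
      g1 \<odot>\<^bsub>C1 \<M>\<^esub> mul \<M> u3 u2 \<ominus>\<^bsub>C1 \<M>\<^esub> a1 \<odot>\<^bsub>C1 \<M>\<^esub> u1,
      g2 \<odot>\<^bsub>C2 \<M>\<^esub> mul2 R \<M> u1 u3 \<ominus>\<^bsub>C2 \<M>\<^esub> a2 \<odot>\<^bsub>C2 \<M>\<^esub> u2,
      g3 \<odot>\<^bsub>C3 \<M>\<^esub> mul3 R \<M> u2 u1 \<ominus>\<^bsub>C3 \<M>\<^esub> a3 \<odot>\<^bsub>C3 \<M>\<^esub> u3)"

end

theory Submission
  imports Defs "HOL-Decision_Procs.Commutative_Ring"
begin

section \<open>Linear maps and direct products of modules\<close>

lemma self_module_simps [simp]:
  "carrier (self_module R) = carrier R"
  "Ring.ring.add (self_module R) = Ring.ring.add R"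
  "Ring.ring.zero (self_module R) = Ring.ring.zero R"
  "smult (self_module R) = monoid.mult R"
  by (simp_all add: self_module_def)

lemma a_inv_self_module [simp]: "a_inv (self_module R) = a_inv R"
  by (simp add: fun_eq_iff a_inv_def m_inv_def)

lemma a_minus_self_module [simp]: "a_minus (self_module R) = a_minus R"
  by (simp add: fun_eq_iff a_minus_def)

lemma polar_self_module [simp]: "polar M (self_module R) q = polar M R q"
  by (simp add: fun_eq_iff polar_def)

lemma module_self_module:
  assumes "cring R"
  shows "module R (self_module R)"
proof -
  interpret cring R by fact
  show ?thesis
  proof (rule moduleI)
    show "abelian_group (self_module R)"
      by (rule abelian_groupI) (auto simp: a_ac intro: r_neg l_neg exI[of _ "\<ominus>\<^bsub>R\<^esub> _"])
  qed (use assms in \<open>auto simp: l_distr r_distr m_assoc\<close>)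
qed

lemma linear_mapsI:
  assumes "\<And>x. x \<in> carrier M \<Longrightarrow> f x \<in> carrier N"
    and "\<And>x y. x \<in> carrier M \<Longrightarrow> y \<in> carrier M \<Longrightarrow> f (x \<oplus>\<^bsub>M\<^esub> y) = f x \<oplus>\<^bsub>N\<^esub> f y"
    and "\<And>r x. r \<in> carrier R \<Longrightarrow> x \<in> carrier M \<Longrightarrow> f (r \<odot>\<^bsub>M\<^esub> x) = r \<odot>\<^bsub>N\<^esub> f x"
  shows "f \<in> linear_maps R M N"
  using assms by (auto simp: linear_maps_def)

lemma linear_maps_closed: "f \<in> linear_maps R M N \<Longrightarrow> x \<in> carrier M \<Longrightarrow> f x \<in> carrier N"
  and linear_maps_add: "f \<in> linear_maps R M N \<Longrightarrow> x \<in> carrier M \<Longrightarrow> y \<in> carrier M \<Longrightarrow>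
    f (x \<oplus>\<^bsub>M\<^esub> y) = f x \<oplus>\<^bsub>N\<^esub> f y"
  and linear_maps_smult: "f \<in> linear_maps R M N \<Longrightarrow> r \<in> carrier R \<Longrightarrow> x \<in> carrier M \<Longrightarrow>
    f (r \<odot>\<^bsub>M\<^esub> x) = r \<odot>\<^bsub>N\<^esub> f x"
  by (auto simp: linear_maps_def)

lemma linear_maps_comp:
  assumes "f \<in> linear_maps R M N" "g \<in> linear_maps R N P"
  shows "(\<lambda>x. g (f x)) \<in> linear_maps R M P"
  using assms by (auto simp: linear_maps_def Pi_iff)

lemma linear_maps_zero:
  assumes "module R M" "module R N" "f \<in> linear_maps R M N"
  shows "f \<zero>\<^bsub>M\<^esub> = \<zero>\<^bsub>N\<^esub>"
proof -
  interpret M: module R M by fact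
  interpret N: module R N by fact
  have "f (\<zero>\<^bsub>R\<^esub> \<odot>\<^bsub>M\<^esub> \<zero>\<^bsub>M\<^esub>) = \<zero>\<^bsub>R\<^esub> \<odot>\<^bsub>N\<^esub> f \<zero>\<^bsub>M\<^esub>"
    using assms(3) by (intro linear_maps_smult) auto
  then show ?thesis using linear_maps_closed[OF assms(3)] by simp
qed

lemma linear_maps_minus:
  assumes "module R M" "module R N" "f \<in> linear_maps R M N" "x \<in> carrier M"
  shows "f (\<ominus>\<^bsub>M\<^esub> x) = \<ominus>\<^bsub>N\<^esub> f x"
proof -
  interpret M: module R M by fact
  interpret N: module R N by fact
  have "f (\<ominus>\<^bsub>M\<^esub> x) \<oplus>\<^bsub>N\<^esub> f x = \<zero>\<^bsub>N\<^esub>"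
    using linear_maps_add[OF assms(3), of "\<ominus>\<^bsub>M\<^esub> x" x] linear_maps_zero[OF assms(1-3)] assms(4)
    by (simp add: M.M.l_neg)
  then show ?thesis
    using linear_maps_closed[OF assms(3)] assms(4) by (simp add: N.minus_equality)
qed

lemma linear_maps_diff:
  assumes "module R M" "module R N" "f \<in> linear_maps R M N" "x \<in> carrier M" "y \<in> carrier M"
  shows "f (x \<ominus>\<^bsub>M\<^esub> y) = f x \<ominus>\<^bsub>N\<^esub> f y"
proof -
  interpret M: module R M by fact
  show ?thesis
    using linear_maps_add[OF assms(3,4), of "\<ominus>\<^bsub>M\<^esub> y"] linear_maps_minus[OF assms(1-3,5)] assms(5)
    by (simp add: a_minus_def)
qed

lemma linear_maps_finsum:
  assumes "module R M" "module R N" "f \<in> linear_maps R M N" "g \<in> A \<rightarrow> carrier M" "finite A"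
  shows "f (\<Oplus>\<^bsub>M\<^esub>i\<in>A. g i) = (\<Oplus>\<^bsub>N\<^esub>i\<in>A. f (g i))"
proof -
  interpret M: module R M by fact
  interpret N: module R N by fact
  show ?thesis
    using assms(5,4)
  proof (induction A rule: finite_induct)
    case empty
    then show ?case using linear_maps_zero[OF assms(1-3)] by simp
  next
    case (insert a A)
    then have "g a \<in> carrier M" "g \<in> A \<rightarrow> carrier M" by auto
    moreover from this have "(\<lambda>i. f (g i)) \<in> A \<rightarrow> carrier N"
      using linear_maps_closed[OF assms(3)] by auto
    ultimately show ?case
      using insert linear_maps_closed[OF assms(3)]
      by (simp add: linear_maps_add[OF assms(3)])
  qed
qed

definition module_iso ::
  "'r ring \<Rightarrow> ('r, 'a) module \<Rightarrow> ('r, 'b) module \<Rightarrow> ('a \<Rightarrow> 'b) \<Rightarrow> bool" where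
  "module_iso R M N f \<longleftrightarrow> f \<in> linear_maps R M N \<and> bij_betw f (carrier M) (carrier N)"

lemma module_iso_comp:
  assumes "module_iso R M N f" "module_iso R N P g"
  shows "module_iso R M P (\<lambda>x. g (f x))"
  using assms linear_maps_comp[of f R M N g P] bij_betw_trans[of f "carrier M" "carrier N" g]
  by (auto simp: module_iso_def comp_def)

lemma module_iso_id: "module_iso R M M (\<lambda>x. x)"
  by (auto simp: module_iso_def linear_maps_def bij_betw_def)

lemma module_isoI:
  assumes "f \<in> linear_maps R M N" "g \<in> linear_maps R N M"
    and "\<And>x. x \<in> carrier M \<Longrightarrow> g (f x) = x" "\<And>y. y \<in> carrier N \<Longrightarrow> f (g y) = y"
  shows "module_iso R M N f"
  unfolding module_iso_def
  using assms linear_maps_closed[OF assms(1)] linear_maps_closed[OF assms(2)]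
  by (auto intro!: bij_betwI[where g = g])

lemma module_iso_inverse:
  assumes "module R M" "module_iso R M N f"
  obtains g where "g \<in> linear_maps R N M" "\<And>x. x \<in> carrier M \<Longrightarrow> g (f x) = x"
    "\<And>y. y \<in> carrier N \<Longrightarrow> f (g y) = y"
proof -
  interpret M: module R M by fact
  have f: "f \<in> linear_maps R M N" and b: "bij_betw f (carrier M) (carrier N)"
    using assms(2) by (auto simp: module_iso_def)
  define g where "g = the_inv_into (carrier M) f"
  have gf: "g (f x) = x" if "x \<in> carrier M" for x
    using that b unfolding g_def by (simp add: bij_betw_def the_inv_into_f_f)
  have fg: "f (g y) = y" and gc: "g y \<in> carrier M" if "y \<in> carrier N" for y
  proof -
    have "y \<in> f ` carrier M" using that b by (simp add: bij_betw_imp_surj_on)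
    then obtain x where "x \<in> carrier M" "y = f x" by auto
    then show "f (g y) = y" "g y \<in> carrier M" using gf by auto
  qed
  have "g \<in> linear_maps R N M"
  proof (rule linear_mapsI)
    fix x y assume xy: "x \<in> carrier N" "y \<in> carrier N"
    then have "g (f (g x \<oplus>\<^bsub>M\<^esub> g y)) = g x \<oplus>\<^bsub>M\<^esub> g y" using gc by (intro gf) auto
    then show "g (x \<oplus>\<^bsub>N\<^esub> y) = g x \<oplus>\<^bsub>M\<^esub> g y" using xy gc fg linear_maps_add[OF f] by simp
  next
    fix r x assume xy: "r \<in> carrier R" "x \<in> carrier N"
    then have "g (f (r \<odot>\<^bsub>M\<^esub> g x)) = r \<odot>\<^bsub>M\<^esub> g x" using gc by (intro gf) auto
    then show "g (r \<odot>\<^bsub>N\<^esub> x) = r \<odot>\<^bsub>M\<^esub> g x" using xy gc fg linear_maps_smult[OF f] by simp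
  qed (rule gc)
  then show thesis using gf fg that by blast
qed

definition prod_module ::
  "('r, 'a) module \<Rightarrow> ('r, 'b) module \<Rightarrow> ('r, 'a \<times> 'b) module" (infixr "\<times>\<^sub>M" 80) where
  "M \<times>\<^sub>M N =
     \<lparr>carrier = carrier M \<times> carrier N, monoid.mult = undefined, one = undefined,
      ring.zero = (\<zero>\<^bsub>M\<^esub>, \<zero>\<^bsub>N\<^esub>),
      add = (\<lambda>(x, y) (x', y'). (x \<oplus>\<^bsub>M\<^esub> x', y \<oplus>\<^bsub>N\<^esub> y')),
      smult = (\<lambda>r (x, y). (r \<odot>\<^bsub>M\<^esub> x, r \<odot>\<^bsub>N\<^esub> y))\<rparr>"

lemma prod_module_simps [simp]:
  "carrier (M \<times>\<^sub>M N) = carrier M \<times> carrier N"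
  "\<zero>\<^bsub>M \<times>\<^sub>M N\<^esub> = (\<zero>\<^bsub>M\<^esub>, \<zero>\<^bsub>N\<^esub>)"
  "(x, y) \<oplus>\<^bsub>M \<times>\<^sub>M N\<^esub> (x', y') = (x \<oplus>\<^bsub>M\<^esub> x', y \<oplus>\<^bsub>N\<^esub> y')"
  "r \<odot>\<^bsub>M \<times>\<^sub>M N\<^esub> (x, y) = (r \<odot>\<^bsub>M\<^esub> x, r \<odot>\<^bsub>N\<^esub> y)"
  by (simp_all add: prod_module_def)

lemma module_prod_module:
  assumes "module R M" "module R N"
  shows "module R (M \<times>\<^sub>M N)"
proof -
  interpret M: module R M by fact
  interpret N: module R N by fact
  show ?thesis
  proof (rule moduleI)
    show "abelian_group (M \<times>\<^sub>M N)"
    proof (rule abelian_groupI)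
      fix x assume "x \<in> carrier (M \<times>\<^sub>M N)"
      then show "\<exists>y\<in>carrier (M \<times>\<^sub>M N). y \<oplus>\<^bsub>M \<times>\<^sub>M N\<^esub> x = \<zero>\<^bsub>M \<times>\<^sub>M N\<^esub>"
        by (intro bexI[of _ "(\<ominus>\<^bsub>M\<^esub> fst x, \<ominus>\<^bsub>N\<^esub> snd x)"]) (auto simp: M.M.l_neg N.M.l_neg)
    qed (auto simp: M.M.a_ac N.M.a_ac)
  qed (auto simp: M.R.cring_axioms M.smult_l_distr N.smult_l_distr M.smult_r_distr N.smult_r_distr
        M.smult_assoc1 N.smult_assoc1)
qed

lemma prod_module_minus:
  assumes "module R M" "module R N" "x \<in> carrier M" "y \<in> carrier N"
  shows "\<ominus>\<^bsub>M \<times>\<^sub>M N\<^esub> (x, y) = (\<ominus>\<^bsub>M\<^esub> x, \<ominus>\<^bsub>N\<^esub> y)"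
proof -
  interpret M: module R M by fact
  interpret N: module R N by fact
  interpret MN: module R "M \<times>\<^sub>M N" by (rule module_prod_module) fact+
  show ?thesis
    by (rule MN.M.minus_equality) (use assms in \<open>auto simp: M.M.l_neg N.M.l_neg\<close>)
qed

lemma prod_module_diff:
  assumes "module R M" "module R N" "x \<in> carrier M" "y \<in> carrier N" "x' \<in> carrier M" "y' \<in> carrier N"
  shows "(x, y) \<ominus>\<^bsub>M \<times>\<^sub>M N\<^esub> (x', y') = (x \<ominus>\<^bsub>M\<^esub> x', y \<ominus>\<^bsub>N\<^esub> y')"
  using assms by (simp add: a_minus_def prod_module_minus)

lemma comp_module_eq_prod:
  "comp_module R \<M> =
     self_module R \<times>\<^sub>M self_module R \<times>\<^sub>M self_module R \<times>\<^sub>M C1 \<M> \<times>\<^sub>M C2 \<M> \<times>\<^sub>M C3 \<M>"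
  by (auto simp: comp_module_def prod_module_def fun_eq_iff)

lemma module_iso_prod:
  assumes "module_iso R M M' f" "module_iso R N N' g"
  shows "module_iso R (M \<times>\<^sub>M N) (M' \<times>\<^sub>M N') (\<lambda>(x, y). (f x, g y))"
  using assms bij_betw_map_prod[of f "carrier M" "carrier M'" g "carrier N" "carrier N'"]
  by (auto simp: module_iso_def linear_maps_def map_prod_def split_def)

subsection \<open>Free and projective modules\<close>

text \<open>Vectors are concatenated by placing the second one at the indices \<open>n, \<dots>, n + m - 1\<close>.\<close>

definition join_vec :: "nat \<Rightarrow> nat \<Rightarrow> (nat \<Rightarrow> 'r) \<Rightarrow> (nat \<Rightarrow> 'r) \<Rightarrow> nat \<Rightarrow> 'r" where
  "join_vec n m f g = (\<lambda>i\<in>{..<n + m}. if i < n then f i else g (i - n))"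

definition upper_part :: "nat \<Rightarrow> nat \<Rightarrow> (nat \<Rightarrow> 'r) \<Rightarrow> nat \<Rightarrow> 'r" where
  "upper_part n m f = (\<lambda>i\<in>{..<m}. f (n + i))"

lemma free_module_simps [simp]:
  "carrier (free_module R n) = {..<n} \<rightarrow>\<^sub>E carrier R"
  "f \<oplus>\<^bsub>free_module R n\<^esub> g = (\<lambda>i\<in>{..<n}. f i \<oplus>\<^bsub>R\<^esub> g i)"
  "r \<odot>\<^bsub>free_module R n\<^esub> f = (\<lambda>i\<in>{..<n}. r \<otimes>\<^bsub>R\<^esub> f i)"
  "\<zero>\<^bsub>free_module R n\<^esub> = (\<lambda>i\<in>{..<n}. \<zero>\<^bsub>R\<^esub>)"
  by (simp_all add: free_module_def)

lemma join_vec_linear: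
  "(\<lambda>(f, g). join_vec n m f g) \<in> linear_maps R (free_module R n \<times>\<^sub>M free_module R m) (free_module R (n + m))"
  unfolding join_vec_def by (rule linear_mapsI) (auto simp: fun_eq_iff PiE_iff)

lemma split_linear:
  "(\<lambda>f. (restrict f {..<n}, upper_part n m f))
     \<in> linear_maps R (free_module R (n + m)) (free_module R n \<times>\<^sub>M free_module R m)"
  unfolding upper_part_def by (rule linear_mapsI) (auto simp: fun_eq_iff PiE_iff)

lemma split_join:
  assumes "f \<in> carrier (free_module R n)" "g \<in> carrier (free_module R m)"
  shows "restrict (join_vec n m f g) {..<n} = f" "upper_part n m (join_vec n m f g) = g"
  using assms by (auto simp: join_vec_def upper_part_def PiE_iff extensional_def fun_eq_iff)

lemma join_split:
  assumes "f \<in> carrier (free_module R (n + m))"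
  shows "join_vec n m (restrict f {..<n}) (upper_part n m f) = f"
  using assms by (auto simp: join_vec_def upper_part_def PiE_iff extensional_def fun_eq_iff)

lemma free_module_add_iso:
  "module_iso R (free_module R n \<times>\<^sub>M free_module R m) (free_module R (n + m)) (\<lambda>(f, g). join_vec n m f g)"
  by (rule module_isoI[OF join_vec_linear split_linear]) (auto simp: split_join join_split simp del: free_module_simps)

lemma free_of_rank_iff: "free_of_rank R M n \<longleftrightarrow> (\<exists>f. module_iso R M (free_module R n) f)"
  by (auto simp: free_of_rank_def module_iso_def)

lemma free_of_rank_prod:
  assumes "free_of_rank R M m" "free_of_rank R N n"
  shows "free_of_rank R (M \<times>\<^sub>M N) (m + n)"
  using assms module_iso_comp[OF module_iso_prod free_module_add_iso]
  unfolding free_of_rank_iff by blast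

lemma free_of_rank_iso:
  assumes "module_iso R M N f" "free_of_rank R N n"
  shows "free_of_rank R M n"
  using assms module_iso_comp unfolding free_of_rank_iff by blast

lemma self_module_iso_free:
  assumes "cring R"
  shows "module_iso R (self_module R) (free_module R 1) (\<lambda>r. \<lambda>i\<in>{..<1}. r)"
proof (rule module_isoI)
  show "(\<lambda>f. f 0) \<in> linear_maps R (free_module R 1) (self_module R)"
    by (rule linear_mapsI) auto
qed (auto intro!: linear_mapsI simp: fun_eq_iff PiE_iff extensional_def)

lemma free_of_rank_self: "cring R \<Longrightarrow> free_of_rank R (self_module R) 1"
  using self_module_iso_free free_of_rank_iff by blast

lemma fg_projective_prod:
  assumes "fg_projective R M" "fg_projective R N"
  shows "fg_projective R (M \<times>\<^sub>M N)"
proof -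
  obtain n s p where M: "module R M" "s \<in> linear_maps R M (free_module R n)"
    "p \<in> linear_maps R (free_module R n) M" "\<And>x. x \<in> carrier M \<Longrightarrow> p (s x) = x"
    using assms(1) by (auto simp: fg_projective_def)
  obtain m t q where N: "module R N" "t \<in> linear_maps R N (free_module R m)"
    "q \<in> linear_maps R (free_module R m) N" "\<And>x. x \<in> carrier N \<Longrightarrow> q (t x) = x"
    using assms(2) by (auto simp: fg_projective_def)
  have st: "(\<lambda>(x, y). (s x, t y)) \<in> linear_maps R (M \<times>\<^sub>M N) (free_module R n \<times>\<^sub>M free_module R m)"
    using M(2) N(2) by (auto simp: linear_maps_def)
  have pq: "(\<lambda>(x, y). (p x, q y)) \<in> linear_maps R (free_module R n \<times>\<^sub>M free_module R m) (M \<times>\<^sub>M N)"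
    using M(3) N(3) by (auto simp: linear_maps_def)
  show ?thesis
    unfolding fg_projective_def
  proof (intro conjI exI bexI ballI)
    show "module R (M \<times>\<^sub>M N)" by (rule module_prod_module) fact+
    show "(\<lambda>z. case case z of (x, y) \<Rightarrow> (s x, t y) of (f, g) \<Rightarrow> join_vec n m f g)
      \<in> linear_maps R (M \<times>\<^sub>M N) (free_module R (n + m))"
      by (rule linear_maps_comp[OF st join_vec_linear])
    show "(\<lambda>f. case (restrict f {..<n}, upper_part n m f) of (x, y) \<Rightarrow> (p x, q y))
      \<in> linear_maps R (free_module R (n + m)) (M \<times>\<^sub>M N)"
      by (rule linear_maps_comp[OF split_linear pq])
    fix z assume "z \<in> carrier (M \<times>\<^sub>M N)"
    then show "(case (restrict (case case z of (x, y) \<Rightarrow> (s x, t y) of (f, g) \<Rightarrow> join_vec n m f g) {..<n},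
        upper_part n m (case case z of (x, y) \<Rightarrow> (s x, t y) of (f, g) \<Rightarrow> join_vec n m f g)) of
        (x, y) \<Rightarrow> (p x, q y)) = z"
      using M(4) N(4) linear_maps_closed[OF M(2)] linear_maps_closed[OF N(2)]
      by (auto simp: split_join[where R = R] simp del: free_module_simps)
  qed
qed

lemma fg_projective_self: "cring R \<Longrightarrow> fg_projective R (self_module R)"
  unfolding fg_projective_def
proof (intro conjI exI bexI ballI)
  show "(\<lambda>f. f 0) \<in> linear_maps R (free_module R 1) (self_module R)"
    by (rule linear_mapsI) auto
  assume "cring R"
  then show "module R (self_module R)" "(\<lambda>r. \<lambda>i\<in>{..<1}. r) \<in> linear_maps R (self_module R) (free_module R 1)"
    using self_module_iso_free[of R] by (auto simp: module_iso_def module_self_module)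
qed auto

lemma linear_map_free_module_eq_sum:
  assumes "module R M" "p \<in> linear_maps R (free_module R n) M" "f \<in> carrier (free_module R n)"
  shows "p f = (\<Oplus>\<^bsub>M\<^esub>k\<in>{..<n}. f k \<odot>\<^bsub>M\<^esub> p (\<lambda>i\<in>{..<n}. if i = k then \<one>\<^bsub>R\<^esub> else \<zero>\<^bsub>R\<^esub>))"
proof -
  interpret M: module R M by fact
  define e where "e k = (\<lambda>i\<in>{..<n}. if i = k then \<one>\<^bsub>R\<^esub> else \<zero>\<^bsub>R\<^esub>)" for k
  have e: "e k \<in> carrier (free_module R n)" for k by (auto simp: e_def)
  have fc: "f i \<in> carrier R" if "i < n" for i using assms(3) that by auto
  have cut: "p (\<lambda>i\<in>{..<n}. if i < k then f i else \<zero>\<^bsub>R\<^esub>) = (\<Oplus>\<^bsub>M\<^esub>k\<in>{..<k}. f k \<odot>\<^bsub>M\<^esub> p (e k))"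
    if "k \<le> n" for k
    using that
  proof (induction k)
    case 0
    have "(\<lambda>i\<in>{..<n}. \<zero>\<^bsub>R\<^esub>) = \<zero>\<^bsub>R\<^esub> \<odot>\<^bsub>free_module R n\<^esub> f" using fc by auto
    then show ?case
      using linear_maps_smult[OF assms(2) _ assms(3), of "\<zero>\<^bsub>R\<^esub>"] linear_maps_closed[OF assms(2,3)]
      by (simp del: free_module_simps)
  next
    case (Suc k)
    have 1: "(\<lambda>i\<in>{..<n}. if i < Suc k then f i else \<zero>\<^bsub>R\<^esub>) =
      (\<lambda>i\<in>{..<n}. if i < k then f i else \<zero>\<^bsub>R\<^esub>) \<oplus>\<^bsub>free_module R n\<^esub> f k \<odot>\<^bsub>free_module R n\<^esub> e k"
      using fc Suc.prems by (auto simp: e_def fun_eq_iff less_Suc_eq)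
    have 2: "(\<lambda>i\<in>{..<n}. if i < k then f i else \<zero>\<^bsub>R\<^esub>) \<in> carrier (free_module R n)"
      "f k \<odot>\<^bsub>free_module R n\<^esub> e k \<in> carrier (free_module R n)"
      using fc Suc.prems by (auto simp: e_def)
    have 3: "(\<lambda>k. f k \<odot>\<^bsub>M\<^esub> p (e k)) \<in> {..<k} \<rightarrow> carrier M" "f k \<odot>\<^bsub>M\<^esub> p (e k) \<in> carrier M"
      using fc Suc.prems linear_maps_closed[OF assms(2) e] by auto
    have IH: "p (\<lambda>i\<in>{..<n}. if i < k then f i else \<zero>\<^bsub>R\<^esub>) = (\<Oplus>\<^bsub>M\<^esub>k\<in>{..<k}. f k \<odot>\<^bsub>M\<^esub> p (e k))"
      by (rule Suc.IH) (use Suc.prems in simp)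
    have fk: "f k \<in> carrier R" using fc Suc.prems by simp
    show ?case
      unfolding 1 linear_maps_add[OF assms(2) 2] linear_maps_smult[OF assms(2) fk e] IH
      using 3 by (simp add: lessThan_Suc M.M.a_comm)
  qed
  have "(\<lambda>i\<in>{..<n}. if i < n then f i else \<zero>\<^bsub>R\<^esub>) = f" using assms(3) by (auto simp: fun_eq_iff PiE_iff extensional_def)
  with cut[of n] show ?thesis by (simp add: e_def)
qed

text \<open>The dual basis of a finitely generated projective module: generators \<open>x\<^sub>i\<close> with coordinate forms.\<close>

lemma fg_projective_dual_basis:
  assumes "fg_projective R M"
  obtains n :: nat and x s where "\<And>i. i < n \<Longrightarrow> x i \<in> carrier M" "\<And>i. i < n \<Longrightarrow> s i \<in> linear_maps R M (self_module R)"
    "\<And>z. z \<in> carrier M \<Longrightarrow> z = (\<Oplus>\<^bsub>M\<^esub>i\<in>{..<n}. s i z \<odot>\<^bsub>M\<^esub> x i)"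
proof -
  obtain n s p where M: "module R M" "s \<in> linear_maps R M (free_module R n)"
    "p \<in> linear_maps R (free_module R n) M" "\<And>x. x \<in> carrier M \<Longrightarrow> p (s x) = x"
    using assms(1) by (auto simp: fg_projective_def)
  interpret M: module R M by fact
  show thesis
  proof (rule that[of n "\<lambda>i. p (\<lambda>j\<in>{..<n}. if j = i then \<one>\<^bsub>R\<^esub> else \<zero>\<^bsub>R\<^esub>)" "\<lambda>i z. s z i"])
    fix z assume z: "z \<in> carrier M"
    show "z = (\<Oplus>\<^bsub>M\<^esub>i\<in>{..<n}. s z i \<odot>\<^bsub>M\<^esub> p (\<lambda>j\<in>{..<n}. if j = i then \<one>\<^bsub>R\<^esub> else \<zero>\<^bsub>R\<^esub>))"
      using linear_map_free_module_eq_sum[OF M(1,3) linear_maps_closed[OF M(2) z]] M(4)[OF z] by simp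
  next
    fix i assume "i < n"
    then show "(\<lambda>z. s z i) \<in> linear_maps R M (self_module R)"
      using M(2) linear_maps_closed[OF M(2)]
      by (intro linear_mapsI) (auto simp: PiE_iff linear_maps_add linear_maps_smult)
  next
    fix i
    show "p (\<lambda>j\<in>{..<n}. if j = i then \<one>\<^bsub>R\<^esub> else \<zero>\<^bsub>R\<^esub>) \<in> carrier M"
      by (rule linear_maps_closed[OF M(3)]) auto
  qed
qed

section \<open>Scalar extension of modules\<close>

lemma (in abelian_group) diff_eq_zero_iff:
  assumes "x \<in> carrier G" "y \<in> carrier G"
  shows "x \<ominus> y = \<zero> \<longleftrightarrow> x = y"
proof
  assume "x \<ominus> y = \<zero>"
  then have "x \<oplus> \<ominus> y \<oplus> y = \<zero> \<oplus> y" by (simp add: a_minus_def)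
  then show "x = y" using assms by (simp add: a_assoc l_neg)
qed (use assms in \<open>simp add: a_minus_def r_neg\<close>)

locale base_change = R: cring R + S: cring S
  for R :: "'r ring" and S :: "'s ring" +
  fixes \<phi> :: "'r \<Rightarrow> 's"
  assumes hom: "\<phi> \<in> ring_hom R S"
begin

lemma \<phi>_closed [simp]: "r \<in> carrier R \<Longrightarrow> \<phi> r \<in> carrier S"
  and \<phi>_mult [simp]: "r \<in> carrier R \<Longrightarrow> r' \<in> carrier R \<Longrightarrow> \<phi> (r \<otimes>\<^bsub>R\<^esub> r') = \<phi> r \<otimes>\<^bsub>S\<^esub> \<phi> r'"
  and \<phi>_add [simp]: "r \<in> carrier R \<Longrightarrow> r' \<in> carrier R \<Longrightarrow> \<phi> (r \<oplus>\<^bsub>R\<^esub> r') = \<phi> r \<oplus>\<^bsub>S\<^esub> \<phi> r'"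
  and \<phi>_one [simp]: "\<phi> \<one>\<^bsub>R\<^esub> = \<one>\<^bsub>S\<^esub>"
  using hom by (auto simp: ring_hom_def)

sublocale ring_hom_cring R S \<phi>
  by unfold_locales (rule hom)

lemma \<phi>_diff [simp]:
  "r \<in> carrier R \<Longrightarrow> r' \<in> carrier R \<Longrightarrow> \<phi> (r \<ominus>\<^bsub>R\<^esub> r') = \<phi> r \<ominus>\<^bsub>S\<^esub> \<phi> r'"
  by (simp add: a_minus_def)

end

locale tensor_product = base_change R S \<phi> + M: module R M
  for R :: "'r ring" and S :: "'s ring" and \<phi> and M :: "('r, 'a) module"
begin

abbreviation "F \<equiv> free_Abelian_group (carrier M \<times> carrier S)"
abbreviation "K \<equiv> tensor_kernel R S \<phi> M"
abbreviation "T \<equiv> tensor R S \<phi> M"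
abbreviation "cls v \<equiv> K #>\<^bsub>F\<^esub> v"
abbreviation "scale t \<equiv> frag_extend (\<lambda>(x, s). frag_of (x, t \<otimes>\<^bsub>S\<^esub> s))"
abbreviation "pure \<equiv> pure_tensor R S \<phi> M"
abbreviation "\<iota> x \<equiv> pure_tensor R S \<phi> M x \<one>\<^bsub>S\<^esub>"

sublocale F: comm_group F by (rule abelian_free_Abelian_group)

lemma F_closed:
  "v \<in> carrier F \<Longrightarrow> w \<in> carrier F \<Longrightarrow> v + w \<in> carrier F"
  "v \<in> carrier F \<Longrightarrow> w \<in> carrier F \<Longrightarrow> v - w \<in> carrier F"
  "v \<in> carrier F \<Longrightarrow> - v \<in> carrier F"
  "0 \<in> carrier F"
  using F.m_closed[of v w] F.m_closed[of v "- w"] by auto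

lemma F_of: "frag_of (x, s) \<in> carrier F \<longleftrightarrow> x \<in> carrier M \<and> s \<in> carrier S"
  by simp

lemma relations_cases:
  assumes "r \<in> tensor_relations R S \<phi> M"
  obtains (add_left) x y s where "x \<in> carrier M" "y \<in> carrier M" "s \<in> carrier S"
        "r = frag_of (x \<oplus>\<^bsub>M\<^esub> y, s) - frag_of (x, s) - frag_of (y, s)"
      | (add_right) x s s' where "x \<in> carrier M" "s \<in> carrier S" "s' \<in> carrier S"
        "r = frag_of (x, s \<oplus>\<^bsub>S\<^esub> s') - frag_of (x, s) - frag_of (x, s')"
      | (smult) q x s where "q \<in> carrier R" "x \<in> carrier M" "s \<in> carrier S"
        "r = frag_of (q \<odot>\<^bsub>M\<^esub> x, s) - frag_of (x, \<phi> q \<otimes>\<^bsub>S\<^esub> s)"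
  using assms unfolding tensor_relations_def
  by (elim UnE CollectE exE conjE)
    ((rule add_left; assumption) | (rule add_right; assumption) | (rule smult; assumption))+

lemma relationsI:
  "x \<in> carrier M \<Longrightarrow> y \<in> carrier M \<Longrightarrow> s \<in> carrier S \<Longrightarrow>
    frag_of (x \<oplus>\<^bsub>M\<^esub> y, s) - frag_of (x, s) - frag_of (y, s) \<in> tensor_relations R S \<phi> M"
  "x \<in> carrier M \<Longrightarrow> s \<in> carrier S \<Longrightarrow> s' \<in> carrier S \<Longrightarrow>
    frag_of (x, s \<oplus>\<^bsub>S\<^esub> s') - frag_of (x, s) - frag_of (x, s') \<in> tensor_relations R S \<phi> M"
  "q \<in> carrier R \<Longrightarrow> x \<in> carrier M \<Longrightarrow> s \<in> carrier S \<Longrightarrow>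
    frag_of (q \<odot>\<^bsub>M\<^esub> x, s) - frag_of (x, \<phi> q \<otimes>\<^bsub>S\<^esub> s) \<in> tensor_relations R S \<phi> M"
  unfolding tensor_relations_def by fast+

lemma relations_subset: "tensor_relations R S \<phi> M \<subseteq> carrier F"
proof
  fix r assume "r \<in> tensor_relations R S \<phi> M"
  then show "r \<in> carrier F"
    by (cases rule: relations_cases)
      (simp_all add: F_closed F_of del: carrier_free_Abelian_group_iff)
qed

lemma K_subgroup: "subgroup K F"
  unfolding tensor_kernel_def by (rule F.generate_is_subgroup) (rule relations_subset)

lemma K_normal: "K \<lhd> F"
  using K_subgroup by (rule F.subgroup_imp_normal)

lemma K_closed:
  "0 \<in> K" "v \<in> K \<Longrightarrow> w \<in> K \<Longrightarrow> v + w \<in> K" "v \<in> K \<Longrightarrow> w \<in> K \<Longrightarrow> v - w \<in> K" "v \<in> K \<Longrightarrow> - v \<in> K"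
proof -
  have sub: "v \<in> carrier F" if "v \<in> K" for v using K_subgroup that by (rule subgroup.mem_carrier)
  show "0 \<in> K" using subgroup.one_closed[OF K_subgroup] by simp
  show add: "v + w \<in> K" if "v \<in> K" "w \<in> K" for v w
    using subgroup.m_closed[OF K_subgroup that] by simp
  show neg: "- v \<in> K" if "v \<in> K" for v
    using subgroup.m_inv_closed[OF K_subgroup that] sub[OF that] by simp
  show "v - w \<in> K" if "v \<in> K" "w \<in> K" for v w
    using add[OF that(1) neg[OF that(2)]] by simp
qed

lemma cls_eq_iff:
  assumes "v \<in> carrier F" "w \<in> carrier F"
  shows "cls v = cls w \<longleftrightarrow> v - w \<in> K"
proof
  assume "cls v = cls w"
  then have "v \<in> cls w" using F.rcos_self[OF assms(1) K_subgroup] by simp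
  then show "v - w \<in> K" by (auto simp: r_coset_def)
next
  assume "v - w \<in> K"
  then have "v \<in> cls w" by (auto simp: r_coset_def intro!: bexI[of _ "v - w"])
  then show "cls v = cls w" using F.repr_independence[OF _ assms(2) K_subgroup] by simp
qed

lemma T_simps:
  "carrier T = cls ` carrier F"
  "\<zero>\<^bsub>T\<^esub> = cls 0"
  "v \<in> carrier F \<Longrightarrow> w \<in> carrier F \<Longrightarrow> cls v \<oplus>\<^bsub>T\<^esub> cls w = cls (v + w)"
  using normal.rcos_sum[OF K_normal, of v w] F.coset_mult_one[of K] subgroup.subset[OF K_subgroup]
  by (simp_all add: tensor_def Let_def carrier_FactGroup)

lemma scale_closed: "t \<in> carrier S \<Longrightarrow> v \<in> carrier F \<Longrightarrow> scale t v \<in> carrier F"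
proof -
  assume t: "t \<in> carrier S" and "v \<in> carrier F"
  then have "Poly_Mapping.keys v \<subseteq> carrier M \<times> carrier S" by simp
  then show ?thesis
    by (induction rule: frag_induction)
      (use t in \<open>auto simp: frag_extend_diff F_closed(2) simp del: carrier_free_Abelian_group_iff intro: F_closed(4) F_of[THEN iffD2]\<close>)
qed

lemma scale_K: assumes "t \<in> carrier S" "k \<in> K" shows "scale t k \<in> K"
proof -
  have rel: "scale t r \<in> K" if r: "r \<in> tensor_relations R S \<phi> M" for r
  proof -
    from r have "scale t r \<in> tensor_relations R S \<phi> M"
    proof (cases rule: relations_cases)
      case (add_left x y s)
      then show ?thesis
        using assms(1) relationsI(1)[of x y "t \<otimes>\<^bsub>S\<^esub> s"] by (simp add: frag_extend_diff)
    next
      case (add_right x s s')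
      then show ?thesis
        using assms(1) relationsI(2)[of x "t \<otimes>\<^bsub>S\<^esub> s" "t \<otimes>\<^bsub>S\<^esub> s'"] by (simp add: frag_extend_diff S.r_distr)
    next
      case (smult q x s)
      then show ?thesis
        using assms(1) relationsI(3)[of q x "t \<otimes>\<^bsub>S\<^esub> s"] by (simp add: frag_extend_diff S.m_lcomm)
    qed
    then show ?thesis unfolding tensor_kernel_def by (rule generate.incl)
  qed
  show ?thesis
    using assms(2) unfolding tensor_kernel_def
  proof (induction rule: generate.induct)
    case one
    then show ?case using K_closed(1) by (simp add: tensor_kernel_def)
  next
    case (incl h)
    then show ?case using rel by (simp add: tensor_kernel_def)
  next
    case (inv h)
    then have "inv\<^bsub>F\<^esub> h = - h" using relations_subset by (simp add: subset_iff)
    then show ?case using K_closed(4)[OF rel[OF inv]] by (simp add: tensor_kernel_def frag_extend_minus)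
  next
    case (eng h1 h2)
    then show ?case using K_closed(2) by (simp add: tensor_kernel_def frag_extend_add)
  qed
qed

lemma T_smult: assumes "t \<in> carrier S" "v \<in> carrier F" shows "t \<odot>\<^bsub>T\<^esub> cls v = cls (scale t v)"
proof -
  have "t \<odot>\<^bsub>T\<^esub> cls v = K <#>\<^bsub>F\<^esub> scale t ` cls v"
    by (simp add: tensor_def Let_def)
  also have "\<dots> = cls (scale t v)"
  proof (intro equalityI subsetI)
    fix w assume "w \<in> K <#>\<^bsub>F\<^esub> scale t ` cls v"
    then obtain k k' where "k \<in> K" "k' \<in> K" "w = (k + scale t k') + scale t v"
      by (auto simp: set_mult_def r_coset_def frag_extend_add add.assoc)
    then show "w \<in> cls (scale t v)"
      using K_closed(2) scale_K[OF assms(1)] by (auto simp: r_coset_def)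
  next
    fix w assume "w \<in> cls (scale t v)"
    then obtain k where "k \<in> K" "w = k + scale t v" by (auto simp: r_coset_def)
    moreover have "scale t v \<in> scale t ` cls v"
      using F.rcos_self[OF assms(2) K_subgroup] by (rule imageI)
    ultimately show "w \<in> K <#>\<^bsub>F\<^esub> scale t ` cls v"
      unfolding set_mult_def mult_free_Abelian_group by blast
  qed
  finally show ?thesis .
qed

lemma T_cases: assumes "z \<in> carrier T" obtains v where "v \<in> carrier F" "z = cls v"
  using assms T_simps(1) by auto

lemma pure_eq: "pure x s = cls (frag_of (x, s))"
  by (simp add: pure_tensor_def)

lemma pure_closed [simp]: "x \<in> carrier M \<Longrightarrow> s \<in> carrier S \<Longrightarrow> pure x s \<in> carrier T"
  unfolding pure_eq T_simps(1) by (rule imageI) simp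

lemma pure_relation:
  assumes "frag_of p - frag_of q - frag_of r \<in> tensor_relations R S \<phi> M"
    "p \<in> carrier M \<times> carrier S" "q \<in> carrier M \<times> carrier S" "r \<in> carrier M \<times> carrier S"
  shows "cls (frag_of p) = cls (frag_of q) \<oplus>\<^bsub>T\<^esub> cls (frag_of r)"
proof -
  have "frag_of p - (frag_of q + frag_of r) \<in> K"
    using generate.incl[OF assms(1)] by (simp add: tensor_kernel_def diff_diff_eq)
  moreover have "frag_of p \<in> carrier F" "frag_of q \<in> carrier F" "frag_of r \<in> carrier F"
    using assms(2-) by auto
  ultimately show ?thesis by (simp add: T_simps cls_eq_iff F_closed del: carrier_free_Abelian_group_iff)
qed

lemma pure_add_left:
  assumes "x \<in> carrier M" "y \<in> carrier M" "s \<in> carrier S"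
  shows "pure (x \<oplus>\<^bsub>M\<^esub> y) s = pure x s \<oplus>\<^bsub>T\<^esub> pure y s"
  unfolding pure_eq using assms by (intro pure_relation relationsI) simp_all

lemma pure_add_right:
  assumes "x \<in> carrier M" "s \<in> carrier S" "s' \<in> carrier S"
  shows "pure x (s \<oplus>\<^bsub>S\<^esub> s') = pure x s \<oplus>\<^bsub>T\<^esub> pure x s'"
  unfolding pure_eq using assms by (intro pure_relation relationsI) simp_all

lemma pure_smult_left:
  assumes "r \<in> carrier R" "x \<in> carrier M" "s \<in> carrier S"
  shows "pure (r \<odot>\<^bsub>M\<^esub> x) s = pure x (\<phi> r \<otimes>\<^bsub>S\<^esub> s)"
proof -
  have "frag_of (r \<odot>\<^bsub>M\<^esub> x, s) - frag_of (x, \<phi> r \<otimes>\<^bsub>S\<^esub> s) \<in> K"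
    unfolding tensor_kernel_def using assms by (intro generate.incl relationsI)
  then show ?thesis unfolding pure_eq using assms by (subst cls_eq_iff) auto
qed

lemma smult_pure:
  "t \<in> carrier S \<Longrightarrow> x \<in> carrier M \<Longrightarrow> s \<in> carrier S \<Longrightarrow> t \<odot>\<^bsub>T\<^esub> pure x s = pure x (t \<otimes>\<^bsub>S\<^esub> s)"
  unfolding pure_eq by (simp add: T_smult)

lemma T_smult_closed: "t \<in> carrier S \<Longrightarrow> z \<in> carrier T \<Longrightarrow> t \<odot>\<^bsub>T\<^esub> z \<in> carrier T"
  by (elim T_cases) (auto simp: T_smult T_simps scale_closed simp del: carrier_free_Abelian_group_iff)

lemma abelian_group_T: "abelian_group T"
proof -
  interpret Q: comm_group "F Mod K" by (rule F.abelian_FactGroup[OF K_subgroup])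
  have T: "carrier T = carrier (F Mod K)" "\<zero>\<^bsub>T\<^esub> = \<one>\<^bsub>F Mod K\<^esub>" "Ring.ring.add T = monoid.mult (F Mod K)"
    by (simp_all add: tensor_def Let_def)
  show ?thesis
    by (rule abelian_groupI; unfold T)
      (rule Q.m_closed Q.one_closed Q.m_assoc Q.m_comm Q.l_one Q.l_inv_ex; assumption)+
qed

lemma tensor_induct_aux [consumes 1, case_names add pure]:
  assumes "z \<in> carrier T"
    and add: "\<And>a b. a \<in> carrier T \<Longrightarrow> b \<in> carrier T \<Longrightarrow> P a \<Longrightarrow> P b \<Longrightarrow> P (a \<oplus>\<^bsub>T\<^esub> b)"
    and pure: "\<And>x s. x \<in> carrier M \<Longrightarrow> s \<in> carrier S \<Longrightarrow> P (pure x s)"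
  shows "P z"
proof -
  interpret T: abelian_group T by (rule abelian_group_T)
  obtain v where v: "v \<in> carrier F" "z = cls v" using assms(1) by (rule T_cases)
  have pure_zero: "pure \<zero>\<^bsub>M\<^esub> s = \<zero>\<^bsub>T\<^esub>" if "s \<in> carrier S" for s
    using pure_add_left[of "\<zero>\<^bsub>M\<^esub>" "\<zero>\<^bsub>M\<^esub>" s] that
    by (simp add: T.add.l_cancel_one' T.add.r_cancel_one')
  from v(1) have "Poly_Mapping.keys v \<subseteq> carrier M \<times> carrier S" by simp
  then have "v \<in> carrier F \<and> P (cls v) \<and> P (cls (- v))"
  proof (induction rule: frag_induction)
    case zero
    then show ?case using pure[of "\<zero>\<^bsub>M\<^esub>" "\<zero>\<^bsub>S\<^esub>"] F_closed(4) pure_zero[of "\<zero>\<^bsub>S\<^esub>"] by (simp add: T_simps)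
  next
    case (one p)
    then obtain x s where p: "p = (x, s)" "x \<in> carrier M" "s \<in> carrier S" by auto
    have F: "frag_of p \<in> carrier F" "frag_of (\<ominus>\<^bsub>M\<^esub> x, s) \<in> carrier F" using p by auto
    have "pure x s \<oplus>\<^bsub>T\<^esub> pure (\<ominus>\<^bsub>M\<^esub> x) s = \<zero>\<^bsub>T\<^esub>"
      using pure_add_left[of x "\<ominus>\<^bsub>M\<^esub> x" s] p pure_zero by (simp add: M.M.r_neg)
    then have "frag_of p + frag_of (\<ominus>\<^bsub>M\<^esub> x, s) - 0 \<in> K"
      using F p by (subst (asm) (1 2) pure_eq) (simp add: T_simps cls_eq_iff F_closed del: carrier_free_Abelian_group_iff)
    then have "frag_of (\<ominus>\<^bsub>M\<^esub> x, s) - (- frag_of p) \<in> K" by (simp add: add.commute)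
    then have "cls (frag_of (\<ominus>\<^bsub>M\<^esub> x, s)) = cls (- frag_of p)"
      using F by (subst cls_eq_iff) (auto simp: F_closed simp del: carrier_free_Abelian_group_iff)
    then show ?case using pure[of x s] pure[of "\<ominus>\<^bsub>M\<^esub> x" s] p F by (simp add: pure_eq)
  next
    case (diff a b)
    then have "cls a \<in> carrier T" "cls b \<in> carrier T" "cls (- a) \<in> carrier T" "cls (- b) \<in> carrier T"
      unfolding T_simps(1) using F_closed(3) by blast+
    then have "P (cls a \<oplus>\<^bsub>T\<^esub> cls (- b))" "P (cls b \<oplus>\<^bsub>T\<^esub> cls (- a))"
      using diff by (blast intro: add)+
    then show ?case using diff by (simp add: T_simps F_closed del: carrier_free_Abelian_group_iff)
  qed
  then show ?thesis using v by simp
qed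

lemma T_smult_add:
  assumes "t \<in> carrier S" "y \<in> carrier T" "z \<in> carrier T"
  shows "t \<odot>\<^bsub>T\<^esub> (y \<oplus>\<^bsub>T\<^esub> z) = t \<odot>\<^bsub>T\<^esub> y \<oplus>\<^bsub>T\<^esub> t \<odot>\<^bsub>T\<^esub> z"
  using assms by (elim T_cases)
    (simp add: T_smult T_simps scale_closed F_closed frag_extend_add del: carrier_free_Abelian_group_iff)

lemma module_T: "module S T"
proof (rule moduleI)
  show "abelian_group T" by (rule abelian_group_T)
  interpret T: abelian_group T by (rule abelian_group_T)
  show "\<And>t z. t \<in> carrier S \<Longrightarrow> z \<in> carrier T \<Longrightarrow> t \<odot>\<^bsub>T\<^esub> z \<in> carrier T" by (rule T_smult_closed)
  show "\<And>t y z. t \<in> carrier S \<Longrightarrow> y \<in> carrier T \<Longrightarrow> z \<in> carrier T \<Longrightarrow>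
    t \<odot>\<^bsub>T\<^esub> (y \<oplus>\<^bsub>T\<^esub> z) = t \<odot>\<^bsub>T\<^esub> y \<oplus>\<^bsub>T\<^esub> t \<odot>\<^bsub>T\<^esub> z" by (rule T_smult_add)
  fix a b z assume ab: "a \<in> carrier S" "b \<in> carrier S" and z: "z \<in> carrier T"
  show "(a \<oplus>\<^bsub>S\<^esub> b) \<odot>\<^bsub>T\<^esub> z = a \<odot>\<^bsub>T\<^esub> z \<oplus>\<^bsub>T\<^esub> b \<odot>\<^bsub>T\<^esub> z"
    using z
  proof (induction rule: tensor_induct_aux)
    case (add y z)
    then show ?case using ab by (simp add: T_smult_add T_smult_closed T.a_ac)
  qed (use ab in \<open>auto simp: smult_pure pure_add_right S.l_distr\<close>)
  show "(a \<otimes>\<^bsub>S\<^esub> b) \<odot>\<^bsub>T\<^esub> z = a \<odot>\<^bsub>T\<^esub> (b \<odot>\<^bsub>T\<^esub> z)"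
    using z
  proof (induction rule: tensor_induct_aux)
    case (add y z)
    then show ?case using ab by (simp add: T_smult_add T_smult_closed)
  qed (use ab in \<open>auto simp: smult_pure S.m_assoc\<close>)
next
  fix z assume "z \<in> carrier T"
  then show "\<one>\<^bsub>S\<^esub> \<odot>\<^bsub>T\<^esub> z = z"
  proof (induction rule: tensor_induct_aux)
    case (add y z)
    then show ?case by (simp add: T_smult_add)
  qed (auto simp: smult_pure)
qed (rule S.cring_axioms)

sublocale T: module S T by (rule module_T)

lemma \<iota>_closed [simp]: "x \<in> carrier M \<Longrightarrow> \<iota> x \<in> carrier T" by simp

lemma \<iota>_add: "x \<in> carrier M \<Longrightarrow> y \<in> carrier M \<Longrightarrow> \<iota> (x \<oplus>\<^bsub>M\<^esub> y) = \<iota> x \<oplus>\<^bsub>T\<^esub> \<iota> y"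
  by (simp add: pure_add_left)

lemma \<iota>_smult: "r \<in> carrier R \<Longrightarrow> x \<in> carrier M \<Longrightarrow> \<iota> (r \<odot>\<^bsub>M\<^esub> x) = \<phi> r \<odot>\<^bsub>T\<^esub> \<iota> x"
  by (simp add: pure_smult_left smult_pure)

lemma pure_smult: "x \<in> carrier M \<Longrightarrow> s \<in> carrier S \<Longrightarrow> pure x s = s \<odot>\<^bsub>T\<^esub> \<iota> x"
  by (simp add: smult_pure)

lemma tensor_induct [consumes 1, case_names add \<iota>]:
  assumes "z \<in> carrier T"
    and "\<And>a b. a \<in> carrier T \<Longrightarrow> b \<in> carrier T \<Longrightarrow> P a \<Longrightarrow> P b \<Longrightarrow> P (a \<oplus>\<^bsub>T\<^esub> b)"
    and "\<And>x s. x \<in> carrier M \<Longrightarrow> s \<in> carrier S \<Longrightarrow> P (s \<odot>\<^bsub>T\<^esub> \<iota> x)"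
  shows "P z"
  using assms(1)
proof (induction rule: tensor_induct_aux)
  case (pure x s)
  then show ?case by (subst pure_smult) (simp_all add: assms(3))
qed (rule assms(2))

lemma \<iota>_zero: "\<iota> \<zero>\<^bsub>M\<^esub> = \<zero>\<^bsub>T\<^esub>"
  using \<iota>_smult[of "\<zero>\<^bsub>R\<^esub>" "\<zero>\<^bsub>M\<^esub>"] by simp

lemma \<iota>_minus: assumes "x \<in> carrier M" shows "\<iota> (\<ominus>\<^bsub>M\<^esub> x) = \<ominus>\<^bsub>T\<^esub> \<iota> x"
proof -
  have "\<iota> (\<ominus>\<^bsub>M\<^esub> x) \<oplus>\<^bsub>T\<^esub> \<iota> x = \<zero>\<^bsub>T\<^esub>"
    using assms by (simp add: \<iota>_zero M.M.l_neg flip: \<iota>_add)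
  then show ?thesis using assms by (simp add: T.minus_equality)
qed

lemma \<iota>_diff: "x \<in> carrier M \<Longrightarrow> y \<in> carrier M \<Longrightarrow> \<iota> (x \<ominus>\<^bsub>M\<^esub> y) = \<iota> x \<ominus>\<^bsub>T\<^esub> \<iota> y"
  by (simp add: a_minus_def \<iota>_add \<iota>_minus)

lemma tensor_lift:
  fixes N :: "('s, 'b) module"
  assumes N: "module S N"
    and f: "\<And>x. x \<in> carrier M \<Longrightarrow> f x \<in> carrier N"
    and f_add: "\<And>x y. x \<in> carrier M \<Longrightarrow> y \<in> carrier M \<Longrightarrow> f (x \<oplus>\<^bsub>M\<^esub> y) = f x \<oplus>\<^bsub>N\<^esub> f y"
    and f_smult: "\<And>r x. r \<in> carrier R \<Longrightarrow> x \<in> carrier M \<Longrightarrow> f (r \<odot>\<^bsub>M\<^esub> x) = \<phi> r \<odot>\<^bsub>N\<^esub> f x"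
  obtains g where "g \<in> linear_maps S T N" "\<And>x. x \<in> carrier M \<Longrightarrow> g (\<iota> x) = f x"
proof -
  interpret N: module S N by fact
  define f' where "f' = (\<lambda>(x, s). s \<odot>\<^bsub>N\<^esub> f x)"
  have "f' ` (carrier M \<times> carrier S) \<subseteq> carrier (add_monoid N)" using f by (auto simp: f'_def)
  then obtain h where h: "h \<in> hom F (add_monoid N)"
    and h_of: "\<And>p. p \<in> carrier M \<times> carrier S \<Longrightarrow> h (frag_of p) = f' p"
    using comm_group.free_Abelian_group_universal[OF N.M.a_comm_group] by blast
  have h_closed: "h v \<in> carrier N" if "v \<in> carrier F" for v
    using h that by (auto simp: hom_def simp del: carrier_free_Abelian_group_iff)
  have h_add: "h (v + w) = h v \<oplus>\<^bsub>N\<^esub> h w" if "v \<in> carrier F" "w \<in> carrier F" for v w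
    using h that by (auto simp: hom_def simp del: carrier_free_Abelian_group_iff)
  have h_zero: "h 0 = \<zero>\<^bsub>N\<^esub>"
    using h_add[OF F_closed(4,4)] h_closed[OF F_closed(4)] by (simp add: N.add.r_cancel_one')
  have h_minus: "h (- v) = \<ominus>\<^bsub>N\<^esub> h v" if "v \<in> carrier F" for v
    using h_add[OF F_closed(3)[OF that] that] h_closed[OF that] h_closed[OF F_closed(3)[OF that]] h_zero
    by (simp add: N.minus_equality)
  have h_diff: "h (v - w) = h v \<ominus>\<^bsub>N\<^esub> h w" if "v \<in> carrier F" "w \<in> carrier F" for v w
    using h_add[OF that(1) F_closed(3)[OF that(2)]] h_minus[OF that(2)] by (simp add: a_minus_def)
  have cancel: "a \<oplus>\<^bsub>N\<^esub> b \<ominus>\<^bsub>N\<^esub> a \<ominus>\<^bsub>N\<^esub> b = \<zero>\<^bsub>N\<^esub>" if "a \<in> carrier N" "b \<in> carrier N" for a b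
    using N.M.r_neg[of "a \<oplus>\<^bsub>N\<^esub> b"] that by (simp add: a_minus_def N.M.minus_add N.M.a_assoc)
  have rel: "h r = \<zero>\<^bsub>N\<^esub>" if r: "r \<in> tensor_relations R S \<phi> M" for r
  proof -
    from r show ?thesis
    proof (cases rule: relations_cases)
      case (add_left x y s)
      then have "h r = h (frag_of (x \<oplus>\<^bsub>M\<^esub> y, s)) \<ominus>\<^bsub>N\<^esub> h (frag_of (x, s)) \<ominus>\<^bsub>N\<^esub> h (frag_of (y, s))"
        by (simp add: h_diff F_closed F_of del: carrier_free_Abelian_group_iff)
      then show ?thesis using add_left f
        by (simp add: h_of f'_def f_add N.smult_r_distr cancel)
    next
      case (add_right x s s')
      then have "h r = h (frag_of (x, s \<oplus>\<^bsub>S\<^esub> s')) \<ominus>\<^bsub>N\<^esub> h (frag_of (x, s)) \<ominus>\<^bsub>N\<^esub> h (frag_of (x, s'))"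
        by (simp add: h_diff F_closed F_of del: carrier_free_Abelian_group_iff)
      then show ?thesis using add_right f
        by (simp add: h_of f'_def N.smult_l_distr cancel)
    next
      case (smult q x s)
      then have "h r = h (frag_of (q \<odot>\<^bsub>M\<^esub> x, s)) \<ominus>\<^bsub>N\<^esub> h (frag_of (x, \<phi> q \<otimes>\<^bsub>S\<^esub> s))"
        by (simp add: h_diff F_closed F_of del: carrier_free_Abelian_group_iff)
      then show ?thesis using smult f
        by (simp add: h_of f'_def f_smult N.smult_assoc1[symmetric] S.m_comm a_minus_def N.M.r_neg)
    qed
  qed
  have hK: "h k = \<zero>\<^bsub>N\<^esub> \<and> k \<in> carrier F" if "k \<in> K" for k
    using that unfolding tensor_kernel_def
  proof (induction rule: generate.induct)
    case (inv r)
    then have "r \<in> carrier F" using relations_subset by blast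
    then show ?case using rel[OF inv] by (simp add: h_minus F_closed(3)[simplified])
  next
    case (incl r)
    then show ?case using rel relations_subset by blast
  next
    case (eng a b)
    then show ?case by (simp add: h_add F_closed del: carrier_free_Abelian_group_iff)
  qed (use F_closed(4) in \<open>simp add: h_zero\<close>)
  have "h v = h w" if "v \<in> carrier F" "w \<in> carrier F" "cls v = cls w" for v w
    using hK[of "v - w"] that by (simp add: cls_eq_iff h_diff h_closed N.M.diff_eq_zero_iff del: carrier_free_Abelian_group_iff)
  then obtain g where g: "g \<in> hom (F Mod K) (add_monoid N)" "\<And>v. v \<in> carrier F \<Longrightarrow> g (cls v) = h v"
    using FactGroup_universal[OF h K_normal] by metis
  have h_scale: "h (scale t v) = t \<odot>\<^bsub>N\<^esub> h v" if "t \<in> carrier S" "v \<in> carrier F" for t v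
  proof -
    have "Poly_Mapping.keys v \<subseteq> carrier M \<times> carrier S" using that by simp
    then have "v \<in> carrier F \<and> h (scale t v) = t \<odot>\<^bsub>N\<^esub> h v"
    proof (induction rule: frag_induction)
      case (diff a b)
      then show ?case
        using that(1)
        by (simp add: frag_extend_diff h_diff F_closed scale_closed h_closed a_minus_def N.smult_r_distr N.smult_r_minus
          del: carrier_free_Abelian_group_iff)
    qed (use that(1) F_closed(4) f in \<open>auto simp: h_zero h_of f'_def N.smult_assoc1\<close>)
    then show ?thesis by simp
  qed
  show thesis
  proof
    show "g \<in> linear_maps S T N"
      using g h_closed
      by (intro linear_mapsI; elim T_cases)
        (auto simp: T_simps T_smult h_add h_scale scale_closed F_closed simp del: carrier_free_Abelian_group_iff)
    show "g (\<iota> x) = f x" if "x \<in> carrier M" for x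
      using g(2)[of "frag_of (x, \<one>\<^bsub>S\<^esub>)"] that f by (simp add: pure_eq h_of f'_def)
  qed
qed

lemma linear_maps_tensor_eqI:
  assumes "f \<in> linear_maps S T N" "g \<in> linear_maps S T N"
    and "\<And>x. x \<in> carrier M \<Longrightarrow> f (\<iota> x) = g (\<iota> x)" "z \<in> carrier T"
  shows "f z = g z"
  using assms(4)
  by (induction rule: tensor_induct)
    (auto simp: linear_maps_add[OF assms(1)] linear_maps_add[OF assms(2)]
      linear_maps_smult[OF assms(1)] linear_maps_smult[OF assms(2)] assms(3))

end

subsection \<open>Tensor products of direct products\<close>

context base_change
begin

lemma tensor_product_intro: "module R M \<Longrightarrow> tensor_product R S \<phi> M"
  by (simp add: tensor_product_def base_change_axioms)

lemma tensor_prod_iso: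
  assumes "module R M" "module R N"
  obtains \<Theta> where "module_iso S (tensor R S \<phi> (M \<times>\<^sub>M N)) (tensor R S \<phi> M \<times>\<^sub>M tensor R S \<phi> N) \<Theta>"
    "\<And>x y. x \<in> carrier M \<Longrightarrow> y \<in> carrier N \<Longrightarrow>
      \<Theta> (pure_tensor R S \<phi> (M \<times>\<^sub>M N) (x, y) \<one>\<^bsub>S\<^esub>) =
      (pure_tensor R S \<phi> M x \<one>\<^bsub>S\<^esub>, pure_tensor R S \<phi> N y \<one>\<^bsub>S\<^esub>)"
proof -
  interpret A: tensor_product R S \<phi> M by (rule tensor_product_intro) fact
  interpret B: tensor_product R S \<phi> N by (rule tensor_product_intro) fact
  interpret AB: tensor_product R S \<phi> "M \<times>\<^sub>M N"
    by (intro tensor_product_intro module_prod_module) fact+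
  have prod: "module S (A.T \<times>\<^sub>M B.T)" by (rule module_prod_module[OF A.module_T B.module_T])
  obtain \<Theta> where \<Theta>: "\<Theta> \<in> linear_maps S AB.T (A.T \<times>\<^sub>M B.T)"
    "\<And>z. z \<in> carrier (M \<times>\<^sub>M N) \<Longrightarrow> \<Theta> (AB.\<iota> z) = (case z of (x, y) \<Rightarrow> (A.\<iota> x, B.\<iota> y))"
    by (rule AB.tensor_lift[OF prod, of "\<lambda>(x, y). (A.\<iota> x, B.\<iota> y)"])
      (auto simp: A.\<iota>_add B.\<iota>_add A.\<iota>_smult B.\<iota>_smult)
  obtain g where g: "g \<in> linear_maps S A.T AB.T" "\<And>x. x \<in> carrier M \<Longrightarrow> g (A.\<iota> x) = AB.\<iota> (x, \<zero>\<^bsub>N\<^esub>)"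
    by (rule A.tensor_lift[OF AB.module_T, of "\<lambda>x. AB.\<iota> (x, \<zero>\<^bsub>N\<^esub>)"])
      (auto simp flip: AB.\<iota>_add AB.\<iota>_smult)
  obtain h where h: "h \<in> linear_maps S B.T AB.T" "\<And>y. y \<in> carrier N \<Longrightarrow> h (B.\<iota> y) = AB.\<iota> (\<zero>\<^bsub>M\<^esub>, y)"
    by (rule B.tensor_lift[OF AB.module_T, of "\<lambda>y. AB.\<iota> (\<zero>\<^bsub>M\<^esub>, y)"])
      (auto simp flip: AB.\<iota>_add AB.\<iota>_smult)
  note lin = linear_maps_closed[OF g(1)] linear_maps_closed[OF h(1)] linear_maps_closed[OF \<Theta>(1)]
    linear_maps_add[OF g(1)] linear_maps_add[OF h(1)] linear_maps_add[OF \<Theta>(1)]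
    linear_maps_smult[OF g(1)] linear_maps_smult[OF h(1)] linear_maps_smult[OF \<Theta>(1)]
  have gh: "(\<lambda>(u, v). g u \<oplus>\<^bsub>AB.T\<^esub> h v) \<in> linear_maps S (A.T \<times>\<^sub>M B.T) AB.T"
    by (rule linear_mapsI) (auto simp: lin AB.T.smult_r_distr AB.T.M.a_ac)
  have "\<Theta> (g u) = (u, \<zero>\<^bsub>B.T\<^esub>)" if "u \<in> carrier A.T" for u
    by (rule A.linear_maps_tensor_eqI[OF linear_maps_comp[OF g(1) \<Theta>(1)] _ _ that, of "\<lambda>u. (u, \<zero>\<^bsub>B.T\<^esub>)"])
      (auto intro!: linear_mapsI simp: g \<Theta> B.\<iota>_zero)
  moreover have "\<Theta> (h v) = (\<zero>\<^bsub>A.T\<^esub>, v)" if "v \<in> carrier B.T" for v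
    by (rule B.linear_maps_tensor_eqI[OF linear_maps_comp[OF h(1) \<Theta>(1)] _ _ that, of "\<lambda>v. (\<zero>\<^bsub>A.T\<^esub>, v)"])
      (auto intro!: linear_mapsI simp: h \<Theta> A.\<iota>_zero)
  moreover have "(\<lambda>(u, v). g u \<oplus>\<^bsub>AB.T\<^esub> h v) (\<Theta> z) = z" if "z \<in> carrier AB.T" for z
    by (rule AB.linear_maps_tensor_eqI[OF linear_maps_comp[OF \<Theta>(1) gh] _ _ that, of "\<lambda>z. z"])
      (auto intro!: linear_mapsI simp: g h \<Theta> simp flip: AB.\<iota>_add)
  ultimately have "module_iso S AB.T (A.T \<times>\<^sub>M B.T) \<Theta>"
    by (intro module_isoI[OF \<Theta>(1) gh]) (auto simp: lin)
  then show thesis by (rule that) (simp add: \<Theta>)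
qed

lemma tensor_self_iso:
  obtains \<Theta> where "module_iso S (tensor R S \<phi> (self_module R)) (self_module S) \<Theta>"
    "\<And>r. r \<in> carrier R \<Longrightarrow> \<Theta> (pure_tensor R S \<phi> (self_module R) r \<one>\<^bsub>S\<^esub>) = \<phi> r"
proof -
  interpret A: tensor_product R S \<phi> "self_module R"
    by (intro tensor_product_intro module_self_module R.cring_axioms)
  have S: "module S (self_module S)" by (rule module_self_module) (rule S.cring_axioms)
  obtain \<Theta> where \<Theta>: "\<Theta> \<in> linear_maps S A.T (self_module S)"
    "\<And>r. r \<in> carrier (self_module R) \<Longrightarrow> \<Theta> (A.\<iota> r) = \<phi> r"
    by (rule A.tensor_lift[OF S, of \<phi>]) auto
  have g: "(\<lambda>s. s \<odot>\<^bsub>A.T\<^esub> A.\<iota> \<one>\<^bsub>R\<^esub>) \<in> linear_maps S (self_module S) A.T"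
    by (rule linear_mapsI) (auto simp: A.T.smult_l_distr A.T.smult_assoc1)
  have "(\<Theta> z) \<odot>\<^bsub>A.T\<^esub> A.\<iota> \<one>\<^bsub>R\<^esub> = z" if "z \<in> carrier A.T" for z
  proof (rule A.linear_maps_tensor_eqI[OF linear_maps_comp[OF \<Theta>(1) g] _ _ that, of "\<lambda>z. z"])
    fix r assume "r \<in> carrier (self_module R)"
    then show "\<Theta> (A.\<iota> r) \<odot>\<^bsub>A.T\<^esub> A.\<iota> \<one>\<^bsub>R\<^esub> = A.\<iota> r"
      using A.\<iota>_smult[of r "\<one>\<^bsub>R\<^esub>"] by (subst \<Theta>(2)) simp_all
  qed (auto intro!: linear_mapsI)
  moreover have "\<Theta> (s \<odot>\<^bsub>A.T\<^esub> A.\<iota> \<one>\<^bsub>R\<^esub>) = s" if "s \<in> carrier S" for s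
    using that linear_maps_smult[OF \<Theta>(1), of s "A.\<iota> \<one>\<^bsub>R\<^esub>"] by (simp add: \<Theta>)
  ultimately have "module_iso S A.T (self_module S) \<Theta>"
    by (intro module_isoI[OF \<Theta>(1) g]) auto
  then show thesis by (rule that) (simp add: \<Theta>)
qed

end

section \<open>Localization\<close>

locale localized = R: cring R for R :: "'r ring" + fixes P
  assumes prime: "primeideal P R"
begin

definition "U = carrier R - P"
abbreviation "fr \<equiv> loc_frac R P"
abbreviation "L \<equiv> localization R P"
abbreviation "\<phi> r \<equiv> loc_frac R P r \<one>\<^bsub>R\<^esub>"

sublocale P: primeideal P R by (rule prime)

lemma U_closed [simp]: "u \<in> U \<Longrightarrow> u \<in> carrier R"
  by (simp add: U_def)

lemma one_U [simp]: "\<one>\<^bsub>R\<^esub> \<in> U"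
  using P.I_notcarr P.one_imp_carrier by (auto simp: U_def)

lemma mult_U [simp]: "u \<in> U \<Longrightarrow> v \<in> U \<Longrightarrow> u \<otimes>\<^bsub>R\<^esub> v \<in> U"
  using P.I_prime by (auto simp: U_def)

lemma frac_iff:
  "(b, t) \<in> fr a s \<longleftrightarrow> b \<in> carrier R \<and> t \<in> U \<and> (\<exists>u\<in>U. u \<otimes>\<^bsub>R\<^esub> (a \<otimes>\<^bsub>R\<^esub> t) = u \<otimes>\<^bsub>R\<^esub> (b \<otimes>\<^bsub>R\<^esub> s))"
  by (simp only: loc_frac_def mem_Collect_eq prod.case U_def)

lemma frac_eqI:
  assumes a: "a \<in> carrier R" and s: "s \<in> U" and b: "b \<in> carrier R" and t: "t \<in> U"
    and u: "u \<in> U" and eq: "u \<otimes>\<^bsub>R\<^esub> (a \<otimes>\<^bsub>R\<^esub> t) = u \<otimes>\<^bsub>R\<^esub> (b \<otimes>\<^bsub>R\<^esub> s)"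
  shows "fr a s \<subseteq> fr b t"
proof
  fix z assume "z \<in> fr a s"
  then obtain c w where z1: "z = (c, w)" "(c, w) \<in> fr a s" by (cases z) simp
  then obtain v where z: "c \<in> carrier R" "w \<in> U" "v \<in> U"
    and eq2: "v \<otimes>\<^bsub>R\<^esub> (a \<otimes>\<^bsub>R\<^esub> w) = v \<otimes>\<^bsub>R\<^esub> (c \<otimes>\<^bsub>R\<^esub> s)"
    by (simp only: frac_iff) blast
  have cl: "a \<in> carrier R" "b \<in> carrier R" "c \<in> carrier R" "s \<in> carrier R" "t \<in> carrier R"
    "u \<in> carrier R" "v \<in> carrier R" "w \<in> carrier R"
    using a s b t u z by (simp_all only: U_closed)
  have "(u \<otimes>\<^bsub>R\<^esub> v \<otimes>\<^bsub>R\<^esub> s) \<otimes>\<^bsub>R\<^esub> (b \<otimes>\<^bsub>R\<^esub> w) = v \<otimes>\<^bsub>R\<^esub> w \<otimes>\<^bsub>R\<^esub> (u \<otimes>\<^bsub>R\<^esub> (b \<otimes>\<^bsub>R\<^esub> s))"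
    using cl by (simp add: R.m_ac)
  also have "\<dots> = u \<otimes>\<^bsub>R\<^esub> t \<otimes>\<^bsub>R\<^esub> (v \<otimes>\<^bsub>R\<^esub> (a \<otimes>\<^bsub>R\<^esub> w))"
    unfolding eq[symmetric] using cl by (simp add: R.m_ac)
  also have "\<dots> = (u \<otimes>\<^bsub>R\<^esub> v \<otimes>\<^bsub>R\<^esub> s) \<otimes>\<^bsub>R\<^esub> (c \<otimes>\<^bsub>R\<^esub> t)"
    unfolding eq2 using cl by (simp add: R.m_ac)
  finally show "z \<in> fr b t"
    unfolding z1(1) frac_iff
    using z u s by (auto intro!: bexI[of _ "u \<otimes>\<^bsub>R\<^esub> v \<otimes>\<^bsub>R\<^esub> s"])
qed

lemma frac_mem: "a \<in> carrier R \<Longrightarrow> s \<in> U \<Longrightarrow> (a, s) \<in> fr a s"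
  unfolding frac_iff by (intro conjI bexI[of _ "\<one>\<^bsub>R\<^esub>"]) (assumption | rule refl one_U)+

lemma frac_memD:
  assumes "(b, t) \<in> fr a s"
  obtains u where "b \<in> carrier R" "t \<in> U" "u \<in> U" "u \<otimes>\<^bsub>R\<^esub> (a \<otimes>\<^bsub>R\<^esub> t) = u \<otimes>\<^bsub>R\<^esub> (b \<otimes>\<^bsub>R\<^esub> s)"
  using assms that unfolding frac_iff by blast

lemma frac_eq_iff:
  assumes "a \<in> carrier R" "s \<in> U" "b \<in> carrier R" "t \<in> U"
  shows "fr a s = fr b t \<longleftrightarrow> (\<exists>u\<in>U. u \<otimes>\<^bsub>R\<^esub> (a \<otimes>\<^bsub>R\<^esub> t) = u \<otimes>\<^bsub>R\<^esub> (b \<otimes>\<^bsub>R\<^esub> s))"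
proof
  assume "fr a s = fr b t"
  then have "(b, t) \<in> fr a s" using frac_mem assms by simp
  then show "\<exists>u\<in>U. u \<otimes>\<^bsub>R\<^esub> (a \<otimes>\<^bsub>R\<^esub> t) = u \<otimes>\<^bsub>R\<^esub> (b \<otimes>\<^bsub>R\<^esub> s)" by (blast elim: frac_memD)
next
  assume "\<exists>u\<in>U. u \<otimes>\<^bsub>R\<^esub> (a \<otimes>\<^bsub>R\<^esub> t) = u \<otimes>\<^bsub>R\<^esub> (b \<otimes>\<^bsub>R\<^esub> s)"
  then obtain u where "u \<in> U" "u \<otimes>\<^bsub>R\<^esub> (a \<otimes>\<^bsub>R\<^esub> t) = u \<otimes>\<^bsub>R\<^esub> (b \<otimes>\<^bsub>R\<^esub> s)" ..
  with assms frac_eqI[of a s b t u] frac_eqI[of b t a s u] show "fr a s = fr b t"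
    by (intro equalityI) simp_all
qed

lemma L_carrier: "z \<in> carrier L \<longleftrightarrow> (\<exists>a\<in>carrier R. \<exists>s\<in>U. z = fr a s)"
  by (auto simp: localization_def U_def)

lemma L_cases: assumes "z \<in> carrier L" obtains a s where "a \<in> carrier R" "s \<in> U" "z = fr a s"
  using assms L_carrier by blast

lemma frac_closed [simp]: "a \<in> carrier R \<Longrightarrow> s \<in> U \<Longrightarrow> fr a s \<in> carrier L"
  using L_carrier by blast

lemma frac_mult:
  assumes "a \<in> carrier R" "s \<in> U" "b \<in> carrier R" "t \<in> U"
  shows "fr a s \<otimes>\<^bsub>L\<^esub> fr b t = fr (a \<otimes>\<^bsub>R\<^esub> b) (s \<otimes>\<^bsub>R\<^esub> t)"
proof -
  have same: "fr (a' \<otimes>\<^bsub>R\<^esub> b') (s' \<otimes>\<^bsub>R\<^esub> t') = fr (a \<otimes>\<^bsub>R\<^esub> b) (s \<otimes>\<^bsub>R\<^esub> t)"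
    if V: "(a', s') \<in> fr a s" and W: "(b', t') \<in> fr b t" for a' b' s' t'
  proof -
    obtain u where u: "a' \<in> carrier R" "s' \<in> U" "u \<in> U" "u \<otimes>\<^bsub>R\<^esub> (a \<otimes>\<^bsub>R\<^esub> s') = u \<otimes>\<^bsub>R\<^esub> (a' \<otimes>\<^bsub>R\<^esub> s)"
      using V by (rule frac_memD)
    obtain v where v: "b' \<in> carrier R" "t' \<in> U" "v \<in> U" "v \<otimes>\<^bsub>R\<^esub> (b \<otimes>\<^bsub>R\<^esub> t') = v \<otimes>\<^bsub>R\<^esub> (b' \<otimes>\<^bsub>R\<^esub> t)"
      using W by (rule frac_memD)
    note cl = u(1) U_closed[OF u(2)] U_closed[OF u(3)] v(1) U_closed[OF v(2)] U_closed[OF v(3)]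
      assms(1) U_closed[OF assms(2)] assms(3) U_closed[OF assms(4)]
    have "(u \<otimes>\<^bsub>R\<^esub> v) \<otimes>\<^bsub>R\<^esub> ((a' \<otimes>\<^bsub>R\<^esub> b') \<otimes>\<^bsub>R\<^esub> (s \<otimes>\<^bsub>R\<^esub> t)) = (u \<otimes>\<^bsub>R\<^esub> (a' \<otimes>\<^bsub>R\<^esub> s)) \<otimes>\<^bsub>R\<^esub> (v \<otimes>\<^bsub>R\<^esub> (b' \<otimes>\<^bsub>R\<^esub> t))"
      using cl by (simp add: R.m_ac)
    also have "\<dots> = (u \<otimes>\<^bsub>R\<^esub> v) \<otimes>\<^bsub>R\<^esub> ((a \<otimes>\<^bsub>R\<^esub> b) \<otimes>\<^bsub>R\<^esub> (s' \<otimes>\<^bsub>R\<^esub> t'))"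
      unfolding u(4)[symmetric] v(4)[symmetric] using cl by (simp add: R.m_ac)
    finally show ?thesis
      using u v assms by (subst frac_eq_iff) (auto intro: R.m_closed mult_U)
  qed
  have "fr a s \<otimes>\<^bsub>L\<^esub> fr b t =
    \<Union>{fr (a' \<otimes>\<^bsub>R\<^esub> b') (s' \<otimes>\<^bsub>R\<^esub> t') | a' s' b' t'. (a', s') \<in> fr a s \<and> (b', t') \<in> fr b t}"
    by (simp add: localization_def)
  also have "{fr (a' \<otimes>\<^bsub>R\<^esub> b') (s' \<otimes>\<^bsub>R\<^esub> t') | a' s' b' t'. (a', s') \<in> fr a s \<and> (b', t') \<in> fr b t} =
    {fr (a \<otimes>\<^bsub>R\<^esub> b) (s \<otimes>\<^bsub>R\<^esub> t)}"
    using same frac_mem[OF assms(1,2)] frac_mem[OF assms(3,4)] by blast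
  finally show ?thesis by simp
qed

lemma frac_add:
  assumes "a \<in> carrier R" "s \<in> U" "b \<in> carrier R" "t \<in> U"
  shows "fr a s \<oplus>\<^bsub>L\<^esub> fr b t = fr (a \<otimes>\<^bsub>R\<^esub> t \<oplus>\<^bsub>R\<^esub> b \<otimes>\<^bsub>R\<^esub> s) (s \<otimes>\<^bsub>R\<^esub> t)"
proof -
  have same: "fr (a' \<otimes>\<^bsub>R\<^esub> t' \<oplus>\<^bsub>R\<^esub> b' \<otimes>\<^bsub>R\<^esub> s') (s' \<otimes>\<^bsub>R\<^esub> t') = fr (a \<otimes>\<^bsub>R\<^esub> t \<oplus>\<^bsub>R\<^esub> b \<otimes>\<^bsub>R\<^esub> s) (s \<otimes>\<^bsub>R\<^esub> t)"
    if V: "(a', s') \<in> fr a s" and W: "(b', t') \<in> fr b t" for a' b' s' t'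
  proof -
    obtain u where u: "a' \<in> carrier R" "s' \<in> U" "u \<in> U" "u \<otimes>\<^bsub>R\<^esub> (a \<otimes>\<^bsub>R\<^esub> s') = u \<otimes>\<^bsub>R\<^esub> (a' \<otimes>\<^bsub>R\<^esub> s)"
      using V by (rule frac_memD)
    obtain v where v: "b' \<in> carrier R" "t' \<in> U" "v \<in> U" "v \<otimes>\<^bsub>R\<^esub> (b \<otimes>\<^bsub>R\<^esub> t') = v \<otimes>\<^bsub>R\<^esub> (b' \<otimes>\<^bsub>R\<^esub> t)"
      using W by (rule frac_memD)
    note cl = u(1) U_closed[OF u(2)] U_closed[OF u(3)] v(1) U_closed[OF v(2)] U_closed[OF v(3)]
      assms(1) U_closed[OF assms(2)] assms(3) U_closed[OF assms(4)]
    have "(u \<otimes>\<^bsub>R\<^esub> v) \<otimes>\<^bsub>R\<^esub> ((a' \<otimes>\<^bsub>R\<^esub> t' \<oplus>\<^bsub>R\<^esub> b' \<otimes>\<^bsub>R\<^esub> s') \<otimes>\<^bsub>R\<^esub> (s \<otimes>\<^bsub>R\<^esub> t)) =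
      (u \<otimes>\<^bsub>R\<^esub> (a' \<otimes>\<^bsub>R\<^esub> s)) \<otimes>\<^bsub>R\<^esub> (v \<otimes>\<^bsub>R\<^esub> t \<otimes>\<^bsub>R\<^esub> t') \<oplus>\<^bsub>R\<^esub> (v \<otimes>\<^bsub>R\<^esub> (b' \<otimes>\<^bsub>R\<^esub> t)) \<otimes>\<^bsub>R\<^esub> (u \<otimes>\<^bsub>R\<^esub> s \<otimes>\<^bsub>R\<^esub> s')"
      using cl by (simp add: R.m_ac R.l_distr R.r_distr)
    also have "\<dots> = (u \<otimes>\<^bsub>R\<^esub> v) \<otimes>\<^bsub>R\<^esub> ((a \<otimes>\<^bsub>R\<^esub> t \<oplus>\<^bsub>R\<^esub> b \<otimes>\<^bsub>R\<^esub> s) \<otimes>\<^bsub>R\<^esub> (s' \<otimes>\<^bsub>R\<^esub> t'))"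
      unfolding u(4)[symmetric] v(4)[symmetric] using cl by (simp add: R.m_ac R.l_distr R.r_distr)
    finally show ?thesis
      using u v assms cl
      by (subst frac_eq_iff) (auto intro: mult_U bexI[of _ "u \<otimes>\<^bsub>R\<^esub> v"])
  qed
  have "fr a s \<oplus>\<^bsub>L\<^esub> fr b t =
    \<Union>{fr (a' \<otimes>\<^bsub>R\<^esub> t' \<oplus>\<^bsub>R\<^esub> b' \<otimes>\<^bsub>R\<^esub> s') (s' \<otimes>\<^bsub>R\<^esub> t') | a' s' b' t'. (a', s') \<in> fr a s \<and> (b', t') \<in> fr b t}"
    by (simp add: localization_def)
  also have "{fr (a' \<otimes>\<^bsub>R\<^esub> t' \<oplus>\<^bsub>R\<^esub> b' \<otimes>\<^bsub>R\<^esub> s') (s' \<otimes>\<^bsub>R\<^esub> t') | a' s' b' t'. (a', s') \<in> fr a s \<and> (b', t') \<in> fr b t} =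
    {fr (a \<otimes>\<^bsub>R\<^esub> t \<oplus>\<^bsub>R\<^esub> b \<otimes>\<^bsub>R\<^esub> s) (s \<otimes>\<^bsub>R\<^esub> t)}"
    using same frac_mem[OF assms(1,2)] frac_mem[OF assms(3,4)] by blast
  finally show ?thesis by simp
qed

lemma frac_cong:
  assumes "a \<in> carrier R" "s \<in> U" "b \<in> carrier R" "t \<in> U" "a \<otimes>\<^bsub>R\<^esub> t = b \<otimes>\<^bsub>R\<^esub> s"
  shows "fr a s = fr b t"
  using assms by (subst frac_eq_iff) (auto intro!: bexI[of _ "\<one>\<^bsub>R\<^esub>"])

lemma L_zero: "\<zero>\<^bsub>L\<^esub> = fr \<zero>\<^bsub>R\<^esub> \<one>\<^bsub>R\<^esub>" and L_one: "\<one>\<^bsub>L\<^esub> = fr \<one>\<^bsub>R\<^esub> \<one>\<^bsub>R\<^esub>"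
  by (simp_all add: localization_def)

lemma cring_L: "cring L"
proof (rule cringI)
  show "abelian_group L"
  proof (rule abelian_groupI)
    fix x assume "x \<in> carrier L"
    then obtain a s where x: "a \<in> carrier R" "s \<in> U" "x = fr a s" by (rule L_cases)
    then have "fr (\<ominus>\<^bsub>R\<^esub> a) s \<oplus>\<^bsub>L\<^esub> x = \<zero>\<^bsub>L\<^esub>"
      by (simp add: frac_add L_zero R.l_minus R.l_neg) (rule frac_cong; simp)
    then show "\<exists>y\<in>carrier L. y \<oplus>\<^bsub>L\<^esub> x = \<zero>\<^bsub>L\<^esub>" using x by (intro bexI[of _ "fr (\<ominus>\<^bsub>R\<^esub> a) s"]) auto
  next
    fix x y z assume "x \<in> carrier L" "y \<in> carrier L" "z \<in> carrier L"
    then obtain a s b t c w where *: "a \<in> carrier R" "s \<in> U" "x = fr a s" "b \<in> carrier R" "t \<in> U" "y = fr b t"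
      "c \<in> carrier R" "w \<in> U" "z = fr c w" by (elim L_cases) blast
    note cl = U_closed[OF *(2)] U_closed[OF *(5)] U_closed[OF *(8)]
    show "x \<oplus>\<^bsub>L\<^esub> y \<oplus>\<^bsub>L\<^esub> z = x \<oplus>\<^bsub>L\<^esub> (y \<oplus>\<^bsub>L\<^esub> z)"
      using * cl by (simp add: frac_add R.l_distr R.r_distr R.m_ac R.a_ac)
  qed (auto elim!: L_cases simp: frac_add L_zero R.a_comm R.m_comm)
  show "comm_monoid L"
    by (rule comm_monoidI) (auto elim!: L_cases simp: frac_mult L_one R.m_ac)
  fix x y z assume "x \<in> carrier L" "y \<in> carrier L" "z \<in> carrier L"
  then obtain a s b t c w where *: "a \<in> carrier R" "s \<in> U" "x = fr a s" "b \<in> carrier R" "t \<in> U" "y = fr b t"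
    "c \<in> carrier R" "w \<in> U" "z = fr c w" by (elim L_cases) blast
  note cl = U_closed[OF *(2)] U_closed[OF *(5)] U_closed[OF *(8)]
  show "(x \<oplus>\<^bsub>L\<^esub> y) \<otimes>\<^bsub>L\<^esub> z = x \<otimes>\<^bsub>L\<^esub> z \<oplus>\<^bsub>L\<^esub> y \<otimes>\<^bsub>L\<^esub> z"
    using * cl
    by (simp add: frac_add frac_mult) 
      (rule frac_cong; simp add: R.l_distr R.r_distr R.m_ac)
qed

lemma \<phi>_hom: "\<phi> \<in> ring_hom R L"
  by (rule ring_hom_memI) (auto simp: frac_mult frac_add L_one)

sublocale base_change R L \<phi>
  by (intro base_change.intro base_change_axioms.intro cring_L \<phi>_hom R.cring_axioms)

lemma \<phi>_eq_iff: "a \<in> carrier R \<Longrightarrow> b \<in> carrier R \<Longrightarrow> \<phi> a = \<phi> b \<longleftrightarrow> (\<exists>u\<in>U. u \<otimes>\<^bsub>R\<^esub> a = u \<otimes>\<^bsub>R\<^esub> b)"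
  by (subst frac_eq_iff) (auto)

lemma clear_denominator:
  assumes "z \<in> carrier L"
  obtains t a where "t \<in> U" "a \<in> carrier R" "\<phi> t \<otimes>\<^bsub>L\<^esub> z = \<phi> a"
proof -
  obtain a s where "a \<in> carrier R" "s \<in> U" "z = fr a s" using assms by (rule L_cases)
  moreover from this have "\<phi> s \<otimes>\<^bsub>L\<^esub> z = \<phi> a"
    by (simp add: frac_mult) (rule frac_cong; simp add: R.m_comm)
  ultimately show thesis using that by blast
qed

end

lemma localized_intro: "cring R \<Longrightarrow> primeideal P R \<Longrightarrow> localized R P"
  by (simp add: localized_def localized_axioms_def)

lemma constant_rank_prod:
  assumes "module R M" "module R N" "constant_rank R M m" "constant_rank R N n"
  shows "constant_rank R (M \<times>\<^sub>M N) (m + n)"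
  unfolding constant_rank_def
proof (intro allI impI)
  fix P assume P: "primeideal P R"
  interpret M: module R M by fact
  interpret localized R P by (rule localized_intro) (fact M.R.cring_axioms P)+
  obtain \<Theta> where "module_iso L (tensor R L \<phi> (M \<times>\<^sub>M N)) (tensor R L \<phi> M \<times>\<^sub>M tensor R L \<phi> N) \<Theta>"
    using tensor_prod_iso[OF assms(1,2)] by blast
  then show "free_of_rank L (tensor R L \<phi> (M \<times>\<^sub>M N)) (m + n)"
    using assms(3,4) P free_of_rank_iso free_of_rank_prod unfolding constant_rank_def by blast
qed

lemma constant_rank_self:
  assumes "cring R"
  shows "constant_rank R (self_module R) 1"
  unfolding constant_rank_def
proof (intro allI impI)
  fix P assume P: "primeideal P R"
  interpret localized R P by (rule localized_intro) (fact assms P)+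
  obtain \<Theta> where "module_iso L (tensor R L \<phi> (self_module R)) (self_module L) \<Theta>"
    using tensor_self_iso by blast
  then show "free_of_rank L (tensor R L \<phi> (self_module R)) 1"
    using free_of_rank_iso free_of_rank_self[OF cring_L] by blast
qed

section \<open>Generation after localization\<close>

lemma (in abelian_monoid) finsum_induct:
  assumes "finite A" "\<And>a. a \<in> A \<Longrightarrow> g a \<in> carrier G" "Q \<zero>"
    "\<And>a. a \<in> A \<Longrightarrow> Q (g a)"
    "\<And>x y. x \<in> carrier G \<Longrightarrow> y \<in> carrier G \<Longrightarrow> Q x \<Longrightarrow> Q y \<Longrightarrow> Q (x \<oplus> y)"
  shows "Q (\<Oplus>i\<in>A. g i)"
  using assms(1,2,4)
proof (induction A rule: finite_induct)
  case (insert a A)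
  moreover from this have "g a \<in> carrier G" "g \<in> A \<rightarrow> carrier G" by auto
  ultimately show ?case using assms(5) by simp
qed (simp add: assms(3))

lemma (in abelian_group) add_diff_cancel_left:
  "x \<in> carrier G \<Longrightarrow> y \<in> carrier G \<Longrightarrow> x \<oplus> y \<ominus> x = y"
  using r_neg1[of x y] a_comm[of "\<ominus> x" "x \<oplus> y"] by (simp add: a_minus_def)

lemma finsum_self_module:
  assumes "cring R" "finite A" "f \<in> A \<rightarrow> carrier R"
  shows "finsum (self_module R) f A = finsum R f A"
proof -
  interpret R: cring R by fact
  interpret RR: module R "self_module R" by (rule module_self_module) fact
  show ?thesis
    using assms(2,3)
  proof (induction A rule: finite_induct)
    case (insert a A)
    then have "f a \<in> carrier R" "f \<in> A \<rightarrow> carrier R" by auto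
    then show ?case using insert by simp
  qed simp
qed

lemma (in module) smult_add_cross:
  assumes "a \<in> carrier R" "b \<in> carrier R" "x \<in> carrier M" "y \<in> carrier M"
  shows "(a \<otimes> b) \<odot>\<^bsub>M\<^esub> (x \<oplus>\<^bsub>M\<^esub> y) = b \<odot>\<^bsub>M\<^esub> (a \<odot>\<^bsub>M\<^esub> x) \<oplus>\<^bsub>M\<^esub> a \<odot>\<^bsub>M\<^esub> (b \<odot>\<^bsub>M\<^esub> y)"
  using assms by (simp add: smult_r_distr smult_assoc1[symmetric] R.m_comm)

lemma (in module) smult_commute:
  "a \<in> carrier R \<Longrightarrow> b \<in> carrier R \<Longrightarrow> x \<in> carrier M \<Longrightarrow> a \<odot>\<^bsub>M\<^esub> (b \<odot>\<^bsub>M\<^esub> x) = b \<odot>\<^bsub>M\<^esub> (a \<odot>\<^bsub>M\<^esub> x)"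
  by (simp add: smult_assoc1[symmetric] R.m_comm)

lemma (in tensor_product) \<iota>_finsum:
  assumes "finite A" "g \<in> A \<rightarrow> carrier M"
  shows "\<iota> (\<Oplus>\<^bsub>M\<^esub>i\<in>A. g i) = (\<Oplus>\<^bsub>T\<^esub>i\<in>A. \<iota> (g i))"
  using assms
proof (induction A rule: finite_induct)
  case (insert a A)
  then have "g a \<in> carrier M" "g \<in> A \<rightarrow> carrier M" by auto
  moreover from this have "(\<lambda>i. \<iota> (g i)) \<in> A \<rightarrow> carrier T" by (simp add: Pi_iff)
  ultimately show ?case using insert by (simp add: \<iota>_add)
qed (simp add: \<iota>_zero)

text \<open>
  The submodule generated by \<open>H\<close>, saturated with respect to \<open>U\<close>: it consists of the elements that
  lie in the span of \<open>H\<close> once the elements of \<open>U\<close> are inverted.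
\<close>

inductive_set saturated_span :: "'r ring \<Rightarrow> 'r set \<Rightarrow> ('r, 'a) module \<Rightarrow> 'a set \<Rightarrow> 'a set"
  for R :: "'r ring" and U :: "'r set" and M :: "('r, 'a) module" and H :: "'a set" where
  zero: "ring.zero M \<in> saturated_span R U M H"
| base: "x \<in> H \<Longrightarrow> x \<in> saturated_span R U M H"
| add: "x \<in> saturated_span R U M H \<Longrightarrow> y \<in> saturated_span R U M H \<Longrightarrow>
    Ring.ring.add M x y \<in> saturated_span R U M H"
| smult: "r \<in> carrier R \<Longrightarrow> x \<in> saturated_span R U M H \<Longrightarrow> Module.smult M r x \<in> saturated_span R U M H"
| divide: "d \<in> U \<Longrightarrow> x \<in> carrier M \<Longrightarrow> Module.smult M d x \<in> saturated_span R U M H \<Longrightarrow>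
    x \<in> saturated_span R U M H"

context localized
begin

lemma not_in_P: "u \<in> U \<Longrightarrow> u \<notin> P"
  by (simp add: U_def)

lemma mult_UD: "u \<in> U \<Longrightarrow> r \<in> carrier R \<Longrightarrow> u \<otimes>\<^bsub>R\<^esub> r \<in> P \<Longrightarrow> r \<in> P"
  using P.I_prime by (auto simp: U_def)

lemma common_multiple:
  assumes "finite A" "\<And>k. k \<in> A \<Longrightarrow> \<exists>u\<in>U. Q u k"
    "\<And>u v k. k \<in> A \<Longrightarrow> u \<in> U \<Longrightarrow> v \<in> U \<Longrightarrow> Q u k \<Longrightarrow> Q (v \<otimes>\<^bsub>R\<^esub> u) k"
  obtains u where "u \<in> U" "\<And>k. k \<in> A \<Longrightarrow> Q u k"
proof -
  have "\<exists>u\<in>U. \<forall>k\<in>A. Q u k"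
    using assms
  proof (induction A rule: finite_induct)
    case (insert a A)
    then obtain u v where "u \<in> U" "\<forall>k\<in>A. Q u k" "v \<in> U" "Q v a" by blast
    then show ?case
      using insert.prems(2)[of _ u v] insert.prems(2)[of a v u]
      by (intro bexI[of _ "v \<otimes>\<^bsub>R\<^esub> u"]) (auto simp: R.m_comm)
  qed (use one_U in blast)
  then show thesis using that by blast
qed

abbreviation "lgen M H \<equiv> saturated_span R U M H"

lemmas lgen_intros = saturated_span.zero saturated_span.base saturated_span.add saturated_span.smult

lemma lgen_closed:
  assumes "module R M" "H \<subseteq> carrier M" "x \<in> lgen M H"
  shows "x \<in> carrier M"
proof -
  interpret M: module R M by fact
  show ?thesis using assms(3) by (induction rule: saturated_span.induct) (use assms(2) in auto)
qed

lemma lgen_least: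
  assumes "H \<subseteq> lgen M Y" shows "lgen M H \<subseteq> lgen M Y"
proof
  fix x assume "x \<in> lgen M H"
  then show "x \<in> lgen M Y"
    by (induction rule: saturated_span.induct) (use assms in \<open>auto intro: saturated_span.intros\<close>)
qed

lemma lgen_mono: "H \<subseteq> Y \<Longrightarrow> lgen M H \<subseteq> lgen M Y"
  by (rule lgen_least) (auto intro: saturated_span.base)

lemma lgen_insertD:
  assumes M: "module R M" and H: "H \<subseteq> carrier M" and b: "b \<in> carrier M" and z: "z \<in> lgen M (insert b H)"
  shows "\<exists>d\<in>U. \<exists>c\<in>carrier R. \<exists>w\<in>lgen M H. d \<odot>\<^bsub>M\<^esub> z = c \<odot>\<^bsub>M\<^esub> b \<oplus>\<^bsub>M\<^esub> w"
proof -
  interpret M: module R M by fact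
  note cl = lgen_closed[OF M H]
  show ?thesis
    using z
  proof (induction rule: saturated_span.induct)
    case zero
    show ?case using b saturated_span.zero by (intro bexI[of _ "\<one>\<^bsub>R\<^esub>"] bexI[of _ "\<zero>\<^bsub>R\<^esub>"] bexI[of _ "\<zero>\<^bsub>M\<^esub>"]) auto
  next
    case (base x)
    show ?case
    proof (cases "x = b")
      case True
      then show ?thesis using b saturated_span.zero by (intro bexI[of _ "\<one>\<^bsub>R\<^esub>"] bexI[of _ "\<zero>\<^bsub>M\<^esub>"]) auto
    next
      case False
      then have "x \<in> H" using base by simp
      then show ?thesis using b H saturated_span.base
        by (intro bexI[of _ "\<one>\<^bsub>R\<^esub>"] bexI[of _ "\<zero>\<^bsub>R\<^esub>"] bexI[of _ x]) auto
    qed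
  next
    case (add x y)
    then obtain d c w d' c' w' where *: "d \<in> U" "c \<in> carrier R" "w \<in> lgen M H" "d \<odot>\<^bsub>M\<^esub> x = c \<odot>\<^bsub>M\<^esub> b \<oplus>\<^bsub>M\<^esub> w"
      "d' \<in> U" "c' \<in> carrier R" "w' \<in> lgen M H" "d' \<odot>\<^bsub>M\<^esub> y = c' \<odot>\<^bsub>M\<^esub> b \<oplus>\<^bsub>M\<^esub> w'" by blast
    have xy: "x \<in> carrier M" "y \<in> carrier M" using add lgen_closed[OF M, of "insert b H"] H b by auto
    have "(d \<otimes>\<^bsub>R\<^esub> d') \<odot>\<^bsub>M\<^esub> (x \<oplus>\<^bsub>M\<^esub> y) = d' \<odot>\<^bsub>M\<^esub> (d \<odot>\<^bsub>M\<^esub> x) \<oplus>\<^bsub>M\<^esub> d \<odot>\<^bsub>M\<^esub> (d' \<odot>\<^bsub>M\<^esub> y)"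
      using xy * by (intro M.smult_add_cross) auto
    also have "\<dots> = (d' \<otimes>\<^bsub>R\<^esub> c \<oplus>\<^bsub>R\<^esub> d \<otimes>\<^bsub>R\<^esub> c') \<odot>\<^bsub>M\<^esub> b \<oplus>\<^bsub>M\<^esub> (d' \<odot>\<^bsub>M\<^esub> w \<oplus>\<^bsub>M\<^esub> d \<odot>\<^bsub>M\<^esub> w')"
      using xy * b cl by (simp add: M.smult_r_distr M.smult_l_distr M.smult_assoc1 M.M.a_ac)
    finally have eq: "(d \<otimes>\<^bsub>R\<^esub> d') \<odot>\<^bsub>M\<^esub> (x \<oplus>\<^bsub>M\<^esub> y) =
      (d' \<otimes>\<^bsub>R\<^esub> c \<oplus>\<^bsub>R\<^esub> d \<otimes>\<^bsub>R\<^esub> c') \<odot>\<^bsub>M\<^esub> b \<oplus>\<^bsub>M\<^esub> (d' \<odot>\<^bsub>M\<^esub> w \<oplus>\<^bsub>M\<^esub> d \<odot>\<^bsub>M\<^esub> w')" .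
    show ?case
      by (intro bexI, rule eq, intro saturated_span.add saturated_span.smult) (use * in auto)
  next
    case (smult r x)
    then obtain d c w where *: "d \<in> U" "c \<in> carrier R" "w \<in> lgen M H" "d \<odot>\<^bsub>M\<^esub> x = c \<odot>\<^bsub>M\<^esub> b \<oplus>\<^bsub>M\<^esub> w" by blast
    have x: "x \<in> carrier M" using smult lgen_closed[OF M, of "insert b H"] H b by auto
    have "d \<odot>\<^bsub>M\<^esub> (r \<odot>\<^bsub>M\<^esub> x) = r \<odot>\<^bsub>M\<^esub> (d \<odot>\<^bsub>M\<^esub> x)"
      using x * smult(1) by (intro M.smult_commute) auto
    also have "\<dots> = (r \<otimes>\<^bsub>R\<^esub> c) \<odot>\<^bsub>M\<^esub> b \<oplus>\<^bsub>M\<^esub> r \<odot>\<^bsub>M\<^esub> w"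
      using x * b cl smult(1) by (simp add: M.smult_r_distr M.smult_assoc1)
    finally show ?case
      using * smult(1) by (intro bexI[of _ d] bexI[of _ "r \<otimes>\<^bsub>R\<^esub> c"] bexI[of _ "r \<odot>\<^bsub>M\<^esub> w"]) (auto intro: lgen_intros)
  next
    case (divide e x)
    then obtain d c w where *: "d \<in> U" "c \<in> carrier R" "w \<in> lgen M H" "d \<odot>\<^bsub>M\<^esub> (e \<odot>\<^bsub>M\<^esub> x) = c \<odot>\<^bsub>M\<^esub> b \<oplus>\<^bsub>M\<^esub> w" by blast
    then show ?case using divide(1,2)
      by (intro bexI[of _ "d \<otimes>\<^bsub>R\<^esub> e"] bexI[of _ c] bexI[of _ w]) (auto simp: M.smult_assoc1)
  qed
qed

lemma lgen_diff:
  assumes "module R M" "H \<subseteq> carrier M" "x \<in> lgen M H" "y \<in> lgen M H"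
  shows "x \<ominus>\<^bsub>M\<^esub> y \<in> lgen M H"
proof -
  interpret M: module R M by fact
  have "\<ominus>\<^bsub>M\<^esub> y = (\<ominus>\<^bsub>R\<^esub> \<one>\<^bsub>R\<^esub>) \<odot>\<^bsub>M\<^esub> y"
    using lgen_closed[OF assms(1,2,4)] by (simp add: M.smult_l_minus)
  then show ?thesis
    using assms(3,4) by (auto simp: a_minus_def intro: saturated_span.intros)
qed

lemma exchange:
  assumes "finite B" "module R M" "Y \<subseteq> carrier M" "B \<subseteq> carrier M"
    and \<mu>: "\<mu> \<in> linear_maps R M (self_module R)" "\<And>y. y \<in> Y \<Longrightarrow> \<mu> y \<in> P"
    and "z \<in> lgen M (Y \<union> B)" "\<mu> z \<notin> P"
  shows "\<exists>b\<in>B. b \<in> lgen M (insert z (Y \<union> (B - {b})))"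
  using assms(1,4,7,8)
proof (induction B arbitrary: z rule: finite_induct)
  case empty
  have "\<mu> z \<in> P" if "z \<in> lgen M Y"
    using that
  proof (induction rule: saturated_span.induct)
    case zero
    show ?case using linear_maps_zero[OF assms(2) module_self_module[OF R.cring_axioms] \<mu>(1)] by simp
  next
    case (add x y)
    then show ?case using lgen_closed[OF assms(2,3)] by (simp add: linear_maps_add[OF \<mu>(1)])
  next
    case (smult r x)
    then show ?case using lgen_closed[OF assms(2,3)]
      by (simp add: linear_maps_smult[OF \<mu>(1)] P.I_l_closed)
  next
    case (divide d x)
    then show ?case
      using mult_UD[of d "\<mu> x"] linear_maps_closed[OF \<mu>(1)]
      by (simp add: linear_maps_smult[OF \<mu>(1)])
  qed (rule \<mu>(2))
  then show ?case using empty by simp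
next
  case (insert b B)
  interpret M: module R M by fact
  have sub: "Y \<union> B \<subseteq> carrier M" "b \<in> carrier M" using insert assms(3) by auto
  have z: "z \<in> carrier M" using lgen_closed[OF assms(2) _ insert.prems(2)] sub by auto
  obtain d c w where *: "d \<in> U" "c \<in> carrier R" "w \<in> lgen M (Y \<union> B)" "d \<odot>\<^bsub>M\<^esub> z = c \<odot>\<^bsub>M\<^esub> b \<oplus>\<^bsub>M\<^esub> w"
    using lgen_insertD[OF assms(2) sub, of z] insert.prems(2) by auto
  have w: "w \<in> carrier M" using lgen_closed[OF assms(2) sub(1) *(3)] .
  have b_notin: "Y \<union> (insert b B - {b}) = Y \<union> B" using insert.hyps by auto
  show ?case
  proof (cases "c \<in> P")
    case False
    let ?H = "insert z (Y \<union> B)"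
    have H: "?H \<subseteq> carrier M" using z sub by auto
    have "c \<odot>\<^bsub>M\<^esub> b = d \<odot>\<^bsub>M\<^esub> z \<ominus>\<^bsub>M\<^esub> w"
      using * w sub z by (simp add: a_minus_def M.M.a_assoc M.M.r_neg)
    moreover have "d \<odot>\<^bsub>M\<^esub> z \<in> lgen M ?H" "w \<in> lgen M ?H"
      using *(1,3) saturated_span.base[of z ?H R U M] subsetD[OF lgen_mono[of "Y \<union> B" ?H M], of w]
      by (auto intro: saturated_span.smult)
    ultimately have "c \<odot>\<^bsub>M\<^esub> b \<in> lgen M ?H" using lgen_diff[OF assms(2) H] by simp
    then have "b \<in> lgen M ?H" by (rule saturated_span.divide[rotated 2]) (use False *(2) sub in \<open>auto simp: U_def\<close>)
    then show ?thesis using b_notin by (intro bexI[of _ b]) auto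
  next
    case True
    have "\<mu> w \<notin> P"
    proof
      assume w_P: "\<mu> w \<in> P"
      have \<mu>_closed: "\<mu> b \<in> carrier R" "\<mu> z \<in> carrier R"
        using linear_maps_closed[OF \<mu>(1)] sub(2) z by simp_all
      have "d \<otimes>\<^bsub>R\<^esub> \<mu> z = \<mu> (c \<odot>\<^bsub>M\<^esub> b \<oplus>\<^bsub>M\<^esub> w)"
        using linear_maps_smult[OF \<mu>(1) U_closed[OF *(1)] z] by (simp only: *(4) self_module_simps)
      also have "\<dots> = c \<otimes>\<^bsub>R\<^esub> \<mu> b \<oplus>\<^bsub>R\<^esub> \<mu> w"
        using linear_maps_add[OF \<mu>(1) M.smult_closed[OF *(2) sub(2)] w] linear_maps_smult[OF \<mu>(1) *(2) sub(2)]
        by (simp only: self_module_simps)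
      also have "\<dots> \<in> P"
        by (rule P.a_closed[OF P.I_r_closed[OF True \<mu>_closed(1)] w_P])
      finally have "\<mu> z \<in> P" by (rule mult_UD[OF *(1) \<mu>_closed(2)])
      with insert.prems(3) show False ..
    qed
    have "\<exists>b'\<in>B. b' \<in> lgen M (insert w (Y \<union> (B - {b'})))"
      by (rule insert.IH[OF _ *(3) \<open>\<mu> w \<notin> P\<close>]) (rule le_supE[OF sub(1)])
    then obtain b' where b': "b' \<in> B" "b' \<in> lgen M (insert w (Y \<union> (B - {b'})))" ..
    let ?H = "insert z (Y \<union> (insert b B - {b'}))"
    have H: "?H \<subseteq> carrier M" using z sub by auto
    have bX: "b \<in> ?H" using insert.hyps b' by auto
    have "w = d \<odot>\<^bsub>M\<^esub> z \<ominus>\<^bsub>M\<^esub> c \<odot>\<^bsub>M\<^esub> b"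
      unfolding *(4) using *(2) w sub by (simp add: M.M.add_diff_cancel_left)
    moreover have "d \<odot>\<^bsub>M\<^esub> z \<in> lgen M ?H" "c \<odot>\<^bsub>M\<^esub> b \<in> lgen M ?H"
      using *(1,2) bX by (auto intro: lgen_intros)
    ultimately have "w \<in> lgen M ?H" using lgen_diff[OF assms(2) H] by simp
    then have "insert w (Y \<union> (B - {b'})) \<subseteq> lgen M ?H" by (auto intro: saturated_span.base)
    from subsetD[OF lgen_least[OF this] b'(2)] show ?thesis using b'(1) by (intro bexI[of _ b']) auto
  qed
qed

lemma steinitz:
  assumes M: "module R M" and H: "finite H" "H \<subseteq> carrier M" "lgen M H = carrier M"
    and I: "finite I" "card H \<le> card I"
    and y: "\<And>i. i \<in> I \<Longrightarrow> y i \<in> carrier M"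
    and \<mu>: "\<And>i. i \<in> I \<Longrightarrow> \<mu> i \<in> linear_maps R M (self_module R)"
    and off: "\<And>i j. i \<in> I \<Longrightarrow> j \<in> I \<Longrightarrow> i \<noteq> j \<Longrightarrow> \<mu> i (y j) \<in> P"
    and diag: "\<And>i. i \<in> I \<Longrightarrow> \<mu> i (y i) \<notin> P"
  shows "lgen M (y ` I) = carrier M"
proof -
  have "\<exists>B. finite B \<and> B \<subseteq> carrier M \<and> card B + card A \<le> card H \<and> lgen M (y ` A \<union> B) = carrier M"
    if "A \<subseteq> I" for A
    using finite_subset[OF that I(1)] that
  proof (induction A rule: finite_induct)
    case empty
    then show ?case using H by (intro exI[of _ H]) auto
  next
    case (insert a A)
    then obtain B where B: "finite B" "B \<subseteq> carrier M" "card B + card A \<le> card H"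
      "lgen M (y ` A \<union> B) = carrier M" by auto
    have A: "y ` A \<subseteq> carrier M" "a \<in> I" using insert y by auto
    have "\<mu> a v \<in> P" if "v \<in> y ` A" for v using that off insert by auto
    with exchange[OF B(1) M A(1) B(2) \<mu>[OF A(2)], of "y a"] obtain b where
      b: "b \<in> B" "b \<in> lgen M (insert (y a) (y ` A \<union> (B - {b})))"
      using B(4) y[OF A(2)] diag[OF A(2)] by auto
    have "y ` A \<union> B \<subseteq> lgen M (insert (y a) (y ` A \<union> (B - {b})))"
      using b by (auto intro: saturated_span.base)
    then have "carrier M \<subseteq> lgen M (insert (y a) (y ` A \<union> (B - {b})))"
      using lgen_least B(4) by blast
    moreover have sub: "insert (y a) (y ` A \<union> (B - {b})) \<subseteq> carrier M" using A B y by auto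
    ultimately have "lgen M (y ` insert a A \<union> (B - {b})) = carrier M"
      using lgen_closed[OF M sub] by auto
    moreover have "card (B - {b}) + card (insert a A) \<le> card H"
      using B b insert by (simp add: card_Diff_singleton card_gt_0_iff) (metis One_nat_def Suc_pred card_gt_0_iff emptyE add_Suc add_Suc_right)
    ultimately show ?case using B by (intro exI[of _ "B - {b}"]) auto
  qed
  from this[of I] obtain B where B: "finite B" "card B + card I \<le> card H" "lgen M (y ` I \<union> B) = carrier M" by auto
  then have "card B = 0" using I by linarith
  then have "B = {}" using B(1) by simp
  with B show ?thesis by simp
qed

lemma tensor_clear_denominator:
  assumes "module R M" "v \<in> carrier (tensor R L \<phi> M)"
  shows "\<exists>t\<in>U. \<exists>x\<in>carrier M. \<phi> t \<odot>\<^bsub>tensor R L \<phi> M\<^esub> v = pure_tensor R L \<phi> M x \<one>\<^bsub>L\<^esub>"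
proof -
  interpret tensor_product R L \<phi> M by (rule tensor_product_intro) fact
  show ?thesis
    using assms(2)
  proof (induction rule: tensor_induct)
    case (add a b)
    then obtain t x t' x' where *: "t \<in> U" "x \<in> carrier M" "\<phi> t \<odot>\<^bsub>T\<^esub> a = \<iota> x"
      "t' \<in> U" "x' \<in> carrier M" "\<phi> t' \<odot>\<^bsub>T\<^esub> b = \<iota> x'" by blast
    have "\<phi> (t \<otimes>\<^bsub>R\<^esub> t') \<odot>\<^bsub>T\<^esub> (a \<oplus>\<^bsub>T\<^esub> b) = \<phi> t' \<odot>\<^bsub>T\<^esub> (\<phi> t \<odot>\<^bsub>T\<^esub> a) \<oplus>\<^bsub>T\<^esub> \<phi> t \<odot>\<^bsub>T\<^esub> (\<phi> t' \<odot>\<^bsub>T\<^esub> b)"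
      using * add by (simp add: T.smult_add_cross)
    also have "\<dots> = \<iota> (t' \<odot>\<^bsub>M\<^esub> x \<oplus>\<^bsub>M\<^esub> t \<odot>\<^bsub>M\<^esub> x')"
      using * by (simp add: \<iota>_add \<iota>_smult)
    finally show ?case
      using * by (intro bexI[of _ "t \<otimes>\<^bsub>R\<^esub> t'"] bexI[of _ "t' \<odot>\<^bsub>M\<^esub> x \<oplus>\<^bsub>M\<^esub> t \<odot>\<^bsub>M\<^esub> x'"]) auto
  next
    case (\<iota> x s)
    then obtain t a where *: "t \<in> U" "a \<in> carrier R" "\<phi> t \<otimes>\<^bsub>L\<^esub> s = \<phi> a" using clear_denominator by blast
    then have "\<phi> t \<odot>\<^bsub>T\<^esub> (s \<odot>\<^bsub>T\<^esub> \<iota> x) = \<iota> (a \<odot>\<^bsub>M\<^esub> x)"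
      using \<iota> by (simp add: T.smult_assoc1[symmetric] \<iota>_smult)
    then show ?case using * \<iota> by (intro bexI[of _ t] bexI[of _ "a \<odot>\<^bsub>M\<^esub> x"]) auto
  qed
qed

text \<open>
  Elements of a finitely generated projective module that vanish after localization are killed by
  an element outside \<open>P\<close>: their finitely many coordinates are.
\<close>

lemma \<iota>_kernel:
  assumes M: "fg_projective R M" and v: "v \<in> carrier M"
    "pure_tensor R L \<phi> M v \<one>\<^bsub>L\<^esub> = \<zero>\<^bsub>tensor R L \<phi> M\<^esub>"
  obtains u where "u \<in> U" "u \<odot>\<^bsub>M\<^esub> v = \<zero>\<^bsub>M\<^esub>"
proof -
  have mod: "module R M" using M by (simp add: fg_projective_def)
  interpret tensor_product R L \<phi> M by (rule tensor_product_intro) fact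
  obtain n :: nat and m s where m: "\<And>i. i < n \<Longrightarrow> m i \<in> carrier M" 
    and s: "\<And>i. i < n \<Longrightarrow> s i \<in> linear_maps R M (self_module R)"
    and sum: "\<And>z. z \<in> carrier M \<Longrightarrow> z = (\<Oplus>\<^bsub>M\<^esub>i\<in>{..<n}. s i z \<odot>\<^bsub>M\<^esub> m i)"
    using fg_projective_dual_basis[OF M] by blast
  have sc: "s i z \<in> carrier R" if "i < n" "z \<in> carrier M" for i z
    using linear_maps_closed[OF s[OF that(1)] that(2)] by simp
  have kill: "\<exists>u\<in>U. u \<otimes>\<^bsub>R\<^esub> s i v = \<zero>\<^bsub>R\<^esub>" if i: "i \<in> {..<n}" for i
  proof -
    have L: "module L (self_module L)" by (rule module_self_module[OF cring_L])
    obtain \<theta> where "\<theta> \<in> linear_maps L T (self_module L)" "\<And>z. z \<in> carrier M \<Longrightarrow> \<theta> (\<iota> z) = \<phi> (s i z)"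
      by (rule tensor_lift[OF L, of "\<lambda>z. \<phi> (s i z)"])
        (use i s[of i] sc[of i] in \<open>auto simp: linear_maps_add linear_maps_smult\<close>)
    then have "\<phi> (s i v) = \<phi> \<zero>\<^bsub>R\<^esub>"
      using linear_maps_zero[OF T.module_axioms L] v by (metis L_zero self_module_simps(3))
    then show ?thesis using \<phi>_eq_iff[of "s i v" "\<zero>\<^bsub>R\<^esub>"] sc i v by auto
  qed
  obtain u where u: "u \<in> U" "\<And>i. i \<in> {..<n} \<Longrightarrow> u \<otimes>\<^bsub>R\<^esub> s i v = \<zero>\<^bsub>R\<^esub>"
    by (rule common_multiple[of "{..<n}" "\<lambda>u i. u \<otimes>\<^bsub>R\<^esub> s i v = \<zero>\<^bsub>R\<^esub>"])
      (use kill sc v in \<open>auto simp: R.m_assoc\<close>)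
  have "u \<odot>\<^bsub>M\<^esub> v = u \<odot>\<^bsub>M\<^esub> (\<Oplus>\<^bsub>M\<^esub>i\<in>{..<n}. s i v \<odot>\<^bsub>M\<^esub> m i)"
    using sum[OF v(1)] by simp
  also have "\<dots> = (\<Oplus>\<^bsub>M\<^esub>i\<in>{..<n}. u \<odot>\<^bsub>M\<^esub> (s i v \<odot>\<^bsub>M\<^esub> m i))"
    using u sc m v by (intro M.finsum_smult_ldistr) auto
  also have "\<dots> = (\<Oplus>\<^bsub>M\<^esub>i\<in>{..<n}. \<zero>\<^bsub>M\<^esub>)"
    using u sc m v by (intro M.M.finsum_cong') (auto simp flip: M.smult_assoc1)
  finally have "u \<odot>\<^bsub>M\<^esub> v = \<zero>\<^bsub>M\<^esub>" by simp
  with u(1) show thesis by (rule that)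
qed

text \<open>Linear forms on the localization come from linear forms on \<open>M\<close> up to a denominator.\<close>

lemma descend_form:
  assumes M: "fg_projective R M" and \<theta>: "\<theta> \<in> linear_maps L (tensor R L \<phi> M) (self_module L)"
  obtains t \<nu> where "t \<in> U" "\<nu> \<in> linear_maps R M (self_module R)"
    "\<And>z. z \<in> carrier M \<Longrightarrow> \<phi> (\<nu> z) = \<phi> t \<otimes>\<^bsub>L\<^esub> \<theta> (pure_tensor R L \<phi> M z \<one>\<^bsub>L\<^esub>)"
proof -
  have mod: "module R M" using M by (simp add: fg_projective_def)
  interpret tensor_product R L \<phi> M by (rule tensor_product_intro) fact
  interpret RR: module R "self_module R" by (rule module_self_module) (rule R.cring_axioms)
  interpret LL: module L "self_module L" by (rule module_self_module) (rule cring_L)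
  obtain n :: nat and m s where m: "\<And>i. i < n \<Longrightarrow> m i \<in> carrier M" 
    and s: "\<And>i. i < n \<Longrightarrow> s i \<in> linear_maps R M (self_module R)"
    and sum: "\<And>z. z \<in> carrier M \<Longrightarrow> z = (\<Oplus>\<^bsub>M\<^esub>i\<in>{..<n}. s i z \<odot>\<^bsub>M\<^esub> m i)"
    using fg_projective_dual_basis[OF M] by blast
  have sc: "s i z \<in> carrier R" if "i < n" "z \<in> carrier M" for i z
    using linear_maps_closed[OF s[OF that(1)] that(2)] by simp
  have \<theta>c: "\<theta> v \<in> carrier L" if "v \<in> carrier T" for v
    using linear_maps_closed[OF \<theta> that] by simp
  obtain t where t: "t \<in> U" "\<And>i. i \<in> {..<n} \<Longrightarrow> \<exists>a\<in>carrier R. \<phi> t \<otimes>\<^bsub>L\<^esub> \<theta> (\<iota> (m i)) = \<phi> a"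
  proof (rule common_multiple[of "{..<n}" "\<lambda>t i. \<exists>a\<in>carrier R. \<phi> t \<otimes>\<^bsub>L\<^esub> \<theta> (\<iota> (m i)) = \<phi> a"])
    fix i assume "i \<in> {..<n}"
    then show "\<exists>t\<in>U. \<exists>a\<in>carrier R. \<phi> t \<otimes>\<^bsub>L\<^esub> \<theta> (\<iota> (m i)) = \<phi> a"
      using clear_denominator[of "\<theta> (\<iota> (m i))"] \<theta>c m by (metis \<iota>_closed lessThan_iff)
  next
    fix u v i assume uv: "i \<in> {..<n}" "u \<in> U" "v \<in> U" "\<exists>a\<in>carrier R. \<phi> u \<otimes>\<^bsub>L\<^esub> \<theta> (\<iota> (m i)) = \<phi> a"
    then obtain a where a: "a \<in> carrier R" "\<phi> u \<otimes>\<^bsub>L\<^esub> \<theta> (\<iota> (m i)) = \<phi> a" by blast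
    then have "\<phi> (v \<otimes>\<^bsub>R\<^esub> u) \<otimes>\<^bsub>L\<^esub> \<theta> (\<iota> (m i)) = \<phi> (v \<otimes>\<^bsub>R\<^esub> a)"
      using uv m \<theta>c by (simp add: S.m_assoc)
    then show "\<exists>a\<in>carrier R. \<phi> (v \<otimes>\<^bsub>R\<^esub> u) \<otimes>\<^bsub>L\<^esub> \<theta> (\<iota> (m i)) = \<phi> a"
      using a uv by (intro bexI[of _ "v \<otimes>\<^bsub>R\<^esub> a"]) auto
  qed auto
  then obtain a where a: "\<And>i. i < n \<Longrightarrow> a i \<in> carrier R" "\<And>i. i < n \<Longrightarrow> \<phi> t \<otimes>\<^bsub>L\<^esub> \<theta> (\<iota> (m i)) = \<phi> (a i)"
    by (metis lessThan_iff)
  define \<nu> where "\<nu> z = (\<Oplus>\<^bsub>R\<^esub>i\<in>{..<n}. s i z \<otimes>\<^bsub>R\<^esub> a i)" for z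
  have "\<nu> \<in> linear_maps R M (self_module R)"
  proof (rule linear_mapsI)
    fix x y assume xy: "x \<in> carrier M" "y \<in> carrier M"
    have "\<nu> (x \<oplus>\<^bsub>M\<^esub> y) = (\<Oplus>\<^bsub>R\<^esub>i\<in>{..<n}. s i x \<otimes>\<^bsub>R\<^esub> a i \<oplus>\<^bsub>R\<^esub> s i y \<otimes>\<^bsub>R\<^esub> a i)"
      unfolding \<nu>_def using xy a sc by (intro R.finsum_cong') (auto simp: linear_maps_add[OF s] R.l_distr)
    then show "\<nu> (x \<oplus>\<^bsub>M\<^esub> y) = \<nu> x \<oplus>\<^bsub>self_module R\<^esub> \<nu> y"
      unfolding \<nu>_def using xy a sc by (simp add: R.finsum_addf Pi_iff)
  next
    fix r x assume rx: "r \<in> carrier R" "x \<in> carrier M"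
    have "\<nu> (r \<odot>\<^bsub>M\<^esub> x) = (\<Oplus>\<^bsub>R\<^esub>i\<in>{..<n}. r \<otimes>\<^bsub>R\<^esub> (s i x \<otimes>\<^bsub>R\<^esub> a i))"
      unfolding \<nu>_def using rx a sc by (intro R.finsum_cong') (auto simp: linear_maps_smult[OF s] R.m_assoc)
    then show "\<nu> (r \<odot>\<^bsub>M\<^esub> x) = r \<odot>\<^bsub>self_module R\<^esub> \<nu> x"
      unfolding \<nu>_def using rx a sc by (simp add: R.finsum_rdistr Pi_iff)
  qed (use a sc in \<open>auto simp: \<nu>_def Pi_iff intro!: R.finsum_closed\<close>)
  moreover have "\<phi> (\<nu> z) = \<phi> t \<otimes>\<^bsub>L\<^esub> \<theta> (\<iota> z)" if z: "z \<in> carrier M" for z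
  proof -
    have "\<phi> (\<nu> z) = (\<Oplus>\<^bsub>L\<^esub>i\<in>{..<n}. \<phi> (s i z \<otimes>\<^bsub>R\<^esub> a i))"
      unfolding \<nu>_def using a sc z by (subst hom_finsum) (auto simp: comp_def)
    also have "\<dots> = (\<Oplus>\<^bsub>L\<^esub>i\<in>{..<n}. \<phi> t \<otimes>\<^bsub>L\<^esub> \<theta> (\<iota> (s i z \<odot>\<^bsub>M\<^esub> m i)))"
    proof (intro S.finsum_cong')
      fix i assume i: "i \<in> {..<n}"
      then show "\<phi> (s i z \<otimes>\<^bsub>R\<^esub> a i) = \<phi> t \<otimes>\<^bsub>L\<^esub> \<theta> (\<iota> (s i z \<odot>\<^bsub>M\<^esub> m i))"
        using sc[of i z] m[of i] a[of i] z t(1) \<theta>c[of "\<iota> (m i)"]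
        by (simp add: \<iota>_smult linear_maps_smult[OF \<theta>] S.m_lcomm flip: a(2))
    qed (use sc m z t \<theta>c in auto)
    also have "\<dots> = \<phi> t \<otimes>\<^bsub>L\<^esub> (\<Oplus>\<^bsub>L\<^esub>i\<in>{..<n}. \<theta> (\<iota> (s i z \<odot>\<^bsub>M\<^esub> m i)))"
      using sc m z t \<theta>c by (subst S.finsum_rdistr) auto
    also have "(\<Oplus>\<^bsub>L\<^esub>i\<in>{..<n}. \<theta> (\<iota> (s i z \<odot>\<^bsub>M\<^esub> m i))) = (\<Oplus>\<^bsub>self_module L\<^esub>i\<in>{..<n}. \<theta> (\<iota> (s i z \<odot>\<^bsub>M\<^esub> m i)))"
      using sc m z \<theta>c by (subst finsum_self_module[OF cring_L]) auto
    also have "\<dots> = \<theta> (\<Oplus>\<^bsub>T\<^esub>i\<in>{..<n}. \<iota> (s i z \<odot>\<^bsub>M\<^esub> m i))"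
      using sc m z by (subst linear_maps_finsum[OF T.module_axioms LL.module_axioms \<theta>]) auto
    also have "\<dots> = \<theta> (\<iota> z)"
      using sc m z by (subst \<iota>_finsum[symmetric]) (auto simp flip: sum)
    finally show ?thesis .
  qed
  ultimately show thesis using t(1) by (intro that) auto
qed

end

context localized
begin

text \<open>
  A module of rank \<open>n\<close> is generated at \<open>P\<close> by \<open>n\<close> elements, and they are linearly independent at
  \<open>P\<close>, as witnessed by linear forms that are dual to them up to elements outside \<open>P\<close>.
\<close>

lemma rank_local_basis:
  assumes M: "fg_projective R M" and rank: "constant_rank R M n"
  obtains x \<nu> where "\<And>j. j < n \<Longrightarrow> x j \<in> carrier M" "lgen M (x ` {..<n}) = carrier M"
    "\<And>i. i < n \<Longrightarrow> \<nu> i \<in> linear_maps R M (self_module R)"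
    "\<And>i j. i < n \<Longrightarrow> j < n \<Longrightarrow> i \<noteq> j \<Longrightarrow> \<nu> i (x j) \<in> P" "\<And>i. i < n \<Longrightarrow> \<nu> i (x i) \<notin> P"
proof -
  have mod: "module R M" using M by (simp add: fg_projective_def)
  interpret tensor_product R L \<phi> M by (rule tensor_product_intro) fact
  obtain f where f: "module_iso L T (free_module L n) f"
    using rank prime by (auto simp: constant_rank_def free_of_rank_iff)
  then have f_lin: "f \<in> linear_maps L T (free_module L n)" by (simp add: module_iso_def)
  obtain g where g: "g \<in> linear_maps L (free_module L n) T" "\<And>v. v \<in> carrier T \<Longrightarrow> g (f v) = v"
    "\<And>h. h \<in> carrier (free_module L n) \<Longrightarrow> f (g h) = h"
    using module_iso_inverse[OF module_T f] by blast
  define e where "e j = (\<lambda>i\<in>{..<n}. if i = j then \<one>\<^bsub>L\<^esub> else \<zero>\<^bsub>L\<^esub>)" for j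
  have e: "e j \<in> carrier (free_module L n)" for j by (auto simp: e_def)
  have w: "g (e j) \<in> carrier T" for j using linear_maps_closed[OF g(1) e] .
  obtain t' x where x: "\<And>j. t' j \<in> U" "\<And>j. x j \<in> carrier M" "\<And>j. \<phi> (t' j) \<odot>\<^bsub>T\<^esub> g (e j) = \<iota> (x j)"
    using tensor_clear_denominator[OF mod w] by metis
  have \<theta>: "(\<lambda>v. f v i) \<in> linear_maps L T (self_module L)" if "i < n" for i
    using that linear_maps_closed[OF f_lin]
    by (intro linear_mapsI) (auto simp: PiE_iff linear_maps_add[OF f_lin] linear_maps_smult[OF f_lin])
  have "\<forall>i. i < n \<longrightarrow> (\<exists>t \<nu>. t \<in> U \<and> \<nu> \<in> linear_maps R M (self_module R) \<and>
    (\<forall>z\<in>carrier M. \<phi> (\<nu> z) = \<phi> t \<otimes>\<^bsub>L\<^esub> f (\<iota> z) i))"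
    using descend_form[OF M \<theta>] by metis
  then obtain t \<nu> where \<nu>: "\<And>i. i < n \<Longrightarrow> t i \<in> U" "\<And>i. i < n \<Longrightarrow> \<nu> i \<in> linear_maps R M (self_module R)"
    "\<And>i z. i < n \<Longrightarrow> z \<in> carrier M \<Longrightarrow> \<phi> (\<nu> i z) = \<phi> (t i) \<otimes>\<^bsub>L\<^esub> f (\<iota> z) i"
    by metis
  have \<nu>c: "\<nu> i z \<in> carrier R" if "i < n" "z \<in> carrier M" for i z
    using linear_maps_closed[OF \<nu>(2)] that by simp
  have f_x: "f (\<iota> (x j)) i = (if i = j then \<phi> (t' j) else \<zero>\<^bsub>L\<^esub>)" if "i < n" "j < n" for i j
    using that x(1)[of j] linear_maps_smult[OF f_lin, of "\<phi> (t' j)" "g (e j)"] w[of j] g(3)[OF e, of j]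
    by (simp add: e_def flip: x(3))
  have kill: "\<exists>t\<in>U. \<exists>y\<in>lgen M (x ` {..<n}). \<phi> t \<odot>\<^bsub>T\<^esub> v = \<iota> y" if v: "v \<in> carrier T" for v
  proof -
    let ?Q = "\<lambda>v. \<exists>t\<in>U. \<exists>y\<in>lgen M (x ` {..<n}). \<phi> t \<odot>\<^bsub>T\<^esub> v = \<iota> y"
    have H: "x ` {..<n} \<subseteq> carrier M" using x by auto
    have fv: "f v i \<in> carrier L" if "i < n" for i
      using linear_maps_closed[OF f_lin v] that by (auto simp: PiE_iff)
    have "?Q (\<Oplus>\<^bsub>T\<^esub>j\<in>{..<n}. f v j \<odot>\<^bsub>T\<^esub> g (e j))"
    proof (rule T.M.finsum_induct)
      fix j assume j: "j \<in> {..<n}"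
      then show "f v j \<odot>\<^bsub>T\<^esub> g (e j) \<in> carrier T" using fv w by simp
      obtain s a where s: "s \<in> U" "a \<in> carrier R" "\<phi> s \<otimes>\<^bsub>L\<^esub> f v j = \<phi> a"
        using clear_denominator fv j by blast
      have "\<phi> (t' j \<otimes>\<^bsub>R\<^esub> s) \<odot>\<^bsub>T\<^esub> (f v j \<odot>\<^bsub>T\<^esub> g (e j)) = (\<phi> s \<otimes>\<^bsub>L\<^esub> f v j) \<odot>\<^bsub>T\<^esub> (\<phi> (t' j) \<odot>\<^bsub>T\<^esub> g (e j))"
        using s(1) x(1) fv j w by (simp add: T.smult_assoc1[symmetric] S.m_ac)
      also have "\<dots> = \<iota> (a \<odot>\<^bsub>M\<^esub> x j)" using s x by (simp add: \<iota>_smult)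
      finally show "?Q (f v j \<odot>\<^bsub>T\<^esub> g (e j))"
        using s x j by (intro bexI[of _ "t' j \<otimes>\<^bsub>R\<^esub> s"] bexI[of _ "a \<odot>\<^bsub>M\<^esub> x j"]) (auto intro: lgen_intros)
    next
      show "?Q \<zero>\<^bsub>T\<^esub>" using \<iota>_zero by (intro bexI[of _ "\<one>\<^bsub>R\<^esub>"] bexI[of _ "\<zero>\<^bsub>M\<^esub>"]) (auto intro: lgen_intros)
    next
      fix a b assume ab: "a \<in> carrier T" "b \<in> carrier T" and "?Q a" "?Q b"
      then obtain s y s' y' where *: "s \<in> U" "y \<in> lgen M (x ` {..<n})" "\<phi> s \<odot>\<^bsub>T\<^esub> a = \<iota> y"
        "s' \<in> U" "y' \<in> lgen M (x ` {..<n})" "\<phi> s' \<odot>\<^bsub>T\<^esub> b = \<iota> y'" by blast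
      note cl = lgen_closed[OF mod H *(2)] lgen_closed[OF mod H *(5)]
      have "\<phi> (s \<otimes>\<^bsub>R\<^esub> s') \<odot>\<^bsub>T\<^esub> (a \<oplus>\<^bsub>T\<^esub> b) = \<phi> s' \<odot>\<^bsub>T\<^esub> (\<phi> s \<odot>\<^bsub>T\<^esub> a) \<oplus>\<^bsub>T\<^esub> \<phi> s \<odot>\<^bsub>T\<^esub> (\<phi> s' \<odot>\<^bsub>T\<^esub> b)"
        using * ab by (simp add: T.smult_add_cross)
      also have "\<dots> = \<iota> (s' \<odot>\<^bsub>M\<^esub> y \<oplus>\<^bsub>M\<^esub> s \<odot>\<^bsub>M\<^esub> y')"
        using * cl by (simp add: \<iota>_add \<iota>_smult)
      finally show "?Q (a \<oplus>\<^bsub>T\<^esub> b)"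
        by (intro bexI[of _ "s \<otimes>\<^bsub>R\<^esub> s'"] bexI[of _ "s' \<odot>\<^bsub>M\<^esub> y \<oplus>\<^bsub>M\<^esub> s \<odot>\<^bsub>M\<^esub> y'"]
          saturated_span.add saturated_span.smult) (use * in auto)
    qed simp
    also have "(\<Oplus>\<^bsub>T\<^esub>j\<in>{..<n}. f v j \<odot>\<^bsub>T\<^esub> g (e j)) = v"
      using linear_map_free_module_eq_sum[OF module_T g(1) linear_maps_closed[OF f_lin v]] g(2)[OF v] by (simp add: e_def)
    finally show ?thesis .
  qed
  show thesis
  proof
    show "x j \<in> carrier M" for j by (rule x)
    show "\<nu> i \<in> linear_maps R M (self_module R)" if "i < n" for i using \<nu> that by blast
    show "\<nu> i (x j) \<in> P" if "i < n" "j < n" "i \<noteq> j" for i j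
    proof -
      have c: "\<nu> i (x j) \<in> carrier R" by (rule \<nu>c[OF that(1) x(2)])
      have "\<phi> (\<nu> i (x j)) = \<phi> \<zero>\<^bsub>R\<^esub>"
        using \<nu>(3)[OF that(1) x(2)[of j]] f_x[OF that(1,2)] that(3) U_closed[OF \<nu>(1)[OF that(1)]] by simp
      then obtain u where u: "u \<in> U" "u \<otimes>\<^bsub>R\<^esub> \<nu> i (x j) = u \<otimes>\<^bsub>R\<^esub> \<zero>\<^bsub>R\<^esub>"
        using \<phi>_eq_iff[OF c R.zero_closed] by auto
      then have "u \<otimes>\<^bsub>R\<^esub> \<nu> i (x j) \<in> P" by simp
      then show ?thesis by (rule mult_UD[OF u(1) c])
    qed
    show "\<nu> i (x i) \<notin> P" if "i < n" for i
    proof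
      assume P: "\<nu> i (x i) \<in> P"
      have c: "\<nu> i (x i) \<in> carrier R" by (rule \<nu>c[OF that x(2)])
      have t: "t i \<otimes>\<^bsub>R\<^esub> t' i \<in> U" by (rule mult_U[OF \<nu>(1)[OF that] x(1)])
      have "\<phi> (\<nu> i (x i)) = \<phi> (t i \<otimes>\<^bsub>R\<^esub> t' i)"
        using \<nu>(3)[OF that x(2)[of i]] f_x[OF that that] U_closed[OF \<nu>(1)[OF that]] U_closed[OF x(1)[of i]] by simp
      then obtain u where u: "u \<in> U" "u \<otimes>\<^bsub>R\<^esub> \<nu> i (x i) = u \<otimes>\<^bsub>R\<^esub> (t i \<otimes>\<^bsub>R\<^esub> t' i)"
        using \<phi>_eq_iff[OF c U_closed[OF t]] by auto
      have "u \<otimes>\<^bsub>R\<^esub> \<nu> i (x i) \<in> P" by (rule P.I_l_closed[OF P U_closed[OF u(1)]])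
      then show False using not_in_P[OF mult_U[OF u(1) t]] u(2) by simp
    qed
    show "lgen M (x ` {..<n}) = carrier M"
    proof (intro equalityI subsetI)
      fix z assume z: "z \<in> carrier M"
      have H: "x ` {..<n} \<subseteq> carrier M" using x by auto
      obtain s y where s: "s \<in> U" "y \<in> lgen M (x ` {..<n})" "\<phi> s \<odot>\<^bsub>T\<^esub> \<iota> z = \<iota> y"
        using kill[OF \<iota>_closed[OF z]] by auto
      have y: "y \<in> carrier M" using lgen_closed[OF mod H s(2)] .
      have "\<iota> (s \<odot>\<^bsub>M\<^esub> z \<ominus>\<^bsub>M\<^esub> y) = \<zero>\<^bsub>T\<^esub>"
        using s z y by (simp add: \<iota>_diff \<iota>_smult T.M.diff_eq_zero_iff)
      then obtain u where u: "u \<in> U" "u \<odot>\<^bsub>M\<^esub> (s \<odot>\<^bsub>M\<^esub> z \<ominus>\<^bsub>M\<^esub> y) = \<zero>\<^bsub>M\<^esub>"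
        using \<iota>_kernel[OF M, of "s \<odot>\<^bsub>M\<^esub> z \<ominus>\<^bsub>M\<^esub> y"] s(1) z y by auto
      then have "u \<odot>\<^bsub>M\<^esub> (s \<odot>\<^bsub>M\<^esub> z) \<ominus>\<^bsub>M\<^esub> u \<odot>\<^bsub>M\<^esub> y = \<zero>\<^bsub>M\<^esub>"
        using s(1) z y by (simp add: a_minus_def M.smult_r_distr M.smult_r_minus)
      then have "u \<odot>\<^bsub>M\<^esub> (s \<odot>\<^bsub>M\<^esub> z) = u \<odot>\<^bsub>M\<^esub> y"
        using u(1) s(1) z y by (simp add: M.M.diff_eq_zero_iff)
      then have "(u \<otimes>\<^bsub>R\<^esub> s) \<odot>\<^bsub>M\<^esub> z \<in> lgen M (x ` {..<n})"
        using saturated_span.smult[OF U_closed[OF u(1)] s(2)] u(1) s(1) z by (simp add: M.smult_assoc1)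
      then show "z \<in> lgen M (x ` {..<n})"
        by (rule saturated_span.divide[rotated 2]) (use u s z in auto)
    next
      fix z assume "z \<in> lgen M (x ` {..<n})"
      then show "z \<in> carrier M" by (rule lgen_closed[OF mod, rotated]) (use x(2) in auto)
    qed
  qed
qed

end

context localized
begin

text \<open>
  Between modules of the same rank, a left inverse at \<open>P\<close> is a right inverse at \<open>P\<close>.
\<close>

lemma left_inverse_is_right_inverse:
  assumes M: "fg_projective R M" "constant_rank R M n" and N: "fg_projective R N" "constant_rank R N n"
    and f: "f \<in> linear_maps R M N" and g: "g \<in> linear_maps R N M"
    and c: "c \<in> U" "\<And>z. z \<in> carrier M \<Longrightarrow> g (f z) = c \<odot>\<^bsub>M\<^esub> z"
  obtains u where "u \<in> U" "\<And>w. w \<in> carrier N \<Longrightarrow> u \<odot>\<^bsub>N\<^esub> f (g w) = u \<odot>\<^bsub>N\<^esub> (c \<odot>\<^bsub>N\<^esub> w)"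
proof -
  interpret M: module R M using M by (simp add: fg_projective_def)
  interpret N: module R N using N by (simp add: fg_projective_def)
  obtain x \<kappa> where x: "\<And>j. j < n \<Longrightarrow> x j \<in> carrier N" "lgen N (x ` {..<n}) = carrier N"
    and "\<And>i. i < n \<Longrightarrow> \<kappa> i \<in> linear_maps R N (self_module R)"
    and "\<And>i j. i < n \<Longrightarrow> j < n \<Longrightarrow> i \<noteq> j \<Longrightarrow> \<kappa> i (x j) \<in> P" "\<And>i. i < n \<Longrightarrow> \<kappa> i (x i) \<notin> P"
    by (rule rank_local_basis[OF N]) (rule that; assumption)
  obtain y \<nu> where y: "\<And>j. j < n \<Longrightarrow> y j \<in> carrier M" and "lgen M (y ` {..<n}) = carrier M"
    and \<nu>: "\<And>i. i < n \<Longrightarrow> \<nu> i \<in> linear_maps R M (self_module R)"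
    and off: "\<And>i j. i < n \<Longrightarrow> j < n \<Longrightarrow> i \<noteq> j \<Longrightarrow> \<nu> i (y j) \<in> P" and diag: "\<And>i. i < n \<Longrightarrow> \<nu> i (y i) \<notin> P"
    by (rule rank_local_basis[OF M]) (rule that; assumption)
  note fg = linear_maps_closed[OF f] linear_maps_closed[OF g] linear_maps_add[OF f] linear_maps_add[OF g]
    linear_maps_smult[OF f] linear_maps_smult[OF g]
  have \<nu>c: "\<nu> i z \<in> carrier R" if "i < n" "z \<in> carrier M" for i z
    using linear_maps_closed[OF \<nu>] that by simp
  have gen: "lgen N ((\<lambda>j. f (y j)) ` {..<n}) = carrier N"
  proof (rule steinitz[where H = "x ` {..<n}" and \<mu> = "\<lambda>i w. \<nu> i (g w)"])
    show "module R N" by (rule N.module_axioms)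
    show "finite (x ` {..<n})" "x ` {..<n} \<subseteq> carrier N" "lgen N (x ` {..<n}) = carrier N" "finite {..<n}"
      using x by auto
    show "card (x ` {..<n}) \<le> card {..<n}" by (rule card_image_le) simp
    fix i assume i: "i \<in> {..<n}"
    then show "f (y i) \<in> carrier N" using y fg(1) by simp
    show "(\<lambda>w. \<nu> i (g w)) \<in> linear_maps R N (self_module R)"
      using linear_maps_comp[OF g \<nu>] i by simp
    have \<nu>_gf: "\<nu> i (g (f (y j))) = c \<otimes>\<^bsub>R\<^esub> \<nu> i (y j)" if "j \<in> {..<n}" for j
      using that i linear_maps_smult[OF \<nu>, of i c "y j"] y[of j] c(1) c(2)[of "y j"] by simp
    show "\<nu> i (g (f (y j))) \<in> P" if "j \<in> {..<n}" "i \<noteq> j" for j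
      unfolding \<nu>_gf[OF that(1)] by (rule P.I_l_closed) (use off i that c in auto)
    show "\<nu> i (g (f (y i))) \<notin> P"
    proof
      assume "\<nu> i (g (f (y i))) \<in> P"
      then have "\<nu> i (y i) \<in> P"
        unfolding \<nu>_gf[OF i] by (rule mult_UD[OF c(1), rotated]) (use \<nu>c y i in auto)
      then show False using diag i by simp
    qed
  qed
  have pointwise: "\<exists>u\<in>U. u \<odot>\<^bsub>N\<^esub> f (g w) = u \<odot>\<^bsub>N\<^esub> (c \<odot>\<^bsub>N\<^esub> w)" if "w \<in> carrier N" for w
  proof -
    have sub: "(\<lambda>j. f (y j)) ` {..<n} \<subseteq> carrier N" using y fg by auto
    note cl = lgen_closed[OF N.module_axioms sub]
    from that have "w \<in> lgen N ((\<lambda>j. f (y j)) ` {..<n})" using gen by simp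
    then show ?thesis
    proof (induction rule: saturated_span.induct)
      case zero
      then show ?case
        using linear_maps_zero[OF N.module_axioms M.module_axioms g]
          linear_maps_zero[OF M.module_axioms N.module_axioms f] c(1)
        by (intro bexI[of _ "\<one>\<^bsub>R\<^esub>"]) auto
    next
      case (base w)
      then show ?case using y c fg by (intro bexI[of _ "\<one>\<^bsub>R\<^esub>"]) auto
    next
      case (add v w)
      then obtain a b where ab: "a \<in> U" "b \<in> U" "a \<odot>\<^bsub>N\<^esub> f (g v) = a \<odot>\<^bsub>N\<^esub> (c \<odot>\<^bsub>N\<^esub> v)" "b \<odot>\<^bsub>N\<^esub> f (g w) = b \<odot>\<^bsub>N\<^esub> (c \<odot>\<^bsub>N\<^esub> w)"
        by blast
      have vw: "v \<in> carrier N" "w \<in> carrier N" using add cl by auto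
      have *: "(a \<otimes>\<^bsub>R\<^esub> b) \<odot>\<^bsub>N\<^esub> (p \<oplus>\<^bsub>N\<^esub> q) = b \<odot>\<^bsub>N\<^esub> (a \<odot>\<^bsub>N\<^esub> p) \<oplus>\<^bsub>N\<^esub> a \<odot>\<^bsub>N\<^esub> (b \<odot>\<^bsub>N\<^esub> q)"
        if "p \<in> carrier N" "q \<in> carrier N" for p q
        using that ab(1,2) by (intro N.smult_add_cross) auto
      show ?case
        using ab vw c(1) fg by (intro bexI[of _ "a \<otimes>\<^bsub>R\<^esub> b"]) (auto simp: * N.smult_r_distr[of c])
    next
      case (smult r w)
      then obtain a where a: "a \<in> U" "a \<odot>\<^bsub>N\<^esub> f (g w) = a \<odot>\<^bsub>N\<^esub> (c \<odot>\<^bsub>N\<^esub> w)" by blast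
      have w: "w \<in> carrier N" using smult cl by auto
      have *: "a \<odot>\<^bsub>N\<^esub> (r \<odot>\<^bsub>N\<^esub> p) = r \<odot>\<^bsub>N\<^esub> (a \<odot>\<^bsub>N\<^esub> p)" if "p \<in> carrier N" for p
        using that a(1) smult(1) by (intro N.smult_commute) auto
      have "c \<odot>\<^bsub>N\<^esub> (r \<odot>\<^bsub>N\<^esub> w) = r \<odot>\<^bsub>N\<^esub> (c \<odot>\<^bsub>N\<^esub> w)"
        using w c(1) smult(1) by (intro N.smult_commute) auto
      then show ?case using a w c(1) fg smult(1) by (intro bexI[of _ a]) (auto simp: *)
    next
      case (divide d w)
      then obtain a where a: "a \<in> U" "a \<odot>\<^bsub>N\<^esub> f (g (d \<odot>\<^bsub>N\<^esub> w)) = a \<odot>\<^bsub>N\<^esub> (c \<odot>\<^bsub>N\<^esub> (d \<odot>\<^bsub>N\<^esub> w))" by blast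
      have "c \<odot>\<^bsub>N\<^esub> (d \<odot>\<^bsub>N\<^esub> w) = d \<odot>\<^bsub>N\<^esub> (c \<odot>\<^bsub>N\<^esub> w)"
        using divide(1,2) c(1) by (intro N.smult_commute) auto
      then show ?case using a divide(1,2) fg c(1) by (intro bexI[of _ "a \<otimes>\<^bsub>R\<^esub> d"]) (auto simp: N.smult_assoc1)
    qed
  qed
  obtain m :: nat and b s where b: "\<And>i. i < m \<Longrightarrow> b i \<in> carrier N" 
    and s: "\<And>i. i < m \<Longrightarrow> s i \<in> linear_maps R N (self_module R)"
    and sum: "\<And>z. z \<in> carrier N \<Longrightarrow> z = (\<Oplus>\<^bsub>N\<^esub>i\<in>{..<m}. s i z \<odot>\<^bsub>N\<^esub> b i)"
    using fg_projective_dual_basis[OF N(1)] by blast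
  obtain u where u: "u \<in> U" "\<And>i. i \<in> {..<m} \<Longrightarrow> u \<odot>\<^bsub>N\<^esub> f (g (b i)) = u \<odot>\<^bsub>N\<^esub> (c \<odot>\<^bsub>N\<^esub> b i)"
  proof (rule common_multiple[of "{..<m}" "\<lambda>u i. u \<odot>\<^bsub>N\<^esub> f (g (b i)) = u \<odot>\<^bsub>N\<^esub> (c \<odot>\<^bsub>N\<^esub> b i)"])
    show "\<exists>u\<in>U. u \<odot>\<^bsub>N\<^esub> f (g (b i)) = u \<odot>\<^bsub>N\<^esub> (c \<odot>\<^bsub>N\<^esub> b i)" if "i \<in> {..<m}" for i
      using pointwise[of "b i"] b that by simp
    show "(v \<otimes>\<^bsub>R\<^esub> u) \<odot>\<^bsub>N\<^esub> f (g (b i)) = (v \<otimes>\<^bsub>R\<^esub> u) \<odot>\<^bsub>N\<^esub> (c \<odot>\<^bsub>N\<^esub> b i)"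
      if "i \<in> {..<m}" "u \<in> U" "v \<in> U" "u \<odot>\<^bsub>N\<^esub> f (g (b i)) = u \<odot>\<^bsub>N\<^esub> (c \<odot>\<^bsub>N\<^esub> b i)" for u v i
      using that b[of i] c(1) fg by (simp add: N.smult_assoc1[of v u])
  qed auto
  show thesis
  proof (rule that[OF u(1)])
    fix w assume w: "w \<in> carrier N"
    let ?Q = "\<lambda>w. u \<odot>\<^bsub>N\<^esub> f (g w) = u \<odot>\<^bsub>N\<^esub> (c \<odot>\<^bsub>N\<^esub> w)"
    have sc: "s i w \<in> carrier R" if "i < m" for i using linear_maps_closed[OF s w] that by simp
    have "?Q (\<Oplus>\<^bsub>N\<^esub>i\<in>{..<m}. s i w \<odot>\<^bsub>N\<^esub> b i)"
    proof (rule N.M.finsum_induct)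
      fix i assume i: "i \<in> {..<m}"
      have "u \<odot>\<^bsub>N\<^esub> f (g (s i w \<odot>\<^bsub>N\<^esub> b i)) = s i w \<odot>\<^bsub>N\<^esub> (u \<odot>\<^bsub>N\<^esub> f (g (b i)))"
        using i sc b fg u(1) by (simp add: N.smult_commute[of u "s i w"])
      also have "\<dots> = u \<odot>\<^bsub>N\<^esub> (c \<odot>\<^bsub>N\<^esub> (s i w \<odot>\<^bsub>N\<^esub> b i))"
        using i sc b u c(1) by (simp add: N.smult_commute[of u "s i w"] N.smult_commute[of c "s i w"])
      finally show "?Q (s i w \<odot>\<^bsub>N\<^esub> b i)" .
    qed (use sc b u(1) c(1) fg linear_maps_zero[OF N.module_axioms M.module_axioms g]
          linear_maps_zero[OF M.module_axioms N.module_axioms f] in \<open>auto simp: N.smult_r_distr\<close>)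
    then show "?Q w" using sum[OF w] by simp
  qed
qed

end

text \<open>An element that is killed at every prime is zero.\<close>

lemma (in cring) exists_maximalideal:
  assumes I: "ideal I R" "I \<noteq> carrier R"
  obtains J where "maximalideal J R" "I \<subseteq> J"
proof -
  define A where "A = {J. ideal J R \<and> I \<subseteq> J \<and> \<one> \<notin> J}"
  have "I \<in> A" using I ideal.one_imp_carrier by (auto simp: A_def)
  moreover have "\<Union>C \<in> A" if C: "C \<noteq> {}" "subset.chain A C" for C
  proof -
    have CA: "\<And>J. J \<in> C \<Longrightarrow> ideal J R \<and> I \<subseteq> J \<and> \<one> \<notin> J" and lin: "\<And>J K. J \<in> C \<Longrightarrow> K \<in> C \<Longrightarrow> J \<subseteq> K \<or> K \<subseteq> J"
      using C by (auto simp: subset_chain_def A_def)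
    have ide: "ideal J R" if "J \<in> C" for J using CA that by simp
    have "ideal (\<Union>C) R"
    proof (rule idealI)
      show "ring R" by (rule ring_axioms)
      show "subgroup (\<Union>C) (add_monoid R)"
      proof (rule add.subgroupI)
        show "\<Union>C \<subseteq> carrier R" using ideal.Icarr[OF ide] by auto
        obtain J where "J \<in> C" using C(1) by auto
        then have "\<zero> \<in> \<Union>C" using additive_subgroup.zero_closed[OF ideal.axioms(1)[OF ide]] by auto
        then show "\<Union>C \<noteq> {}" by auto
      next
        fix a assume "a \<in> \<Union>C"
        then obtain J where "J \<in> C" "a \<in> J" by auto
        then show "\<ominus> a \<in> \<Union>C"
          using additive_subgroup.a_inv_closed[OF ideal.axioms(1)[OF ide]] by auto
      next
        fix a b assume "a \<in> \<Union>C" "b \<in> \<Union>C"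
        then obtain J K where JK: "J \<in> C" "K \<in> C" "a \<in> J" "b \<in> K" by auto
        obtain H where H: "H \<in> C" "a \<in> H" "b \<in> H" using lin[OF JK(1,2)] JK by auto
        then show "a \<oplus> b \<in> \<Union>C"
          using additive_subgroup.a_closed[OF ideal.axioms(1)[OF ide[OF H(1)]] H(2,3)] by auto
      qed
    next
      fix a x assume "a \<in> \<Union>C" and x: "x \<in> carrier R"
      then obtain J where J: "J \<in> C" "a \<in> J" by auto
      show "x \<otimes> a \<in> \<Union>C" "a \<otimes> x \<in> \<Union>C"
        using J ideal.I_l_closed[OF ide[OF J(1)] J(2) x] ideal.I_r_closed[OF ide[OF J(1)] J(2) x] by auto
    qed
    then show ?thesis using C CA by (auto simp: A_def)
  qed
  ultimately obtain J where J: "J \<in> A" "\<And>K. K \<in> A \<Longrightarrow> J \<subseteq> K \<Longrightarrow> K = J"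
    using subset_Zorn_nonempty[of A] by blast
  have "maximalideal J R"
  proof (rule maximalidealI)
    show "ideal J R" "carrier R \<noteq> J" using J by (auto simp: A_def)
    fix K assume K: "ideal K R" "J \<subseteq> K" "K \<subseteq> carrier R"
    show "K = J \<or> K = carrier R"
    proof (cases "\<one> \<in> K")
      case True
      then show ?thesis using ideal.one_imp_carrier[OF K(1)] by simp
    next
      case False
      then have "K \<in> A" using K J by (auto simp: A_def)
      then show ?thesis using J(2) K by blast
    qed
  qed
  then show thesis using that J by (auto simp: A_def)
qed

lemma locally_zero_imp_zero:
  assumes "module R M" "x \<in> carrier M"
    and local: "\<And>P. primeideal P R \<Longrightarrow> \<exists>d\<in>carrier R - P. d \<odot>\<^bsub>M\<^esub> x = \<zero>\<^bsub>M\<^esub>"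
  shows "x = \<zero>\<^bsub>M\<^esub>"
proof (rule ccontr)
  assume "x \<noteq> \<zero>\<^bsub>M\<^esub>"
  interpret module R M by fact
  define J where "J = {d \<in> carrier R. d \<odot>\<^bsub>M\<^esub> x = \<zero>\<^bsub>M\<^esub>}"
  have "ideal J R"
  proof (rule idealI)
    show "ring R" by (rule R.ring_axioms)
    show "subgroup J (add_monoid R)"
    proof (rule R.add.subgroupI)
      show "J \<noteq> {}" using assms(2) by (auto simp: J_def intro!: exI[of _ "\<zero>\<^bsub>R\<^esub>"])
    qed (use assms(2) in \<open>auto simp: J_def smult_l_distr smult_l_minus\<close>)
    fix a r assume "a \<in> J" "r \<in> carrier R"
    then show "r \<otimes>\<^bsub>R\<^esub> a \<in> J" using assms(2) by (simp add: J_def smult_assoc1)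
    then show "a \<otimes>\<^bsub>R\<^esub> r \<in> J" using \<open>a \<in> J\<close> \<open>r \<in> carrier R\<close> R.m_comm[of a r] by (simp add: J_def)
  qed
  moreover have "\<one>\<^bsub>R\<^esub> \<notin> J" using \<open>x \<noteq> \<zero>\<^bsub>M\<^esub>\<close> assms(2) by (simp add: J_def)
  then have "J \<noteq> carrier R" by auto
  ultimately obtain P where P: "maximalideal P R" "J \<subseteq> P" using R.exists_maximalideal by blast
  then have "primeideal P R" using R.maximalideal_prime by blast
  with local P(2) show False by (auto simp: J_def)
qed

section \<open>Polynomial identities\<close>

context cring
begin

definition represents :: "'a list \<Rightarrow> polex \<Rightarrow> 'a \<Rightarrow> bool" where
  "represents l P a \<longleftrightarrow> Ipolex l P = a"

lemma represents_intros:
  "represents l P a \<Longrightarrow> represents l Q b \<Longrightarrow> represents l (Add P Q) (a \<oplus> b)"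
  "represents l P a \<Longrightarrow> represents l Q b \<Longrightarrow> represents l (Sub P Q) (a \<ominus> b)"
  "represents l P a \<Longrightarrow> represents l Q b \<Longrightarrow> represents l (Mul P Q) (a \<otimes> b)"
  "represents l (Const 0) \<zero>" "represents l (Const 1) \<one>"
  "represents (a # l) (Var 0) a"
  "represents l (Var n) a \<Longrightarrow> represents (b # l) (Var (Suc n)) a"
  by (simp_all add: represents_def)

lemma ring_identity:
  assumes "in_carrier l" "represents l P a" "represents l Q b" "norm P = norm Q"
  shows "a = b"
  using norm_eq[OF assms(1,4)] assms(2,3) by (simp add: represents_def)

lemmas (in -) polynomial_normalization = mkPinj_def mkPX_def sub_def

end

section \<open>Nonsingular quadratic forms\<close>

lemma (in cring) polar_expansion:
  "c \<in> carrier R \<Longrightarrow> d \<in> carrier R \<Longrightarrow> e \<in> carrier R \<Longrightarrow> d \<oplus> e \<oplus> (c \<ominus> d \<ominus> e) = c"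
  by (simp add: a_minus_def a_ac r_neg r_neg1 r_neg2)

lemma (in cring) polar_double:
  assumes "d \<in> carrier R" "e \<in> carrier R" and eq: "((\<one> \<oplus> \<one>) \<otimes> (\<one> \<oplus> \<one>)) \<otimes> d = d \<oplus> d \<oplus> e"
  shows "e = d \<oplus> d"
proof -
  have "e = (d \<oplus> d \<oplus> e) \<ominus> d \<ominus> d"
    by (rule ring_identity[of "[d, e]"])
      (use assms in \<open>simp add: in_carrier_def\<close>, (rule represents_intros)+, simp add: polynomial_normalization)
  also have "\<dots> = d \<oplus> d"
    unfolding eq[symmetric]
    by (rule ring_identity[of "[d]"])
      (use assms in \<open>simp add: in_carrier_def\<close>, (rule represents_intros)+, simp add: polynomial_normalization)
  finally show ?thesis .
qed

locale nonsingular_form = R: cring R + module R C for R :: "'r ring" and C :: "('r, 'a) module" +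
  fixes q :: "'a \<Rightarrow> 'r"
  assumes quadratic: "quadratic_form R C q" and nonsingular: "nonsingular R C q"
begin

abbreviation "b \<equiv> polar C R q"

lemma b_linear: "x \<in> carrier C \<Longrightarrow> b x \<in> linear_maps R C (self_module R)"
  and b_linear': "y \<in> carrier C \<Longrightarrow> (\<lambda>x. b x y) \<in> linear_maps R C (self_module R)"
  using quadratic by (auto simp: quadratic_map_def bilinear_map_def)

lemma self: "module R (self_module R)" by (rule module_self_module) (rule R.cring_axioms)

lemma q_closed [simp]: "x \<in> carrier C \<Longrightarrow> q x \<in> carrier R"
  and q_smult: "r \<in> carrier R \<Longrightarrow> x \<in> carrier C \<Longrightarrow> q (r \<odot>\<^bsub>C\<^esub> x) = (r \<otimes>\<^bsub>R\<^esub> r) \<otimes>\<^bsub>R\<^esub> q x"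
  using quadratic by (auto simp: quadratic_map_def)

lemma b_closed [simp]: "x \<in> carrier C \<Longrightarrow> y \<in> carrier C \<Longrightarrow> b x y \<in> carrier R"
  using linear_maps_closed[OF b_linear] by simp

lemma b_add: 
  "x \<in> carrier C \<Longrightarrow> x' \<in> carrier C \<Longrightarrow> y \<in> carrier C \<Longrightarrow> b (x \<oplus>\<^bsub>C\<^esub> x') y = b x y \<oplus>\<^bsub>R\<^esub> b x' y"
  "x \<in> carrier C \<Longrightarrow> y \<in> carrier C \<Longrightarrow> y' \<in> carrier C \<Longrightarrow> b x (y \<oplus>\<^bsub>C\<^esub> y') = b x y \<oplus>\<^bsub>R\<^esub> b x y'"
  using linear_maps_add[OF b_linear] linear_maps_add[OF b_linear'] by simp_all

lemma b_smult: 
  "r \<in> carrier R \<Longrightarrow> x \<in> carrier C \<Longrightarrow> y \<in> carrier C \<Longrightarrow> b (r \<odot>\<^bsub>C\<^esub> x) y = r \<otimes>\<^bsub>R\<^esub> b x y"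
  "r \<in> carrier R \<Longrightarrow> x \<in> carrier C \<Longrightarrow> y \<in> carrier C \<Longrightarrow> b x (r \<odot>\<^bsub>C\<^esub> y) = r \<otimes>\<^bsub>R\<^esub> b x y"
  using linear_maps_smult[OF b_linear] linear_maps_smult[OF b_linear'] by simp_all

lemma b_minus: 
  "x \<in> carrier C \<Longrightarrow> y \<in> carrier C \<Longrightarrow> b (\<ominus>\<^bsub>C\<^esub> x) y = \<ominus>\<^bsub>R\<^esub> b x y"
  "x \<in> carrier C \<Longrightarrow> y \<in> carrier C \<Longrightarrow> b x (\<ominus>\<^bsub>C\<^esub> y) = \<ominus>\<^bsub>R\<^esub> b x y"
  using linear_maps_minus[OF module_axioms self b_linear] linear_maps_minus[OF module_axioms self b_linear']
  by simp_all

lemma b_diff: 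
  "x \<in> carrier C \<Longrightarrow> x' \<in> carrier C \<Longrightarrow> y \<in> carrier C \<Longrightarrow> b (x \<ominus>\<^bsub>C\<^esub> x') y = b x y \<ominus>\<^bsub>R\<^esub> b x' y"
  "x \<in> carrier C \<Longrightarrow> y \<in> carrier C \<Longrightarrow> y' \<in> carrier C \<Longrightarrow> b x (y \<ominus>\<^bsub>C\<^esub> y') = b x y \<ominus>\<^bsub>R\<^esub> b x y'"
  by (simp_all add: a_minus_def b_add b_minus)

lemma b_zero [simp]:
  "x \<in> carrier C \<Longrightarrow> b \<zero>\<^bsub>C\<^esub> x = \<zero>\<^bsub>R\<^esub>" "x \<in> carrier C \<Longrightarrow> b x \<zero>\<^bsub>C\<^esub> = \<zero>\<^bsub>R\<^esub>"
  using linear_maps_zero[OF module_axioms self b_linear] linear_maps_zero[OF module_axioms self b_linear'] by simp_all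

lemma b_sym: "x \<in> carrier C \<Longrightarrow> y \<in> carrier C \<Longrightarrow> b x y = b y x"
  by (simp add: polar_def a_minus_def M.a_comm R.a_assoc) (simp add: R.a_comm)

lemma q_add:
  assumes "x \<in> carrier C" "y \<in> carrier C"
  shows "q (x \<oplus>\<^bsub>C\<^esub> y) = q x \<oplus>\<^bsub>R\<^esub> q y \<oplus>\<^bsub>R\<^esub> b x y"
  unfolding polar_def using assms by (subst R.polar_expansion) simp_all

lemma q_zero [simp]: "q \<zero>\<^bsub>C\<^esub> = \<zero>\<^bsub>R\<^esub>"
  using q_smult[of "\<zero>\<^bsub>R\<^esub>" "\<zero>\<^bsub>C\<^esub>"] by simp

lemma q_minus: assumes "x \<in> carrier C" shows "q (\<ominus>\<^bsub>C\<^esub> x) = q x"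
proof -
  have "\<ominus>\<^bsub>C\<^esub> x = (\<ominus>\<^bsub>R\<^esub> \<one>\<^bsub>R\<^esub>) \<odot>\<^bsub>C\<^esub> x" using assms by (simp add: smult_l_minus)
  then show ?thesis using assms by (simp add: q_smult R.l_minus R.r_minus)
qed

lemma q_diff: "x \<in> carrier C \<Longrightarrow> y \<in> carrier C \<Longrightarrow> q (x \<ominus>\<^bsub>C\<^esub> y) = q x \<oplus>\<^bsub>R\<^esub> q y \<ominus>\<^bsub>R\<^esub> b x y"
  by (simp add: a_minus_def q_add q_minus b_minus)

lemma b_self: "x \<in> carrier C \<Longrightarrow> b x x = q x \<oplus>\<^bsub>R\<^esub> q x"
proof -
  assume x: "x \<in> carrier C"
  define d where "d = q x"
  define e where "e = b x x"
  have de: "d \<in> carrier R" "e \<in> carrier R" using x by (auto simp: d_def e_def)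
  have "q ((\<one>\<^bsub>R\<^esub> \<oplus>\<^bsub>R\<^esub> \<one>\<^bsub>R\<^esub>) \<odot>\<^bsub>C\<^esub> x) = d \<oplus>\<^bsub>R\<^esub> d \<oplus>\<^bsub>R\<^esub> e"
    unfolding d_def e_def using x q_add[of x x] by (simp add: smult_l_distr)
  then have eq: "((\<one>\<^bsub>R\<^esub> \<oplus>\<^bsub>R\<^esub> \<one>\<^bsub>R\<^esub>) \<otimes>\<^bsub>R\<^esub> (\<one>\<^bsub>R\<^esub> \<oplus>\<^bsub>R\<^esub> \<one>\<^bsub>R\<^esub>)) \<otimes>\<^bsub>R\<^esub> d = d \<oplus>\<^bsub>R\<^esub> d \<oplus>\<^bsub>R\<^esub> e"
    using x by (subst (asm) q_smult) (auto simp: d_def)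
  show ?thesis using R.polar_double[OF de eq] by (simp add: d_def e_def)
qed

lemma eqI:
  assumes "x \<in> carrier C" "x' \<in> carrier C" "\<And>y. y \<in> carrier C \<Longrightarrow> b x y = b x' y"
  shows "x = x'"
proof -
  have "\<exists>!z. z \<in> carrier C \<and> (\<forall>y\<in>carrier C. b z y = b x' y)"
    using nonsingular b_linear[OF assms(2)] by (auto simp: nonsingular_def)
  with assms show ?thesis by blast
qed

lemma ex_not_in_prime:
  assumes "fg_projective R C" "constant_rank R C n" "0 < n" "primeideal P R"
  obtains y where "y \<in> carrier C" "q y \<notin> P"
proof -
  interpret localized R P by (rule localized_intro) (fact R.cring_axioms assms)+
  obtain x \<nu> where x: "\<And>j. j < n \<Longrightarrow> x j \<in> carrier C" and "lgen C (x ` {..<n}) = carrier C"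
    and \<nu>: "\<And>i. i < n \<Longrightarrow> \<nu> i \<in> linear_maps R C (self_module R)"
    and "\<And>i j. i < n \<Longrightarrow> j < n \<Longrightarrow> i \<noteq> j \<Longrightarrow> \<nu> i (x j) \<in> P" and diag: "\<And>i. i < n \<Longrightarrow> \<nu> i (x i) \<notin> P"
    by (rule rank_local_basis[OF assms(1,2)]) (rule that; assumption)
  obtain z where z: "z \<in> carrier C" "\<And>y. y \<in> carrier C \<Longrightarrow> b z y = \<nu> 0 y"
    using nonsingular \<nu>[OF assms(3)] unfolding nonsingular_def by blast
  have "\<exists>y\<in>carrier C. q y \<notin> P"
  proof (rule ccontr)
    assume "\<not> ?thesis"
    then have "q y \<in> P" if "y \<in> carrier C" for y using that by blast
    then have "b z (x 0) \<in> P"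
      unfolding polar_def using z(1) x[OF assms(3)] by (simp add: a_minus_def)
    then show False using z(2) x diag assms(3) by simp
  qed
  then show thesis using that by blast
qed

end

section \<open>Compositions\<close>

locale composition_forms = A: nonsingular_form R "C1 \<M>" "q1 \<M>" +
    B: nonsingular_form R "C2 \<M>" "q2 \<M>" + D: nonsingular_form R "C3 \<M>" "q3 \<M>"
  for R :: "'r ring" and \<M> :: "('r, 'c1, 'c2, 'c3) composition" +
  assumes mul_bilinear: "bilinear_map R (C3 \<M>) (C2 \<M>) (C1 \<M>) (composition.mul \<M>)"
    and q_mul: "x3 \<in> carrier (C3 \<M>) \<Longrightarrow> x2 \<in> carrier (C2 \<M>) \<Longrightarrow>
      q1 \<M> (composition.mul \<M> x3 x2) = q3 \<M> x3 \<otimes>\<^bsub>R\<^esub> q2 \<M> x2"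
begin

abbreviation "m \<equiv> composition.mul \<M>"
abbreviation "m2 \<equiv> mul2 R \<M>"
abbreviation "m3 \<equiv> mul3 R \<M>"

lemma m_linear: "x \<in> carrier (C3 \<M>) \<Longrightarrow> m x \<in> linear_maps R (C2 \<M>) (C1 \<M>)"
  and m_linear': "y \<in> carrier (C2 \<M>) \<Longrightarrow> (\<lambda>x. m x y) \<in> linear_maps R (C3 \<M>) (C1 \<M>)"
  using mul_bilinear by (auto simp: bilinear_map_def)

lemma m_closed [simp]: "x \<in> carrier (C3 \<M>) \<Longrightarrow> y \<in> carrier (C2 \<M>) \<Longrightarrow> m x y \<in> carrier (C1 \<M>)"
  using linear_maps_closed[OF m_linear] by simp

lemma mul2_props:
  assumes "x1 \<in> carrier (C1 \<M>)" "x3 \<in> carrier (C3 \<M>)"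
  shows "m2 x1 x3 \<in> carrier (C2 \<M>) \<and> (\<forall>x2\<in>carrier (C2 \<M>). B.b (m2 x1 x3) x2 = A.b x1 (m x3 x2))"
proof -
  have "(\<lambda>x2. A.b x1 (m x3 x2)) \<in> linear_maps R (C2 \<M>) (self_module R)"
    using linear_maps_comp[OF m_linear A.b_linear] assms by blast
  then have "\<exists>!z. z \<in> carrier (C2 \<M>) \<and> (\<forall>x2\<in>carrier (C2 \<M>). B.b z x2 = A.b x1 (m x3 x2))"
    using B.nonsingular by (simp add: nonsingular_def)
  then show ?thesis unfolding mul2_def bil1_def bil2_def by (rule theI')
qed

lemma m2_closed [simp]: "x1 \<in> carrier (C1 \<M>) \<Longrightarrow> x3 \<in> carrier (C3 \<M>) \<Longrightarrow> m2 x1 x3 \<in> carrier (C2 \<M>)"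
  and m2_adjoint: "x1 \<in> carrier (C1 \<M>) \<Longrightarrow> x3 \<in> carrier (C3 \<M>) \<Longrightarrow> x2 \<in> carrier (C2 \<M>) \<Longrightarrow>
    B.b (m2 x1 x3) x2 = A.b x1 (m x3 x2)"
  using mul2_props by auto

lemma mul3_props:
  assumes "x2 \<in> carrier (C2 \<M>)" "x1 \<in> carrier (C1 \<M>)"
  shows "m3 x2 x1 \<in> carrier (C3 \<M>) \<and> (\<forall>x3\<in>carrier (C3 \<M>). D.b x3 (m3 x2 x1) = A.b (m x3 x2) x1)"
proof -
  have "(\<lambda>x3. A.b (m x3 x2) x1) \<in> linear_maps R (C3 \<M>) (self_module R)"
    using linear_maps_comp[OF m_linear' A.b_linear'] assms by blast
  then have "\<exists>!z. z \<in> carrier (C3 \<M>) \<and> (\<forall>x3\<in>carrier (C3 \<M>). D.b z x3 = A.b (m x3 x2) x1)"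
    using D.nonsingular by (simp add: nonsingular_def)
  also have "(\<lambda>z. z \<in> carrier (C3 \<M>) \<and> (\<forall>x3\<in>carrier (C3 \<M>). D.b z x3 = A.b (m x3 x2) x1)) =
     (\<lambda>z. z \<in> carrier (C3 \<M>) \<and> (\<forall>x3\<in>carrier (C3 \<M>). D.b x3 z = A.b (m x3 x2) x1))"
    using D.b_sym by (intro ext conj_cong refl ball_cong) auto
  finally show ?thesis unfolding mul3_def bil1_def bil3_def by (rule theI')
qed

lemma m3_closed [simp]: "x2 \<in> carrier (C2 \<M>) \<Longrightarrow> x1 \<in> carrier (C1 \<M>) \<Longrightarrow> m3 x2 x1 \<in> carrier (C3 \<M>)"
  and m3_adjoint': "x1 \<in> carrier (C1 \<M>) \<Longrightarrow> x3 \<in> carrier (C3 \<M>) \<Longrightarrow> x2 \<in> carrier (C2 \<M>) \<Longrightarrow>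
    D.b x3 (m3 x2 x1) = A.b (m x3 x2) x1"
  using mul3_props by auto

lemma m3_adjoint: "x1 \<in> carrier (C1 \<M>) \<Longrightarrow> x3 \<in> carrier (C3 \<M>) \<Longrightarrow> x2 \<in> carrier (C2 \<M>) \<Longrightarrow>
    D.b (m3 x2 x1) x3 = A.b x1 (m x3 x2)"
  using m3_adjoint'[of x1 x3 x2] by (simp add: D.b_sym A.b_sym)

lemma m_add:
  "x \<in> carrier (C3 \<M>) \<Longrightarrow> x' \<in> carrier (C3 \<M>) \<Longrightarrow> y \<in> carrier (C2 \<M>) \<Longrightarrow> m (x \<oplus>\<^bsub>C3 \<M>\<^esub> x') y = m x y \<oplus>\<^bsub>C1 \<M>\<^esub> m x' y"
  "x \<in> carrier (C3 \<M>) \<Longrightarrow> y \<in> carrier (C2 \<M>) \<Longrightarrow> y' \<in> carrier (C2 \<M>) \<Longrightarrow> m x (y \<oplus>\<^bsub>C2 \<M>\<^esub> y') = m x y \<oplus>\<^bsub>C1 \<M>\<^esub> m x y'"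
  using linear_maps_add[OF m_linear] linear_maps_add[OF m_linear'] by simp_all

lemma m_smult:
  "r \<in> carrier R \<Longrightarrow> x \<in> carrier (C3 \<M>) \<Longrightarrow> y \<in> carrier (C2 \<M>) \<Longrightarrow> m (r \<odot>\<^bsub>C3 \<M>\<^esub> x) y = r \<odot>\<^bsub>C1 \<M>\<^esub> m x y"
  "r \<in> carrier R \<Longrightarrow> x \<in> carrier (C3 \<M>) \<Longrightarrow> y \<in> carrier (C2 \<M>) \<Longrightarrow> m x (r \<odot>\<^bsub>C2 \<M>\<^esub> y) = r \<odot>\<^bsub>C1 \<M>\<^esub> m x y"
  using linear_maps_smult[OF m_linear] linear_maps_smult[OF m_linear'] by simp_all

lemma m_minus:
  "x \<in> carrier (C3 \<M>) \<Longrightarrow> y \<in> carrier (C2 \<M>) \<Longrightarrow> m (\<ominus>\<^bsub>C3 \<M>\<^esub> x) y = \<ominus>\<^bsub>C1 \<M>\<^esub> m x y"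
  "x \<in> carrier (C3 \<M>) \<Longrightarrow> y \<in> carrier (C2 \<M>) \<Longrightarrow> m x (\<ominus>\<^bsub>C2 \<M>\<^esub> y) = \<ominus>\<^bsub>C1 \<M>\<^esub> m x y"
  using linear_maps_minus[OF B.module_axioms A.module_axioms m_linear]
    linear_maps_minus[OF D.module_axioms A.module_axioms m_linear'] by simp_all

lemma m_diff:
  "x \<in> carrier (C3 \<M>) \<Longrightarrow> x' \<in> carrier (C3 \<M>) \<Longrightarrow> y \<in> carrier (C2 \<M>) \<Longrightarrow> m (x \<ominus>\<^bsub>C3 \<M>\<^esub> x') y = m x y \<ominus>\<^bsub>C1 \<M>\<^esub> m x' y"
  "x \<in> carrier (C3 \<M>) \<Longrightarrow> y \<in> carrier (C2 \<M>) \<Longrightarrow> y' \<in> carrier (C2 \<M>) \<Longrightarrow> m x (y \<ominus>\<^bsub>C2 \<M>\<^esub> y') = m x y \<ominus>\<^bsub>C1 \<M>\<^esub> m x y'"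
  by (simp_all add: a_minus_def m_add m_minus)

lemma m2_bilinear: "bilinear_map R (C1 \<M>) (C3 \<M>) (C2 \<M>) m2"
  unfolding bilinear_map_def
  by (intro conjI ballI linear_mapsI B.eqI)
    (simp_all add: m2_adjoint B.b_add B.b_smult A.b_add A.b_smult m_add m_smult)

lemma m3_bilinear: "bilinear_map R (C2 \<M>) (C1 \<M>) (C3 \<M>) m3"
  unfolding bilinear_map_def
  by (intro conjI ballI linear_mapsI D.eqI)
    (simp_all add: m3_adjoint D.b_add D.b_smult A.b_add A.b_smult m_add m_smult)

text \<open>The composition law, polarized in the second factor.\<close>

lemma b_mul_right:
  assumes "x \<in> carrier (C3 \<M>)" "y \<in> carrier (C2 \<M>)" "y' \<in> carrier (C2 \<M>)"
  shows "A.b (m x y) (m x y') = q3 \<M> x \<otimes>\<^bsub>R\<^esub> B.b y y'"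
  using assms unfolding polar_def by (simp add: q_mul A.R.r_distr A.R.r_minus a_minus_def flip: m_add)

lemma b_mul_left:
  assumes "x \<in> carrier (C3 \<M>)" "x' \<in> carrier (C3 \<M>)" "y \<in> carrier (C2 \<M>)"
  shows "A.b (m x y) (m x' y) = D.b x x' \<otimes>\<^bsub>R\<^esub> q2 \<M> y"
  using assms unfolding polar_def by (simp add: q_mul A.R.l_distr A.R.l_minus a_minus_def flip: m_add)

lemma m2_m:
  assumes "x3 \<in> carrier (C3 \<M>)" "x2 \<in> carrier (C2 \<M>)"
  shows "m2 (m x3 x2) x3 = q3 \<M> x3 \<odot>\<^bsub>C2 \<M>\<^esub> x2"
  using assms by (intro B.eqI) (simp_all add: m2_adjoint b_mul_right B.b_smult)

lemma m3_m:
  assumes "x3 \<in> carrier (C3 \<M>)" "x2 \<in> carrier (C2 \<M>)"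
  shows "m3 x2 (m x3 x2) = q2 \<M> x2 \<odot>\<^bsub>C3 \<M>\<^esub> x3"
  using assms by (intro D.eqI) (simp_all add: m3_adjoint b_mul_left D.b_smult A.R.m_comm)

end

subsection \<open>The composition law for the adjoint multiplications\<close>

context composition_forms
begin

lemma b_mul_cross:
  assumes "x \<in> carrier (C3 \<M>)" "x' \<in> carrier (C3 \<M>)" "y \<in> carrier (C2 \<M>)" "y' \<in> carrier (C2 \<M>)"
  shows "A.b (m x y) (m x' y') \<oplus>\<^bsub>R\<^esub> A.b (m x' y) (m x y') = D.b x x' \<otimes>\<^bsub>R\<^esub> B.b y y'"
proof -
  define p where "p = A.b (m x y) (m x' y')"
  define q where "q = A.b (m x' y) (m x y')"
  define s where "s = q3 \<M> x"
  define t where "t = q3 \<M> x'"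
  define c where "c = D.b x x'"
  define d where "d = B.b y y'"
  note defs = p_def q_def s_def t_def c_def d_def
  have cl: "p \<in> carrier R" "q \<in> carrier R" "s \<in> carrier R" "t \<in> carrier R" "c \<in> carrier R" "d \<in> carrier R"
    using assms by (simp_all add: defs)
  have "A.b (m (x \<oplus>\<^bsub>C3 \<M>\<^esub> x') y) (m (x \<oplus>\<^bsub>C3 \<M>\<^esub> x') y') = (s \<oplus>\<^bsub>R\<^esub> t \<oplus>\<^bsub>R\<^esub> c) \<otimes>\<^bsub>R\<^esub> d"
    using assms by (simp add: b_mul_right D.q_add defs)
  moreover have "A.b (m (x \<oplus>\<^bsub>C3 \<M>\<^esub> x') y) (m (x \<oplus>\<^bsub>C3 \<M>\<^esub> x') y') = (s \<otimes>\<^bsub>R\<^esub> d \<oplus>\<^bsub>R\<^esub> p) \<oplus>\<^bsub>R\<^esub> (q \<oplus>\<^bsub>R\<^esub> t \<otimes>\<^bsub>R\<^esub> d)"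
    using assms by (simp add: m_add A.b_add b_mul_right defs A.R.a_ac)
  ultimately have eq: "(s \<otimes>\<^bsub>R\<^esub> d \<oplus>\<^bsub>R\<^esub> p) \<oplus>\<^bsub>R\<^esub> (q \<oplus>\<^bsub>R\<^esub> t \<otimes>\<^bsub>R\<^esub> d) = (s \<oplus>\<^bsub>R\<^esub> t \<oplus>\<^bsub>R\<^esub> c) \<otimes>\<^bsub>R\<^esub> d"
    by simp
  have "p \<oplus>\<^bsub>R\<^esub> q = ((s \<otimes>\<^bsub>R\<^esub> d \<oplus>\<^bsub>R\<^esub> p) \<oplus>\<^bsub>R\<^esub> (q \<oplus>\<^bsub>R\<^esub> t \<otimes>\<^bsub>R\<^esub> d)) \<ominus>\<^bsub>R\<^esub> s \<otimes>\<^bsub>R\<^esub> d \<ominus>\<^bsub>R\<^esub> t \<otimes>\<^bsub>R\<^esub> d"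
    by (rule A.R.ring_identity[of "[p, q, s, t, c, d]"])
      (use cl in \<open>simp add: A.R.in_carrier_def\<close>, (rule A.R.represents_intros)+, simp add: polynomial_normalization)
  also have "\<dots> = c \<otimes>\<^bsub>R\<^esub> d"
    unfolding eq
    by (rule A.R.ring_identity[of "[p, q, s, t, c, d]"])
      (use cl in \<open>simp add: A.R.in_carrier_def\<close>, (rule A.R.represents_intros)+, simp add: polynomial_normalization)
  finally show ?thesis by (simp add: defs)
qed

lemma m2_m_cross:
  assumes "x \<in> carrier (C3 \<M>)" "x' \<in> carrier (C3 \<M>)" "y \<in> carrier (C2 \<M>)"
  shows "m2 (m x y) x' = D.b x x' \<odot>\<^bsub>C2 \<M>\<^esub> y \<ominus>\<^bsub>C2 \<M>\<^esub> m2 (m x' y) x"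
proof (rule B.eqI)
  fix t assume t: "t \<in> carrier (C2 \<M>)"
  have "A.b (m x y) (m x' t) = D.b x x' \<otimes>\<^bsub>R\<^esub> B.b y t \<ominus>\<^bsub>R\<^esub> A.b (m x' y) (m x t)"
    using assms t by (simp add: A.R.a_assoc A.R.r_neg a_minus_def flip: b_mul_cross)
  then show "B.b (m2 (m x y) x') t = B.b (D.b x x' \<odot>\<^bsub>C2 \<M>\<^esub> y \<ominus>\<^bsub>C2 \<M>\<^esub> m2 (m x' y) x) t"
    using assms t by (simp add: m2_adjoint B.b_diff B.b_smult)
qed (use assms in auto)

lemma m2_smult:
  assumes "r \<in> carrier R" "x1 \<in> carrier (C1 \<M>)" "x3 \<in> carrier (C3 \<M>)"
  shows "m2 (r \<odot>\<^bsub>C1 \<M>\<^esub> x1) x3 = r \<odot>\<^bsub>C2 \<M>\<^esub> m2 x1 x3"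
  using m2_bilinear assms by (auto simp: bilinear_map_def linear_maps_def)

end

lemma (in cring) cancel_local_factors:
  assumes cl: "u \<in> carrier R" "c \<in> carrier R" "A \<in> carrier R" "B \<in> carrier R" "V \<in> carrier R" "W \<in> carrier R"
      "Z \<in> carrier R" "Q \<in> carrier R"
    and 1: "u \<otimes> u \<otimes> (c \<otimes> c) \<otimes> A = u \<otimes> u \<otimes> B"
    and 2: "u \<otimes> u \<otimes> (c \<otimes> c) \<otimes> V = u \<otimes> u \<otimes> (c \<otimes> B)"
    and 3: "V = Q \<otimes> W"
    and 4: "u \<otimes> u \<otimes> (c \<otimes> c) \<otimes> Z = u \<otimes> u \<otimes> (c \<otimes> W)"
  shows "(u \<otimes> u \<otimes> (c \<otimes> c) \<otimes> (c \<otimes> c)) \<otimes> (A \<ominus> Z \<otimes> Q) = \<zero>"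
proof -
  have "(u \<otimes> u \<otimes> (c \<otimes> c) \<otimes> (c \<otimes> c)) \<otimes> A = (c \<otimes> c) \<otimes> (u \<otimes> u \<otimes> (c \<otimes> c) \<otimes> A)" using cl by (simp add: m_ac)
  also have "\<dots> = c \<otimes> (u \<otimes> u \<otimes> (c \<otimes> B))" unfolding 1 using cl by (simp add: m_ac)
  also have "\<dots> = c \<otimes> Q \<otimes> c \<otimes> (u \<otimes> u \<otimes> (c \<otimes> W))" unfolding 2[symmetric] 3 using cl by (simp add: m_ac)
  also have "\<dots> = (u \<otimes> u \<otimes> (c \<otimes> c) \<otimes> (c \<otimes> c)) \<otimes> (Z \<otimes> Q)" unfolding 4[symmetric] using cl by (simp add: m_ac)
  finally have "(u \<otimes> u \<otimes> (c \<otimes> c) \<otimes> (c \<otimes> c)) \<otimes> A = (u \<otimes> u \<otimes> (c \<otimes> c) \<otimes> (c \<otimes> c)) \<otimes> (Z \<otimes> Q)" .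
  then show ?thesis using cl by (simp add: a_minus_def r_distr r_minus r_neg)
qed

context composition_forms
begin

lemma q_mul2_of_rank:
  assumes rank: "fg_projective R (C1 \<M>)" "constant_rank R (C1 \<M>) n"
      "fg_projective R (C2 \<M>)" "constant_rank R (C2 \<M>) n"
      "fg_projective R (C3 \<M>)" "constant_rank R (C3 \<M>) n" "0 < n"
    and z: "z \<in> carrier (C1 \<M>)" and x: "x \<in> carrier (C3 \<M>)"
  shows "q2 \<M> (m2 z x) = q1 \<M> z \<otimes>\<^bsub>R\<^esub> q3 \<M> x"
proof -
  have "q2 \<M> (m2 z x) \<ominus>\<^bsub>R\<^esub> q1 \<M> z \<otimes>\<^bsub>R\<^esub> q3 \<M> x = \<zero>\<^bsub>self_module R\<^esub>"
  proof (rule locally_zero_imp_zero[OF A.self])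
    fix P assume P: "primeideal P R"
    interpret localized R P by (rule localized_intro) (fact A.R.cring_axioms P)+
    obtain y where y: "y \<in> carrier (C3 \<M>)" "q3 \<M> y \<notin> P"
      by (rule D.ex_not_in_prime[OF rank(5-7) P])
    define c where "c = q3 \<M> y"
    have c: "c \<in> U" using y by (simp add: U_def c_def)
    have m2_lin: "(\<lambda>z. m2 z y) \<in> linear_maps R (C1 \<M>) (C2 \<M>)"
      using m2_bilinear y(1) by (simp add: bilinear_map_def)
    obtain u where u: "u \<in> U"
      and u_eq: "\<And>v. v \<in> carrier (C1 \<M>) \<Longrightarrow> u \<odot>\<^bsub>C1 \<M>\<^esub> m y (m2 v y) = u \<odot>\<^bsub>C1 \<M>\<^esub> (c \<odot>\<^bsub>C1 \<M>\<^esub> v)"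
      by (rule left_inverse_is_right_inverse[OF rank(3,4,1,2) m_linear[OF y(1)] m2_lin c])
        (use m2_m[OF y(1)] c_def in auto)
    have cl: "u \<in> carrier R" "c \<in> carrier R" using u c by auto
    have scaled: "u \<otimes>\<^bsub>R\<^esub> u \<otimes>\<^bsub>R\<^esub> (c \<otimes>\<^bsub>R\<^esub> c) \<otimes>\<^bsub>R\<^esub> q1 \<M> v = u \<otimes>\<^bsub>R\<^esub> u \<otimes>\<^bsub>R\<^esub> (c \<otimes>\<^bsub>R\<^esub> q2 \<M> (m2 v y))"
      if v: "v \<in> carrier (C1 \<M>)" for v
    proof -
      have "q1 \<M> (u \<odot>\<^bsub>C1 \<M>\<^esub> (c \<odot>\<^bsub>C1 \<M>\<^esub> v)) = q1 \<M> (u \<odot>\<^bsub>C1 \<M>\<^esub> m y (m2 v y))" using u_eq[OF v] by simp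
      then show ?thesis using v y(1) cl by (simp add: A.q_smult q_mul c_def A.R.m_assoc)
    qed
    define w where "w = m2 z y"
    define v where "v = m x w"
    have wv: "w \<in> carrier (C2 \<M>)" "v \<in> carrier (C1 \<M>)" using x y(1) z by (simp_all add: w_def v_def)
    define \<beta> where "\<beta> = D.b y x"
    have \<beta>: "\<beta> \<in> carrier R" using x y by (simp add: \<beta>_def)
    have cross: "B.b w (m2 v y) = \<beta> \<otimes>\<^bsub>R\<^esub> q2 \<M> w"
      using wv x y(1) by (subst B.b_sym) (simp_all add: m2_adjoint v_def b_mul_left \<beta>_def D.b_sym)
    have "q2 \<M> (m2 (m y w) x) = \<beta> \<otimes>\<^bsub>R\<^esub> \<beta> \<otimes>\<^bsub>R\<^esub> q2 \<M> w \<oplus>\<^bsub>R\<^esub> q2 \<M> (m2 v y) \<ominus>\<^bsub>R\<^esub> \<beta> \<otimes>\<^bsub>R\<^esub> (\<beta> \<otimes>\<^bsub>R\<^esub> q2 \<M> w)"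
      using wv x y(1) \<beta> cross by (simp add: m2_m_cross B.q_diff B.q_smult B.b_smult v_def[symmetric] \<beta>_def[symmetric])
    also have "\<dots> = q2 \<M> (m2 v y)"
      using wv x y(1) \<beta> by (simp add: A.R.m_assoc A.R.add_diff_cancel_left)
    finally have q_cross: "q2 \<M> (m2 (m y w) x) = q2 \<M> (m2 v y)" .
    have "u \<otimes>\<^bsub>R\<^esub> u \<otimes>\<^bsub>R\<^esub> (c \<otimes>\<^bsub>R\<^esub> c) \<otimes>\<^bsub>R\<^esub> q2 \<M> (m2 z x) = q2 \<M> (m2 (u \<odot>\<^bsub>C1 \<M>\<^esub> (c \<odot>\<^bsub>C1 \<M>\<^esub> z)) x)"
      using cl x z by (simp add: m2_smult B.q_smult A.R.m_assoc)
    also have "\<dots> = u \<otimes>\<^bsub>R\<^esub> u \<otimes>\<^bsub>R\<^esub> q2 \<M> (m2 (m y w) x)"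
      unfolding u_eq[OF z, symmetric] w_def using cl x z y(1) by (simp add: m2_smult B.q_smult)
    finally have 1: "u \<otimes>\<^bsub>R\<^esub> u \<otimes>\<^bsub>R\<^esub> (c \<otimes>\<^bsub>R\<^esub> c) \<otimes>\<^bsub>R\<^esub> q2 \<M> (m2 z x) = u \<otimes>\<^bsub>R\<^esub> u \<otimes>\<^bsub>R\<^esub> q2 \<M> (m2 v y)"
      unfolding q_cross .
    have "(u \<otimes>\<^bsub>R\<^esub> u \<otimes>\<^bsub>R\<^esub> (c \<otimes>\<^bsub>R\<^esub> c) \<otimes>\<^bsub>R\<^esub> (c \<otimes>\<^bsub>R\<^esub> c)) \<otimes>\<^bsub>R\<^esub> (q2 \<M> (m2 z x) \<ominus>\<^bsub>R\<^esub> q1 \<M> z \<otimes>\<^bsub>R\<^esub> q3 \<M> x) = \<zero>\<^bsub>R\<^esub>"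
    proof (rule A.R.cancel_local_factors[OF cl _ _ _ _ _ _ 1 scaled[OF wv(2)] _ scaled[OF z]])
      show "q1 \<M> v = q3 \<M> x \<otimes>\<^bsub>R\<^esub> q2 \<M> (m2 z y)"
        using wv x by (simp add: v_def q_mul flip: w_def)
    qed (use x y(1) z wv in simp_all)
    moreover have "u \<otimes>\<^bsub>R\<^esub> u \<otimes>\<^bsub>R\<^esub> (c \<otimes>\<^bsub>R\<^esub> c) \<otimes>\<^bsub>R\<^esub> (c \<otimes>\<^bsub>R\<^esub> c) \<in> U" using u c by (intro mult_U)
    ultimately show "\<exists>d\<in>carrier R - P. d \<odot>\<^bsub>self_module R\<^esub> (q2 \<M> (m2 z x) \<ominus>\<^bsub>R\<^esub> q1 \<M> z \<otimes>\<^bsub>R\<^esub> q3 \<M> x) = \<zero>\<^bsub>self_module R\<^esub>"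
      unfolding U_def by auto
  qed (use x z in simp)
  then show ?thesis using x z by (simp add: A.R.diff_eq_zero_iff)
qed

end

text \<open>Interchanging the two factors.\<close>

definition opposite :: "('r, 'c1, 'c2, 'c3) composition \<Rightarrow> ('r, 'c1, 'c3, 'c2) composition" where
  "opposite \<M> = \<lparr>C1 = C1 \<M>, C2 = C3 \<M>, C3 = C2 \<M>, q1 = q1 \<M>, q2 = q3 \<M>, q3 = q2 \<M>,
    mul = (\<lambda>x y. composition.mul \<M> y x)\<rparr>"

text \<open>The cyclic rotation of the three modules.\<close>

definition rotate :: "'r ring \<Rightarrow> ('r, 'c1, 'c2, 'c3) composition \<Rightarrow> ('r, 'c2, 'c3, 'c1) composition" where
  "rotate R \<M> = \<lparr>C1 = C2 \<M>, C2 = C3 \<M>, C3 = C1 \<M>, q1 = q2 \<M>, q2 = q3 \<M>, q3 = q1 \<M>,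
    mul = mul2 R \<M>\<rparr>"

lemma opposite_simps [simp]:
  "C1 (opposite \<M>) = C1 \<M>" "C2 (opposite \<M>) = C3 \<M>" "C3 (opposite \<M>) = C2 \<M>"
  "q1 (opposite \<M>) = q1 \<M>" "q2 (opposite \<M>) = q3 \<M>" "q3 (opposite \<M>) = q2 \<M>"
  "composition.mul (opposite \<M>) x y = composition.mul \<M> y x"
  by (simp_all add: opposite_def)

lemma rotate_simps [simp]:
  "C1 (rotate R \<M>) = C2 \<M>" "C2 (rotate R \<M>) = C3 \<M>" "C3 (rotate R \<M>) = C1 \<M>"
  "q1 (rotate R \<M>) = q2 \<M>" "q2 (rotate R \<M>) = q3 \<M>" "q3 (rotate R \<M>) = q1 \<M>"
  "composition.mul (rotate R \<M>) = mul2 R \<M>"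
  by (simp_all add: rotate_def)

context composition_forms
begin

lemma opposite_composition: "composition_forms R (opposite \<M>)"
proof -
  have "bilinear_map R (C2 \<M>) (C3 \<M>) (C1 \<M>) (composition.mul (opposite \<M>))"
    unfolding bilinear_map_def opposite_simps
    using m_linear m_linear' by (auto simp: opposite_def)
  then show ?thesis
    by (intro composition_forms.intro composition_forms_axioms.intro)
      (simp_all add: A.nonsingular_form_axioms B.nonsingular_form_axioms D.nonsingular_form_axioms q_mul A.R.m_comm)
qed

lemma mul2_opposite:
  assumes "x1 \<in> carrier (C1 \<M>)" "x2 \<in> carrier (C2 \<M>)"
  shows "mul2 R (opposite \<M>) x1 x2 = m3 x2 x1"
proof -
  interpret op: composition_forms R "opposite \<M>" by (rule opposite_composition)
  show ?thesis
    by (rule D.eqI) (use assms op.m2_closed[of x1 x2] op.m2_adjoint[of x1 x2] in \<open>simp_all add: m3_adjoint\<close>)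
qed

lemma q_mul3_of_rank:
  assumes rank: "fg_projective R (C1 \<M>)" "constant_rank R (C1 \<M>) n"
      "fg_projective R (C2 \<M>)" "constant_rank R (C2 \<M>) n"
      "fg_projective R (C3 \<M>)" "constant_rank R (C3 \<M>) n" "0 < n"
    and "x2 \<in> carrier (C2 \<M>)" "x1 \<in> carrier (C1 \<M>)"
  shows "q3 \<M> (m3 x2 x1) = q2 \<M> x2 \<otimes>\<^bsub>R\<^esub> q1 \<M> x1"
  using composition_forms.q_mul2_of_rank[OF opposite_composition, of n x1 x2] assms
  by (simp add: mul2_opposite A.R.m_comm)

end

locale full_composition = composition_forms +
  assumes q_mul2: "x1 \<in> carrier (C1 \<M>) \<Longrightarrow> x3 \<in> carrier (C3 \<M>) \<Longrightarrow> q2 \<M> (m2 x1 x3) = q1 \<M> x1 \<otimes>\<^bsub>R\<^esub> q3 \<M> x3"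
    and q_mul3: "x2 \<in> carrier (C2 \<M>) \<Longrightarrow> x1 \<in> carrier (C1 \<M>) \<Longrightarrow> q3 \<M> (m3 x2 x1) = q2 \<M> x2 \<otimes>\<^bsub>R\<^esub> q1 \<M> x1"
begin

lemma rotate_forms: "composition_forms R (rotate R \<M>)"
  by (intro composition_forms.intro composition_forms_axioms.intro)
    (simp_all add: A.nonsingular_form_axioms B.nonsingular_form_axioms D.nonsingular_form_axioms q_mul2 m2_bilinear)

lemma mul2_rotate:
  assumes "x2 \<in> carrier (C2 \<M>)" "x1 \<in> carrier (C1 \<M>)"
  shows "mul2 R (rotate R \<M>) x2 x1 = m3 x2 x1"
proof -
  interpret N: composition_forms R "rotate R \<M>" by (rule rotate_forms)
  show ?thesis
    by (rule D.eqI) (use assms N.m2_closed[of x2 x1] N.m2_adjoint[of x2 x1] in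
      \<open>simp_all add: m3_adjoint B.b_sym[of x2] m2_adjoint\<close>)
qed

lemma mul3_rotate:
  assumes "x3 \<in> carrier (C3 \<M>)" "x2 \<in> carrier (C2 \<M>)"
  shows "mul3 R (rotate R \<M>) x3 x2 = m x3 x2"
proof -
  interpret N: composition_forms R "rotate R \<M>" by (rule rotate_forms)
  show ?thesis
    by (rule A.eqI) (use assms N.m3_closed[of x3 x2] N.m3_adjoint[of x2 _ x3] in
      \<open>simp_all add: B.b_sym[of x2] m2_adjoint A.b_sym[of "m x3 x2"]\<close>)
qed

lemma rotate_full: "full_composition R (rotate R \<M>)"
  by (intro full_composition.intro full_composition_axioms.intro rotate_forms)
    (simp_all add: mul2_rotate mul3_rotate q_mul3 q_mul)

lemma m_m2:
  assumes "x3 \<in> carrier (C3 \<M>)" "x1 \<in> carrier (C1 \<M>)"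
  shows "m x3 (m2 x1 x3) = q3 \<M> x3 \<odot>\<^bsub>C1 \<M>\<^esub> x1"
  using composition_forms.m3_m[OF rotate_forms, of x1 x3] assms by (simp add: mul3_rotate)

lemma m3_m2:
  assumes "x3 \<in> carrier (C3 \<M>)" "x1 \<in> carrier (C1 \<M>)"
  shows "m3 (m2 x1 x3) x1 = q1 \<M> x1 \<odot>\<^bsub>C3 \<M>\<^esub> x3"
  using composition_forms.m2_m[OF rotate_forms, of x1 x3] assms by (simp add: mul2_rotate)

lemma m2_cross:
  assumes "x \<in> carrier (C1 \<M>)" "x' \<in> carrier (C1 \<M>)" "y \<in> carrier (C3 \<M>)" "y' \<in> carrier (C3 \<M>)"
  shows "B.b (m2 x y) (m2 x' y') \<oplus>\<^bsub>R\<^esub> B.b (m2 x' y) (m2 x y') = A.b x x' \<otimes>\<^bsub>R\<^esub> D.b y y'"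
  using composition_forms.b_mul_cross[OF rotate_forms, of x x' y y'] assms by simp

end

context full_composition
begin

lemma m2_m3:
  assumes "x1 \<in> carrier (C1 \<M>)" "x2 \<in> carrier (C2 \<M>)"
  shows "m2 x1 (m3 x2 x1) = q1 \<M> x1 \<odot>\<^bsub>C2 \<M>\<^esub> x2"
  using full_composition.m_m2[OF rotate_full, of x1 x2] assms by (simp add: mul2_rotate)

lemma m_m3:
  assumes "x1 \<in> carrier (C1 \<M>)" "x2 \<in> carrier (C2 \<M>)"
  shows "m (m3 x2 x1) x2 = q2 \<M> x2 \<odot>\<^bsub>C1 \<M>\<^esub> x1"
  using full_composition.m3_m2[OF rotate_full, of x1 x2] assms by (simp add: mul2_rotate mul3_rotate)

lemma m_m3_m2:
  assumes x: "x1 \<in> carrier (C1 \<M>)" "x2 \<in> carrier (C2 \<M>)" "x3 \<in> carrier (C3 \<M>)"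
  shows "m (m3 x2 x1) (m2 x1 x3) = A.b (m x3 x2) x1 \<odot>\<^bsub>C1 \<M>\<^esub> x1 \<ominus>\<^bsub>C1 \<M>\<^esub> q1 \<M> x1 \<odot>\<^bsub>C1 \<M>\<^esub> m x3 x2"
proof (rule A.eqI)
  fix y assume y: "y \<in> carrier (C1 \<M>)"
  have "A.b (m (m3 x2 x1) (m2 x1 x3)) y = B.b (m2 y (m3 x2 x1)) (m2 x1 x3)"
    using x y by (subst A.b_sym) (simp_all add: m2_adjoint)
  also have "\<dots> = (B.b (m2 x1 (m3 x2 x1)) (m2 y x3) \<oplus>\<^bsub>R\<^esub> B.b (m2 y (m3 x2 x1)) (m2 x1 x3)) \<ominus>\<^bsub>R\<^esub> B.b (m2 x1 (m3 x2 x1)) (m2 y x3)"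
    using x y by (simp add: A.R.add_diff_cancel_left)
  also have "\<dots> = A.b x1 y \<otimes>\<^bsub>R\<^esub> D.b (m3 x2 x1) x3 \<ominus>\<^bsub>R\<^esub> q1 \<M> x1 \<otimes>\<^bsub>R\<^esub> A.b y (m x3 x2)"
    using x y by (simp add: m2_cross) (simp add: m2_m3 B.b_smult B.b_sym[of x2] m2_adjoint)
  also have "\<dots> = A.b (A.b (m x3 x2) x1 \<odot>\<^bsub>C1 \<M>\<^esub> x1 \<ominus>\<^bsub>C1 \<M>\<^esub> q1 \<M> x1 \<odot>\<^bsub>C1 \<M>\<^esub> m x3 x2) y"
    using x y by (simp add: A.b_diff A.b_smult m3_adjoint A.b_sym[of x1 "m x3 x2"] A.b_sym[of y] A.R.m_comm)
  finally show "A.b (m (m3 x2 x1) (m2 x1 x3)) y = \<dots>" .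
qed (use x in auto)

end

context full_composition
begin

lemma triple_rotate:
  assumes "x1 \<in> carrier (C1 \<M>)" "x2 \<in> carrier (C2 \<M>)" "x3 \<in> carrier (C3 \<M>)"
  shows "B.b (m2 x1 x3) x2 = A.b (m x3 x2) x1" "D.b (m3 x2 x1) x3 = A.b (m x3 x2) x1"
  using assms by (simp_all add: m2_adjoint m3_adjoint A.b_sym)

lemma m2_m_m3:
  assumes "x1 \<in> carrier (C1 \<M>)" "x2 \<in> carrier (C2 \<M>)" "x3 \<in> carrier (C3 \<M>)"
  shows "m2 (m x3 x2) (m3 x2 x1) = A.b (m x3 x2) x1 \<odot>\<^bsub>C2 \<M>\<^esub> x2 \<ominus>\<^bsub>C2 \<M>\<^esub> q2 \<M> x2 \<odot>\<^bsub>C2 \<M>\<^esub> m2 x1 x3"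
  using full_composition.m_m3_m2[OF rotate_full, of x2 x3 x1] assms
  by (simp add: mul2_rotate mul3_rotate triple_rotate)

end

context full_composition
begin

lemma m3_m2_m:
  assumes "x1 \<in> carrier (C1 \<M>)" "x2 \<in> carrier (C2 \<M>)" "x3 \<in> carrier (C3 \<M>)"
  shows "m3 (m2 x1 x3) (m x3 x2) = A.b (m x3 x2) x1 \<odot>\<^bsub>C3 \<M>\<^esub> x3 \<ominus>\<^bsub>C3 \<M>\<^esub> q3 \<M> x3 \<odot>\<^bsub>C3 \<M>\<^esub> m3 x2 x1"
  using full_composition.m2_m_m3[OF rotate_full, of x2 x3 x1] assms
  by (simp add: mul2_rotate mul3_rotate triple_rotate)

end

lemma composition_forms_of_rank8:
  assumes "cring R" "composition_of_rank8 R \<M>"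
  shows "composition_forms R \<M>"
  using assms unfolding composition_of_rank8_def fg_projective_def
  by (intro composition_forms.intro composition_forms_axioms.intro nonsingular_form.intro nonsingular_form_axioms.intro)
    auto

lemma full_composition_of_rank8:
  assumes "cring R" "composition_of_rank8 R \<M>"
  shows "full_composition R \<M>"
proof -
  interpret composition_forms R \<M> by (rule composition_forms_of_rank8) fact+
  show ?thesis
    using assms(2) q_mul2_of_rank[of 8] q_mul3_of_rank[of 8] unfolding composition_of_rank8_def
    by unfold_locales auto
qed

section \<open>Polynomial identities\<close>

context cring
begin

lemma eq_by_diff: "a \<ominus> b = \<zero> \<Longrightarrow> a \<in> carrier R \<Longrightarrow> b \<in> carrier R \<Longrightarrow> a = b"
  by (simp add: diff_eq_zero_iff)

text \<open>
  The norm and its derivative as polynomials in the coordinates: \<open>a\<^sub>i\<close> and \<open>b\<^sub>i\<close> are the diagonal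
  entries, \<open>p\<^sub>i\<close> stands for \<open>q\<^sub>i(u\<^sub>i)\<close>, \<open>s\<^sub>i\<close> for \<open>\<langle>u\<^sub>i, v\<^sub>i\<rangle>\<close> and \<open>t\<close> for the trilinear term.
\<close>

abbreviation "nrm g1 g2 g3 a1 a2 a3 p1 p2 p3 t \<equiv>
  a1 \<otimes> a2 \<otimes> a3 \<oplus> g1 \<otimes> g2 \<otimes> g3 \<otimes> t \<ominus> (g2 \<otimes> g3 \<otimes> a1 \<otimes> p1 \<oplus> g3 \<otimes> g1 \<otimes> a2 \<otimes> p2 \<oplus> g1 \<otimes> g2 \<otimes> a3 \<otimes> p3)"

abbreviation "der g1 g2 g3 a1 a2 a3 b1 b2 b3 p1 p2 p3 s1 s2 s3 x3 x2 x1 \<equiv>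
  (b1 \<otimes> a2 \<otimes> a3 \<oplus> a1 \<otimes> b2 \<otimes> a3 \<oplus> a1 \<otimes> a2 \<otimes> b3) \<oplus> g1 \<otimes> g2 \<otimes> g3 \<otimes> (x3 \<oplus> x2 \<oplus> x1)
  \<ominus> (g2 \<otimes> g3 \<otimes> (b1 \<otimes> p1 \<oplus> a1 \<otimes> s1) \<oplus> g3 \<otimes> g1 \<otimes> (b2 \<otimes> p2 \<oplus> a2 \<otimes> s2) \<oplus> g1 \<otimes> g2 \<otimes> (b3 \<otimes> p3 \<oplus> a3 \<otimes> s3))"

lemma nrm_add:
  assumes cl: "g1 \<in> carrier R" "g2 \<in> carrier R" "g3 \<in> carrier R"
    "a1 \<in> carrier R" "a2 \<in> carrier R" "a3 \<in> carrier R" "b1 \<in> carrier R" "b2 \<in> carrier R" "b3 \<in> carrier R"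
    "p1 \<in> carrier R" "p2 \<in> carrier R" "p3 \<in> carrier R" "r1 \<in> carrier R" "r2 \<in> carrier R" "r3 \<in> carrier R"
    "s1 \<in> carrier R" "s2 \<in> carrier R" "s3 \<in> carrier R" "t \<in> carrier R" "t' \<in> carrier R"
    "x1 \<in> carrier R" "x2 \<in> carrier R" "x3 \<in> carrier R" "y1 \<in> carrier R" "y2 \<in> carrier R" "y3 \<in> carrier R"
    and eqs: "P1 = p1 \<oplus> r1 \<oplus> s1" "P2 = p2 \<oplus> r2 \<oplus> s2" "P3 = p3 \<oplus> r3 \<oplus> s3"
    "T = t \<oplus> (x3 \<oplus> x2 \<oplus> x1) \<oplus> (y3 \<oplus> y2 \<oplus> y1) \<oplus> t'" "s1' = s1" "s2' = s2" "s3' = s3"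
  shows "nrm g1 g2 g3 (a1 \<oplus> b1) (a2 \<oplus> b2) (a3 \<oplus> b3) P1 P2 P3 T =
    nrm g1 g2 g3 a1 a2 a3 p1 p2 p3 t \<oplus> der g1 g2 g3 a1 a2 a3 b1 b2 b3 p1 p2 p3 s1 s2 s3 x3 x2 x1 \<oplus>
    der g1 g2 g3 b1 b2 b3 a1 a2 a3 r1 r2 r3 s1' s2' s3' y3 y2 y1 \<oplus> nrm g1 g2 g3 b1 b2 b3 r1 r2 r3 t'"
  unfolding eqs
  by (rule ring_identity[of "[g1, g2, g3, a1, a2, a3, b1, b2, b3, p1, p2, p3, r1, r2, r3, s1, s2, s3, t, t', x1, x2, x3, y1, y2, y3]"])
    (use cl in \<open>simp add: in_carrier_def\<close>, (rule represents_intros)+, simp add: polynomial_normalization)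

lemma nrm_smult:
  assumes cl: "g1 \<in> carrier R" "g2 \<in> carrier R" "g3 \<in> carrier R" "a1 \<in> carrier R" "a2 \<in> carrier R" "a3 \<in> carrier R"
    "p1 \<in> carrier R" "p2 \<in> carrier R" "p3 \<in> carrier R" "t \<in> carrier R" "r \<in> carrier R"
    and eqs: "P1 = (r \<otimes> r) \<otimes> p1" "P2 = (r \<otimes> r) \<otimes> p2" "P3 = (r \<otimes> r) \<otimes> p3" "T = r \<otimes> (r \<otimes> (r \<otimes> t))"
  shows "nrm g1 g2 g3 (r \<otimes> a1) (r \<otimes> a2) (r \<otimes> a3) P1 P2 P3 T = (r \<otimes> r \<otimes> r) \<otimes> nrm g1 g2 g3 a1 a2 a3 p1 p2 p3 t"
  unfolding eqs
  by (rule ring_identity[of "[g1, g2, g3, a1, a2, a3, p1, p2, p3, t, r]"])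
    (use cl in \<open>simp add: in_carrier_def\<close>, (rule represents_intros)+, simp add: polynomial_normalization)

lemma der_diagonal:
  assumes cl: "g1 \<in> carrier R" "g2 \<in> carrier R" "g3 \<in> carrier R" "a1 \<in> carrier R" "a2 \<in> carrier R" "a3 \<in> carrier R"
    "p1 \<in> carrier R" "p2 \<in> carrier R" "p3 \<in> carrier R" "t \<in> carrier R"
    and eqs: "s1 = p1 \<oplus> p1" "s2 = p2 \<oplus> p2" "s3 = p3 \<oplus> p3"
  shows "der g1 g2 g3 a1 a2 a3 a1 a2 a3 p1 p2 p3 s1 s2 s3 t t t =
    nrm g1 g2 g3 a1 a2 a3 p1 p2 p3 t \<oplus> nrm g1 g2 g3 a1 a2 a3 p1 p2 p3 t \<oplus> nrm g1 g2 g3 a1 a2 a3 p1 p2 p3 t"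
  unfolding eqs
  by (rule ring_identity[of "[g1, g2, g3, a1, a2, a3, p1, p2, p3, t]"])
    (use cl in \<open>simp add: in_carrier_def\<close>, (rule represents_intros)+, simp add: polynomial_normalization)

text \<open>The bilinear trace at the base point; \<open>s\<^sub>i\<close> stands for \<open>\<langle>u\<^sub>i, v\<^sub>i\<rangle>\<close>.\<close>

lemma trace_poly:
  assumes cl: "g1 \<in> carrier R" "g2 \<in> carrier R" "g3 \<in> carrier R" "a1 \<in> carrier R" "a2 \<in> carrier R" "a3 \<in> carrier R"
    "b1 \<in> carrier R" "b2 \<in> carrier R" "b3 \<in> carrier R" "p1 \<in> carrier R" "p2 \<in> carrier R" "p3 \<in> carrier R"
    "s1 \<in> carrier R" "s2 \<in> carrier R" "s3 \<in> carrier R" "x1 \<in> carrier R" "x2 \<in> carrier R" "x3 \<in> carrier R"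
    and eqs: "c = a1 \<oplus> a2 \<oplus> a3" "d = b1 \<oplus> b2 \<oplus> b3"
  shows "c \<otimes> d \<ominus> (der g1 g2 g3 (\<one> \<oplus> a1) (\<one> \<oplus> a2) (\<one> \<oplus> a3) b1 b2 b3 p1 p2 p3 s1 s2 s3 x3 x2 x1 \<ominus> d
      \<ominus> der g1 g2 g3 a1 a2 a3 b1 b2 b3 p1 p2 p3 s1 s2 s3 x3 x2 x1) =
    (a1 \<otimes> b1 \<oplus> a2 \<otimes> b2 \<oplus> a3 \<otimes> b3) \<oplus> (g2 \<otimes> g3 \<otimes> s1 \<oplus> g3 \<otimes> g1 \<otimes> s2 \<oplus> g1 \<otimes> g2 \<otimes> s3)"
  unfolding eqs
  by (rule ring_identity[of "[g1, g2, g3, a1, a2, a3, b1, b2, b3, p1, p2, p3, s1, s2, s3, x1, x2, x3]"])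
    (use cl in \<open>simp add: in_carrier_def\<close>, (rule represents_intros)+, simp add: polynomial_normalization)

lemma trace_sharp_poly:
  assumes cl: "g1 \<in> carrier R" "g2 \<in> carrier R" "g3 \<in> carrier R" "a1 \<in> carrier R" "a2 \<in> carrier R" "a3 \<in> carrier R"
    "b1 \<in> carrier R" "b2 \<in> carrier R" "b3 \<in> carrier R" "p1 \<in> carrier R" "p2 \<in> carrier R" "p3 \<in> carrier R"
    "s1 \<in> carrier R" "s2 \<in> carrier R" "s3 \<in> carrier R" "x1 \<in> carrier R" "x2 \<in> carrier R" "x3 \<in> carrier R"
    and eqs: "S1 = g1 \<otimes> x1 \<ominus> a1 \<otimes> s1" "S2 = g2 \<otimes> x2 \<ominus> a2 \<otimes> s2" "S3 = g3 \<otimes> x3 \<ominus> a3 \<otimes> s3"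
  shows "der g1 g2 g3 a1 a2 a3 b1 b2 b3 p1 p2 p3 s1 s2 s3 x3 x2 x1 =
    ((a2 \<otimes> a3 \<ominus> g2 \<otimes> g3 \<otimes> p1) \<otimes> b1 \<oplus> (a3 \<otimes> a1 \<ominus> g3 \<otimes> g1 \<otimes> p2) \<otimes> b2 \<oplus> (a1 \<otimes> a2 \<ominus> g1 \<otimes> g2 \<otimes> p3) \<otimes> b3) \<oplus>
    (g2 \<otimes> g3 \<otimes> S1 \<oplus> g3 \<otimes> g1 \<otimes> S2 \<oplus> g1 \<otimes> g2 \<otimes> S3)"
  unfolding eqs
  by (rule ring_identity[of "[g1, g2, g3, a1, a2, a3, b1, b2, b3, p1, p2, p3, s1, s2, s3, x1, x2, x3]"])
    (use cl in \<open>simp add: in_carrier_def\<close>, (rule represents_intros)+, simp add: polynomial_normalization)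

text \<open>
  The diagonal and the off-diagonal entries of \<open>(x\<^sup>\<sharp>)\<^sup>\<sharp> = N(x)x\<close>, the latter after pairing with a
  vector: \<open>k\<close> and \<open>l\<close> are the values at \<open>u\<^sub>i\<close> and \<open>m\<^sub>i(u\<^sub>l, u\<^sub>j)\<close>.
\<close>

lemma sharp_sharp_diagonal:
  assumes cl: "g1 \<in> carrier R" "g2 \<in> carrier R" "g3 \<in> carrier R" "a1 \<in> carrier R" "a2 \<in> carrier R" "a3 \<in> carrier R"
    "p1 \<in> carrier R" "p2 \<in> carrier R" "p3 \<in> carrier R" "t \<in> carrier R"
  shows "(a3 \<otimes> a1 \<ominus> g3 \<otimes> g1 \<otimes> p2) \<otimes> (a1 \<otimes> a2 \<ominus> g1 \<otimes> g2 \<otimes> p3) \<ominus> g2 \<otimes> g3 \<otimes>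
      ((g1 \<otimes> g1) \<otimes> (p3 \<otimes> p2) \<oplus> (a1 \<otimes> a1) \<otimes> p1 \<ominus> g1 \<otimes> (a1 \<otimes> t)) =
    nrm g1 g2 g3 a1 a2 a3 p1 p2 p3 t \<otimes> a1"
  by (rule ring_identity[of "[g1, g2, g3, a1, a2, a3, p1, p2, p3, t]"])
    (use cl in \<open>simp add: in_carrier_def\<close>, (rule represents_intros)+, simp add: polynomial_normalization)

lemma nrm_rotate:
  assumes cl: "g1 \<in> carrier R" "g2 \<in> carrier R" "g3 \<in> carrier R" "a1 \<in> carrier R" "a2 \<in> carrier R" "a3 \<in> carrier R"
    "p1 \<in> carrier R" "p2 \<in> carrier R" "p3 \<in> carrier R" "t \<in> carrier R"
  shows "nrm g2 g3 g1 a2 a3 a1 p2 p3 p1 t = nrm g1 g2 g3 a1 a2 a3 p1 p2 p3 t"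
  by (rule ring_identity[of "[g1, g2, g3, a1, a2, a3, p1, p2, p3, t]"])
    (use cl in \<open>simp add: in_carrier_def\<close>, (rule represents_intros)+, simp add: polynomial_normalization)

end

section \<open>Constructions of linear and quadratic maps\<close>

lemma bilinear_mapI:
  assumes "\<And>x y. x \<in> carrier M \<Longrightarrow> y \<in> carrier N \<Longrightarrow> b x y \<in> carrier P"
    and "\<And>x x' y. x \<in> carrier M \<Longrightarrow> x' \<in> carrier M \<Longrightarrow> y \<in> carrier N \<Longrightarrow> b (x \<oplus>\<^bsub>M\<^esub> x') y = b x y \<oplus>\<^bsub>P\<^esub> b x' y"
    and "\<And>x y y'. x \<in> carrier M \<Longrightarrow> y \<in> carrier N \<Longrightarrow> y' \<in> carrier N \<Longrightarrow> b x (y \<oplus>\<^bsub>N\<^esub> y') = b x y \<oplus>\<^bsub>P\<^esub> b x y'"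
    and "\<And>r x y. r \<in> carrier R \<Longrightarrow> x \<in> carrier M \<Longrightarrow> y \<in> carrier N \<Longrightarrow> b (r \<odot>\<^bsub>M\<^esub> x) y = r \<odot>\<^bsub>P\<^esub> b x y"
    and "\<And>r x y. r \<in> carrier R \<Longrightarrow> x \<in> carrier M \<Longrightarrow> y \<in> carrier N \<Longrightarrow> b x (r \<odot>\<^bsub>N\<^esub> y) = r \<odot>\<^bsub>P\<^esub> b x y"
  shows "bilinear_map R M N P b"
  using assms unfolding bilinear_map_def by (intro conjI ballI linear_mapsI) auto

lemma bilinear_mapD:
  assumes "bilinear_map R M N P b"
  shows "x \<in> carrier M \<Longrightarrow> y \<in> carrier N \<Longrightarrow> b x y \<in> carrier P"
    and "x \<in> carrier M \<Longrightarrow> x' \<in> carrier M \<Longrightarrow> y \<in> carrier N \<Longrightarrow> b (x \<oplus>\<^bsub>M\<^esub> x') y = b x y \<oplus>\<^bsub>P\<^esub> b x' y"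
    and "x \<in> carrier M \<Longrightarrow> y \<in> carrier N \<Longrightarrow> y' \<in> carrier N \<Longrightarrow> b x (y \<oplus>\<^bsub>N\<^esub> y') = b x y \<oplus>\<^bsub>P\<^esub> b x y'"
    and "r \<in> carrier R \<Longrightarrow> x \<in> carrier M \<Longrightarrow> y \<in> carrier N \<Longrightarrow> b (r \<odot>\<^bsub>M\<^esub> x) y = r \<odot>\<^bsub>P\<^esub> b x y"
    and "r \<in> carrier R \<Longrightarrow> x \<in> carrier M \<Longrightarrow> y \<in> carrier N \<Longrightarrow> b x (r \<odot>\<^bsub>N\<^esub> y) = r \<odot>\<^bsub>P\<^esub> b x y"
  using assms unfolding bilinear_map_def linear_maps_def by auto

lemma bilinear_map_comp:
  assumes "bilinear_map R M N P b" "f \<in> linear_maps R L M" "g \<in> linear_maps R L N"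
  shows "bilinear_map R L L P (\<lambda>x y. b (f x) (g y))"
  using assms(2,3) unfolding linear_maps_def
  by (intro bilinear_mapI) (auto simp: Pi_iff bilinear_mapD[OF assms(1)])

lemma fst_linear: "fst \<in> linear_maps R (M \<times>\<^sub>M N) M" and snd_linear: "snd \<in> linear_maps R (M \<times>\<^sub>M N) N"
  by (auto intro!: linear_mapsI)

locale ring_module = module R M for R :: "'r ring" and M :: "('r, 'a) module"
begin

lemma linear_maps_sum:
  "f \<in> linear_maps R L M \<Longrightarrow> g \<in> linear_maps R L M \<Longrightarrow> (\<lambda>x. f x \<oplus>\<^bsub>M\<^esub> g x) \<in> linear_maps R L M"
  by (rule linear_mapsI) (auto simp: linear_maps_def Pi_iff smult_r_distr M.a_ac)

lemma linear_maps_scale: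
  "c \<in> carrier R \<Longrightarrow> f \<in> linear_maps R L M \<Longrightarrow> (\<lambda>x. c \<odot>\<^bsub>M\<^esub> f x) \<in> linear_maps R L M"
  by (rule linear_mapsI) (auto simp: linear_maps_def Pi_iff smult_r_distr smult_assoc1[symmetric] R.m_comm)

lemma linear_maps_uminus:
  "f \<in> linear_maps R L M \<Longrightarrow> (\<lambda>x. \<ominus>\<^bsub>M\<^esub> f x) \<in> linear_maps R L M"
  by (rule linear_mapsI) (auto simp: linear_maps_def Pi_iff smult_r_minus M.minus_add)

lemma linear_maps_difference:
  "f \<in> linear_maps R L M \<Longrightarrow> g \<in> linear_maps R L M \<Longrightarrow> (\<lambda>x. f x \<ominus>\<^bsub>M\<^esub> g x) \<in> linear_maps R L M"
  using linear_maps_sum[OF _ linear_maps_uminus] by (simp add: a_minus_def)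

lemma bilinear_smult: "bilinear_map R (self_module R) M M (smult M)"
  by (rule bilinear_mapI) (auto simp: smult_l_distr smult_r_distr smult_assoc1 smult_commute)

end

lemma quadratic_mapI:
  assumes "\<And>x. x \<in> carrier M \<Longrightarrow> q x \<in> carrier N"
    and "\<And>r x. r \<in> carrier R \<Longrightarrow> x \<in> carrier M \<Longrightarrow> q (r \<odot>\<^bsub>M\<^esub> x) = (r \<otimes>\<^bsub>R\<^esub> r) \<odot>\<^bsub>N\<^esub> q x"
    and "bilinear_map R M M N b" "\<And>x y. x \<in> carrier M \<Longrightarrow> y \<in> carrier M \<Longrightarrow> polar M N q x y = b x y"
    and "module R M"
  shows "quadratic_map R M N q"
proof -
  interpret module R M by fact
  have "bilinear_map R M M N (polar M N q)"
    by (rule bilinear_mapI) (simp_all add: assms(4) bilinear_mapD[OF assms(3)])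
  with assms show ?thesis by (auto simp: quadratic_map_def)
qed

lemma quadratic_mapD:
  assumes "quadratic_map R M N q"
  shows "x \<in> carrier M \<Longrightarrow> q x \<in> carrier N"
    and "r \<in> carrier R \<Longrightarrow> x \<in> carrier M \<Longrightarrow> q (r \<odot>\<^bsub>M\<^esub> x) = (r \<otimes>\<^bsub>R\<^esub> r) \<odot>\<^bsub>N\<^esub> q x"
    and "bilinear_map R M M N (polar M N q)"
  using assms by (auto simp: quadratic_map_def)

lemma (in abelian_group) polar_sum:
  assumes "a \<in> carrier G" "b \<in> carrier G" "c \<in> carrier G" "a' \<in> carrier G" "b' \<in> carrier G" "c' \<in> carrier G"
  shows "(a \<oplus> a') \<ominus> (b \<oplus> b') \<ominus> (c \<oplus> c') = (a \<ominus> b \<ominus> c) \<oplus> (a' \<ominus> b' \<ominus> c')"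
  using assms by (simp add: a_minus_def minus_add a_ac)

lemma (in abelian_group) polar_minus:
  assumes "a \<in> carrier G" "b \<in> carrier G" "c \<in> carrier G"
  shows "\<ominus> a \<ominus> \<ominus> b \<ominus> \<ominus> c = \<ominus> (a \<ominus> b \<ominus> c)"
  using assms by (simp add: a_minus_def minus_add a_ac)

lemma (in abelian_group) polar_bilinear_cancel:
  assumes "a \<in> carrier G" "b \<in> carrier G" "c \<in> carrier G" "d \<in> carrier G"
  shows "a \<oplus> b \<oplus> (c \<oplus> d) \<ominus> a \<ominus> d = c \<oplus> b"
proof -
  have "a \<oplus> b \<oplus> (c \<oplus> d) \<ominus> a \<ominus> d = (a \<oplus> \<ominus> a) \<oplus> (d \<oplus> \<ominus> d) \<oplus> (c \<oplus> b)"
    using assms by (simp add: a_minus_def minus_add a_ac del: r_neg)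
  then show ?thesis using assms by (simp add: r_neg)
qed

locale two_modules = L: module R L + ring_module R M for R :: "'r ring" and L :: "('r, 'l) module" and M :: "('r, 'a) module"
begin

lemma quadratic_map_sum:
  assumes f: "quadratic_map R L M f" and g: "quadratic_map R L M g"
  shows "quadratic_map R L M (\<lambda>x. f x \<oplus>\<^bsub>M\<^esub> g x)"
proof (rule quadratic_mapI)
  show "bilinear_map R L L M (\<lambda>x y. polar L M f x y \<oplus>\<^bsub>M\<^esub> polar L M g x y)"
    by (rule bilinear_mapI)
      (simp_all add: bilinear_mapD[OF quadratic_mapD(3)[OF f]] bilinear_mapD[OF quadratic_mapD(3)[OF g]]
        smult_r_distr M.a_ac)
  show "polar L M (\<lambda>x. f x \<oplus>\<^bsub>M\<^esub> g x) x y = polar L M f x y \<oplus>\<^bsub>M\<^esub> polar L M g x y"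
    if "x \<in> carrier L" "y \<in> carrier L" for x y
    unfolding polar_def using that by (intro M.polar_sum) (simp_all add: quadratic_mapD(1)[OF f] quadratic_mapD(1)[OF g])
qed (simp_all add: quadratic_mapD[OF f] quadratic_mapD[OF g] smult_r_distr L.module_axioms)

lemma quadratic_map_uminus:
  assumes f: "quadratic_map R L M f"
  shows "quadratic_map R L M (\<lambda>x. \<ominus>\<^bsub>M\<^esub> f x)"
proof (rule quadratic_mapI)
  show "bilinear_map R L L M (\<lambda>x y. \<ominus>\<^bsub>M\<^esub> polar L M f x y)"
    by (rule bilinear_mapI)
      (simp_all add: bilinear_mapD[OF quadratic_mapD(3)[OF f]] smult_r_minus M.minus_add)
  show "polar L M (\<lambda>x. \<ominus>\<^bsub>M\<^esub> f x) x y = \<ominus>\<^bsub>M\<^esub> polar L M f x y"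
    if "x \<in> carrier L" "y \<in> carrier L" for x y
    unfolding polar_def using that by (intro M.polar_minus) (simp_all add: quadratic_mapD(1)[OF f])
qed (simp_all add: quadratic_mapD[OF f] smult_r_minus L.module_axioms)

lemma quadratic_map_difference:
  "quadratic_map R L M f \<Longrightarrow> quadratic_map R L M g \<Longrightarrow> quadratic_map R L M (\<lambda>x. f x \<ominus>\<^bsub>M\<^esub> g x)"
  using quadratic_map_sum[OF _ quadratic_map_uminus] by (simp add: a_minus_def)

lemma quadratic_map_bilinear:
  assumes b: "bilinear_map R L L M b"
  shows "quadratic_map R L M (\<lambda>x. b x x)"
proof (rule quadratic_mapI)
  note bD = bilinear_mapD[OF b]
  show "bilinear_map R L L M (\<lambda>x y. b x y \<oplus>\<^bsub>M\<^esub> b y x)"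
    by (rule bilinear_mapI) (simp_all add: bD smult_r_distr M.a_ac)
  show "polar L M (\<lambda>x. b x x) x y = b x y \<oplus>\<^bsub>M\<^esub> b y x" if "x \<in> carrier L" "y \<in> carrier L" for x y
    unfolding polar_def using that M.polar_bilinear_cancel[of "b x x" "b y x" "b x y" "b y y"]
    by (simp add: bD)
qed (simp_all add: bilinear_mapD[OF b] smult_assoc1 L.module_axioms)

lemma quadratic_map_bilinear_comp:
  assumes "bilinear_map R N P M b" "f \<in> linear_maps R L N" "g \<in> linear_maps R L P"
  shows "quadratic_map R L M (\<lambda>x. b (f x) (g x))"
  by (rule quadratic_map_bilinear[OF bilinear_map_comp[OF assms]])

lemma quadratic_map_scale:
  assumes c: "c \<in> carrier R" and f: "quadratic_map R L M f"
  shows "quadratic_map R L M (\<lambda>x. c \<odot>\<^bsub>M\<^esub> f x)"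
proof (rule quadratic_mapI)
  show "bilinear_map R L L M (\<lambda>x y. c \<odot>\<^bsub>M\<^esub> polar L M f x y)"
    by (rule bilinear_mapI)
      (simp_all add: bilinear_mapD[OF quadratic_mapD(3)[OF f]] smult_r_distr c smult_commute)
  show "polar L M (\<lambda>x. c \<odot>\<^bsub>M\<^esub> f x) x y = c \<odot>\<^bsub>M\<^esub> polar L M f x y"
    if "x \<in> carrier L" "y \<in> carrier L" for x y
    unfolding polar_def using that c by (simp add: quadratic_mapD(1)[OF f] a_minus_def smult_r_distr smult_r_minus)
qed (simp_all add: quadratic_mapD[OF f] c L.module_axioms smult_commute)

lemma quadratic_map_comp:
  assumes q: "quadratic_map R N M q" and f: "f \<in> linear_maps R L N"
  shows "quadratic_map R L M (\<lambda>x. q (f x))"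
proof (rule quadratic_mapI)
  show "bilinear_map R L L M (\<lambda>x y. polar N M q (f x) (f y))"
    by (rule bilinear_map_comp[OF quadratic_mapD(3)[OF q] f f])
  show "polar L M (\<lambda>x. q (f x)) x y = polar N M q (f x) (f y)" if "x \<in> carrier L" "y \<in> carrier L" for x y
    unfolding polar_def using that by (simp add: linear_maps_add[OF f])
qed (simp_all add: quadratic_mapD[OF q] linear_maps_closed[OF f] linear_maps_smult[OF f] L.module_axioms)

end

lemma quadratic_map_pair:
  assumes "module R M" "module R N" "module R L"
    and f: "quadratic_map R L M f" and g: "quadratic_map R L N g"
  shows "quadratic_map R L (M \<times>\<^sub>M N) (\<lambda>x. (f x, g x))"
proof (rule quadratic_mapI)
  interpret L: module R L by fact
  interpret M: module R M by fact
  interpret N: module R N by fact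
  show "bilinear_map R L L (M \<times>\<^sub>M N) (\<lambda>x y. (polar L M f x y, polar L N g x y))"
    by (rule bilinear_mapI)
      (simp_all add: bilinear_mapD[OF quadratic_mapD(3)[OF f]] bilinear_mapD[OF quadratic_mapD(3)[OF g]])
  show "polar L (M \<times>\<^sub>M N) (\<lambda>x. (f x, g x)) x y = (polar L M f x y, polar L N g x y)"
    if "x \<in> carrier L" "y \<in> carrier L" for x y
    unfolding polar_def using that
    by (simp add: prod_module_diff[OF assms(1,2)] quadratic_mapD(1)[OF f] quadratic_mapD(1)[OF g])
qed (simp_all add: quadratic_mapD[OF f] quadratic_mapD[OF g] assms)

text \<open>The same for maps into the ring.\<close>

context ring_module
begin

lemma two_modules_self: "two_modules R M (self_module R)"
  by (intro two_modules.intro ring_module.intro module_axioms module_self_module R.cring_axioms)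

lemma linear_form_intros:
  "f \<in> linear_maps R M (self_module R) \<Longrightarrow> g \<in> linear_maps R M (self_module R) \<Longrightarrow>
    (\<lambda>x. f x \<oplus>\<^bsub>R\<^esub> g x) \<in> linear_maps R M (self_module R)"
  "f \<in> linear_maps R M (self_module R) \<Longrightarrow> g \<in> linear_maps R M (self_module R) \<Longrightarrow>
    (\<lambda>x. f x \<ominus>\<^bsub>R\<^esub> g x) \<in> linear_maps R M (self_module R)"
  "c \<in> carrier R \<Longrightarrow> f \<in> linear_maps R M (self_module R) \<Longrightarrow> (\<lambda>x. c \<otimes>\<^bsub>R\<^esub> f x) \<in> linear_maps R M (self_module R)"
  "c \<in> carrier R \<Longrightarrow> f \<in> linear_maps R M (self_module R) \<Longrightarrow> (\<lambda>x. f x \<otimes>\<^bsub>R\<^esub> c) \<in> linear_maps R M (self_module R)"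
proof -
  interpret S: ring_module R "self_module R" by (intro ring_module.intro module_self_module) (rule R.cring_axioms)
  note S.linear_maps_sum[of f M g] S.linear_maps_difference[of f M g] S.linear_maps_scale[of c f M]
  then show "f \<in> linear_maps R M (self_module R) \<Longrightarrow> g \<in> linear_maps R M (self_module R) \<Longrightarrow>
    (\<lambda>x. f x \<oplus>\<^bsub>R\<^esub> g x) \<in> linear_maps R M (self_module R)"
    "f \<in> linear_maps R M (self_module R) \<Longrightarrow> g \<in> linear_maps R M (self_module R) \<Longrightarrow>
    (\<lambda>x. f x \<ominus>\<^bsub>R\<^esub> g x) \<in> linear_maps R M (self_module R)"
    "c \<in> carrier R \<Longrightarrow> f \<in> linear_maps R M (self_module R) \<Longrightarrow> (\<lambda>x. c \<otimes>\<^bsub>R\<^esub> f x) \<in> linear_maps R M (self_module R)"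
    by simp_all
  assume "c \<in> carrier R" "f \<in> linear_maps R M (self_module R)"
  then show "(\<lambda>x. f x \<otimes>\<^bsub>R\<^esub> c) \<in> linear_maps R M (self_module R)"
    using linear_maps_closed[of f R M "self_module R"]
    by (intro linear_mapsI) (auto simp: linear_maps_add linear_maps_smult R.l_distr R.m_assoc)
qed

lemma quadratic_form_intros:
  "quadratic_form R M f \<Longrightarrow> quadratic_form R M g \<Longrightarrow> quadratic_form R M (\<lambda>x. f x \<oplus>\<^bsub>R\<^esub> g x)"
  "quadratic_form R M f \<Longrightarrow> quadratic_form R M g \<Longrightarrow> quadratic_form R M (\<lambda>x. f x \<ominus>\<^bsub>R\<^esub> g x)"
  "c \<in> carrier R \<Longrightarrow> quadratic_form R M f \<Longrightarrow> quadratic_form R M (\<lambda>x. c \<otimes>\<^bsub>R\<^esub> f x)"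
  using two_modules.quadratic_map_sum[OF two_modules_self] two_modules.quadratic_map_difference[OF two_modules_self]
    two_modules.quadratic_map_scale[OF two_modules_self] by simp_all

lemma quadratic_form_mult:
  assumes "f \<in> linear_maps R M (self_module R)" "g \<in> linear_maps R M (self_module R)"
  shows "quadratic_form R M (\<lambda>x. f x \<otimes>\<^bsub>R\<^esub> g x)"
proof -
  have "bilinear_map R (self_module R) (self_module R) (self_module R) (monoid.mult R)"
    by (rule bilinear_mapI) (auto simp: R.l_distr R.r_distr R.m_ac)
  from two_modules.quadratic_map_bilinear_comp[OF two_modules_self this assms] show ?thesis .
qed

lemma quadratic_form_scale_right:
  assumes "c \<in> carrier R" "quadratic_form R M f"
  shows "quadratic_form R M (\<lambda>x. f x \<otimes>\<^bsub>R\<^esub> c)"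
proof (rule quadratic_mapI)
  note f = quadratic_mapD[OF assms(2)]
  show "bilinear_map R M M (self_module R) (\<lambda>x y. polar M R f x y \<otimes>\<^bsub>R\<^esub> c)"
    using bilinear_mapD[OF f(3)] assms(1) by (intro bilinear_mapI) (auto simp: R.l_distr R.m_assoc)
  show "polar M (self_module R) (\<lambda>x. f x \<otimes>\<^bsub>R\<^esub> c) x y = polar M R f x y \<otimes>\<^bsub>R\<^esub> c" if "x \<in> carrier M" "y \<in> carrier M" for x y
    using f(1) assms(1) that by (simp add: polar_def a_minus_def R.l_distr R.l_minus)
qed (use quadratic_mapD[OF assms(2)] assms(1) module_axioms in \<open>auto simp: R.m_assoc\<close>)

lemmas quadratic_form_bilinear = two_modules.quadratic_map_bilinear_comp[OF two_modules_self]
lemmas quadratic_form_comp = two_modules.quadratic_map_comp[OF two_modules_self]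

end

section \<open>The cubic norm structure of a composition\<close>

lemma comp_module_simps [simp]:
  "carrier (comp_module R \<M>) = carrier R \<times> carrier R \<times> carrier R \<times> carrier (C1 \<M>) \<times> carrier (C2 \<M>) \<times> carrier (C3 \<M>)"
  "(a1, a2, a3, u1, u2, u3) \<oplus>\<^bsub>comp_module R \<M>\<^esub> (b1, b2, b3, v1, v2, v3) =
    (a1 \<oplus>\<^bsub>R\<^esub> b1, a2 \<oplus>\<^bsub>R\<^esub> b2, a3 \<oplus>\<^bsub>R\<^esub> b3, u1 \<oplus>\<^bsub>C1 \<M>\<^esub> v1, u2 \<oplus>\<^bsub>C2 \<M>\<^esub> v2, u3 \<oplus>\<^bsub>C3 \<M>\<^esub> v3)"
  "r \<odot>\<^bsub>comp_module R \<M>\<^esub> (a1, a2, a3, u1, u2, u3) =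
    (r \<otimes>\<^bsub>R\<^esub> a1, r \<otimes>\<^bsub>R\<^esub> a2, r \<otimes>\<^bsub>R\<^esub> a3, r \<odot>\<^bsub>C1 \<M>\<^esub> u1, r \<odot>\<^bsub>C2 \<M>\<^esub> u2, r \<odot>\<^bsub>C3 \<M>\<^esub> u3)"
  "\<zero>\<^bsub>comp_module R \<M>\<^esub> = (\<zero>\<^bsub>R\<^esub>, \<zero>\<^bsub>R\<^esub>, \<zero>\<^bsub>R\<^esub>, \<zero>\<^bsub>C1 \<M>\<^esub>, \<zero>\<^bsub>C2 \<M>\<^esub>, \<zero>\<^bsub>C3 \<M>\<^esub>)"
  by (simp_all add: comp_module_def)

lemmas bil_defs = bil1_def bil2_def bil3_def

locale cubic_construction = full_composition R \<M> for R :: "'r ring" and \<M> :: "('r, 'c1, 'c2, 'c3) composition" +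
  fixes g1 g2 g3 :: 'r
  assumes g_closed [simp]: "g1 \<in> carrier R" "g2 \<in> carrier R" "g3 \<in> carrier R"
begin

abbreviation "J \<equiv> comp_module R \<M>"
abbreviation "N \<equiv> comp_norm R \<M> (g1, g2, g3)"
abbreviation "N' \<equiv> comp_norm_deriv R \<M> (g1, g2, g3)"
abbreviation "sharp \<equiv> comp_sharp R \<M> (g1, g2, g3)"
abbreviation "e \<equiv> comp_base R \<M>"

lemma module_J: "module R J"
  unfolding comp_module_eq_prod
  by (intro module_prod_module A.self A.module_axioms B.module_axioms D.module_axioms)

sublocale J: ring_module R J by (rule ring_module.intro) (rule module_J)

lemma J_minus:
  assumes "a1 \<in> carrier R" "a2 \<in> carrier R" "a3 \<in> carrier R"
    "u1 \<in> carrier (C1 \<M>)" "u2 \<in> carrier (C2 \<M>)" "u3 \<in> carrier (C3 \<M>)"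
  shows "\<ominus>\<^bsub>J\<^esub> (a1, a2, a3, u1, u2, u3) =
    (\<ominus>\<^bsub>R\<^esub> a1, \<ominus>\<^bsub>R\<^esub> a2, \<ominus>\<^bsub>R\<^esub> a3, \<ominus>\<^bsub>C1 \<M>\<^esub> u1, \<ominus>\<^bsub>C2 \<M>\<^esub> u2, \<ominus>\<^bsub>C3 \<M>\<^esub> u3)"
  by (rule J.M.minus_equality)
    (use assms in \<open>simp_all add: A.R.l_neg A.M.l_neg B.M.l_neg D.M.l_neg\<close>)

lemma J_diff:
  assumes "a1 \<in> carrier R" "a2 \<in> carrier R" "a3 \<in> carrier R"
    "u1 \<in> carrier (C1 \<M>)" "u2 \<in> carrier (C2 \<M>)" "u3 \<in> carrier (C3 \<M>)"
    "b1 \<in> carrier R" "b2 \<in> carrier R" "b3 \<in> carrier R"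
    "v1 \<in> carrier (C1 \<M>)" "v2 \<in> carrier (C2 \<M>)" "v3 \<in> carrier (C3 \<M>)"
  shows "(a1, a2, a3, u1, u2, u3) \<ominus>\<^bsub>J\<^esub> (b1, b2, b3, v1, v2, v3) =
    (a1 \<ominus>\<^bsub>R\<^esub> b1, a2 \<ominus>\<^bsub>R\<^esub> b2, a3 \<ominus>\<^bsub>R\<^esub> b3, u1 \<ominus>\<^bsub>C1 \<M>\<^esub> v1, u2 \<ominus>\<^bsub>C2 \<M>\<^esub> v2, u3 \<ominus>\<^bsub>C3 \<M>\<^esub> v3)"
  using assms by (simp add: a_minus_def J_minus)

lemma J_cases:
  assumes "x \<in> carrier J"
  obtains a1 a2 a3 u1 u2 u3 where "x = (a1, a2, a3, u1, u2, u3)"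
    "a1 \<in> carrier R" "a2 \<in> carrier R" "a3 \<in> carrier R"
    "u1 \<in> carrier (C1 \<M>)" "u2 \<in> carrier (C2 \<M>)" "u3 \<in> carrier (C3 \<M>)"
  using assms by auto

lemma e_closed [simp]: "e \<in> carrier J"
  by (simp add: comp_base_def)

lemma N_closed: "x \<in> carrier J \<Longrightarrow> N x \<in> carrier R"
  by (elim J_cases) (simp add: bil_defs)

lemma N'_closed: "x \<in> carrier J \<Longrightarrow> y \<in> carrier J \<Longrightarrow> N' x y \<in> carrier R"
  by (elim J_cases) (simp add: bil_defs)

lemma sharp_closed: "x \<in> carrier J \<Longrightarrow> sharp x \<in> carrier J"
  by (elim J_cases) simp

lemma N_smult:
  assumes "r \<in> carrier R" "x \<in> carrier J"
  shows "N (r \<odot>\<^bsub>J\<^esub> x) = (r \<otimes>\<^bsub>R\<^esub> r \<otimes>\<^bsub>R\<^esub> r) \<otimes>\<^bsub>R\<^esub> N x"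
  using assms(2)
proof (rule J_cases)
  fix a1 a2 a3 u1 u2 u3
  assume x: "x = (a1, a2, a3, u1, u2, u3)" and cl: "a1 \<in> carrier R" "a2 \<in> carrier R" "a3 \<in> carrier R"
    "u1 \<in> carrier (C1 \<M>)" "u2 \<in> carrier (C2 \<M>)" "u3 \<in> carrier (C3 \<M>)"
  show ?thesis
    unfolding x comp_module_simps comp_norm.simps bil_defs
    by (rule A.R.nrm_smult)
      (use cl assms(1) in \<open>simp_all add: A.q_smult B.q_smult D.q_smult m_smult A.b_smult\<close>)
qed

lemma N_add:
  assumes "x \<in> carrier J" "y \<in> carrier J"
  shows "N (x \<oplus>\<^bsub>J\<^esub> y) = N x \<oplus>\<^bsub>R\<^esub> N' x y \<oplus>\<^bsub>R\<^esub> N' y x \<oplus>\<^bsub>R\<^esub> N y"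
  using assms(1)
proof (rule J_cases)
  fix a1 a2 a3 u1 u2 u3
  assume x: "x = (a1, a2, a3, u1, u2, u3)" and clx: "a1 \<in> carrier R" "a2 \<in> carrier R" "a3 \<in> carrier R"
    "u1 \<in> carrier (C1 \<M>)" "u2 \<in> carrier (C2 \<M>)" "u3 \<in> carrier (C3 \<M>)"
  from assms(2) obtain b1 b2 b3 v1 v2 v3 where y: "y = (b1, b2, b3, v1, v2, v3)" and
    cly: "b1 \<in> carrier R" "b2 \<in> carrier R" "b3 \<in> carrier R"
    "v1 \<in> carrier (C1 \<M>)" "v2 \<in> carrier (C2 \<M>)" "v3 \<in> carrier (C3 \<M>)" by (rule J_cases)
  show ?thesis
    unfolding x y comp_module_simps comp_norm.simps comp_norm_deriv.simps bil_defs
    by (rule A.R.nrm_add)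
      (use clx cly in \<open>simp_all add: A.q_add B.q_add D.q_add m_add A.b_add A.R.a_ac A.b_sym B.b_sym D.b_sym\<close>)
qed

lemma N'_diagonal:
  assumes "x \<in> carrier J"
  shows "N' x x = N x \<oplus>\<^bsub>R\<^esub> N x \<oplus>\<^bsub>R\<^esub> N x"
  using assms(1)
proof (rule J_cases)
  fix a1 a2 a3 u1 u2 u3
  assume x: "x = (a1, a2, a3, u1, u2, u3)" and cl: "a1 \<in> carrier R" "a2 \<in> carrier R" "a3 \<in> carrier R"
    "u1 \<in> carrier (C1 \<M>)" "u2 \<in> carrier (C2 \<M>)" "u3 \<in> carrier (C3 \<M>)"
  show ?thesis
    unfolding x comp_norm.simps comp_norm_deriv.simps bil_defs
    by (rule A.R.der_diagonal) (use cl in \<open>simp_all add: A.b_self B.b_self D.b_self\<close>)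
qed

lemma projections:
  "fst \<in> linear_maps R J (self_module R)"
  "(\<lambda>x. fst (snd x)) \<in> linear_maps R J (self_module R)"
  "(\<lambda>x. fst (snd (snd x))) \<in> linear_maps R J (self_module R)"
  "(\<lambda>x. fst (snd (snd (snd x)))) \<in> linear_maps R J (C1 \<M>)"
  "(\<lambda>x. fst (snd (snd (snd (snd x))))) \<in> linear_maps R J (C2 \<M>)"
  "(\<lambda>x. snd (snd (snd (snd (snd x))))) \<in> linear_maps R J (C3 \<M>)"
  unfolding comp_module_eq_prod
  by (rule fst_linear snd_linear linear_maps_comp[OF snd_linear])+

lemma N'_linear:
  assumes "x \<in> carrier J"
  shows "N' x \<in> linear_maps R J (self_module R)"
  using assms
proof (rule J_cases)
  fix a1 a2 a3 u1 u2 u3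
  assume x: "x = (a1, a2, a3, u1, u2, u3)" and cl: "a1 \<in> carrier R" "a2 \<in> carrier R" "a3 \<in> carrier R"
    "u1 \<in> carrier (C1 \<M>)" "u2 \<in> carrier (C2 \<M>)" "u3 \<in> carrier (C3 \<M>)"
  define b1 where "b1 = (fst :: ('r, 'c1, 'c2, 'c3) comp_elt \<Rightarrow> 'r)"
  define b2 where "b2 = (\<lambda>x :: ('r, 'c1, 'c2, 'c3) comp_elt. fst (snd x))"
  define b3 where "b3 = (\<lambda>x :: ('r, 'c1, 'c2, 'c3) comp_elt. fst (snd (snd x)))"
  define v1 where "v1 = (\<lambda>x :: ('r, 'c1, 'c2, 'c3) comp_elt. fst (snd (snd (snd x))))"
  define v2 where "v2 = (\<lambda>x :: ('r, 'c1, 'c2, 'c3) comp_elt. fst (snd (snd (snd (snd x)))))"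
  define v3 where "v3 = (\<lambda>x :: ('r, 'c1, 'c2, 'c3) comp_elt. snd (snd (snd (snd (snd x)))))"
  note pr = projections[folded b1_def b2_def b3_def v1_def v2_def v3_def]
  have "N' x = (\<lambda>y. A.R.der g1 g2 g3 a1 a2 a3 (b1 y) (b2 y) (b3 y) (q1 \<M> u1) (q2 \<M> u2) (q3 \<M> u3)
    (A.b u1 (v1 y)) (B.b u2 (v2 y)) (D.b u3 (v3 y)) (A.b (m (v3 y) u2) u1) (A.b (m u3 (v2 y)) u1) (A.b (m u3 u2) (v1 y)))"
    by (simp add: fun_eq_iff x bil_defs b1_def b2_def b3_def v1_def v2_def v3_def)
  also have "\<dots> \<in> linear_maps R J (self_module R)"
    by (intro J.linear_form_intros pr linear_maps_comp[OF pr(4) A.b_linear] linear_maps_comp[OF pr(5) B.b_linear]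
      linear_maps_comp[OF pr(6) D.b_linear] linear_maps_comp[OF linear_maps_comp[OF pr(6) m_linear'] A.b_linear']
      linear_maps_comp[OF linear_maps_comp[OF pr(5) m_linear] A.b_linear'])
      (use cl in simp_all)
  finally show ?thesis .
qed

lemma N'_quadratic:
  assumes "y \<in> carrier J"
  shows "quadratic_form R J (\<lambda>x. N' x y)"
  using assms
proof (rule J_cases)
  fix b1 b2 b3 v1 v2 v3
  assume y: "y = (b1, b2, b3, v1, v2, v3)" and cl: "b1 \<in> carrier R" "b2 \<in> carrier R" "b3 \<in> carrier R"
    "v1 \<in> carrier (C1 \<M>)" "v2 \<in> carrier (C2 \<M>)" "v3 \<in> carrier (C3 \<M>)"
  define a1 where "a1 = (fst :: ('r, 'c1, 'c2, 'c3) comp_elt \<Rightarrow> 'r)"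
  define a2 where "a2 = (\<lambda>x :: ('r, 'c1, 'c2, 'c3) comp_elt. fst (snd x))"
  define a3 where "a3 = (\<lambda>x :: ('r, 'c1, 'c2, 'c3) comp_elt. fst (snd (snd x)))"
  define u1 where "u1 = (\<lambda>x :: ('r, 'c1, 'c2, 'c3) comp_elt. fst (snd (snd (snd x))))"
  define u2 where "u2 = (\<lambda>x :: ('r, 'c1, 'c2, 'c3) comp_elt. fst (snd (snd (snd (snd x)))))"
  define u3 where "u3 = (\<lambda>x :: ('r, 'c1, 'c2, 'c3) comp_elt. snd (snd (snd (snd (snd x)))))"
  note pr = projections[folded a1_def a2_def a3_def u1_def u2_def u3_def]
  have eq: "(\<lambda>x. N' x y) = (\<lambda>x. A.R.der g1 g2 g3 (a1 x) (a2 x) (a3 x) b1 b2 b3 (q1 \<M> (u1 x)) (q2 \<M> (u2 x)) (q3 \<M> (u3 x))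
    (A.b (u1 x) v1) (B.b (u2 x) v2) (D.b (u3 x) v3) (A.b (m v3 (u2 x)) (u1 x)) (A.b (m (u3 x) v2) (u1 x)) (A.b (m (u3 x) (u2 x)) v1))"
    by (simp add: fun_eq_iff y bil_defs a1_def a2_def a3_def u1_def u2_def u3_def)
  have diag: "quadratic_form R J (\<lambda>x. b1 \<otimes>\<^bsub>R\<^esub> a2 x \<otimes>\<^bsub>R\<^esub> a3 x)" "quadratic_form R J (\<lambda>x. a1 x \<otimes>\<^bsub>R\<^esub> b2 \<otimes>\<^bsub>R\<^esub> a3 x)"
    "quadratic_form R J (\<lambda>x. a1 x \<otimes>\<^bsub>R\<^esub> a2 x \<otimes>\<^bsub>R\<^esub> b3)"
    using cl by (auto intro!: J.quadratic_form_mult J.linear_form_intros J.quadratic_form_scale_right pr)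
  have bil: "bilinear_map R (C2 \<M>) (C1 \<M>) (self_module R) (\<lambda>x2 x1. A.b (m v3 x2) x1)"
    "bilinear_map R (C3 \<M>) (C1 \<M>) (self_module R) (\<lambda>x3 x1. A.b (m x3 v2) x1)"
    "bilinear_map R (C3 \<M>) (C2 \<M>) (self_module R) (\<lambda>x3 x2. A.b (m x3 x2) v1)"
    by (rule bilinear_mapI; use cl in \<open>simp add: m_add m_smult A.b_add A.b_smult\<close>)+
  have tri: "quadratic_form R J (\<lambda>x. A.b (m v3 (u2 x)) (u1 x) \<oplus>\<^bsub>R\<^esub> A.b (m (u3 x) v2) (u1 x) \<oplus>\<^bsub>R\<^esub> A.b (m (u3 x) (u2 x)) v1)"
    by (intro J.quadratic_form_intros J.quadratic_form_bilinear[OF bil(1) pr(5,4)]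
      J.quadratic_form_bilinear[OF bil(2) pr(6,4)] J.quadratic_form_bilinear[OF bil(3) pr(6,5)])
  have mixed: "quadratic_form R J (\<lambda>x. a1 x \<otimes>\<^bsub>R\<^esub> A.b (u1 x) v1)" "quadratic_form R J (\<lambda>x. a2 x \<otimes>\<^bsub>R\<^esub> B.b (u2 x) v2)"
    "quadratic_form R J (\<lambda>x. a3 x \<otimes>\<^bsub>R\<^esub> D.b (u3 x) v3)"
    by (rule J.quadratic_form_mult[OF pr(1) linear_maps_comp[OF pr(4) A.b_linear'[OF cl(4)]]]
      J.quadratic_form_mult[OF pr(2) linear_maps_comp[OF pr(5) B.b_linear'[OF cl(5)]]]
      J.quadratic_form_mult[OF pr(3) linear_maps_comp[OF pr(6) D.b_linear'[OF cl(6)]]])+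
  have forms: "quadratic_form R J (\<lambda>x. q1 \<M> (u1 x))" "quadratic_form R J (\<lambda>x. q2 \<M> (u2 x))" "quadratic_form R J (\<lambda>x. q3 \<M> (u3 x))"
    by (rule J.quadratic_form_comp[OF A.quadratic pr(4)] J.quadratic_form_comp[OF B.quadratic pr(5)]
      J.quadratic_form_comp[OF D.quadratic pr(6)])+
  show ?thesis
    unfolding eq
    by (intro J.quadratic_form_intros(1,2) diag J.quadratic_form_intros(3)[OF _ tri]
      J.quadratic_form_intros(3)[OF _ J.quadratic_form_intros(1)[OF J.quadratic_form_intros(3)[OF _ forms(1)] mixed(1)]]
      J.quadratic_form_intros(3)[OF _ J.quadratic_form_intros(1)[OF J.quadratic_form_intros(3)[OF _ forms(2)] mixed(2)]]
      J.quadratic_form_intros(3)[OF _ J.quadratic_form_intros(1)[OF J.quadratic_form_intros(3)[OF _ forms(3)] mixed(3)]])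
      (use cl in simp_all)
qed

lemma cubic_form_N: "cubic_form R J N N'"
  unfolding cubic_form_def
  by (intro conjI ballI) (simp_all add: N_closed N_smult N_add N'_diagonal N'_linear N'_quadratic Pi_iff del: comp_module_simps)

lemma sharp_quadratic: "quadratic_map R J J sharp"
proof -
  define a1 where "a1 = (fst :: ('r, 'c1, 'c2, 'c3) comp_elt \<Rightarrow> 'r)"
  define a2 where "a2 = (\<lambda>x :: ('r, 'c1, 'c2, 'c3) comp_elt. fst (snd x))"
  define a3 where "a3 = (\<lambda>x :: ('r, 'c1, 'c2, 'c3) comp_elt. fst (snd (snd x)))"
  define u1 where "u1 = (\<lambda>x :: ('r, 'c1, 'c2, 'c3) comp_elt. fst (snd (snd (snd x))))"
  define u2 where "u2 = (\<lambda>x :: ('r, 'c1, 'c2, 'c3) comp_elt. fst (snd (snd (snd (snd x)))))"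
  define u3 where "u3 = (\<lambda>x :: ('r, 'c1, 'c2, 'c3) comp_elt. snd (snd (snd (snd (snd x)))))"
  note pr = projections[folded a1_def a2_def a3_def u1_def u2_def u3_def]
  interpret JA: two_modules R J "C1 \<M>" by (intro two_modules.intro ring_module.intro module_J A.module_axioms)
  interpret JB: two_modules R J "C2 \<M>" by (intro two_modules.intro ring_module.intro module_J B.module_axioms)
  interpret JD: two_modules R J "C3 \<M>" by (intro two_modules.intro ring_module.intro module_J D.module_axioms)
  have eq: "sharp = (\<lambda>x.
     (a2 x \<otimes>\<^bsub>R\<^esub> a3 x \<ominus>\<^bsub>R\<^esub> g2 \<otimes>\<^bsub>R\<^esub> g3 \<otimes>\<^bsub>R\<^esub> q1 \<M> (u1 x), a3 x \<otimes>\<^bsub>R\<^esub> a1 x \<ominus>\<^bsub>R\<^esub> g3 \<otimes>\<^bsub>R\<^esub> g1 \<otimes>\<^bsub>R\<^esub> q2 \<M> (u2 x),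
      a1 x \<otimes>\<^bsub>R\<^esub> a2 x \<ominus>\<^bsub>R\<^esub> g1 \<otimes>\<^bsub>R\<^esub> g2 \<otimes>\<^bsub>R\<^esub> q3 \<M> (u3 x),
      g1 \<odot>\<^bsub>C1 \<M>\<^esub> m (u3 x) (u2 x) \<ominus>\<^bsub>C1 \<M>\<^esub> a1 x \<odot>\<^bsub>C1 \<M>\<^esub> u1 x,
      g2 \<odot>\<^bsub>C2 \<M>\<^esub> m2 (u1 x) (u3 x) \<ominus>\<^bsub>C2 \<M>\<^esub> a2 x \<odot>\<^bsub>C2 \<M>\<^esub> u2 x,
      g3 \<odot>\<^bsub>C3 \<M>\<^esub> m3 (u2 x) (u1 x) \<ominus>\<^bsub>C3 \<M>\<^esub> a3 x \<odot>\<^bsub>C3 \<M>\<^esub> u3 x))"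
    by (simp add: fun_eq_iff a1_def a2_def a3_def u1_def u2_def u3_def)
  have "quadratic_form R J (\<lambda>x. a2 x \<otimes>\<^bsub>R\<^esub> a3 x \<ominus>\<^bsub>R\<^esub> g2 \<otimes>\<^bsub>R\<^esub> g3 \<otimes>\<^bsub>R\<^esub> q1 \<M> (u1 x))"
    "quadratic_form R J (\<lambda>x. a3 x \<otimes>\<^bsub>R\<^esub> a1 x \<ominus>\<^bsub>R\<^esub> g3 \<otimes>\<^bsub>R\<^esub> g1 \<otimes>\<^bsub>R\<^esub> q2 \<M> (u2 x))"
    "quadratic_form R J (\<lambda>x. a1 x \<otimes>\<^bsub>R\<^esub> a2 x \<ominus>\<^bsub>R\<^esub> g1 \<otimes>\<^bsub>R\<^esub> g2 \<otimes>\<^bsub>R\<^esub> q3 \<M> (u3 x))"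
    by (intro J.quadratic_form_intros(2) J.quadratic_form_mult pr
      J.quadratic_form_intros(3)[OF _ J.quadratic_form_comp[OF A.quadratic pr(4)]]
      J.quadratic_form_intros(3)[OF _ J.quadratic_form_comp[OF B.quadratic pr(5)]]
      J.quadratic_form_intros(3)[OF _ J.quadratic_form_comp[OF D.quadratic pr(6)]]; simp)+
  moreover have "quadratic_map R J (C1 \<M>) (\<lambda>x. g1 \<odot>\<^bsub>C1 \<M>\<^esub> m (u3 x) (u2 x) \<ominus>\<^bsub>C1 \<M>\<^esub> a1 x \<odot>\<^bsub>C1 \<M>\<^esub> u1 x)"
    by (intro JA.quadratic_map_difference JA.quadratic_map_scale JA.quadratic_map_bilinear_comp[OF mul_bilinear pr(6,5)]
      JA.quadratic_map_bilinear_comp[OF JA.bilinear_smult pr(1,4)]) simp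
  moreover have "quadratic_map R J (C2 \<M>) (\<lambda>x. g2 \<odot>\<^bsub>C2 \<M>\<^esub> m2 (u1 x) (u3 x) \<ominus>\<^bsub>C2 \<M>\<^esub> a2 x \<odot>\<^bsub>C2 \<M>\<^esub> u2 x)"
    by (intro JB.quadratic_map_difference JB.quadratic_map_scale JB.quadratic_map_bilinear_comp[OF m2_bilinear pr(4,6)]
      JB.quadratic_map_bilinear_comp[OF JB.bilinear_smult pr(2,5)]) simp
  moreover have "quadratic_map R J (C3 \<M>) (\<lambda>x. g3 \<odot>\<^bsub>C3 \<M>\<^esub> m3 (u2 x) (u1 x) \<ominus>\<^bsub>C3 \<M>\<^esub> a3 x \<odot>\<^bsub>C3 \<M>\<^esub> u3 x)"
    by (intro JD.quadratic_map_difference JD.quadratic_map_scale JD.quadratic_map_bilinear_comp[OF m3_bilinear pr(5,4)]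
      JD.quadratic_map_bilinear_comp[OF JD.bilinear_smult pr(3,6)]) simp
  ultimately have "quadratic_map R J (self_module R \<times>\<^sub>M self_module R \<times>\<^sub>M self_module R \<times>\<^sub>M C1 \<M> \<times>\<^sub>M C2 \<M> \<times>\<^sub>M C3 \<M>) sharp"
    unfolding eq
    by (intro quadratic_map_pair module_prod_module module_J A.self A.module_axioms B.module_axioms D.module_axioms)
  then show ?thesis by (simp only: comp_module_eq_prod[symmetric])
qed

lemma N'_base:
  assumes "b1 \<in> carrier R" "b2 \<in> carrier R" "b3 \<in> carrier R"
    "v1 \<in> carrier (C1 \<M>)" "v2 \<in> carrier (C2 \<M>)" "v3 \<in> carrier (C3 \<M>)"
  shows "N' e (b1, b2, b3, v1, v2, v3) = b1 \<oplus>\<^bsub>R\<^esub> b2 \<oplus>\<^bsub>R\<^esub> b3"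
proof -
  have z: "m \<zero>\<^bsub>C3 \<M>\<^esub> y = \<zero>\<^bsub>C1 \<M>\<^esub>" if "y \<in> carrier (C2 \<M>)" for y
    using linear_maps_zero[OF D.module_axioms A.module_axioms m_linear'[OF that]] .
  have z': "m x \<zero>\<^bsub>C2 \<M>\<^esub> = \<zero>\<^bsub>C1 \<M>\<^esub>" if "x \<in> carrier (C3 \<M>)" for x
    using linear_maps_zero[OF B.module_axioms A.module_axioms m_linear[OF that]] .
  show ?thesis using assms by (simp add: comp_base_def bil_defs z z' a_minus_def)
qed

lemma trace_formula:
  assumes "a1 \<in> carrier R" "a2 \<in> carrier R" "a3 \<in> carrier R"
    "u1 \<in> carrier (C1 \<M>)" "u2 \<in> carrier (C2 \<M>)" "u3 \<in> carrier (C3 \<M>)"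
    "b1 \<in> carrier R" "b2 \<in> carrier R" "b3 \<in> carrier R"
    "v1 \<in> carrier (C1 \<M>)" "v2 \<in> carrier (C2 \<M>)" "v3 \<in> carrier (C3 \<M>)"
  shows "bilinear_trace R J e N' (a1, a2, a3, u1, u2, u3) (b1, b2, b3, v1, v2, v3) =
    (a1 \<otimes>\<^bsub>R\<^esub> b1 \<oplus>\<^bsub>R\<^esub> a2 \<otimes>\<^bsub>R\<^esub> b2 \<oplus>\<^bsub>R\<^esub> a3 \<otimes>\<^bsub>R\<^esub> b3) \<oplus>\<^bsub>R\<^esub>
    (g2 \<otimes>\<^bsub>R\<^esub> g3 \<otimes>\<^bsub>R\<^esub> A.b u1 v1 \<oplus>\<^bsub>R\<^esub> g3 \<otimes>\<^bsub>R\<^esub> g1 \<otimes>\<^bsub>R\<^esub> B.b u2 v2 \<oplus>\<^bsub>R\<^esub> g1 \<otimes>\<^bsub>R\<^esub> g2 \<otimes>\<^bsub>R\<^esub> D.b u3 v3)"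
proof -
  have e_add: "e \<oplus>\<^bsub>J\<^esub> (a1, a2, a3, u1, u2, u3) = (\<one>\<^bsub>R\<^esub> \<oplus>\<^bsub>R\<^esub> a1, \<one>\<^bsub>R\<^esub> \<oplus>\<^bsub>R\<^esub> a2, \<one>\<^bsub>R\<^esub> \<oplus>\<^bsub>R\<^esub> a3, u1, u2, u3)"
    using assms by (simp add: comp_base_def)
  show ?thesis
    unfolding bilinear_trace_def e_add N'_base[OF assms(1-6)] N'_base[OF assms(7-12)]
    unfolding comp_norm_deriv.simps bil_defs
    by (rule A.R.trace_poly) (use assms in simp_all)
qed

lemma N_base: "N e = \<one>\<^bsub>R\<^esub>"
  and sharp_base: "sharp e = e"
proof -
  have z: "m \<zero>\<^bsub>C3 \<M>\<^esub> \<zero>\<^bsub>C2 \<M>\<^esub> = \<zero>\<^bsub>C1 \<M>\<^esub>"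
    using linear_maps_zero[OF B.module_axioms A.module_axioms m_linear] by simp
  have z2: "m2 \<zero>\<^bsub>C1 \<M>\<^esub> \<zero>\<^bsub>C3 \<M>\<^esub> = \<zero>\<^bsub>C2 \<M>\<^esub>"
    by (rule B.eqI) (simp_all add: m2_adjoint)
  have z3: "m3 \<zero>\<^bsub>C2 \<M>\<^esub> \<zero>\<^bsub>C1 \<M>\<^esub> = \<zero>\<^bsub>C3 \<M>\<^esub>"
    by (rule D.eqI) (simp_all add: m3_adjoint)
  show "N e = \<one>\<^bsub>R\<^esub>" by (simp add: comp_base_def bil_defs z a_minus_def)
  show "sharp e = e" by (simp add: comp_base_def z z2 z3 a_minus_def)
qed

end

context cubic_construction
begin

lemma m2_linear: "x \<in> carrier (C1 \<M>) \<Longrightarrow> m2 x \<in> linear_maps R (C3 \<M>) (C2 \<M>)"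
  and m2_linear': "y \<in> carrier (C3 \<M>) \<Longrightarrow> (\<lambda>x. m2 x y) \<in> linear_maps R (C1 \<M>) (C2 \<M>)"
  using m2_bilinear by (simp_all add: bilinear_map_def)

lemma m3_linear: "x \<in> carrier (C2 \<M>) \<Longrightarrow> m3 x \<in> linear_maps R (C1 \<M>) (C3 \<M>)"
  and m3_linear': "y \<in> carrier (C1 \<M>) \<Longrightarrow> (\<lambda>x. m3 x y) \<in> linear_maps R (C2 \<M>) (C3 \<M>)"
  using m3_bilinear by (simp_all add: bilinear_map_def)

lemma m2_diff:
  "x \<in> carrier (C1 \<M>) \<Longrightarrow> x' \<in> carrier (C1 \<M>) \<Longrightarrow> y \<in> carrier (C3 \<M>) \<Longrightarrow> m2 (x \<ominus>\<^bsub>C1 \<M>\<^esub> x') y = m2 x y \<ominus>\<^bsub>C2 \<M>\<^esub> m2 x' y"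
  "x \<in> carrier (C1 \<M>) \<Longrightarrow> y \<in> carrier (C3 \<M>) \<Longrightarrow> y' \<in> carrier (C3 \<M>) \<Longrightarrow> m2 x (y \<ominus>\<^bsub>C3 \<M>\<^esub> y') = m2 x y \<ominus>\<^bsub>C2 \<M>\<^esub> m2 x y'"
  using linear_maps_diff[OF A.module_axioms B.module_axioms m2_linear'] linear_maps_diff[OF D.module_axioms B.module_axioms m2_linear]
  by simp_all

lemma m3_diff:
  "x \<in> carrier (C2 \<M>) \<Longrightarrow> x' \<in> carrier (C2 \<M>) \<Longrightarrow> y \<in> carrier (C1 \<M>) \<Longrightarrow> m3 (x \<ominus>\<^bsub>C2 \<M>\<^esub> x') y = m3 x y \<ominus>\<^bsub>C3 \<M>\<^esub> m3 x' y"
  "x \<in> carrier (C2 \<M>) \<Longrightarrow> y \<in> carrier (C1 \<M>) \<Longrightarrow> y' \<in> carrier (C1 \<M>) \<Longrightarrow> m3 x (y \<ominus>\<^bsub>C1 \<M>\<^esub> y') = m3 x y \<ominus>\<^bsub>C3 \<M>\<^esub> m3 x y'"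
  using linear_maps_diff[OF B.module_axioms D.module_axioms m3_linear'] linear_maps_diff[OF A.module_axioms D.module_axioms m3_linear]
  by simp_all

lemmas m2_smults = bilinear_mapD(4,5)[OF m2_bilinear]
lemmas m3_smults = bilinear_mapD(4,5)[OF m3_bilinear]

lemma N'_eq_trace:
  assumes "x \<in> carrier J" "y \<in> carrier J"
  shows "N' x y = bilinear_trace R J e N' (sharp x) y"
  using assms(1)
proof (rule J_cases)
  fix a1 a2 a3 u1 u2 u3
  assume x: "x = (a1, a2, a3, u1, u2, u3)" and clx: "a1 \<in> carrier R" "a2 \<in> carrier R" "a3 \<in> carrier R"
    "u1 \<in> carrier (C1 \<M>)" "u2 \<in> carrier (C2 \<M>)" "u3 \<in> carrier (C3 \<M>)"
  from assms(2) obtain b1 b2 b3 v1 v2 v3 where y: "y = (b1, b2, b3, v1, v2, v3)" and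
    cly: "b1 \<in> carrier R" "b2 \<in> carrier R" "b3 \<in> carrier R"
    "v1 \<in> carrier (C1 \<M>)" "v2 \<in> carrier (C2 \<M>)" "v3 \<in> carrier (C3 \<M>)" by (rule J_cases)
  have trace: "bilinear_trace R J e N' (sharp x) y =
    ((a2 \<otimes>\<^bsub>R\<^esub> a3 \<ominus>\<^bsub>R\<^esub> g2 \<otimes>\<^bsub>R\<^esub> g3 \<otimes>\<^bsub>R\<^esub> q1 \<M> u1) \<otimes>\<^bsub>R\<^esub> b1 \<oplus>\<^bsub>R\<^esub> (a3 \<otimes>\<^bsub>R\<^esub> a1 \<ominus>\<^bsub>R\<^esub> g3 \<otimes>\<^bsub>R\<^esub> g1 \<otimes>\<^bsub>R\<^esub> q2 \<M> u2) \<otimes>\<^bsub>R\<^esub> b2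
       \<oplus>\<^bsub>R\<^esub> (a1 \<otimes>\<^bsub>R\<^esub> a2 \<ominus>\<^bsub>R\<^esub> g1 \<otimes>\<^bsub>R\<^esub> g2 \<otimes>\<^bsub>R\<^esub> q3 \<M> u3) \<otimes>\<^bsub>R\<^esub> b3) \<oplus>\<^bsub>R\<^esub>
    (g2 \<otimes>\<^bsub>R\<^esub> g3 \<otimes>\<^bsub>R\<^esub> A.b (g1 \<odot>\<^bsub>C1 \<M>\<^esub> m u3 u2 \<ominus>\<^bsub>C1 \<M>\<^esub> a1 \<odot>\<^bsub>C1 \<M>\<^esub> u1) v1
     \<oplus>\<^bsub>R\<^esub> g3 \<otimes>\<^bsub>R\<^esub> g1 \<otimes>\<^bsub>R\<^esub> B.b (g2 \<odot>\<^bsub>C2 \<M>\<^esub> m2 u1 u3 \<ominus>\<^bsub>C2 \<M>\<^esub> a2 \<odot>\<^bsub>C2 \<M>\<^esub> u2) v2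
     \<oplus>\<^bsub>R\<^esub> g1 \<otimes>\<^bsub>R\<^esub> g2 \<otimes>\<^bsub>R\<^esub> D.b (g3 \<odot>\<^bsub>C3 \<M>\<^esub> m3 u2 u1 \<ominus>\<^bsub>C3 \<M>\<^esub> a3 \<odot>\<^bsub>C3 \<M>\<^esub> u3) v3)"
    unfolding x y comp_sharp.simps by (rule trace_formula) (use clx cly in simp_all)
  show ?thesis
    unfolding trace unfolding x y comp_norm_deriv.simps bil_defs
    by (rule A.R.trace_sharp_poly)
      (use clx cly in \<open>simp_all add: A.b_diff A.b_smult B.b_diff B.b_smult D.b_diff D.b_smult m2_adjoint m3_adjoint A.b_sym\<close>)
qed

lemma m_zero:
  "y \<in> carrier (C2 \<M>) \<Longrightarrow> m \<zero>\<^bsub>C3 \<M>\<^esub> y = \<zero>\<^bsub>C1 \<M>\<^esub>" "x \<in> carrier (C3 \<M>) \<Longrightarrow> m x \<zero>\<^bsub>C2 \<M>\<^esub> = \<zero>\<^bsub>C1 \<M>\<^esub>"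
  using linear_maps_zero[OF D.module_axioms A.module_axioms m_linear'] linear_maps_zero[OF B.module_axioms A.module_axioms m_linear]
  by simp_all

lemma m2_zero:
  "y \<in> carrier (C3 \<M>) \<Longrightarrow> m2 \<zero>\<^bsub>C1 \<M>\<^esub> y = \<zero>\<^bsub>C2 \<M>\<^esub>" "x \<in> carrier (C1 \<M>) \<Longrightarrow> m2 x \<zero>\<^bsub>C3 \<M>\<^esub> = \<zero>\<^bsub>C2 \<M>\<^esub>"
  by (rule B.eqI; simp add: m2_adjoint m_zero)+

lemma m3_zero:
  "y \<in> carrier (C1 \<M>) \<Longrightarrow> m3 \<zero>\<^bsub>C2 \<M>\<^esub> y = \<zero>\<^bsub>C3 \<M>\<^esub>" "x \<in> carrier (C2 \<M>) \<Longrightarrow> m3 x \<zero>\<^bsub>C1 \<M>\<^esub> = \<zero>\<^bsub>C3 \<M>\<^esub>"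
  by (rule D.eqI; simp add: m3_adjoint m_zero)+

end

lemma (in cring) sharp_sharp_off_entry:
  assumes cl: "g1 \<in> carrier R" "g2 \<in> carrier R" "g3 \<in> carrier R" "a1 \<in> carrier R" "a2 \<in> carrier R" "a3 \<in> carrier R"
    "p1 \<in> carrier R" "p2 \<in> carrier R" "p3 \<in> carrier R" "t \<in> carrier R" "k \<in> carrier R" "l \<in> carrier R"
  shows "g1 \<otimes> (g2 \<otimes> (g3 \<otimes> (t \<otimes> k \<ominus> p1 \<otimes> l) \<ominus> a3 \<otimes> (p3 \<otimes> k)) \<ominus> a2 \<otimes> (g3 \<otimes> (p2 \<otimes> k) \<ominus> a3 \<otimes> l))
      \<ominus> (a2 \<otimes> a3 \<ominus> g2 \<otimes> g3 \<otimes> p1) \<otimes> (g1 \<otimes> l \<ominus> a1 \<otimes> k) =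
    nrm g1 g2 g3 a1 a2 a3 p1 p2 p3 t \<otimes> k"
  by (rule ring_identity[of "[g1, g2, g3, a1, a2, a3, p1, p2, p3, t, k, l]"])
    (use cl in \<open>simp add: in_carrier_def\<close>, (rule represents_intros)+, simp add: polynomial_normalization)

lemma (in cring) base_cross_diagonal:
  assumes cl: "a1 \<in> carrier R" "a2 \<in> carrier R" "a3 \<in> carrier R" "p \<in> carrier R"
  shows "((\<one> \<oplus> a2) \<otimes> (\<one> \<oplus> a3) \<ominus> p) \<ominus> \<one> \<ominus> (a2 \<otimes> a3 \<ominus> p) = (a1 \<oplus> a2 \<oplus> a3) \<otimes> \<one> \<ominus> a1"
  by (rule ring_identity[of "[a1, a2, a3, p]"])
    (use cl in \<open>simp add: in_carrier_def\<close>, (rule represents_intros)+, simp add: polynomial_normalization)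

lemma (in cring) base_cross_diagonal':
  assumes "a1 \<in> carrier R" "a2 \<in> carrier R" "a3 \<in> carrier R" "p \<in> carrier R"
  shows "((\<one> \<oplus> a3) \<otimes> (\<one> \<oplus> a1) \<ominus> p) \<ominus> \<one> \<ominus> (a3 \<otimes> a1 \<ominus> p) = (a1 \<oplus> a2 \<oplus> a3) \<otimes> \<one> \<ominus> a2"
    "((\<one> \<oplus> a1) \<otimes> (\<one> \<oplus> a2) \<ominus> p) \<ominus> \<one> \<ominus> (a1 \<otimes> a2 \<ominus> p) = (a1 \<oplus> a2 \<oplus> a3) \<otimes> \<one> \<ominus> a3"
  using base_cross_diagonal[of a2 a3 a1 p] base_cross_diagonal[of a3 a1 a2 p] assms by (simp_all add: a_ac)

lemma (in cring) base_cross_off_diagonal: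
  assumes cl: "a \<in> carrier R" "c \<in> carrier R" "l \<in> carrier R" "k \<in> carrier R"
  shows "(l \<ominus> (\<one> \<oplus> a) \<otimes> k) \<ominus> \<zero> \<ominus> (l \<ominus> a \<otimes> k) = c \<otimes> \<zero> \<ominus> k"
  by (rule ring_identity[of "[a, c, l, k]"])
    (use cl in \<open>simp add: in_carrier_def\<close>, (rule represents_intros)+, simp add: polynomial_normalization)

context cubic_construction
begin

lemma J_diff_diff:
  assumes "a1 \<ominus>\<^bsub>R\<^esub> b1 \<ominus>\<^bsub>R\<^esub> c1 = d1" "a2 \<ominus>\<^bsub>R\<^esub> b2 \<ominus>\<^bsub>R\<^esub> c2 = d2" "a3 \<ominus>\<^bsub>R\<^esub> b3 \<ominus>\<^bsub>R\<^esub> c3 = d3"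
    "u1 \<ominus>\<^bsub>C1 \<M>\<^esub> v1 \<ominus>\<^bsub>C1 \<M>\<^esub> w1 = x1" "u2 \<ominus>\<^bsub>C2 \<M>\<^esub> v2 \<ominus>\<^bsub>C2 \<M>\<^esub> w2 = x2" "u3 \<ominus>\<^bsub>C3 \<M>\<^esub> v3 \<ominus>\<^bsub>C3 \<M>\<^esub> w3 = x3"
    "a1 \<in> carrier R" "a2 \<in> carrier R" "a3 \<in> carrier R"
    "u1 \<in> carrier (C1 \<M>)" "u2 \<in> carrier (C2 \<M>)" "u3 \<in> carrier (C3 \<M>)"
    "b1 \<in> carrier R" "b2 \<in> carrier R" "b3 \<in> carrier R"
    "v1 \<in> carrier (C1 \<M>)" "v2 \<in> carrier (C2 \<M>)" "v3 \<in> carrier (C3 \<M>)"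
    "c1 \<in> carrier R" "c2 \<in> carrier R" "c3 \<in> carrier R"
    "w1 \<in> carrier (C1 \<M>)" "w2 \<in> carrier (C2 \<M>)" "w3 \<in> carrier (C3 \<M>)"
  shows "(a1, a2, a3, u1, u2, u3) \<ominus>\<^bsub>J\<^esub> (b1, b2, b3, v1, v2, v3) \<ominus>\<^bsub>J\<^esub> (c1, c2, c3, w1, w2, w3) =
    (d1, d2, d3, x1, x2, x3)"
  using assms by (simp add: J_diff)

lemma polar_sharp_base:
  assumes "x \<in> carrier J"
  shows "polar J J sharp e x = bilinear_trace R J e N' x e \<odot>\<^bsub>J\<^esub> e \<ominus>\<^bsub>J\<^esub> x"
  using assms
proof (rule J_cases)
  fix a1 a2 a3 u1 u2 u3
  assume x: "x = (a1, a2, a3, u1, u2, u3)" and cl: "a1 \<in> carrier R" "a2 \<in> carrier R" "a3 \<in> carrier R"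
    "u1 \<in> carrier (C1 \<M>)" "u2 \<in> carrier (C2 \<M>)" "u3 \<in> carrier (C3 \<M>)"
  have trace: "bilinear_trace R J e N' x e = a1 \<oplus>\<^bsub>R\<^esub> a2 \<oplus>\<^bsub>R\<^esub> a3"
    using trace_formula[of a1 a2 a3 u1 u2 u3 "\<one>\<^bsub>R\<^esub>" "\<one>\<^bsub>R\<^esub>" "\<one>\<^bsub>R\<^esub>" "\<zero>\<^bsub>C1 \<M>\<^esub>" "\<zero>\<^bsub>C2 \<M>\<^esub>" "\<zero>\<^bsub>C3 \<M>\<^esub>"] cl
    by (simp add: x comp_base_def)
  have e_add: "e \<oplus>\<^bsub>J\<^esub> x = (\<one>\<^bsub>R\<^esub> \<oplus>\<^bsub>R\<^esub> a1, \<one>\<^bsub>R\<^esub> \<oplus>\<^bsub>R\<^esub> a2, \<one>\<^bsub>R\<^esub> \<oplus>\<^bsub>R\<^esub> a3, u1, u2, u3)"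
    using cl by (simp add: x comp_base_def)
  have off: "(w \<ominus>\<^bsub>C1 \<M>\<^esub> (\<one>\<^bsub>R\<^esub> \<oplus>\<^bsub>R\<^esub> a) \<odot>\<^bsub>C1 \<M>\<^esub> u) \<ominus>\<^bsub>C1 \<M>\<^esub> \<zero>\<^bsub>C1 \<M>\<^esub> \<ominus>\<^bsub>C1 \<M>\<^esub> (w \<ominus>\<^bsub>C1 \<M>\<^esub> a \<odot>\<^bsub>C1 \<M>\<^esub> u) = c \<odot>\<^bsub>C1 \<M>\<^esub> \<zero>\<^bsub>C1 \<M>\<^esub> \<ominus>\<^bsub>C1 \<M>\<^esub> u"
    if "w \<in> carrier (C1 \<M>)" "u \<in> carrier (C1 \<M>)" "a \<in> carrier R" "c \<in> carrier R" for w u a c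
    using that A.R.base_cross_off_diagonal[of a c] by (intro A.eqI) (simp_all add: A.b_diff A.b_smult)
  have off': "(w \<ominus>\<^bsub>C2 \<M>\<^esub> (\<one>\<^bsub>R\<^esub> \<oplus>\<^bsub>R\<^esub> a) \<odot>\<^bsub>C2 \<M>\<^esub> u) \<ominus>\<^bsub>C2 \<M>\<^esub> \<zero>\<^bsub>C2 \<M>\<^esub> \<ominus>\<^bsub>C2 \<M>\<^esub> (w \<ominus>\<^bsub>C2 \<M>\<^esub> a \<odot>\<^bsub>C2 \<M>\<^esub> u) = c \<odot>\<^bsub>C2 \<M>\<^esub> \<zero>\<^bsub>C2 \<M>\<^esub> \<ominus>\<^bsub>C2 \<M>\<^esub> u"
    if "w \<in> carrier (C2 \<M>)" "u \<in> carrier (C2 \<M>)" "a \<in> carrier R" "c \<in> carrier R" for w u a c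
    using that A.R.base_cross_off_diagonal[of a c] by (intro B.eqI) (simp_all add: B.b_diff B.b_smult)
  have off'': "(w \<ominus>\<^bsub>C3 \<M>\<^esub> (\<one>\<^bsub>R\<^esub> \<oplus>\<^bsub>R\<^esub> a) \<odot>\<^bsub>C3 \<M>\<^esub> u) \<ominus>\<^bsub>C3 \<M>\<^esub> \<zero>\<^bsub>C3 \<M>\<^esub> \<ominus>\<^bsub>C3 \<M>\<^esub> (w \<ominus>\<^bsub>C3 \<M>\<^esub> a \<odot>\<^bsub>C3 \<M>\<^esub> u) = c \<odot>\<^bsub>C3 \<M>\<^esub> \<zero>\<^bsub>C3 \<M>\<^esub> \<ominus>\<^bsub>C3 \<M>\<^esub> u"
    if "w \<in> carrier (C3 \<M>)" "u \<in> carrier (C3 \<M>)" "a \<in> carrier R" "c \<in> carrier R" for w u a c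
    using that A.R.base_cross_off_diagonal[of a c] by (intro D.eqI) (simp_all add: D.b_diff D.b_smult)
  have "polar J J sharp e x = sharp (\<one>\<^bsub>R\<^esub> \<oplus>\<^bsub>R\<^esub> a1, \<one>\<^bsub>R\<^esub> \<oplus>\<^bsub>R\<^esub> a2, \<one>\<^bsub>R\<^esub> \<oplus>\<^bsub>R\<^esub> a3, u1, u2, u3) \<ominus>\<^bsub>J\<^esub>
      (\<one>\<^bsub>R\<^esub>, \<one>\<^bsub>R\<^esub>, \<one>\<^bsub>R\<^esub>, \<zero>\<^bsub>C1 \<M>\<^esub>, \<zero>\<^bsub>C2 \<M>\<^esub>, \<zero>\<^bsub>C3 \<M>\<^esub>) \<ominus>\<^bsub>J\<^esub> sharp (a1, a2, a3, u1, u2, u3)"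
    unfolding polar_def e_add sharp_base by (simp add: comp_base_def x)
  also have "\<dots> = ((a1 \<oplus>\<^bsub>R\<^esub> a2 \<oplus>\<^bsub>R\<^esub> a3) \<otimes>\<^bsub>R\<^esub> \<one>\<^bsub>R\<^esub> \<ominus>\<^bsub>R\<^esub> a1, (a1 \<oplus>\<^bsub>R\<^esub> a2 \<oplus>\<^bsub>R\<^esub> a3) \<otimes>\<^bsub>R\<^esub> \<one>\<^bsub>R\<^esub> \<ominus>\<^bsub>R\<^esub> a2,
      (a1 \<oplus>\<^bsub>R\<^esub> a2 \<oplus>\<^bsub>R\<^esub> a3) \<otimes>\<^bsub>R\<^esub> \<one>\<^bsub>R\<^esub> \<ominus>\<^bsub>R\<^esub> a3, (a1 \<oplus>\<^bsub>R\<^esub> a2 \<oplus>\<^bsub>R\<^esub> a3) \<odot>\<^bsub>C1 \<M>\<^esub> \<zero>\<^bsub>C1 \<M>\<^esub> \<ominus>\<^bsub>C1 \<M>\<^esub> u1,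
      (a1 \<oplus>\<^bsub>R\<^esub> a2 \<oplus>\<^bsub>R\<^esub> a3) \<odot>\<^bsub>C2 \<M>\<^esub> \<zero>\<^bsub>C2 \<M>\<^esub> \<ominus>\<^bsub>C2 \<M>\<^esub> u2, (a1 \<oplus>\<^bsub>R\<^esub> a2 \<oplus>\<^bsub>R\<^esub> a3) \<odot>\<^bsub>C3 \<M>\<^esub> \<zero>\<^bsub>C3 \<M>\<^esub> \<ominus>\<^bsub>C3 \<M>\<^esub> u3)"
    unfolding comp_sharp.simps
  proof (rule J_diff_diff)
    show "(\<one>\<^bsub>R\<^esub> \<oplus>\<^bsub>R\<^esub> a2) \<otimes>\<^bsub>R\<^esub> (\<one>\<^bsub>R\<^esub> \<oplus>\<^bsub>R\<^esub> a3) \<ominus>\<^bsub>R\<^esub> g2 \<otimes>\<^bsub>R\<^esub> g3 \<otimes>\<^bsub>R\<^esub> q1 \<M> u1 \<ominus>\<^bsub>R\<^esub> \<one>\<^bsub>R\<^esub>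
      \<ominus>\<^bsub>R\<^esub> (a2 \<otimes>\<^bsub>R\<^esub> a3 \<ominus>\<^bsub>R\<^esub> g2 \<otimes>\<^bsub>R\<^esub> g3 \<otimes>\<^bsub>R\<^esub> q1 \<M> u1) = (a1 \<oplus>\<^bsub>R\<^esub> a2 \<oplus>\<^bsub>R\<^esub> a3) \<otimes>\<^bsub>R\<^esub> \<one>\<^bsub>R\<^esub> \<ominus>\<^bsub>R\<^esub> a1"
      by (rule A.R.base_cross_diagonal) (use cl in simp_all)
    show "(\<one>\<^bsub>R\<^esub> \<oplus>\<^bsub>R\<^esub> a3) \<otimes>\<^bsub>R\<^esub> (\<one>\<^bsub>R\<^esub> \<oplus>\<^bsub>R\<^esub> a1) \<ominus>\<^bsub>R\<^esub> g3 \<otimes>\<^bsub>R\<^esub> g1 \<otimes>\<^bsub>R\<^esub> q2 \<M> u2 \<ominus>\<^bsub>R\<^esub> \<one>\<^bsub>R\<^esub>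
      \<ominus>\<^bsub>R\<^esub> (a3 \<otimes>\<^bsub>R\<^esub> a1 \<ominus>\<^bsub>R\<^esub> g3 \<otimes>\<^bsub>R\<^esub> g1 \<otimes>\<^bsub>R\<^esub> q2 \<M> u2) = (a1 \<oplus>\<^bsub>R\<^esub> a2 \<oplus>\<^bsub>R\<^esub> a3) \<otimes>\<^bsub>R\<^esub> \<one>\<^bsub>R\<^esub> \<ominus>\<^bsub>R\<^esub> a2"
      by (rule A.R.base_cross_diagonal') (use cl in simp_all)
    show "(\<one>\<^bsub>R\<^esub> \<oplus>\<^bsub>R\<^esub> a1) \<otimes>\<^bsub>R\<^esub> (\<one>\<^bsub>R\<^esub> \<oplus>\<^bsub>R\<^esub> a2) \<ominus>\<^bsub>R\<^esub> g1 \<otimes>\<^bsub>R\<^esub> g2 \<otimes>\<^bsub>R\<^esub> q3 \<M> u3 \<ominus>\<^bsub>R\<^esub> \<one>\<^bsub>R\<^esub>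
      \<ominus>\<^bsub>R\<^esub> (a1 \<otimes>\<^bsub>R\<^esub> a2 \<ominus>\<^bsub>R\<^esub> g1 \<otimes>\<^bsub>R\<^esub> g2 \<otimes>\<^bsub>R\<^esub> q3 \<M> u3) = (a1 \<oplus>\<^bsub>R\<^esub> a2 \<oplus>\<^bsub>R\<^esub> a3) \<otimes>\<^bsub>R\<^esub> \<one>\<^bsub>R\<^esub> \<ominus>\<^bsub>R\<^esub> a3"
      by (rule A.R.base_cross_diagonal') (use cl in simp_all)
  qed (rule off off' off''; use cl in simp | use cl in simp)+
  also have "\<dots> = bilinear_trace R J e N' x e \<odot>\<^bsub>J\<^esub> e \<ominus>\<^bsub>J\<^esub> x"
    unfolding trace unfolding x comp_base_def comp_module_simps by (subst J_diff) (use cl in simp_all)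
  finally show ?thesis .
qed

lemma sharp_sharp:
  assumes "x \<in> carrier J"
  shows "sharp (sharp x) = N x \<odot>\<^bsub>J\<^esub> x"
  using assms
proof (rule J_cases)
  fix a1 a2 a3 u1 u2 u3
  assume x: "x = (a1, a2, a3, u1, u2, u3)" and cl: "a1 \<in> carrier R" "a2 \<in> carrier R" "a3 \<in> carrier R"
    "u1 \<in> carrier (C1 \<M>)" "u2 \<in> carrier (C2 \<M>)" "u3 \<in> carrier (C3 \<M>)"
  define t where "t = A.b (m u3 u2) u1"
  define p1 where "p1 = q1 \<M> u1"
  define p2 where "p2 = q2 \<M> u2"
  define p3 where "p3 = q3 \<M> u3"
  have tp: "t \<in> carrier R" "p1 \<in> carrier R" "p2 \<in> carrier R" "p3 \<in> carrier R"
    using cl by (simp_all add: t_def p1_def p2_def p3_def)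
  note defs = t_def[symmetric] p1_def[symmetric] p2_def[symmetric] p3_def[symmetric]
  define n where "n = A.R.nrm g1 g2 g3 a1 a2 a3 p1 p2 p3 t"
  have n: "n \<in> carrier R" using tp cl by (simp add: n_def)
  have Nx: "N x = n" by (simp add: x n_def bil_defs t_def p1_def p2_def p3_def)
  have n2: "A.R.nrm g2 g3 g1 a2 a3 a1 p2 p3 p1 t = n"
    unfolding n_def by (rule A.R.nrm_rotate) (use tp cl in simp_all)
  have n3: "A.R.nrm g3 g1 g2 a3 a1 a2 p3 p1 p2 t = n"
    unfolding n2[symmetric] by (rule A.R.nrm_rotate) (use tp cl in simp_all)
  define W1 where "W1 = g1 \<odot>\<^bsub>C1 \<M>\<^esub> m u3 u2 \<ominus>\<^bsub>C1 \<M>\<^esub> a1 \<odot>\<^bsub>C1 \<M>\<^esub> u1"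
  define W2 where "W2 = g2 \<odot>\<^bsub>C2 \<M>\<^esub> m2 u1 u3 \<ominus>\<^bsub>C2 \<M>\<^esub> a2 \<odot>\<^bsub>C2 \<M>\<^esub> u2"
  define W3 where "W3 = g3 \<odot>\<^bsub>C3 \<M>\<^esub> m3 u2 u1 \<ominus>\<^bsub>C3 \<M>\<^esub> a3 \<odot>\<^bsub>C3 \<M>\<^esub> u3"
  have W: "W1 \<in> carrier (C1 \<M>)" "W2 \<in> carrier (C2 \<M>)" "W3 \<in> carrier (C3 \<M>)"
    using cl by (simp_all add: W1_def W2_def W3_def)
  have q_W: "q1 \<M> W1 = (g1 \<otimes>\<^bsub>R\<^esub> g1) \<otimes>\<^bsub>R\<^esub> (p3 \<otimes>\<^bsub>R\<^esub> p2) \<oplus>\<^bsub>R\<^esub> (a1 \<otimes>\<^bsub>R\<^esub> a1) \<otimes>\<^bsub>R\<^esub> p1 \<ominus>\<^bsub>R\<^esub> g1 \<otimes>\<^bsub>R\<^esub> (a1 \<otimes>\<^bsub>R\<^esub> t)"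
    "q2 \<M> W2 = (g2 \<otimes>\<^bsub>R\<^esub> g2) \<otimes>\<^bsub>R\<^esub> (p1 \<otimes>\<^bsub>R\<^esub> p3) \<oplus>\<^bsub>R\<^esub> (a2 \<otimes>\<^bsub>R\<^esub> a2) \<otimes>\<^bsub>R\<^esub> p2 \<ominus>\<^bsub>R\<^esub> g2 \<otimes>\<^bsub>R\<^esub> (a2 \<otimes>\<^bsub>R\<^esub> t)"
    "q3 \<M> W3 = (g3 \<otimes>\<^bsub>R\<^esub> g3) \<otimes>\<^bsub>R\<^esub> (p2 \<otimes>\<^bsub>R\<^esub> p1) \<oplus>\<^bsub>R\<^esub> (a3 \<otimes>\<^bsub>R\<^esub> a3) \<otimes>\<^bsub>R\<^esub> p3 \<ominus>\<^bsub>R\<^esub> g3 \<otimes>\<^bsub>R\<^esub> (a3 \<otimes>\<^bsub>R\<^esub> t)"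
    using cl tp by (simp_all add: W1_def W2_def W3_def A.R.m_lcomm[of _ _ t] A.q_diff A.q_smult A.b_smult q_mul B.q_diff B.q_smult B.b_smult q_mul2
      D.q_diff D.q_smult D.b_smult q_mul3 triple_rotate defs)
  have diag: "(a3 \<otimes>\<^bsub>R\<^esub> a1 \<ominus>\<^bsub>R\<^esub> g3 \<otimes>\<^bsub>R\<^esub> g1 \<otimes>\<^bsub>R\<^esub> p2) \<otimes>\<^bsub>R\<^esub> (a1 \<otimes>\<^bsub>R\<^esub> a2 \<ominus>\<^bsub>R\<^esub> g1 \<otimes>\<^bsub>R\<^esub> g2 \<otimes>\<^bsub>R\<^esub> p3) \<ominus>\<^bsub>R\<^esub> g2 \<otimes>\<^bsub>R\<^esub> g3 \<otimes>\<^bsub>R\<^esub> q1 \<M> W1 = n \<otimes>\<^bsub>R\<^esub> a1"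
    "(a1 \<otimes>\<^bsub>R\<^esub> a2 \<ominus>\<^bsub>R\<^esub> g1 \<otimes>\<^bsub>R\<^esub> g2 \<otimes>\<^bsub>R\<^esub> p3) \<otimes>\<^bsub>R\<^esub> (a2 \<otimes>\<^bsub>R\<^esub> a3 \<ominus>\<^bsub>R\<^esub> g2 \<otimes>\<^bsub>R\<^esub> g3 \<otimes>\<^bsub>R\<^esub> p1) \<ominus>\<^bsub>R\<^esub> g3 \<otimes>\<^bsub>R\<^esub> g1 \<otimes>\<^bsub>R\<^esub> q2 \<M> W2 = n \<otimes>\<^bsub>R\<^esub> a2"
    "(a2 \<otimes>\<^bsub>R\<^esub> a3 \<ominus>\<^bsub>R\<^esub> g2 \<otimes>\<^bsub>R\<^esub> g3 \<otimes>\<^bsub>R\<^esub> p1) \<otimes>\<^bsub>R\<^esub> (a3 \<otimes>\<^bsub>R\<^esub> a1 \<ominus>\<^bsub>R\<^esub> g3 \<otimes>\<^bsub>R\<^esub> g1 \<otimes>\<^bsub>R\<^esub> p2) \<ominus>\<^bsub>R\<^esub> g1 \<otimes>\<^bsub>R\<^esub> g2 \<otimes>\<^bsub>R\<^esub> q3 \<M> W3 = n \<otimes>\<^bsub>R\<^esub> a3"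
    unfolding q_W
    using A.R.sharp_sharp_diagonal[of g1 g2 g3 a1 a2 a3 p1 p2 p3 t] A.R.sharp_sharp_diagonal[of g2 g3 g1 a2 a3 a1 p2 p3 p1 t]
      A.R.sharp_sharp_diagonal[of g3 g1 g2 a3 a1 a2 p3 p1 p2 t] tp cl
    unfolding n2 n3 n_def[symmetric] by (simp_all only: g_closed)
  have off1: "g1 \<odot>\<^bsub>C1 \<M>\<^esub> m W3 W2 \<ominus>\<^bsub>C1 \<M>\<^esub> (a2 \<otimes>\<^bsub>R\<^esub> a3 \<ominus>\<^bsub>R\<^esub> g2 \<otimes>\<^bsub>R\<^esub> g3 \<otimes>\<^bsub>R\<^esub> p1) \<odot>\<^bsub>C1 \<M>\<^esub> W1 = n \<odot>\<^bsub>C1 \<M>\<^esub> u1"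
  proof (rule A.eqI)
    fix y assume y: "y \<in> carrier (C1 \<M>)"
    show "A.b (g1 \<odot>\<^bsub>C1 \<M>\<^esub> m W3 W2 \<ominus>\<^bsub>C1 \<M>\<^esub> (a2 \<otimes>\<^bsub>R\<^esub> a3 \<ominus>\<^bsub>R\<^esub> g2 \<otimes>\<^bsub>R\<^esub> g3 \<otimes>\<^bsub>R\<^esub> p1) \<odot>\<^bsub>C1 \<M>\<^esub> W1) y = A.b (n \<odot>\<^bsub>C1 \<M>\<^esub> u1) y"
      using cl y tp n A.R.sharp_sharp_off_entry[of g1 g2 g3 a1 a2 a3 p1 p2 p3 t "A.b u1 y" "A.b (m u3 u2) y"]
      by (simp add: W1_def W2_def W3_def m_diff m_smult m_m3_m2 m_m3 m_m2 A.b_diff A.b_smult defs n_def[symmetric])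
  qed (use cl W tp n in simp_all)
  have off2: "g2 \<odot>\<^bsub>C2 \<M>\<^esub> m2 W1 W3 \<ominus>\<^bsub>C2 \<M>\<^esub> (a3 \<otimes>\<^bsub>R\<^esub> a1 \<ominus>\<^bsub>R\<^esub> g3 \<otimes>\<^bsub>R\<^esub> g1 \<otimes>\<^bsub>R\<^esub> p2) \<odot>\<^bsub>C2 \<M>\<^esub> W2 = n \<odot>\<^bsub>C2 \<M>\<^esub> u2"
  proof (rule B.eqI)
    fix y assume y: "y \<in> carrier (C2 \<M>)"
    show "B.b (g2 \<odot>\<^bsub>C2 \<M>\<^esub> m2 W1 W3 \<ominus>\<^bsub>C2 \<M>\<^esub> (a3 \<otimes>\<^bsub>R\<^esub> a1 \<ominus>\<^bsub>R\<^esub> g3 \<otimes>\<^bsub>R\<^esub> g1 \<otimes>\<^bsub>R\<^esub> p2) \<odot>\<^bsub>C2 \<M>\<^esub> W2) y = B.b (n \<odot>\<^bsub>C2 \<M>\<^esub> u2) y"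
      using cl y tp n A.R.sharp_sharp_off_entry[of g2 g3 g1 a2 a3 a1 p2 p3 p1 t "B.b u2 y" "B.b (m2 u1 u3) y"]
      unfolding n2
      by (simp add: W1_def W2_def W3_def m2_diff m2_smults m2_m_m3 m2_m m2_m3 B.b_diff B.b_smult defs)
  qed (use cl W tp n in simp_all)
  have off3: "g3 \<odot>\<^bsub>C3 \<M>\<^esub> m3 W2 W1 \<ominus>\<^bsub>C3 \<M>\<^esub> (a1 \<otimes>\<^bsub>R\<^esub> a2 \<ominus>\<^bsub>R\<^esub> g1 \<otimes>\<^bsub>R\<^esub> g2 \<otimes>\<^bsub>R\<^esub> p3) \<odot>\<^bsub>C3 \<M>\<^esub> W3 = n \<odot>\<^bsub>C3 \<M>\<^esub> u3"
  proof (rule D.eqI)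
    fix y assume y: "y \<in> carrier (C3 \<M>)"
    show "D.b (g3 \<odot>\<^bsub>C3 \<M>\<^esub> m3 W2 W1 \<ominus>\<^bsub>C3 \<M>\<^esub> (a1 \<otimes>\<^bsub>R\<^esub> a2 \<ominus>\<^bsub>R\<^esub> g1 \<otimes>\<^bsub>R\<^esub> g2 \<otimes>\<^bsub>R\<^esub> p3) \<odot>\<^bsub>C3 \<M>\<^esub> W3) y = D.b (n \<odot>\<^bsub>C3 \<M>\<^esub> u3) y"
      using cl y tp n A.R.sharp_sharp_off_entry[of g3 g1 g2 a3 a1 a2 p3 p1 p2 t "D.b u3 y" "D.b (m3 u2 u1) y"]
      unfolding n3
      by (simp add: W1_def W2_def W3_def m3_diff m3_smults m3_m2_m m3_m m3_m2 D.b_diff D.b_smult defs)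
  qed (use cl W tp n in simp_all)
  show ?thesis
    unfolding Nx unfolding x comp_sharp.simps comp_module_simps
    unfolding W1_def[symmetric] W2_def[symmetric] W3_def[symmetric] defs
    by (simp only: diag off1 off2 off3)
qed

lemma cubic_norm_identities: "cubic_norm_identities R J e N N' sharp"
  unfolding cubic_norm_identities_def
  by (intro conjI ballI N_base sharp_base sharp_sharp N'_eq_trace polar_sharp_base)

end

section \<open>Simplicity over a field\<close>

lemma (in abelian_group) polar_U_cancel:
  assumes "A \<in> carrier G" "B \<in> carrier G" "C \<in> carrier G" "D \<in> carrier G" "P \<in> carrier G" "Q \<in> carrier G" "S \<in> carrier G"
  shows "(A \<oplus> B \<oplus> (C \<oplus> D)) \<ominus> (P \<oplus> Q \<oplus> S) \<ominus> (A \<ominus> P) \<ominus> (D \<ominus> Q) = B \<oplus> C \<ominus> S"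
proof -
  have "(A \<oplus> B \<oplus> (C \<oplus> D)) \<ominus> (P \<oplus> Q \<oplus> S) \<ominus> (A \<ominus> P) \<ominus> (D \<ominus> Q) =
    (A \<oplus> \<ominus> A) \<oplus> ((D \<oplus> \<ominus> D) \<oplus> ((P \<oplus> \<ominus> P) \<oplus> ((Q \<oplus> \<ominus> Q) \<oplus> (B \<oplus> C \<oplus> \<ominus> S))))"
    using assms by (simp add: a_minus_def minus_add a_ac del: r_neg)
  then show ?thesis using assms by (simp add: r_neg a_minus_def)
qed

context cubic_construction
begin

abbreviation "T \<equiv> bilinear_trace R J e N'"
abbreviation "cross \<equiv> polar J J sharp"
abbreviation "U \<equiv> cubic_U R J e N' sharp"

abbreviation "E1 \<equiv> (\<one>\<^bsub>R\<^esub>, \<zero>\<^bsub>R\<^esub>, \<zero>\<^bsub>R\<^esub>, \<zero>\<^bsub>C1 \<M>\<^esub>, \<zero>\<^bsub>C2 \<M>\<^esub>, \<zero>\<^bsub>C3 \<M>\<^esub>)"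
abbreviation "E2 \<equiv> (\<zero>\<^bsub>R\<^esub>, \<one>\<^bsub>R\<^esub>, \<zero>\<^bsub>R\<^esub>, \<zero>\<^bsub>C1 \<M>\<^esub>, \<zero>\<^bsub>C2 \<M>\<^esub>, \<zero>\<^bsub>C3 \<M>\<^esub>)"
abbreviation "E3 \<equiv> (\<zero>\<^bsub>R\<^esub>, \<zero>\<^bsub>R\<^esub>, \<one>\<^bsub>R\<^esub>, \<zero>\<^bsub>C1 \<M>\<^esub>, \<zero>\<^bsub>C2 \<M>\<^esub>, \<zero>\<^bsub>C3 \<M>\<^esub>)"
abbreviation "F1 v \<equiv> (\<zero>\<^bsub>R\<^esub>, \<zero>\<^bsub>R\<^esub>, \<zero>\<^bsub>R\<^esub>, v, \<zero>\<^bsub>C2 \<M>\<^esub>, \<zero>\<^bsub>C3 \<M>\<^esub>)"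
abbreviation "F2 v \<equiv> (\<zero>\<^bsub>R\<^esub>, \<zero>\<^bsub>R\<^esub>, \<zero>\<^bsub>R\<^esub>, \<zero>\<^bsub>C1 \<M>\<^esub>, v, \<zero>\<^bsub>C3 \<M>\<^esub>)"
abbreviation "F3 v \<equiv> (\<zero>\<^bsub>R\<^esub>, \<zero>\<^bsub>R\<^esub>, \<zero>\<^bsub>R\<^esub>, \<zero>\<^bsub>C1 \<M>\<^esub>, \<zero>\<^bsub>C2 \<M>\<^esub>, v)"

lemma T_closed: "x \<in> carrier J \<Longrightarrow> y \<in> carrier J \<Longrightarrow> T x y \<in> carrier R"
  by (elim J_cases) (simp add: trace_formula)

lemma T_add:
  assumes "x \<in> carrier J" "z \<in> carrier J" "y \<in> carrier J"
  shows "T (x \<oplus>\<^bsub>J\<^esub> z) y = T x y \<oplus>\<^bsub>R\<^esub> T z y"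
  using assms
  by (elim J_cases) (simp add: trace_formula A.b_add B.b_add D.b_add A.R.l_distr A.R.r_distr A.R.a_ac)

lemma cross_bilinear: "bilinear_map R J J J cross"
  by (rule quadratic_mapD(3)[OF sharp_quadratic])

lemmas cross_closed = bilinear_mapD(1)[OF cross_bilinear]

lemma cross_zero: "y \<in> carrier J \<Longrightarrow> cross \<zero>\<^bsub>J\<^esub> y = \<zero>\<^bsub>J\<^esub>"
proof -
  assume "y \<in> carrier J"
  then have "(\<lambda>x. cross x y) \<in> linear_maps R J J" using cross_bilinear unfolding bilinear_map_def by blast
  then show ?thesis by (rule linear_maps_zero[OF module_J module_J])
qed

lemma polar_U:
  assumes x: "x \<in> carrier J" and y: "y \<in> carrier J" and z: "z \<in> carrier J"
  shows "polar J J (\<lambda>w. U w y) x z = T x y \<odot>\<^bsub>J\<^esub> z \<oplus>\<^bsub>J\<^esub> T z y \<odot>\<^bsub>J\<^esub> x \<ominus>\<^bsub>J\<^esub> cross (cross x z) y"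
proof -
  note cl = T_closed[OF x y] T_closed[OF z y] cross_closed[OF x z] sharp_closed[OF x] sharp_closed[OF z]
  have "sharp (x \<oplus>\<^bsub>J\<^esub> z) = sharp x \<oplus>\<^bsub>J\<^esub> sharp z \<oplus>\<^bsub>J\<^esub> cross x z"
    using sharp_closed[OF x] sharp_closed[OF z] sharp_closed[OF J.M.a_closed[OF x z]]
    unfolding polar_def by (simp add: a_minus_def J.M.a_ac J.M.r_neg J.M.r_neg1 J.M.r_neg2 del: comp_module_simps)
  then have "cross (sharp (x \<oplus>\<^bsub>J\<^esub> z)) y = cross (sharp x) y \<oplus>\<^bsub>J\<^esub> cross (sharp z) y \<oplus>\<^bsub>J\<^esub> cross (cross x z) y"
    using cl x y z by (simp add: bilinear_mapD(2)[OF cross_bilinear] del: comp_module_simps)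
  moreover have "T (x \<oplus>\<^bsub>J\<^esub> z) y \<odot>\<^bsub>J\<^esub> (x \<oplus>\<^bsub>J\<^esub> z) =
      T x y \<odot>\<^bsub>J\<^esub> x \<oplus>\<^bsub>J\<^esub> T x y \<odot>\<^bsub>J\<^esub> z \<oplus>\<^bsub>J\<^esub> (T z y \<odot>\<^bsub>J\<^esub> x \<oplus>\<^bsub>J\<^esub> T z y \<odot>\<^bsub>J\<^esub> z)"
    using cl x y z by (simp add: T_add J.smult_l_distr J.smult_r_distr J.M.a_ac del: comp_module_simps)
  ultimately show ?thesis
    unfolding polar_def[of J J "\<lambda>w. U w y"]
    unfolding cubic_U_def
    using J.M.polar_U_cancel cl x y z cross_closed[OF cl(4) y] cross_closed[OF cl(5) y] cross_closed[OF cl(3) y]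
    by (simp del: comp_module_simps)
qed

lemma sharp_E: "sharp E1 = \<zero>\<^bsub>J\<^esub>" "sharp E2 = \<zero>\<^bsub>J\<^esub>" "sharp E3 = \<zero>\<^bsub>J\<^esub>"
  by (simp_all add: m_zero m2_zero m3_zero a_minus_def)

lemma T_E:
  assumes "x \<in> carrier J"
  shows "T E1 x = fst x" "T E2 x = fst (snd x)" "T E3 x = fst (snd (snd x))"
    "T x E1 = fst x" "T x E2 = fst (snd x)" "T x E3 = fst (snd (snd x))"
  using assms by (auto simp: trace_formula)

lemma U_E:
  assumes "x \<in> carrier J"
  shows "U E1 x = fst x \<odot>\<^bsub>J\<^esub> E1" "U E2 x = fst (snd x) \<odot>\<^bsub>J\<^esub> E2" "U E3 x = fst (snd (snd x)) \<odot>\<^bsub>J\<^esub> E3"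
proof -
  have "fst x \<in> carrier R" "fst (snd x) \<in> carrier R" "fst (snd (snd x)) \<in> carrier R" using assms by auto
  then have cl: "fst x \<odot>\<^bsub>J\<^esub> E1 \<in> carrier J" "fst (snd x) \<odot>\<^bsub>J\<^esub> E2 \<in> carrier J" "fst (snd (snd x)) \<odot>\<^bsub>J\<^esub> E3 \<in> carrier J"
    by simp_all
  show "U E1 x = fst x \<odot>\<^bsub>J\<^esub> E1" "U E2 x = fst (snd x) \<odot>\<^bsub>J\<^esub> E2" "U E3 x = fst (snd (snd x)) \<odot>\<^bsub>J\<^esub> E3"
    unfolding cubic_U_def sharp_E cross_zero[OF assms] T_E(1-3)[OF assms]
    using cl by (simp_all add: a_minus_def del: comp_module_simps)
qed

lemma diagonal_diff:
  assumes "x \<in> carrier J" "y \<in> carrier J"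
  shows "fst (x \<ominus>\<^bsub>J\<^esub> y) = fst x \<ominus>\<^bsub>R\<^esub> fst y" "fst (snd (x \<ominus>\<^bsub>J\<^esub> y)) = fst (snd x) \<ominus>\<^bsub>R\<^esub> fst (snd y)"
    "fst (snd (snd (x \<ominus>\<^bsub>J\<^esub> y))) = fst (snd (snd x)) \<ominus>\<^bsub>R\<^esub> fst (snd (snd y))"
  using linear_maps_diff[OF module_J A.self projections(1) assms] linear_maps_diff[OF module_J A.self projections(2) assms]
    linear_maps_diff[OF module_J A.self projections(3) assms] by simp_all

end

lemma (in cring) cross_diagonal_entry:
  assumes cl: "a \<in> carrier R" "b \<in> carrier R" "c \<in> carrier R" "d \<in> carrier R" "g \<in> carrier R"
    "p \<in> carrier R" "r \<in> carrier R" "s \<in> carrier R"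
  shows "((a \<oplus> c) \<otimes> (b \<oplus> d) \<ominus> g \<otimes> (p \<oplus> r \<oplus> s)) \<ominus> (a \<otimes> b \<ominus> g \<otimes> p) \<ominus> (c \<otimes> d \<ominus> g \<otimes> r) =
    a \<otimes> d \<oplus> c \<otimes> b \<ominus> g \<otimes> s"
  by (rule ring_identity[of "[a, b, c, d, g, p, r, s]"])
    (use cl in \<open>simp add: in_carrier_def\<close>, (rule represents_intros)+, simp add: polynomial_normalization)

context cubic_construction
begin

lemma cross_diagonal:
  assumes x: "a1 \<in> carrier R" "a2 \<in> carrier R" "a3 \<in> carrier R"
    "u1 \<in> carrier (C1 \<M>)" "u2 \<in> carrier (C2 \<M>)" "u3 \<in> carrier (C3 \<M>)"
    and y: "b1 \<in> carrier R" "b2 \<in> carrier R" "b3 \<in> carrier R"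
    "v1 \<in> carrier (C1 \<M>)" "v2 \<in> carrier (C2 \<M>)" "v3 \<in> carrier (C3 \<M>)"
  shows "fst (cross (a1, a2, a3, u1, u2, u3) (b1, b2, b3, v1, v2, v3)) = a2 \<otimes>\<^bsub>R\<^esub> b3 \<oplus>\<^bsub>R\<^esub> b2 \<otimes>\<^bsub>R\<^esub> a3 \<ominus>\<^bsub>R\<^esub> g2 \<otimes>\<^bsub>R\<^esub> g3 \<otimes>\<^bsub>R\<^esub> A.b u1 v1"
    "fst (snd (cross (a1, a2, a3, u1, u2, u3) (b1, b2, b3, v1, v2, v3))) = a3 \<otimes>\<^bsub>R\<^esub> b1 \<oplus>\<^bsub>R\<^esub> b3 \<otimes>\<^bsub>R\<^esub> a1 \<ominus>\<^bsub>R\<^esub> g3 \<otimes>\<^bsub>R\<^esub> g1 \<otimes>\<^bsub>R\<^esub> B.b u2 v2"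
    "fst (snd (snd (cross (a1, a2, a3, u1, u2, u3) (b1, b2, b3, v1, v2, v3)))) = a1 \<otimes>\<^bsub>R\<^esub> b2 \<oplus>\<^bsub>R\<^esub> b1 \<otimes>\<^bsub>R\<^esub> a2 \<ominus>\<^bsub>R\<^esub> g1 \<otimes>\<^bsub>R\<^esub> g2 \<otimes>\<^bsub>R\<^esub> D.b u3 v3"
proof -
  let ?x = "(a1, a2, a3, u1, u2, u3)" and ?y = "(b1, b2, b3, v1, v2, v3)"
  have cl: "?x \<in> carrier J" "?y \<in> carrier J" using x y by auto
  note s = sharp_closed[OF cl(1)] sharp_closed[OF cl(2)] sharp_closed[OF J.M.a_closed[OF cl]]
  note d = diagonal_diff[OF J.M.minus_closed[OF s(3,1)] s(2)] diagonal_diff[OF s(3,1)]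
  show "fst (cross ?x ?y) = a2 \<otimes>\<^bsub>R\<^esub> b3 \<oplus>\<^bsub>R\<^esub> b2 \<otimes>\<^bsub>R\<^esub> a3 \<ominus>\<^bsub>R\<^esub> g2 \<otimes>\<^bsub>R\<^esub> g3 \<otimes>\<^bsub>R\<^esub> A.b u1 v1"
    "fst (snd (cross ?x ?y)) = a3 \<otimes>\<^bsub>R\<^esub> b1 \<oplus>\<^bsub>R\<^esub> b3 \<otimes>\<^bsub>R\<^esub> a1 \<ominus>\<^bsub>R\<^esub> g3 \<otimes>\<^bsub>R\<^esub> g1 \<otimes>\<^bsub>R\<^esub> B.b u2 v2"
    "fst (snd (snd (cross ?x ?y))) = a1 \<otimes>\<^bsub>R\<^esub> b2 \<oplus>\<^bsub>R\<^esub> b1 \<otimes>\<^bsub>R\<^esub> a2 \<ominus>\<^bsub>R\<^esub> g1 \<otimes>\<^bsub>R\<^esub> g2 \<otimes>\<^bsub>R\<^esub> D.b u3 v3"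
    unfolding polar_def[of J J sharp] d
    using x y by (simp_all add: A.q_add B.q_add D.q_add A.R.cross_diagonal_entry)
qed

lemma cross_E_diagonal:
  assumes "y \<in> carrier J"
  shows "fst (snd (cross y E1)) = fst (snd (snd y))" "fst (snd (snd (cross y E2))) = fst y" "fst (cross y E3) = fst (snd y)"
  using assms by (auto simp: cross_diagonal a_minus_def)

lemma F_closed: "v \<in> carrier (C1 \<M>) \<Longrightarrow> F1 v \<in> carrier J" "w \<in> carrier (C2 \<M>) \<Longrightarrow> F2 w \<in> carrier J"
    "z \<in> carrier (C3 \<M>) \<Longrightarrow> F3 z \<in> carrier J"
  by simp_all

lemma E_closed: "E1 \<in> carrier J" "E2 \<in> carrier J" "E3 \<in> carrier J"
  by simp_all

lemma diagonal_comb: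
  assumes "x \<in> carrier J" "y \<in> carrier J" "z \<in> carrier J" "r \<in> carrier R" "s \<in> carrier R"
  shows "fst (r \<odot>\<^bsub>J\<^esub> x \<oplus>\<^bsub>J\<^esub> s \<odot>\<^bsub>J\<^esub> y \<ominus>\<^bsub>J\<^esub> z) = r \<otimes>\<^bsub>R\<^esub> fst x \<oplus>\<^bsub>R\<^esub> s \<otimes>\<^bsub>R\<^esub> fst y \<ominus>\<^bsub>R\<^esub> fst z"
    "fst (snd (r \<odot>\<^bsub>J\<^esub> x \<oplus>\<^bsub>J\<^esub> s \<odot>\<^bsub>J\<^esub> y \<ominus>\<^bsub>J\<^esub> z)) = r \<otimes>\<^bsub>R\<^esub> fst (snd x) \<oplus>\<^bsub>R\<^esub> s \<otimes>\<^bsub>R\<^esub> fst (snd y) \<ominus>\<^bsub>R\<^esub> fst (snd z)"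
    "fst (snd (snd (r \<odot>\<^bsub>J\<^esub> x \<oplus>\<^bsub>J\<^esub> s \<odot>\<^bsub>J\<^esub> y \<ominus>\<^bsub>J\<^esub> z))) =
      r \<otimes>\<^bsub>R\<^esub> fst (snd (snd x)) \<oplus>\<^bsub>R\<^esub> s \<otimes>\<^bsub>R\<^esub> fst (snd (snd y)) \<ominus>\<^bsub>R\<^esub> fst (snd (snd z))"
proof -
  have cl: "r \<odot>\<^bsub>J\<^esub> x \<oplus>\<^bsub>J\<^esub> s \<odot>\<^bsub>J\<^esub> y \<in> carrier J" by (intro J.M.a_closed J.smult_closed assms)
  show "fst (r \<odot>\<^bsub>J\<^esub> x \<oplus>\<^bsub>J\<^esub> s \<odot>\<^bsub>J\<^esub> y \<ominus>\<^bsub>J\<^esub> z) = r \<otimes>\<^bsub>R\<^esub> fst x \<oplus>\<^bsub>R\<^esub> s \<otimes>\<^bsub>R\<^esub> fst y \<ominus>\<^bsub>R\<^esub> fst z"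
    "fst (snd (r \<odot>\<^bsub>J\<^esub> x \<oplus>\<^bsub>J\<^esub> s \<odot>\<^bsub>J\<^esub> y \<ominus>\<^bsub>J\<^esub> z)) = r \<otimes>\<^bsub>R\<^esub> fst (snd x) \<oplus>\<^bsub>R\<^esub> s \<otimes>\<^bsub>R\<^esub> fst (snd y) \<ominus>\<^bsub>R\<^esub> fst (snd z)"
    "fst (snd (snd (r \<odot>\<^bsub>J\<^esub> x \<oplus>\<^bsub>J\<^esub> s \<odot>\<^bsub>J\<^esub> y \<ominus>\<^bsub>J\<^esub> z))) =
      r \<otimes>\<^bsub>R\<^esub> fst (snd (snd x)) \<oplus>\<^bsub>R\<^esub> s \<otimes>\<^bsub>R\<^esub> fst (snd (snd y)) \<ominus>\<^bsub>R\<^esub> fst (snd (snd z))"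
    unfolding diagonal_diff[OF cl assms(3)] using assms by auto
qed

text \<open>The triple product of \<open>x\<close>, \<open>e\<^sub>1\<close> and \<open>v[12]\<close> has the diagonal entry \<open>\<gamma>\<^sub>1\<gamma>\<^sub>2\<langle>u\<^sub>3, v\<rangle>\<close> at \<open>e\<^sub>2\<close>, and cyclically.\<close>

lemma triple_diagonal:
  assumes x: "a1 \<in> carrier R" "a2 \<in> carrier R" "a3 \<in> carrier R"
    "u1 \<in> carrier (C1 \<M>)" "u2 \<in> carrier (C2 \<M>)" "u3 \<in> carrier (C3 \<M>)"
    and v: "v1 \<in> carrier (C1 \<M>)" "v2 \<in> carrier (C2 \<M>)" "v3 \<in> carrier (C3 \<M>)"
  defines "x \<equiv> (a1, a2, a3, u1, u2, u3)"
  shows "fst (snd (polar J J (\<lambda>w. U w E1) x (F3 v3))) = g1 \<otimes>\<^bsub>R\<^esub> g2 \<otimes>\<^bsub>R\<^esub> D.b u3 v3"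
    "fst (snd (snd (polar J J (\<lambda>w. U w E2) x (F1 v1)))) = g2 \<otimes>\<^bsub>R\<^esub> g3 \<otimes>\<^bsub>R\<^esub> A.b u1 v1"
    "fst (polar J J (\<lambda>w. U w E3) x (F2 v2)) = g3 \<otimes>\<^bsub>R\<^esub> g1 \<otimes>\<^bsub>R\<^esub> B.b u2 v2"
proof -
  have xJ: "x \<in> carrier J" using x by (simp add: x_def)
  note F = F_closed(1)[OF v(1)] F_closed(2)[OF v(2)] F_closed(3)[OF v(3)]
  note c = cross_closed[OF xJ F(1)] cross_closed[OF xJ F(2)] cross_closed[OF xJ F(3)]
  note cc = cross_closed[OF c(3) E_closed(1)] cross_closed[OF c(1) E_closed(2)] cross_closed[OF c(2) E_closed(3)]
  show "fst (snd (polar J J (\<lambda>w. U w E1) x (F3 v3))) = g1 \<otimes>\<^bsub>R\<^esub> g2 \<otimes>\<^bsub>R\<^esub> D.b u3 v3"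
    unfolding polar_U[OF xJ E_closed(1) F(3)]
    unfolding diagonal_comb[OF F(3) xJ cc(1) T_closed[OF xJ E_closed(1)] T_closed[OF F(3) E_closed(1)]]
    unfolding cross_E_diagonal[OF c(3)] T_E(4)[OF xJ] T_E(4)[OF F(3)]
    using x v by (simp add: x_def cross_diagonal a_minus_def)
  show "fst (snd (snd (polar J J (\<lambda>w. U w E2) x (F1 v1)))) = g2 \<otimes>\<^bsub>R\<^esub> g3 \<otimes>\<^bsub>R\<^esub> A.b u1 v1"
    unfolding polar_U[OF xJ E_closed(2) F(1)]
    unfolding diagonal_comb[OF F(1) xJ cc(2) T_closed[OF xJ E_closed(2)] T_closed[OF F(1) E_closed(2)]]
    unfolding cross_E_diagonal[OF c(1)] T_E(5)[OF xJ] T_E(5)[OF F(1)]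
    using x v by (simp add: x_def cross_diagonal a_minus_def)
  show "fst (polar J J (\<lambda>w. U w E3) x (F2 v2)) = g3 \<otimes>\<^bsub>R\<^esub> g1 \<otimes>\<^bsub>R\<^esub> B.b u2 v2"
    unfolding polar_U[OF xJ E_closed(3) F(2)]
    unfolding diagonal_comb[OF F(2) xJ cc(3) T_closed[OF xJ E_closed(3)] T_closed[OF F(2) E_closed(3)]]
    unfolding cross_E_diagonal[OF c(2)] T_E(6)[OF xJ] T_E(6)[OF F(2)]
    using x v by (simp add: x_def cross_diagonal a_minus_def)
qed

lemma cross_E_F:
  assumes "v1 \<in> carrier (C1 \<M>)" "v2 \<in> carrier (C2 \<M>)" "v3 \<in> carrier (C3 \<M>)"
  shows "cross E1 (F3 v3) = \<zero>\<^bsub>J\<^esub>" "cross E2 (F1 v1) = \<zero>\<^bsub>J\<^esub>" "cross E3 (F2 v2) = \<zero>\<^bsub>J\<^esub>"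
proof -
  have "sharp (E1 \<oplus>\<^bsub>J\<^esub> F3 v3) = sharp (F3 v3)" "sharp (E2 \<oplus>\<^bsub>J\<^esub> F1 v1) = sharp (F1 v1)" "sharp (E3 \<oplus>\<^bsub>J\<^esub> F2 v2) = sharp (F2 v2)"
    using assms by (simp_all add: m_zero m2_zero m3_zero a_minus_def)
  then show "cross E1 (F3 v3) = \<zero>\<^bsub>J\<^esub>" "cross E2 (F1 v1) = \<zero>\<^bsub>J\<^esub>" "cross E3 (F2 v2) = \<zero>\<^bsub>J\<^esub>"
    unfolding polar_def[of J J sharp] sharp_E
    using sharp_closed[OF F_closed(1)[OF assms(1)]] sharp_closed[OF F_closed(2)[OF assms(2)]] sharp_closed[OF F_closed(3)[OF assms(3)]]
    by (simp_all add: a_minus_def J.M.r_neg J.M.minus_equality[OF J.M.l_zero[OF J.M.zero_closed] J.M.zero_closed J.M.zero_closed]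
      del: comp_module_simps comp_sharp.simps)
qed

text \<open>The triple product of \<open>e\<^sub>1\<close>, \<open>e\<^sub>1\<close> and \<open>v[12]\<close> is \<open>v[12]\<close>, and cyclically.\<close>

lemma triple_E_E:
  assumes v: "v1 \<in> carrier (C1 \<M>)" "v2 \<in> carrier (C2 \<M>)" "v3 \<in> carrier (C3 \<M>)"
  shows "polar J J (\<lambda>w. U w E1) E1 (F3 v3) = F3 v3" "polar J J (\<lambda>w. U w E2) E2 (F1 v1) = F1 v1"
    "polar J J (\<lambda>w. U w E3) E3 (F2 v2) = F2 v2"
proof -
  note F = F_closed(1)[OF v(1)] F_closed(2)[OF v(2)] F_closed(3)[OF v(3)]
  show "polar J J (\<lambda>w. U w E1) E1 (F3 v3) = F3 v3"
    unfolding polar_U[OF E_closed(1) E_closed(1) F(3)] cross_E_F[OF v] cross_zero[OF E_closed(1)] T_E(4)[OF E_closed(1)] T_E(4)[OF F(3)]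
    using v by (simp add: J_diff A.R.r_neg A.M.r_neg a_minus_def J_minus)
  show "polar J J (\<lambda>w. U w E2) E2 (F1 v1) = F1 v1"
    unfolding polar_U[OF E_closed(2) E_closed(2) F(1)] cross_E_F[OF v] cross_zero[OF E_closed(2)] T_E(5)[OF E_closed(2)] T_E(5)[OF F(1)]
    using v by (simp add: J_diff A.R.r_neg A.M.r_neg a_minus_def J_minus)
  show "polar J J (\<lambda>w. U w E3) E3 (F2 v2) = F2 v2"
    unfolding polar_U[OF E_closed(3) E_closed(3) F(2)] cross_E_F[OF v] cross_zero[OF E_closed(3)] T_E(6)[OF E_closed(3)] T_E(6)[OF F(2)]
    using v by (simp add: J_diff A.R.r_neg A.M.r_neg a_minus_def J_minus)
qed

lemma simple_over_field:
  assumes field: "field R" and g: "g1 \<noteq> \<zero>\<^bsub>R\<^esub>" "g2 \<noteq> \<zero>\<^bsub>R\<^esub>" "g3 \<noteq> \<zero>\<^bsub>R\<^esub>"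
    and nonzero: "w1 \<in> carrier (C1 \<M>)" "w1 \<noteq> \<zero>\<^bsub>C1 \<M>\<^esub>" "w2 \<in> carrier (C2 \<M>)" "w2 \<noteq> \<zero>\<^bsub>C2 \<M>\<^esub>"
      "w3 \<in> carrier (C3 \<M>)" "w3 \<noteq> \<zero>\<^bsub>C3 \<M>\<^esub>"
  shows "simple_jordan R J U"
  unfolding simple_jordan_def
proof (intro conjI allI impI)
  interpret F: field R by fact
  show "carrier J \<noteq> {\<zero>\<^bsub>J\<^esub>}"
  proof
    assume "carrier J = {\<zero>\<^bsub>J\<^esub>}"
    with E_closed(1) have "E1 \<in> {\<zero>\<^bsub>J\<^esub>}" by (simp only:)
    then show False by simp
  qed
  fix I assume ideal: "jordan_ideal R J U I"
  have sub: "submodule I R J" using ideal by (simp add: jordan_ideal_def)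
  note I = J.submoduleE[OF sub]
  have I_zero: "\<zero>\<^bsub>J\<^esub> \<in> I"
  proof -
    obtain x where x: "x \<in> I" using I(2) by blast
    then have "x \<in> carrier J" using I(1) by blast
    then show ?thesis using I(4)[OF A.R.zero_closed x] J.smult_l_null by (simp del: comp_module_simps)
  qed
  have I_U: "U y x \<in> I" if "x \<in> I" "y \<in> carrier J" for x y using ideal that by (auto simp: jordan_ideal_def)
  have I_polar: "polar J J (\<lambda>w. U w y) x z \<in> I" if "x \<in> I" "y \<in> carrier J" "z \<in> carrier J" for x y z
    using ideal that by (auto simp: jordan_ideal_def)
  have divide: "z \<in> I" if "c \<in> carrier R" "c \<noteq> \<zero>\<^bsub>R\<^esub>" "c \<odot>\<^bsub>J\<^esub> z \<in> I" "z \<in> carrier J" for c z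
  proof -
    have "c \<in> Units R" using that(1,2) by (simp add: F.field_Units)
    then have "inv\<^bsub>R\<^esub> c \<odot>\<^bsub>J\<^esub> (c \<odot>\<^bsub>J\<^esub> z) = z"
      using that(1,4) by (simp add: J.smult_assoc1[symmetric] del: comp_module_simps)
    with I(4)[OF A.R.Units_inv_closed[OF \<open>c \<in> Units R\<close>] that(3)] show ?thesis by simp
  qed
  have diag: "fst x \<noteq> \<zero>\<^bsub>R\<^esub> \<Longrightarrow> E1 \<in> I" "fst (snd x) \<noteq> \<zero>\<^bsub>R\<^esub> \<Longrightarrow> E2 \<in> I" "fst (snd (snd x)) \<noteq> \<zero>\<^bsub>R\<^esub> \<Longrightarrow> E3 \<in> I"
    if "x \<in> I" for x
  proof -
    have xJ: "x \<in> carrier J" using that I(1) by blast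
    then have c: "fst x \<in> carrier R" "fst (snd x) \<in> carrier R" "fst (snd (snd x)) \<in> carrier R" by auto
    note u = I_U[OF that E_closed(1), unfolded U_E[OF xJ]] I_U[OF that E_closed(2), unfolded U_E[OF xJ]]
      I_U[OF that E_closed(3), unfolded U_E[OF xJ]]
    show "fst x \<noteq> \<zero>\<^bsub>R\<^esub> \<Longrightarrow> E1 \<in> I" "fst (snd x) \<noteq> \<zero>\<^bsub>R\<^esub> \<Longrightarrow> E2 \<in> I" "fst (snd (snd x)) \<noteq> \<zero>\<^bsub>R\<^esub> \<Longrightarrow> E3 \<in> I"
      using divide[OF c(1) _ u(1) E_closed(1)] divide[OF c(2) _ u(2) E_closed(2)] divide[OF c(3) _ u(3) E_closed(3)] by blast+
  qed
  have off: "u3 \<noteq> \<zero>\<^bsub>C3 \<M>\<^esub> \<Longrightarrow> E2 \<in> I" "u1 \<noteq> \<zero>\<^bsub>C1 \<M>\<^esub> \<Longrightarrow> E3 \<in> I" "u2 \<noteq> \<zero>\<^bsub>C2 \<M>\<^esub> \<Longrightarrow> E1 \<in> I"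
    if x: "(a1, a2, a3, u1, u2, u3) \<in> I" for a1 a2 a3 u1 u2 u3
  proof -
    have "(a1, a2, a3, u1, u2, u3) \<in> carrier J" using x I(1) by blast
    then have cl: "a1 \<in> carrier R" "a2 \<in> carrier R" "a3 \<in> carrier R"
      "u1 \<in> carrier (C1 \<M>)" "u2 \<in> carrier (C2 \<M>)" "u3 \<in> carrier (C3 \<M>)" by auto
    show "E2 \<in> I" if "u3 \<noteq> \<zero>\<^bsub>C3 \<M>\<^esub>"
    proof -
      have "\<exists>v\<in>carrier (C3 \<M>). D.b u3 v \<noteq> \<zero>\<^bsub>R\<^esub>"
      proof (rule ccontr)
        assume "\<not> (\<exists>v\<in>carrier (C3 \<M>). D.b u3 v \<noteq> \<zero>\<^bsub>R\<^esub>)"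
        then have "u3 = \<zero>\<^bsub>C3 \<M>\<^esub>" by (intro D.eqI[OF cl(6) D.M.zero_closed]) simp
        with that show False by contradiction
      qed
      then obtain v where v: "v \<in> carrier (C3 \<M>)" "D.b u3 v \<noteq> \<zero>\<^bsub>R\<^esub>" by blast
      show ?thesis
        by (rule diag(2)[OF I_polar[OF x E_closed(1) F_closed(3)[OF v(1)]]])
          (use triple_diagonal(1)[OF cl A.M.zero_closed B.M.zero_closed v(1)] g v cl in \<open>simp add: F.integral_iff\<close>)
    qed
    show "E3 \<in> I" if "u1 \<noteq> \<zero>\<^bsub>C1 \<M>\<^esub>"
    proof -
      have "\<exists>v\<in>carrier (C1 \<M>). A.b u1 v \<noteq> \<zero>\<^bsub>R\<^esub>"
      proof (rule ccontr)
        assume "\<not> (\<exists>v\<in>carrier (C1 \<M>). A.b u1 v \<noteq> \<zero>\<^bsub>R\<^esub>)"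
        then have "u1 = \<zero>\<^bsub>C1 \<M>\<^esub>" by (intro A.eqI[OF cl(4) A.M.zero_closed]) simp
        with that show False by contradiction
      qed
      then obtain v where v: "v \<in> carrier (C1 \<M>)" "A.b u1 v \<noteq> \<zero>\<^bsub>R\<^esub>" by blast
      show ?thesis
        by (rule diag(3)[OF I_polar[OF x E_closed(2) F_closed(1)[OF v(1)]]])
          (use triple_diagonal(2)[OF cl v(1) B.M.zero_closed D.M.zero_closed] g v cl in \<open>simp add: F.integral_iff\<close>)
    qed
    show "E1 \<in> I" if "u2 \<noteq> \<zero>\<^bsub>C2 \<M>\<^esub>"
    proof -
      have "\<exists>v\<in>carrier (C2 \<M>). B.b u2 v \<noteq> \<zero>\<^bsub>R\<^esub>"
      proof (rule ccontr)
        assume "\<not> (\<exists>v\<in>carrier (C2 \<M>). B.b u2 v \<noteq> \<zero>\<^bsub>R\<^esub>)"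
        then have "u2 = \<zero>\<^bsub>C2 \<M>\<^esub>" by (intro B.eqI[OF cl(5) B.M.zero_closed]) simp
        with that show False by contradiction
      qed
      then obtain v where v: "v \<in> carrier (C2 \<M>)" "B.b u2 v \<noteq> \<zero>\<^bsub>R\<^esub>" by blast
      show ?thesis
        by (rule diag(1)[OF I_polar[OF x E_closed(3) F_closed(2)[OF v(1)]]])
          (use triple_diagonal(3)[OF cl A.M.zero_closed v(1) D.M.zero_closed] g v cl in \<open>simp add: F.integral_iff\<close>)
    qed
  qed
  have F_in: "F3 v3 \<in> I" if "E1 \<in> I" "v3 \<in> carrier (C3 \<M>)" for v3
    using I_polar[OF that(1) E_closed(1) F_closed(3)[OF that(2)]]
    by (simp only: triple_E_E(1)[OF A.M.zero_closed B.M.zero_closed that(2)])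
  have F_in': "F1 v1 \<in> I" if "E2 \<in> I" "v1 \<in> carrier (C1 \<M>)" for v1
    using I_polar[OF that(1) E_closed(2) F_closed(1)[OF that(2)]]
    by (simp only: triple_E_E(2)[OF that(2) B.M.zero_closed D.M.zero_closed])
  have F_in'': "F2 v2 \<in> I" if "E3 \<in> I" "v2 \<in> carrier (C2 \<M>)" for v2
    using I_polar[OF that(1) E_closed(3) F_closed(2)[OF that(2)]]
    by (simp only: triple_E_E(3)[OF A.M.zero_closed that(2) D.M.zero_closed])
  have step: "E1 \<in> I \<Longrightarrow> E2 \<in> I" "E2 \<in> I \<Longrightarrow> E3 \<in> I" "E3 \<in> I \<Longrightarrow> E1 \<in> I"
    by (rule off(1)[OF F_in[OF _ nonzero(5)] nonzero(6)] off(2)[OF F_in'[OF _ nonzero(1)] nonzero(2)]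
      off(3)[OF F_in''[OF _ nonzero(3)] nonzero(4)]; assumption)+
  show "I = {\<zero>\<^bsub>J\<^esub>} \<or> I = carrier J"
  proof (cases "I \<subseteq> {\<zero>\<^bsub>J\<^esub>}")
    case True
    then show ?thesis using I_zero by blast
  next
    case False
    then obtain x where x: "x \<in> I" "x \<noteq> \<zero>\<^bsub>J\<^esub>" by blast
    obtain a1 a2 a3 u1 u2 u3 where x_eq: "x = (a1, a2, a3, u1, u2, u3)" by (cases x)
    have "E1 \<in> I \<or> E2 \<in> I \<or> E3 \<in> I"
      using diag[OF x(1)] off[of a1 a2 a3 u1 u2 u3] x x_eq by auto
    then have E: "E1 \<in> I" "E2 \<in> I" "E3 \<in> I" using step by blast+
    have "y \<in> I" if "y \<in> carrier J" for y
      using that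
    proof (rule J_cases)
      fix b1 b2 b3 v1 v2 v3
      assume y: "y = (b1, b2, b3, v1, v2, v3)" and cl: "b1 \<in> carrier R" "b2 \<in> carrier R" "b3 \<in> carrier R"
        "v1 \<in> carrier (C1 \<M>)" "v2 \<in> carrier (C2 \<M>)" "v3 \<in> carrier (C3 \<M>)"
      have "(b1 \<odot>\<^bsub>J\<^esub> E1 \<oplus>\<^bsub>J\<^esub> b2 \<odot>\<^bsub>J\<^esub> E2 \<oplus>\<^bsub>J\<^esub> b3 \<odot>\<^bsub>J\<^esub> E3) \<oplus>\<^bsub>J\<^esub> (F1 v1 \<oplus>\<^bsub>J\<^esub> F2 v2 \<oplus>\<^bsub>J\<^esub> F3 v3) \<in> I"
        by (intro I(5) I(4) E F_in F_in' F_in'' cl)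
      then show ?thesis using cl unfolding y by simp
    qed
    then show ?thesis using I(1) by blast
  qed
qed

end

section \<open>Scalar extension of quadratic forms\<close>

lemma (in ring_module) linear_maps_finsum_pointwise:
  assumes "finite A" "\<And>i. i \<in> A \<Longrightarrow> f i \<in> linear_maps R L M"
  shows "(\<lambda>x. \<Oplus>\<^bsub>M\<^esub>i\<in>A. f i x) \<in> linear_maps R L M"
proof (rule linear_mapsI)
  note f = linear_maps_closed[OF assms(2)] linear_maps_add[OF assms(2)] linear_maps_smult[OF assms(2)]
  show "(\<Oplus>\<^bsub>M\<^esub>i\<in>A. f i x) \<in> carrier M" if "x \<in> carrier L" for x
    by (rule M.finsum_closed) (use f that in auto)
  show "(\<Oplus>\<^bsub>M\<^esub>i\<in>A. f i (x \<oplus>\<^bsub>L\<^esub> y)) = (\<Oplus>\<^bsub>M\<^esub>i\<in>A. f i x) \<oplus>\<^bsub>M\<^esub> (\<Oplus>\<^bsub>M\<^esub>i\<in>A. f i y)"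
    if "x \<in> carrier L" "y \<in> carrier L" for x y
  proof -
    have "(\<Oplus>\<^bsub>M\<^esub>i\<in>A. f i (x \<oplus>\<^bsub>L\<^esub> y)) = (\<Oplus>\<^bsub>M\<^esub>i\<in>A. f i x \<oplus>\<^bsub>M\<^esub> f i y)"
      by (rule M.finsum_cong') (use f that in auto)
    also have "\<dots> = (\<Oplus>\<^bsub>M\<^esub>i\<in>A. f i x) \<oplus>\<^bsub>M\<^esub> (\<Oplus>\<^bsub>M\<^esub>i\<in>A. f i y)"
      by (rule M.finsum_addf) (use f that in auto)
    finally show ?thesis .
  qed
  show "(\<Oplus>\<^bsub>M\<^esub>i\<in>A. f i (r \<odot>\<^bsub>L\<^esub> x)) = r \<odot>\<^bsub>M\<^esub> (\<Oplus>\<^bsub>M\<^esub>i\<in>A. f i x)" if "r \<in> carrier R" "x \<in> carrier L" for r x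
  proof -
    have "(\<Oplus>\<^bsub>M\<^esub>i\<in>A. f i (r \<odot>\<^bsub>L\<^esub> x)) = (\<Oplus>\<^bsub>M\<^esub>i\<in>A. r \<odot>\<^bsub>M\<^esub> f i x)"
      by (rule M.finsum_cong') (use f that in auto)
    also have "\<dots> = r \<odot>\<^bsub>M\<^esub> (\<Oplus>\<^bsub>M\<^esub>i\<in>A. f i x)"
      by (rule finsum_smult_ldistr[symmetric]) (use f that assms(1) in auto)
    finally show ?thesis .
  qed
qed

context base_change
begin

abbreviation "tens M \<equiv> tensor R S \<phi> M"
abbreviation "inc M x \<equiv> pure_tensor R S \<phi> M x \<one>\<^bsub>S\<^esub>"

lemma bilinear_maps_tensor_eqI:
  assumes "module R L" "module R M"
    and f: "bilinear_map S (tens L) (tens M) N f" and g: "bilinear_map S (tens L) (tens M) N g"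
    and eq: "\<And>x y. x \<in> carrier L \<Longrightarrow> y \<in> carrier M \<Longrightarrow> f (inc L x) (inc M y) = g (inc L x) (inc M y)"
    and zw: "z \<in> carrier (tens L)" "w \<in> carrier (tens M)"
  shows "f z w = g z w"
proof -
  interpret L: tensor_product R S \<phi> L by (rule tensor_product_intro) fact
  interpret M: tensor_product R S \<phi> M by (rule tensor_product_intro) fact
  have f': "\<And>z. z \<in> carrier L.T \<Longrightarrow> f z \<in> linear_maps S M.T N" "\<And>w. w \<in> carrier M.T \<Longrightarrow> (\<lambda>z. f z w) \<in> linear_maps S L.T N"
    and g': "\<And>z. z \<in> carrier L.T \<Longrightarrow> g z \<in> linear_maps S M.T N" "\<And>w. w \<in> carrier M.T \<Longrightarrow> (\<lambda>z. g z w) \<in> linear_maps S L.T N"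
    using f g by (auto simp: bilinear_map_def)
  have *: "f (L.\<iota> x) w = g (L.\<iota> x) w" if "x \<in> carrier L" for x
    by (rule M.linear_maps_tensor_eqI[OF f'(1) g'(1) _ zw(2)]) (use that eq in auto)
  show ?thesis
    by (rule L.linear_maps_tensor_eqI[OF f'(2)[OF zw(2)] g'(2)[OF zw(2)] _ zw(1)]) (rule *)
qed

lemma bilinear_lift:
  assumes "module R L" "module R M" "module S N"
    and closed: "\<And>x y. x \<in> carrier L \<Longrightarrow> y \<in> carrier M \<Longrightarrow> f x y \<in> carrier N"
    and add: "\<And>x x' y. x \<in> carrier L \<Longrightarrow> x' \<in> carrier L \<Longrightarrow> y \<in> carrier M \<Longrightarrow> f (x \<oplus>\<^bsub>L\<^esub> x') y = f x y \<oplus>\<^bsub>N\<^esub> f x' y"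
      "\<And>x y y'. x \<in> carrier L \<Longrightarrow> y \<in> carrier M \<Longrightarrow> y' \<in> carrier M \<Longrightarrow> f x (y \<oplus>\<^bsub>M\<^esub> y') = f x y \<oplus>\<^bsub>N\<^esub> f x y'"
    and smult: "\<And>r x y. r \<in> carrier R \<Longrightarrow> x \<in> carrier L \<Longrightarrow> y \<in> carrier M \<Longrightarrow> f (r \<odot>\<^bsub>L\<^esub> x) y = \<phi> r \<odot>\<^bsub>N\<^esub> f x y"
      "\<And>r x y. r \<in> carrier R \<Longrightarrow> x \<in> carrier L \<Longrightarrow> y \<in> carrier M \<Longrightarrow> f x (r \<odot>\<^bsub>M\<^esub> y) = \<phi> r \<odot>\<^bsub>N\<^esub> f x y"
  obtains g where "bilinear_map S (tens L) (tens M) N g"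
    "\<And>x y. x \<in> carrier L \<Longrightarrow> y \<in> carrier M \<Longrightarrow> g (inc L x) (inc M y) = f x y"
proof -
  interpret L: tensor_product R S \<phi> L by (rule tensor_product_intro) fact
  interpret M: tensor_product R S \<phi> M by (rule tensor_product_intro) fact
  interpret N: ring_module S N by (rule ring_module.intro) fact
  have "\<exists>h. h \<in> linear_maps S M.T N \<and> (\<forall>y\<in>carrier M. h (M.\<iota> y) = f x y)" if x: "x \<in> carrier L" for x
  proof -
    obtain h where "h \<in> linear_maps S M.T N" "\<And>y. y \<in> carrier M \<Longrightarrow> h (M.\<iota> y) = f x y"
      by (rule M.tensor_lift[OF N.module_axioms, of "f x"]) (use x closed add smult in auto)
    then show ?thesis by blast
  qed
  then obtain h where h: "\<And>x. x \<in> carrier L \<Longrightarrow> h x \<in> linear_maps S M.T N"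
    and h_inc: "\<And>x y. x \<in> carrier L \<Longrightarrow> y \<in> carrier M \<Longrightarrow> h x (M.\<iota> y) = f x y" by metis
  have h_add: "h (x \<oplus>\<^bsub>L\<^esub> x') w = h x w \<oplus>\<^bsub>N\<^esub> h x' w" if "x \<in> carrier L" "x' \<in> carrier L" "w \<in> carrier M.T" for x x' w
    by (rule M.linear_maps_tensor_eqI[OF h[OF L.M.M.a_closed[OF that(1,2)]] N.linear_maps_sum[OF h[OF that(1)] h[OF that(2)]] _ that(3)])
      (use that in \<open>simp add: h_inc add\<close>)
  have h_smult: "h (r \<odot>\<^bsub>L\<^esub> x) w = \<phi> r \<odot>\<^bsub>N\<^esub> h x w" if "r \<in> carrier R" "x \<in> carrier L" "w \<in> carrier M.T" for r x w
    by (rule M.linear_maps_tensor_eqI[OF h[OF L.M.smult_closed[OF that(1,2)]] N.linear_maps_scale[OF \<phi>_closed[OF that(1)] h[OF that(2)]] _ that(3)])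
      (use that in \<open>simp add: h_inc smult\<close>)
  have "\<exists>k. k \<in> linear_maps S L.T N \<and> (\<forall>x\<in>carrier L. k (L.\<iota> x) = h x w)" if w: "w \<in> carrier M.T" for w
  proof -
    obtain k where "k \<in> linear_maps S L.T N" "\<And>x. x \<in> carrier L \<Longrightarrow> k (L.\<iota> x) = h x w"
      by (rule L.tensor_lift[OF N.module_axioms, of "\<lambda>x. h x w"])
        (use w h_add h_smult linear_maps_closed[OF h] in auto)
    then show ?thesis by blast
  qed
  then obtain k where k: "\<And>w. w \<in> carrier M.T \<Longrightarrow> k w \<in> linear_maps S L.T N"
    and k_inc: "\<And>w x. w \<in> carrier M.T \<Longrightarrow> x \<in> carrier L \<Longrightarrow> k w (L.\<iota> x) = h x w" by metis
  have k_add: "k (w \<oplus>\<^bsub>M.T\<^esub> w') z = k w z \<oplus>\<^bsub>N\<^esub> k w' z" if "w \<in> carrier M.T" "w' \<in> carrier M.T" "z \<in> carrier L.T" for w w' z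
    by (rule L.linear_maps_tensor_eqI[OF k[OF M.T.M.a_closed[OF that(1,2)]] N.linear_maps_sum[OF k[OF that(1)] k[OF that(2)]] _ that(3)])
      (use that in \<open>simp add: k_inc linear_maps_add[OF h]\<close>)
  have k_smult: "k (s \<odot>\<^bsub>M.T\<^esub> w) z = s \<odot>\<^bsub>N\<^esub> k w z" if "s \<in> carrier S" "w \<in> carrier M.T" "z \<in> carrier L.T" for s w z
    by (rule L.linear_maps_tensor_eqI[OF k[OF M.T.smult_closed[OF that(1,2)]] N.linear_maps_scale[OF that(1) k[OF that(2)]] _ that(3)])
      (use that in \<open>simp add: k_inc linear_maps_smult[OF h]\<close>)
  show thesis
  proof
    show "bilinear_map S L.T M.T N (\<lambda>z w. k w z)"
      by (rule bilinear_mapI)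
        (simp_all add: linear_maps_closed[OF k] linear_maps_add[OF k] linear_maps_smult[OF k] k_add k_smult)
    show "k (M.\<iota> y) (L.\<iota> x) = f x y" if "x \<in> carrier L" "y \<in> carrier M" for x y
      using that by (simp add: k_inc h_inc)
  qed
qed

lemma polar_eq:
  assumes "module S N" "quadratic_map S M N q" "module S M" "x \<in> carrier M" "y \<in> carrier M"
  shows "q (x \<oplus>\<^bsub>M\<^esub> y) = q x \<oplus>\<^bsub>N\<^esub> q y \<oplus>\<^bsub>N\<^esub> polar M N q x y"
proof -
  interpret N: module S N by fact
  interpret M: module S M by fact
  show ?thesis
    unfolding polar_def using assms(4,5) quadratic_mapD(1)[OF assms(2)]
    by (simp add: a_minus_def N.M.a_ac N.M.r_neg N.M.r_neg1 N.M.r_neg2)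
qed

lemma quadratic_maps_tensor_eqI:
  assumes "module R M" "module S N"
    and f: "quadratic_map S (tens M) N f" and g: "quadratic_map S (tens M) N g"
    and eq: "\<And>x. x \<in> carrier M \<Longrightarrow> f (inc M x) = g (inc M x)" and z: "z \<in> carrier (tens M)"
  shows "f z = g z"
proof -
  interpret M: tensor_product R S \<phi> M by (rule tensor_product_intro) fact
  interpret N: module S N by fact
  have "polar M.T N f z w = polar M.T N g z w" if "z \<in> carrier M.T" "w \<in> carrier M.T" for z w
    by (rule bilinear_maps_tensor_eqI[OF assms(1,1) quadratic_mapD(3)[OF f] quadratic_mapD(3)[OF g] _ that])
      (simp add: polar_def eq flip: M.\<iota>_add)
  note polar_eq[OF assms(2) f M.module_T] polar_eq[OF assms(2) g M.module_T] this
  note * = this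
  show ?thesis
    using z
  proof (induction rule: M.tensor_induct)
    case (add a b)
    then show ?case by (simp add: *)
  next
    case (\<iota> x s)
    then show ?case by (simp add: quadratic_mapD(2)[OF f] quadratic_mapD(2)[OF g] eq)
  qed
qed

end

text \<open>
  On a finitely generated projective module a quadratic form is the diagonal of a bilinear form: in
  terms of a dual basis, keep the terms on one side of the diagonal.
\<close>

lemma quadratic_form_eq_bilinear:
  assumes R: "cring R" and proj: "fg_projective R M" and q: "quadratic_form R M q"
  obtains \<beta> where "bilinear_map R M M (self_module R) \<beta>" "\<And>z. z \<in> carrier M \<Longrightarrow> \<beta> z z = q z"
proof -
  interpret R: cring R by fact
  interpret M: ring_module R M using proj by (intro ring_module.intro) (simp add: fg_projective_def)
  obtain n :: nat and x s where x: "\<And>i. i < n \<Longrightarrow> x i \<in> carrier M"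
    and s: "\<And>i. i < n \<Longrightarrow> s i \<in> linear_maps R M (self_module R)"
    and expand: "\<And>z. z \<in> carrier M \<Longrightarrow> z = (\<Oplus>\<^bsub>M\<^esub>i\<in>{..<n}. s i z \<odot>\<^bsub>M\<^esub> x i)"
    by (rule fg_projective_dual_basis[OF proj]) (rule that; assumption)
  note s_closed = linear_maps_closed[OF s, simplified]
  have comb: "(\<lambda>z. s i z \<odot>\<^bsub>M\<^esub> x i) \<in> linear_maps R M M" if "i < n" for i
    using that x s by (intro linear_mapsI)
      (auto simp: s_closed linear_maps_add[OF s] linear_maps_smult[OF s] M.smult_l_distr M.smult_assoc1)
  define p where "p k z = (\<Oplus>\<^bsub>M\<^esub>i\<in>{..<k}. s i z \<odot>\<^bsub>M\<^esub> x i)" for k z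
  have p_linear: "p k \<in> linear_maps R M M" if "k \<le> n" for k
    unfolding p_def using that by (intro M.linear_maps_finsum_pointwise comb) auto
  note p_closed = linear_maps_closed[OF p_linear]
  have p_Suc: "p (Suc k) z = p k z \<oplus>\<^bsub>M\<^esub> s k z \<odot>\<^bsub>M\<^esub> x k" if "Suc k \<le> n" "z \<in> carrier M" for k z
    using that x s_closed unfolding p_def lessThan_Suc
    by (subst M.M.finsum_insert) (auto simp: M.M.a_comm intro!: M.M.finsum_closed)
  note q_closed = quadratic_mapD(1)[OF q, simplified] and q_smult = quadratic_mapD(2)[OF q, simplified]
  note b = bilinear_mapD[OF quadratic_mapD(3)[OF q], simplified]
  have q_add: "q (y \<oplus>\<^bsub>M\<^esub> z) = q y \<oplus>\<^bsub>R\<^esub> q z \<oplus>\<^bsub>R\<^esub> polar M R q y z" if "y \<in> carrier M" "z \<in> carrier M" for y z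
    unfolding polar_def using that by (subst R.polar_expansion) (simp_all add: q_closed)
  have "k \<le> n \<Longrightarrow> \<exists>\<beta>. bilinear_map R M M (self_module R) \<beta> \<and> (\<forall>z\<in>carrier M. \<beta> z z = q (p k z))" for k
  proof (induction k)
    case 0
    have "q \<zero>\<^bsub>M\<^esub> = \<zero>\<^bsub>R\<^esub>" using q_smult[of "\<zero>\<^bsub>R\<^esub>" "\<zero>\<^bsub>M\<^esub>"] q_closed by simp
    moreover have "bilinear_map R M M (self_module R) (\<lambda>z w. \<zero>\<^bsub>R\<^esub>)" by (rule bilinear_mapI) auto
    ultimately show ?case by (intro exI[of _ "\<lambda>z w. \<zero>\<^bsub>R\<^esub>"]) (auto simp: p_def)
  next
    case (Suc k)
    then have k: "k < n" "k \<le> n" by auto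
    obtain \<beta> where \<beta>: "bilinear_map R M M (self_module R) \<beta>" "\<And>z. z \<in> carrier M \<Longrightarrow> \<beta> z z = q (p k z)"
      using Suc.IH k by auto
    note bD = bilinear_mapD[OF \<beta>(1), simplified]
    note sk = s_closed[OF k(1)] linear_maps_add[OF s[OF k(1)], simplified] linear_maps_smult[OF s[OF k(1)], simplified]
    note pk = p_closed[OF k(2)] linear_maps_add[OF p_linear[OF k(2)]] linear_maps_smult[OF p_linear[OF k(2)]]
    define \<beta>' where "\<beta>' z w = \<beta> z w \<oplus>\<^bsub>R\<^esub> s k z \<otimes>\<^bsub>R\<^esub> (s k w \<otimes>\<^bsub>R\<^esub> q (x k)) \<oplus>\<^bsub>R\<^esub> s k w \<otimes>\<^bsub>R\<^esub> polar M R q (p k z) (x k)" for z w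
    have "bilinear_map R M M (self_module R) \<beta>'"
      unfolding \<beta>'_def
      by (rule bilinear_mapI)
        (simp_all add: bD sk pk b q_closed x[OF k(1)] R.l_distr R.r_distr R.a_ac R.m_ac)
    moreover have "\<beta>' z z = q (p (Suc k) z)" if "z \<in> carrier M" for z
      unfolding p_Suc[OF Suc.prems that] \<beta>'_def \<beta>(2)[OF that]
      using that by (simp add: q_add pk sk q_smult q_closed b x[OF k(1)] R.m_assoc)
    ultimately show ?case by blast
  qed
  from this[of n] obtain \<beta> where "bilinear_map R M M (self_module R) \<beta>" "\<And>z. z \<in> carrier M \<Longrightarrow> \<beta> z z = q (p n z)"
    by auto
  then show thesis using expand by (intro that[of \<beta>]) (simp_all add: p_def)
qed

context base_change
begin

lemma quadratic_form_lift:
  assumes proj: "fg_projective R M" and q: "quadratic_form R M q"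
  obtains q' where "quadratic_form S (tens M) q'" "\<And>x. x \<in> carrier M \<Longrightarrow> q' (inc M x) = \<phi> (q x)"
proof -
  have M: "module R M" using proj by (simp add: fg_projective_def)
  interpret M: tensor_product R S \<phi> M by (rule tensor_product_intro) fact
  interpret T: ring_module S M.T by (rule ring_module.intro) (rule M.module_T)
  have self: "module S (self_module S)" by (rule module_self_module) (rule S.cring_axioms)
  obtain \<beta> where \<beta>: "bilinear_map R M M (self_module R) \<beta>" "\<And>z. z \<in> carrier M \<Longrightarrow> \<beta> z z = q z"
    by (rule quadratic_form_eq_bilinear[OF R.cring_axioms proj q]) (rule that; assumption)
  note \<beta>D = bilinear_mapD[OF \<beta>(1), simplified]
  obtain \<beta>' where \<beta>': "bilinear_map S M.T M.T (self_module S) \<beta>'"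
    "\<And>x y. x \<in> carrier M \<Longrightarrow> y \<in> carrier M \<Longrightarrow> \<beta>' (M.\<iota> x) (M.\<iota> y) = \<phi> (\<beta> x y)"
    by (rule bilinear_lift[OF M M self, of "\<lambda>x y. \<phi> (\<beta> x y)"]) (use \<beta>D in auto)
  show thesis
    by (rule that[of "\<lambda>z. \<beta>' z z"])
      (simp_all add: two_modules.quadratic_map_bilinear[OF T.two_modules_self \<beta>'(1)] \<beta>' \<beta>(2))
qed

lemma nonsingular_form_lift:
  assumes form: "nonsingular_form R M q" and proj: "fg_projective R M"
  obtains q' where "nonsingular_form S (tens M) q'" "\<And>x. x \<in> carrier M \<Longrightarrow> q' (inc M x) = \<phi> (q x)"
proof -
  interpret Q: nonsingular_form R M q by fact
  interpret M: tensor_product R S \<phi> M by (rule tensor_product_intro) (rule Q.module_axioms)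
  interpret T: ring_module S M.T by (rule ring_module.intro) (rule M.module_T)
  have self: "module S (self_module S)" by (rule module_self_module) (rule S.cring_axioms)
  obtain q' where q': "quadratic_form S M.T q'" "\<And>x. x \<in> carrier M \<Longrightarrow> q' (M.\<iota> x) = \<phi> (q x)"
    by (rule quadratic_form_lift[OF proj Q.quadratic]) (rule that; assumption)
  define b' where "b' = polar M.T S q'"
  have b_inc: "b' (M.\<iota> x) (M.\<iota> y) = \<phi> (Q.b x y)" if "x \<in> carrier M" "y \<in> carrier M" for x y
    using that by (simp add: b'_def polar_def q'(2) flip: M.\<iota>_add)
  have b: "bilinear_map S M.T M.T (self_module S) b'" using quadratic_mapD(3)[OF q'(1)] by (simp add: b'_def)
  note bD = bilinear_mapD[OF b, simplified]
  have b_linear: "z \<in> carrier M.T \<Longrightarrow> b' z \<in> linear_maps S M.T (self_module S)"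
    "z \<in> carrier M.T \<Longrightarrow> (\<lambda>w. b' w z) \<in> linear_maps S M.T (self_module S)" for z
    using b by (auto simp: bilinear_map_def)
  have b_sym: "b' z w = b' w z" if "z \<in> carrier M.T" "w \<in> carrier M.T" for z w
    unfolding b'_def polar_def using that quadratic_mapD(1)[OF q'(1), simplified]
    by (simp add: M.T.M.a_comm S.a_ac a_minus_def)
  obtain n :: nat and x s where x: "\<And>i. i < n \<Longrightarrow> x i \<in> carrier M"
    and s: "\<And>i. i < n \<Longrightarrow> s i \<in> linear_maps R M (self_module R)"
    and expand: "\<And>z. z \<in> carrier M \<Longrightarrow> z = (\<Oplus>\<^bsub>M\<^esub>i\<in>{..<n}. s i z \<odot>\<^bsub>M\<^esub> x i)"
    by (rule fg_projective_dual_basis[OF proj]) (rule that; assumption)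
  note s_closed = linear_maps_closed[OF s, simplified]
  have "\<exists>y. y \<in> carrier M \<and> (\<forall>z\<in>carrier M. Q.b y z = s i z)" if "i < n" for i
    using Q.nonsingular s[OF that] unfolding nonsingular_def by blast
  then obtain y where y: "\<And>i. i < n \<Longrightarrow> y i \<in> carrier M"
    and by_eq: "\<And>i z. i < n \<Longrightarrow> z \<in> carrier M \<Longrightarrow> Q.b (y i) z = s i z" by metis
  have inc_expand: "(\<Oplus>\<^bsub>M.T\<^esub>i\<in>{..<n}. \<phi> (s i z) \<odot>\<^bsub>M.T\<^esub> M.\<iota> (x i)) = M.\<iota> z" if "z \<in> carrier M" for z
  proof -
    have "M.\<iota> z = M.\<iota> (\<Oplus>\<^bsub>M\<^esub>i\<in>{..<n}. s i z \<odot>\<^bsub>M\<^esub> x i)" using expand[OF that] by simp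
    also have "\<dots> = (\<Oplus>\<^bsub>M.T\<^esub>i\<in>{..<n}. M.\<iota> (s i z \<odot>\<^bsub>M\<^esub> x i))"
      by (rule M.\<iota>_finsum) (use x s_closed that in auto)
    also have "\<dots> = (\<Oplus>\<^bsub>M.T\<^esub>i\<in>{..<n}. \<phi> (s i z) \<odot>\<^bsub>M.T\<^esub> M.\<iota> (x i))"
      by (rule M.T.M.finsum_cong') (use x s_closed that in \<open>auto simp: M.\<iota>_smult\<close>)
    finally show ?thesis by simp
  qed
  have dual: "(\<Oplus>\<^bsub>M.T\<^esub>i\<in>{..<n}. b' (M.\<iota> (y i)) w \<odot>\<^bsub>M.T\<^esub> M.\<iota> (x i)) = w" if "w \<in> carrier M.T" for w
  proof (rule M.linear_maps_tensor_eqI[OF _ _ _ that, of "\<lambda>w. \<Oplus>\<^bsub>M.T\<^esub>i\<in>{..<n}. b' (M.\<iota> (y i)) w \<odot>\<^bsub>M.T\<^esub> M.\<iota> (x i)" _ "\<lambda>w. w"])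
    show "(\<lambda>w. \<Oplus>\<^bsub>M.T\<^esub>i\<in>{..<n}. b' (M.\<iota> (y i)) w \<odot>\<^bsub>M.T\<^esub> M.\<iota> (x i)) \<in> linear_maps S M.T M.T"
      by (intro T.linear_maps_finsum_pointwise linear_mapsI)
        (use x y in \<open>auto simp: bD M.T.smult_l_distr M.T.smult_assoc1\<close>)
    show "(\<lambda>w. w) \<in> linear_maps S M.T M.T" by (rule linear_mapsI) auto
    fix z assume z: "z \<in> carrier M"
    have "(\<Oplus>\<^bsub>M.T\<^esub>i\<in>{..<n}. b' (M.\<iota> (y i)) (M.\<iota> z) \<odot>\<^bsub>M.T\<^esub> M.\<iota> (x i)) = (\<Oplus>\<^bsub>M.T\<^esub>i\<in>{..<n}. \<phi> (s i z) \<odot>\<^bsub>M.T\<^esub> M.\<iota> (x i))"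
      by (rule M.T.M.finsum_cong') (use x y z s_closed in \<open>auto simp: b_inc by_eq\<close>)
    then show "(\<Oplus>\<^bsub>M.T\<^esub>i\<in>{..<n}. b' (M.\<iota> (y i)) (M.\<iota> z) \<odot>\<^bsub>M.T\<^esub> M.\<iota> (x i)) = M.\<iota> z"
      by (simp only: inc_expand[OF z])
  qed
  have unique: "w = w'" if "w \<in> carrier M.T" "w' \<in> carrier M.T" "\<And>z. z \<in> carrier M.T \<Longrightarrow> b' w z = b' w' z" for w w'
  proof -
    have "w = (\<Oplus>\<^bsub>M.T\<^esub>i\<in>{..<n}. b' (M.\<iota> (y i)) w \<odot>\<^bsub>M.T\<^esub> M.\<iota> (x i))" using dual[OF that(1)] by simp
    also have "\<dots> = (\<Oplus>\<^bsub>M.T\<^esub>i\<in>{..<n}. b' (M.\<iota> (y i)) w' \<odot>\<^bsub>M.T\<^esub> M.\<iota> (x i))"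
      by (rule M.T.M.finsum_cong') (use x y that in \<open>auto simp: bD b_sym[of "M.\<iota> (y _)"]\<close>)
    also have "\<dots> = w'" by (rule dual) fact
    finally show ?thesis .
  qed
  have ex: "\<exists>w\<in>carrier M.T. \<forall>z\<in>carrier M.T. b' w z = f z" if f: "f \<in> linear_maps S M.T (self_module S)" for f
  proof -
    note fc = linear_maps_closed[OF f, simplified]
    define w where "w = (\<Oplus>\<^bsub>M.T\<^esub>i\<in>{..<n}. f (M.\<iota> (x i)) \<odot>\<^bsub>M.T\<^esub> M.\<iota> (y i))"
    have w: "w \<in> carrier M.T" unfolding w_def by (rule M.T.M.finsum_closed) (use x y fc in auto)
    have "b' w z = f z" if "z \<in> carrier M.T" for z
    proof (rule M.linear_maps_tensor_eqI[OF b_linear(1)[OF w] f _ that])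
      fix u assume u: "u \<in> carrier M"
      then have u': "M.\<iota> u \<in> carrier M.T" by simp
      have "b' w (M.\<iota> u) = (\<Oplus>\<^bsub>self_module S\<^esub>i\<in>{..<n}. b' (f (M.\<iota> (x i)) \<odot>\<^bsub>M.T\<^esub> M.\<iota> (y i)) (M.\<iota> u))"
        unfolding w_def by (rule linear_maps_finsum[OF M.module_T self b_linear(2)[OF u']]) (use x y fc in auto)
      also have "\<dots> = (\<Oplus>\<^bsub>self_module S\<^esub>i\<in>{..<n}. f (\<phi> (s i u) \<odot>\<^bsub>M.T\<^esub> M.\<iota> (x i)))"
        by (rule abelian_monoid.finsum_cong'[OF abelian_group.axioms(1)[OF module.axioms(2)[OF self]]])
          (use x y u fc s_closed in \<open>auto simp: bD b_inc by_eq linear_maps_smult[OF f] S.m_comm\<close>)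
      also have "\<dots> = f (\<Oplus>\<^bsub>M.T\<^esub>i\<in>{..<n}. \<phi> (s i u) \<odot>\<^bsub>M.T\<^esub> M.\<iota> (x i))"
        by (rule linear_maps_finsum[OF M.module_T self f, symmetric]) (use x u s_closed in auto)
      finally show "b' w (M.\<iota> u) = f (M.\<iota> u)" by (simp only: inc_expand[OF u])
    qed
    then show ?thesis using w by blast
  qed
  have "nonsingular S M.T q'"
    unfolding nonsingular_def b'_def[symmetric]
  proof
    fix f assume f: "f \<in> linear_maps S M.T (self_module S)"
    obtain w where w: "w \<in> carrier M.T" "\<And>z. z \<in> carrier M.T \<Longrightarrow> b' w z = f z" using ex[OF f] by blast
    show "\<exists>!w. w \<in> carrier M.T \<and> (\<forall>z\<in>carrier M.T. b' w z = f z)"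
    proof (rule ex1I[of _ w])
      fix v assume "v \<in> carrier M.T \<and> (\<forall>z\<in>carrier M.T. b' v z = f z)"
      then show "v = w" by (intro unique) (simp_all add: w)
    qed (use w in simp)
  qed
  then have "nonsingular_form S M.T q'"
    by (intro nonsingular_form.intro nonsingular_form_axioms.intro S.cring_axioms M.module_T q'(1))
  then show thesis using q'(2) by (rule that)
qed

lemma biquadratic_identity_lift:
  assumes "module R L" "module R M" "module S N"
    and f: "bilinear_map S (tens L) (tens M) N f"
    and q: "quadratic_form S N q" and q1: "quadratic_form S (tens L) q1'" and q2: "quadratic_form S (tens M) q2'"
    and eq: "\<And>x y. x \<in> carrier L \<Longrightarrow> y \<in> carrier M \<Longrightarrow> q (f (inc L x) (inc M y)) = q1' (inc L x) \<otimes>\<^bsub>S\<^esub> q2' (inc M y)"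
    and zw: "z \<in> carrier (tens L)" "w \<in> carrier (tens M)"
  shows "q (f z w) = q1' z \<otimes>\<^bsub>S\<^esub> q2' w"
proof -
  interpret L: tensor_product R S \<phi> L by (rule tensor_product_intro) fact
  interpret M: tensor_product R S \<phi> M by (rule tensor_product_intro) fact
  interpret TL: ring_module S L.T by (rule ring_module.intro) (rule L.module_T)
  interpret TM: ring_module S M.T by (rule ring_module.intro) (rule M.module_T)
  have self: "module S (self_module S)" by (rule module_self_module) (rule S.cring_axioms)
  have f': "f z \<in> linear_maps S M.T N" if "z \<in> carrier L.T" for z using f that by (auto simp: bilinear_map_def)
  have f'': "(\<lambda>z. f z w) \<in> linear_maps S L.T N" if "w \<in> carrier M.T" for w using f that by (auto simp: bilinear_map_def)
  note c = quadratic_mapD(1)[OF q1, simplified] quadratic_mapD(1)[OF q2, simplified]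
  have *: "q (f (L.\<iota> x) w) = q1' (L.\<iota> x) \<otimes>\<^bsub>S\<^esub> q2' w" if x: "x \<in> carrier L" for x
    by (rule quadratic_maps_tensor_eqI[OF assms(2) self TM.quadratic_form_comp[OF q f'] TM.quadratic_form_intros(3)[OF _ q2] _ zw(2)])
      (use x c eq in auto)
  show ?thesis
    by (rule quadratic_maps_tensor_eqI[OF assms(1) self TL.quadratic_form_comp[OF q f''[OF zw(2)]] TL.quadratic_form_scale_right[OF _ q1] _ zw(1)])
      (use zw c * in auto)
qed

end

section \<open>Scalar extension of compositions\<close>

context base_change
begin

lemma composition_lift:
  fixes \<M> :: "('r, 'c1, 'c2, 'c3) composition"
  assumes comp: "full_composition R \<M>"
    and proj: "fg_projective R (C1 \<M>)" "fg_projective R (C2 \<M>)" "fg_projective R (C3 \<M>)"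
  obtains \<M>' where "full_composition S \<M>'"
    "C1 \<M>' = tens (C1 \<M>)" "C2 \<M>' = tens (C2 \<M>)" "C3 \<M>' = tens (C3 \<M>)"
    "\<And>x. x \<in> carrier (C1 \<M>) \<Longrightarrow> q1 \<M>' (inc (C1 \<M>) x) = \<phi> (q1 \<M> x)"
    "\<And>x. x \<in> carrier (C2 \<M>) \<Longrightarrow> q2 \<M>' (inc (C2 \<M>) x) = \<phi> (q2 \<M> x)"
    "\<And>x. x \<in> carrier (C3 \<M>) \<Longrightarrow> q3 \<M>' (inc (C3 \<M>) x) = \<phi> (q3 \<M> x)"
    "\<And>x y. x \<in> carrier (C3 \<M>) \<Longrightarrow> y \<in> carrier (C2 \<M>) \<Longrightarrow>
      composition.mul \<M>' (inc (C3 \<M>) x) (inc (C2 \<M>) y) = inc (C1 \<M>) (composition.mul \<M> x y)"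
    "\<And>x y. x \<in> carrier (C1 \<M>) \<Longrightarrow> y \<in> carrier (C3 \<M>) \<Longrightarrow>
      mul2 S \<M>' (inc (C1 \<M>) x) (inc (C3 \<M>) y) = inc (C2 \<M>) (mul2 R \<M> x y)"
    "\<And>x y. x \<in> carrier (C2 \<M>) \<Longrightarrow> y \<in> carrier (C1 \<M>) \<Longrightarrow>
      mul3 S \<M>' (inc (C2 \<M>) x) (inc (C1 \<M>) y) = inc (C3 \<M>) (mul3 R \<M> x y)"
proof -
  interpret full_composition R \<M> by fact
  interpret T1: tensor_product R S \<phi> "C1 \<M>" by (rule tensor_product_intro) (rule A.module_axioms)
  interpret T2: tensor_product R S \<phi> "C2 \<M>" by (rule tensor_product_intro) (rule B.module_axioms)
  interpret T3: tensor_product R S \<phi> "C3 \<M>" by (rule tensor_product_intro) (rule D.module_axioms)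
  obtain r1 where r1: "nonsingular_form S T1.T r1" "\<And>x. x \<in> carrier (C1 \<M>) \<Longrightarrow> r1 (T1.\<iota> x) = \<phi> (q1 \<M> x)"
    by (rule nonsingular_form_lift[OF A.nonsingular_form_axioms proj(1)]) (rule that; assumption)
  obtain r2 where r2: "nonsingular_form S T2.T r2" "\<And>x. x \<in> carrier (C2 \<M>) \<Longrightarrow> r2 (T2.\<iota> x) = \<phi> (q2 \<M> x)"
    by (rule nonsingular_form_lift[OF B.nonsingular_form_axioms proj(2)]) (rule that; assumption)
  obtain r3 where r3: "nonsingular_form S T3.T r3" "\<And>x. x \<in> carrier (C3 \<M>) \<Longrightarrow> r3 (T3.\<iota> x) = \<phi> (q3 \<M> x)"
    by (rule nonsingular_form_lift[OF D.nonsingular_form_axioms proj(3)]) (rule that; assumption)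
  obtain k where k: "bilinear_map S T3.T T2.T T1.T k"
    "\<And>x y. x \<in> carrier (C3 \<M>) \<Longrightarrow> y \<in> carrier (C2 \<M>) \<Longrightarrow> k (T3.\<iota> x) (T2.\<iota> y) = T1.\<iota> (m x y)"
    by (rule bilinear_lift[OF D.module_axioms B.module_axioms T1.module_T, of "\<lambda>x y. T1.\<iota> (m x y)"])
      (simp_all add: m_add m_smult T1.\<iota>_add T1.\<iota>_smult)
  define \<M>' where "\<M>' = \<lparr>C1 = T1.T, C2 = T2.T, C3 = T3.T, q1 = r1, q2 = r2, q3 = r3, mul = k\<rparr>"
  have simps [simp]: "C1 \<M>' = T1.T" "C2 \<M>' = T2.T" "C3 \<M>' = T3.T" "q1 \<M>' = r1" "q2 \<M>' = r2" "q3 \<M>' = r3"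
    "composition.mul \<M>' = k"
    by (simp_all add: \<M>'_def)
  have r: "quadratic_form S T1.T r1" "quadratic_form S T2.T r2" "quadratic_form S T3.T r3"
    using r1(1) r2(1) r3(1) by (simp_all add: nonsingular_form_def nonsingular_form_axioms_def)
  have "composition_forms S \<M>'"
  proof (intro composition_forms.intro composition_forms_axioms.intro; unfold simps)
    fix z w assume zw: "z \<in> carrier T3.T" "w \<in> carrier T2.T"
    show "r1 (k z w) = r3 z \<otimes>\<^bsub>S\<^esub> r2 w"
      by (rule biquadratic_identity_lift[OF D.module_axioms B.module_axioms T1.module_T k(1) r(1,3,2) _ zw])
        (simp add: k(2) r1(2) r2(2) r3(2) q_mul)
  qed (rule r1 r2 r3 k)+
  then interpret E: composition_forms S \<M>' .
  have b1: "E.A.b (T1.\<iota> x) (T1.\<iota> y) = \<phi> (A.b x y)" if "x \<in> carrier (C1 \<M>)" "y \<in> carrier (C1 \<M>)" for x y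
    using that by (simp add: polar_def r1(2) flip: T1.\<iota>_add)
  have b2: "E.B.b (T2.\<iota> x) (T2.\<iota> y) = \<phi> (B.b x y)" if "x \<in> carrier (C2 \<M>)" "y \<in> carrier (C2 \<M>)" for x y
    using that by (simp add: polar_def r2(2) flip: T2.\<iota>_add)
  have b3: "E.D.b (T3.\<iota> x) (T3.\<iota> y) = \<phi> (D.b x y)" if "x \<in> carrier (C3 \<M>)" "y \<in> carrier (C3 \<M>)" for x y
    using that by (simp add: polar_def r3(2) flip: T3.\<iota>_add)
  have k_linear: "k z \<in> linear_maps S T2.T T1.T" if "z \<in> carrier T3.T" for z using E.m_linear that by simp
  have k_linear': "(\<lambda>z. k z w) \<in> linear_maps S T3.T T1.T" if "w \<in> carrier T2.T" for w using E.m_linear' that by simp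
  have b1_linear: "E.A.b z \<in> linear_maps S T1.T (self_module S)" if "z \<in> carrier T1.T" for z using E.A.b_linear that by simp
  have b2_linear: "E.B.b z \<in> linear_maps S T2.T (self_module S)" if "z \<in> carrier T2.T" for z using E.B.b_linear that by simp
  have b3_linear: "E.D.b z \<in> linear_maps S T3.T (self_module S)" if "z \<in> carrier T3.T" for z using E.D.b_linear that by simp
  have mul2: "mul2 S \<M>' (T1.\<iota> x) (T3.\<iota> y) = T2.\<iota> (m2 x y)" if xy: "x \<in> carrier (C1 \<M>)" "y \<in> carrier (C3 \<M>)" for x y
  proof -
    have cl: "T1.\<iota> x \<in> carrier T1.T" "T3.\<iota> y \<in> carrier T3.T" "T2.\<iota> (m2 x y) \<in> carrier T2.T" using xy by simp_all
    have "E.A.b (T1.\<iota> x) (k (T3.\<iota> y) w) = E.B.b (T2.\<iota> (m2 x y)) w" if "w \<in> carrier T2.T" for w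
      by (rule T2.linear_maps_tensor_eqI[OF linear_maps_comp[OF k_linear[OF cl(2)] b1_linear[OF cl(1)]] b2_linear[OF cl(3)] _ that])
        (use xy in \<open>simp add: k(2) b1[simplified] b2[simplified] m2_adjoint\<close>)
    then show ?thesis using cl E.m2_closed[of "T1.\<iota> x" "T3.\<iota> y"] E.m2_adjoint[of "T1.\<iota> x" "T3.\<iota> y"] by (intro E.B.eqI) simp_all
  qed
  have mul3: "mul3 S \<M>' (T2.\<iota> x) (T1.\<iota> y) = T3.\<iota> (m3 x y)" if xy: "x \<in> carrier (C2 \<M>)" "y \<in> carrier (C1 \<M>)" for x y
  proof -
    have cl: "T2.\<iota> x \<in> carrier T2.T" "T1.\<iota> y \<in> carrier T1.T" "T3.\<iota> (m3 x y) \<in> carrier T3.T" using xy by simp_all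
    have "E.A.b (T1.\<iota> y) (k w (T2.\<iota> x)) = E.D.b (T3.\<iota> (m3 x y)) w" if "w \<in> carrier T3.T" for w
      by (rule T3.linear_maps_tensor_eqI[OF linear_maps_comp[OF k_linear'[OF cl(1)] b1_linear[OF cl(2)]] b3_linear[OF cl(3)] _ that])
        (use xy in \<open>simp add: k(2) b1[simplified] b3[simplified] m3_adjoint\<close>)
    then show ?thesis using cl E.m3_closed[of "T2.\<iota> x" "T1.\<iota> y"] E.m3_adjoint[of "T1.\<iota> y" _ "T2.\<iota> x"] by (intro E.D.eqI) simp_all
  qed
  have "full_composition S \<M>'"
  proof (intro full_composition.intro full_composition_axioms.intro E.composition_forms_axioms; unfold simps)
    fix z w assume zw: "z \<in> carrier T1.T" "w \<in> carrier T3.T"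
    show "r2 (mul2 S \<M>' z w) = r1 z \<otimes>\<^bsub>S\<^esub> r3 w"
      by (rule biquadratic_identity_lift[OF A.module_axioms D.module_axioms T2.module_T E.m2_bilinear[simplified] r(2,1,3) _ zw])
        (simp add: mul2 r1(2) r2(2) r3(2) q_mul2)
  next
    fix z w assume zw: "z \<in> carrier T2.T" "w \<in> carrier T1.T"
    show "r3 (mul3 S \<M>' z w) = r2 z \<otimes>\<^bsub>S\<^esub> r1 w"
      by (rule biquadratic_identity_lift[OF B.module_axioms A.module_axioms T3.module_T E.m3_bilinear[simplified] r(3,2,1) _ zw])
        (simp add: mul3 r1(2) r2(2) r3(2) q_mul3)
  qed
  then show thesis by (rule that) (simp_all add: r1(2) r2(2) r3(2) k(2) mul2 mul3)
qed

lemma comp_module_lift: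
  fixes \<M> :: "('r, 'c1, 'c2, 'c3) composition"
  assumes "module R (C1 \<M>)" "module R (C2 \<M>)" "module R (C3 \<M>)"
    and "C1 \<M>' = tens (C1 \<M>)" "C2 \<M>' = tens (C2 \<M>)" "C3 \<M>' = tens (C3 \<M>)"
  obtains \<Theta> where "module_iso S (tens (comp_module R \<M>)) (comp_module S \<M>') \<Theta>"
    "\<And>a1 a2 a3 u1 u2 u3. a1 \<in> carrier R \<Longrightarrow> a2 \<in> carrier R \<Longrightarrow> a3 \<in> carrier R \<Longrightarrow>
      u1 \<in> carrier (C1 \<M>) \<Longrightarrow> u2 \<in> carrier (C2 \<M>) \<Longrightarrow> u3 \<in> carrier (C3 \<M>) \<Longrightarrow>
      \<Theta> (inc (comp_module R \<M>) (a1, a2, a3, u1, u2, u3)) =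
        (\<phi> a1, \<phi> a2, \<phi> a3, inc (C1 \<M>) u1, inc (C2 \<M>) u2, inc (C3 \<M>) u3)"
proof -
  have self: "module R (self_module R)" by (rule module_self_module) (rule R.cring_axioms)
  have scalar_factor: "\<exists>\<Theta>. module_iso S (tens (self_module R \<times>\<^sub>M M)) (self_module S \<times>\<^sub>M N) \<Theta> \<and>
      (\<forall>a\<in>carrier R. \<forall>x\<in>carrier M. \<Theta> (inc (self_module R \<times>\<^sub>M M) (a, x)) = (\<phi> a, \<Psi> (inc M x)))"
    if M: "module R M" and \<Psi>: "module_iso S (tens M) N \<Psi>" for M :: "('r, 'a) module" and N :: "('s, 'b) module" and \<Psi>
  proof -
    obtain \<Theta>1 where \<Theta>1: "module_iso S (tens (self_module R \<times>\<^sub>M M)) (tens (self_module R) \<times>\<^sub>M tens M) \<Theta>1"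
      "\<And>x y. x \<in> carrier (self_module R) \<Longrightarrow> y \<in> carrier M \<Longrightarrow>
        \<Theta>1 (inc (self_module R \<times>\<^sub>M M) (x, y)) = (inc (self_module R) x, inc M y)"
      by (rule tensor_prod_iso[OF self M]) (rule that; assumption)
    obtain \<Theta>2 where \<Theta>2: "module_iso S (tens (self_module R)) (self_module S) \<Theta>2"
      "\<And>r. r \<in> carrier R \<Longrightarrow> \<Theta>2 (inc (self_module R) r) = \<phi> r"
      by (rule tensor_self_iso) (rule that; assumption)
    show ?thesis
      by (rule exI, rule conjI, rule module_iso_comp[OF \<Theta>1(1) module_iso_prod[OF \<Theta>2(1) \<Psi>]]) (simp add: \<Theta>1(2) \<Theta>2(2))
  qed
  obtain \<Theta>1 where \<Theta>1: "module_iso S (tens (C2 \<M> \<times>\<^sub>M C3 \<M>)) (tens (C2 \<M>) \<times>\<^sub>M tens (C3 \<M>)) \<Theta>1"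
    "\<And>x y. x \<in> carrier (C2 \<M>) \<Longrightarrow> y \<in> carrier (C3 \<M>) \<Longrightarrow> \<Theta>1 (inc (C2 \<M> \<times>\<^sub>M C3 \<M>) (x, y)) = (inc (C2 \<M>) x, inc (C3 \<M>) y)"
    by (rule tensor_prod_iso[OF assms(2,3)]) (rule that; assumption)
  note m23 = module_prod_module[OF assms(2,3)]
  obtain \<Theta>2 where \<Theta>2: "module_iso S (tens (C1 \<M> \<times>\<^sub>M C2 \<M> \<times>\<^sub>M C3 \<M>)) (tens (C1 \<M>) \<times>\<^sub>M tens (C2 \<M> \<times>\<^sub>M C3 \<M>)) \<Theta>2"
    "\<And>x y. x \<in> carrier (C1 \<M>) \<Longrightarrow> y \<in> carrier (C2 \<M> \<times>\<^sub>M C3 \<M>) \<Longrightarrow>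
      \<Theta>2 (inc (C1 \<M> \<times>\<^sub>M C2 \<M> \<times>\<^sub>M C3 \<M>) (x, y)) = (inc (C1 \<M>) x, inc (C2 \<M> \<times>\<^sub>M C3 \<M>) y)"
    by (rule tensor_prod_iso[OF assms(1) m23]) (rule that; assumption)
  note m123 = module_prod_module[OF assms(1) m23]
  obtain \<Theta>5 where \<Theta>5: "module_iso S (tens (C1 \<M> \<times>\<^sub>M C2 \<M> \<times>\<^sub>M C3 \<M>)) (tens (C1 \<M>) \<times>\<^sub>M tens (C2 \<M>) \<times>\<^sub>M tens (C3 \<M>)) \<Theta>5"
    "\<And>x y z. x \<in> carrier (C1 \<M>) \<Longrightarrow> y \<in> carrier (C2 \<M>) \<Longrightarrow> z \<in> carrier (C3 \<M>) \<Longrightarrow>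
      \<Theta>5 (inc (C1 \<M> \<times>\<^sub>M C2 \<M> \<times>\<^sub>M C3 \<M>) (x, y, z)) = (inc (C1 \<M>) x, inc (C2 \<M>) y, inc (C3 \<M>) z)"
    by (rule that, rule module_iso_comp[OF \<Theta>2(1) module_iso_prod[OF module_iso_id \<Theta>1(1)]]) (simp add: \<Theta>1(2) \<Theta>2(2))
  obtain \<Theta>6 where \<Theta>6: "module_iso S (tens (self_module R \<times>\<^sub>M C1 \<M> \<times>\<^sub>M C2 \<M> \<times>\<^sub>M C3 \<M>))
      (self_module S \<times>\<^sub>M tens (C1 \<M>) \<times>\<^sub>M tens (C2 \<M>) \<times>\<^sub>M tens (C3 \<M>)) \<Theta>6"
    "\<forall>a\<in>carrier R. \<forall>x\<in>carrier (C1 \<M> \<times>\<^sub>M C2 \<M> \<times>\<^sub>M C3 \<M>).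
      \<Theta>6 (inc (self_module R \<times>\<^sub>M C1 \<M> \<times>\<^sub>M C2 \<M> \<times>\<^sub>M C3 \<M>) (a, x)) = (\<phi> a, \<Theta>5 (inc (C1 \<M> \<times>\<^sub>M C2 \<M> \<times>\<^sub>M C3 \<M>) x))"
    using scalar_factor[OF m123 \<Theta>5(1)] by blast
  note m3 = module_prod_module[OF self m123]
  obtain \<Theta>7 where \<Theta>7: "module_iso S (tens (self_module R \<times>\<^sub>M self_module R \<times>\<^sub>M C1 \<M> \<times>\<^sub>M C2 \<M> \<times>\<^sub>M C3 \<M>))
      (self_module S \<times>\<^sub>M self_module S \<times>\<^sub>M tens (C1 \<M>) \<times>\<^sub>M tens (C2 \<M>) \<times>\<^sub>M tens (C3 \<M>)) \<Theta>7"
    "\<forall>a\<in>carrier R. \<forall>x\<in>carrier (self_module R \<times>\<^sub>M C1 \<M> \<times>\<^sub>M C2 \<M> \<times>\<^sub>M C3 \<M>).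
      \<Theta>7 (inc (self_module R \<times>\<^sub>M self_module R \<times>\<^sub>M C1 \<M> \<times>\<^sub>M C2 \<M> \<times>\<^sub>M C3 \<M>) (a, x)) =
        (\<phi> a, \<Theta>6 (inc (self_module R \<times>\<^sub>M C1 \<M> \<times>\<^sub>M C2 \<M> \<times>\<^sub>M C3 \<M>) x))"
    using scalar_factor[OF m3 \<Theta>6(1)] by blast
  note m2 = module_prod_module[OF self m3]
  obtain \<Theta> where \<Theta>: "module_iso S (tens (self_module R \<times>\<^sub>M self_module R \<times>\<^sub>M self_module R \<times>\<^sub>M C1 \<M> \<times>\<^sub>M C2 \<M> \<times>\<^sub>M C3 \<M>))
      (self_module S \<times>\<^sub>M self_module S \<times>\<^sub>M self_module S \<times>\<^sub>M tens (C1 \<M>) \<times>\<^sub>M tens (C2 \<M>) \<times>\<^sub>M tens (C3 \<M>)) \<Theta>"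
    "\<forall>a\<in>carrier R. \<forall>x\<in>carrier (self_module R \<times>\<^sub>M self_module R \<times>\<^sub>M C1 \<M> \<times>\<^sub>M C2 \<M> \<times>\<^sub>M C3 \<M>).
      \<Theta> (inc (self_module R \<times>\<^sub>M self_module R \<times>\<^sub>M self_module R \<times>\<^sub>M C1 \<M> \<times>\<^sub>M C2 \<M> \<times>\<^sub>M C3 \<M>) (a, x)) =
        (\<phi> a, \<Theta>7 (inc (self_module R \<times>\<^sub>M self_module R \<times>\<^sub>M C1 \<M> \<times>\<^sub>M C2 \<M> \<times>\<^sub>M C3 \<M>) x))"
    using scalar_factor[OF m2 \<Theta>7(1)] by blast
  show thesis
    by (rule that[of \<Theta>]; unfold comp_module_eq_prod assms(4-6))
      (use \<Theta> \<Theta>7(2) \<Theta>6(2) \<Theta>5(2) in simp_all)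
qed

end

section \<open>Transport along an isomorphism\<close>

locale module_isomorphism = M: ring_module S M + P: ring_module S P for S :: "'s ring" and M :: "('s, 'a) module" and P :: "('s, 'b) module" +
  fixes \<Theta> \<Psi>
  assumes \<Theta>: "\<Theta> \<in> linear_maps S M P" and \<Psi>: "\<Psi> \<in> linear_maps S P M"
    and \<Psi>_\<Theta> [simp]: "x \<in> carrier M \<Longrightarrow> \<Psi> (\<Theta> x) = x" and \<Theta>_\<Psi> [simp]: "y \<in> carrier P \<Longrightarrow> \<Theta> (\<Psi> y) = y"
begin

lemmas \<Theta>_simps [simp] = linear_maps_closed[OF \<Theta>] linear_maps_add[OF \<Theta>] linear_maps_smult[OF \<Theta>]
  linear_maps_diff[OF M.module_axioms P.module_axioms \<Theta>]
lemmas \<Psi>_simps [simp] = linear_maps_closed[OF \<Psi>] linear_maps_add[OF \<Psi>] linear_maps_smult[OF \<Psi>]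
  linear_maps_diff[OF P.module_axioms M.module_axioms \<Psi>]

lemma transport_cubic_form:
  assumes "cubic_form S P N D"
  shows "cubic_form S M (\<lambda>x. N (\<Theta> x)) (\<lambda>x y. D (\<Theta> x) (\<Theta> y))"
  using assms unfolding cubic_form_def
  by (auto simp: Pi_iff intro: linear_maps_comp[OF \<Theta>] M.quadratic_form_comp[OF _ \<Theta>])

lemma transport_polar:
  assumes "\<And>x. x \<in> carrier P \<Longrightarrow> sh x \<in> carrier P" "x \<in> carrier M" "y \<in> carrier M"
  shows "polar M M (\<lambda>x. \<Psi> (sh (\<Theta> x))) x y = \<Psi> (polar P P sh (\<Theta> x) (\<Theta> y))"
  unfolding polar_def using assms by simp

lemma transport_quadratic_map:
  assumes "quadratic_map S P P sh"
  shows "quadratic_map S M M (\<lambda>x. \<Psi> (sh (\<Theta> x)))"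
proof (rule quadratic_mapI)
  note q = quadratic_mapD[OF assms]
  show "bilinear_map S M M M (\<lambda>x y. \<Psi> (polar P P sh (\<Theta> x) (\<Theta> y)))"
    by (rule bilinear_mapI) (simp_all add: bilinear_mapD[OF q(3)])
  show "polar M M (\<lambda>x. \<Psi> (sh (\<Theta> x))) x y = \<Psi> (polar P P sh (\<Theta> x) (\<Theta> y))" if "x \<in> carrier M" "y \<in> carrier M" for x y
    by (rule transport_polar) (use q that in auto)
qed (simp_all add: quadratic_mapD[OF assms] M.module_axioms)

lemma transport_trace:
  assumes "c \<in> carrier M" "x \<in> carrier M" "y \<in> carrier M"
  shows "bilinear_trace S M c (\<lambda>x y. D (\<Theta> x) (\<Theta> y)) x y = bilinear_trace S P (\<Theta> c) D (\<Theta> x) (\<Theta> y)"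
  unfolding bilinear_trace_def using assms by simp

lemma trace_closed:
  assumes "cubic_form S P N D" "c \<in> carrier P" "x \<in> carrier P" "y \<in> carrier P"
  shows "bilinear_trace S P c D x y \<in> carrier S"
proof -
  have "D u v \<in> carrier S" if "u \<in> carrier P" "v \<in> carrier P" for u v
    using assms(1) that unfolding cubic_form_def linear_maps_def by auto
  then show ?thesis unfolding bilinear_trace_def using assms by simp
qed

lemma transport_cubic_norm_identities:
  assumes ids: "cubic_norm_identities S P (\<Theta> c) N D sh" and c: "c \<in> carrier M"
    and cubic: "cubic_form S P N D" and sh: "quadratic_map S P P sh"
  shows "cubic_norm_identities S M c (\<lambda>x. N (\<Theta> x)) (\<lambda>x y. D (\<Theta> x) (\<Theta> y)) (\<lambda>x. \<Psi> (sh (\<Theta> x)))"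
proof -
  note sh_closed = quadratic_mapD(1)[OF sh]
  have N: "N x \<in> carrier S" if "x \<in> carrier P" for x using cubic that by (auto simp: cubic_form_def)
  show ?thesis
    using ids unfolding cubic_norm_identities_def
    by (auto simp: sh_closed c N transport_trace transport_polar trace_closed[OF cubic])
qed

lemma transport_U:
  assumes c: "c \<in> carrier M" and cubic: "cubic_form S P N D" and sh: "quadratic_map S P P sh"
    and xy: "x \<in> carrier M" "y \<in> carrier M"
  shows "cubic_U S M c (\<lambda>x y. D (\<Theta> x) (\<Theta> y)) (\<lambda>x. \<Psi> (sh (\<Theta> x))) x y = \<Psi> (cubic_U S P (\<Theta> c) D sh (\<Theta> x) (\<Theta> y))"
proof -
  note q = quadratic_mapD[OF sh]
  show ?thesis
    unfolding cubic_U_def using c xy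
    by (simp add: q(1) transport_trace transport_polar trace_closed[OF cubic] bilinear_mapD(1)[OF q(3)])
qed

lemma transport_simple:
  assumes simple: "simple_jordan S P U" and U: "\<And>x y. x \<in> carrier P \<Longrightarrow> y \<in> carrier P \<Longrightarrow> U x y \<in> carrier P"
    and U': "\<And>x y. x \<in> carrier M \<Longrightarrow> y \<in> carrier M \<Longrightarrow> U' x y = \<Psi> (U (\<Theta> x) (\<Theta> y))"
  shows "simple_jordan S M U'"
  unfolding simple_jordan_def
proof (intro conjI allI impI)
  have \<Theta>_zero: "\<Theta> \<zero>\<^bsub>M\<^esub> = \<zero>\<^bsub>P\<^esub>" by (rule linear_maps_zero[OF M.module_axioms P.module_axioms \<Theta>])
  have \<Psi>_zero: "\<Psi> \<zero>\<^bsub>P\<^esub> = \<zero>\<^bsub>M\<^esub>" by (rule linear_maps_zero[OF P.module_axioms M.module_axioms \<Psi>])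
  show "carrier M \<noteq> {\<zero>\<^bsub>M\<^esub>}"
  proof
    assume M: "carrier M = {\<zero>\<^bsub>M\<^esub>}"
    have "y = \<zero>\<^bsub>P\<^esub>" if y: "y \<in> carrier P" for y
    proof -
      have "\<Psi> y = \<zero>\<^bsub>M\<^esub>" using \<Psi>_simps(1)[OF y] M by simp
      then show ?thesis using \<Theta>_\<Psi>[OF y] \<Theta>_zero by simp
    qed
    then have "carrier P = {\<zero>\<^bsub>P\<^esub>}" using P.M.zero_closed by blast
    then show False using simple by (simp add: simple_jordan_def)
  qed
  fix I assume ideal: "jordan_ideal S M U' I"
  have sub: "submodule I S M" using ideal by (simp add: jordan_ideal_def)
  note I = M.submoduleE[OF sub]
  have I_closed: "x \<in> I \<Longrightarrow> x \<in> carrier M" for x using I(1) by blast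
  have U_I: "U' x y \<in> I" "U' y x \<in> I" if "x \<in> I" "y \<in> carrier M" for x y
    using ideal that unfolding jordan_ideal_def by blast+
  have polar_I: "polar M M (\<lambda>w. U' w y) x z \<in> I" if "x \<in> I" "y \<in> carrier M" "z \<in> carrier M" for x y z
    using ideal that unfolding jordan_ideal_def by blast
  have mem: "\<Theta> x \<in> \<Theta> ` I \<longleftrightarrow> x \<in> I" if "x \<in> carrier M" for x
    using that I_closed by (metis \<Psi>_\<Theta> image_iff)
  have memP: "y \<in> \<Theta> ` I \<longleftrightarrow> \<Psi> y \<in> I" if "y \<in> carrier P" for y
    using mem[of "\<Psi> y"] that by simp
  have "submodule (\<Theta> ` I) S P"
  proof (rule P.submoduleI)
    show "\<Theta> ` I \<subseteq> carrier P" using I_closed by auto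
    obtain x where "x \<in> I" using I(2) by blast
    then have "\<zero>\<^bsub>S\<^esub> \<odot>\<^bsub>M\<^esub> x \<in> I" "\<zero>\<^bsub>S\<^esub> \<odot>\<^bsub>M\<^esub> x = \<zero>\<^bsub>M\<^esub>"
      using I(4)[OF M.R.zero_closed] I_closed by simp_all
    then show "\<zero>\<^bsub>P\<^esub> \<in> \<Theta> ` I" using \<Theta>_zero by force
    show "\<ominus>\<^bsub>P\<^esub> a \<in> \<Theta> ` I" if "a \<in> \<Theta> ` I" for a
    proof -
      obtain x where x: "x \<in> I" "a = \<Theta> x" using \<open>a \<in> \<Theta> ` I\<close> by blast
      have "\<ominus>\<^bsub>P\<^esub> a = \<Theta> (\<ominus>\<^bsub>M\<^esub> x)"
        unfolding x(2) by (rule linear_maps_minus[OF M.module_axioms P.module_axioms \<Theta>, symmetric]) (rule I_closed[OF x(1)])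
      then show ?thesis using I(3)[OF x(1)] by blast
    qed
    show "a \<oplus>\<^bsub>P\<^esub> b \<in> \<Theta> ` I" if ab: "a \<in> \<Theta> ` I" "b \<in> \<Theta> ` I" for a b
    proof -
      obtain x y where "x \<in> I" "a = \<Theta> x" "y \<in> I" "b = \<Theta> y" using ab by blast
      then show ?thesis using I(5)[of x y] I_closed \<Theta>_simps(2)[of x y] by (metis imageI)
    qed
    show "r \<odot>\<^bsub>P\<^esub> a \<in> \<Theta> ` I" if ra: "r \<in> carrier S" "a \<in> \<Theta> ` I" for r a
    proof -
      obtain x where "x \<in> I" "a = \<Theta> x" using ra(2) by blast
      then show ?thesis using I(4)[OF ra(1), of x] I_closed \<Theta>_simps(3)[OF ra(1), of x] by (metis imageI)
    qed
  qed
  moreover have "U a b \<in> \<Theta> ` I" "U b a \<in> \<Theta> ` I" if ab: "a \<in> \<Theta> ` I" "b \<in> carrier P" for a b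
  proof -
    obtain x where x: "x \<in> I" "a = \<Theta> x" using ab(1) by blast
    have a: "a \<in> carrier P" using x I_closed by simp
    have "\<Psi> (U a b) \<in> I" "\<Psi> (U b a) \<in> I"
      using U_I[OF x(1) \<Psi>_simps(1)[OF ab(2)]] U'[of x "\<Psi> b"] U'[of "\<Psi> b" x] x I_closed ab(2) by simp_all
    then show "U a b \<in> \<Theta> ` I" "U b a \<in> \<Theta> ` I" using memP U[OF a ab(2)] U[OF ab(2) a] by simp_all
  qed
  moreover have "polar P P (\<lambda>w. U w b) a d \<in> \<Theta> ` I" if ab: "a \<in> \<Theta> ` I" "b \<in> carrier P" "d \<in> carrier P" for a b d
  proof -
    obtain x where x: "x \<in> I" "a = \<Theta> x" using ab(1) by blast
    have xM: "x \<in> carrier M" and a: "a \<in> carrier P" using x I_closed by simp_all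
    have "polar M M (\<lambda>w. U' w (\<Psi> b)) x (\<Psi> d) = \<Psi> (polar P P (\<lambda>w. U w b) a d)"
      unfolding polar_def using xM ab(2,3) a by (simp add: U' U x(2))
    then have "\<Psi> (polar P P (\<lambda>w. U w b) a d) \<in> I"
      using polar_I[OF x(1) \<Psi>_simps(1)[OF ab(2)] \<Psi>_simps(1)[OF ab(3)]] by simp
    moreover have "polar P P (\<lambda>w. U w b) a d \<in> carrier P" unfolding polar_def using a ab U by simp
    ultimately show ?thesis using memP by simp
  qed
  ultimately have "jordan_ideal S P U (\<Theta> ` I)" unfolding jordan_ideal_def by blast
  then consider "\<Theta> ` I = {\<zero>\<^bsub>P\<^esub>}" | "\<Theta> ` I = carrier P" using simple unfolding simple_jordan_def by blast
  then show "I = {\<zero>\<^bsub>M\<^esub>} \<or> I = carrier M"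
  proof cases
    case 1
    have "x = \<zero>\<^bsub>M\<^esub>" if "x \<in> I" for x
    proof -
      have "\<Theta> x = \<zero>\<^bsub>P\<^esub>" using 1 that by blast
      then show ?thesis using \<Psi>_\<Theta>[OF I_closed[OF that]] \<Psi>_zero by simp
    qed
    then show ?thesis using I(2) by blast
  next
    case 2
    have "x \<in> I" if "x \<in> carrier M" for x using mem[OF that] 2 that by simp
    then show ?thesis using I(1) by blast
  qed
qed

end

section \<open>The Albert algebra of a composition\<close>

lemma (in base_change) comp_construction_lift:
  fixes \<M> :: "('r, 'c1, 'c2, 'c3) composition"
  assumes comp: "full_composition R \<M>"
    and proj: "fg_projective R (C1 \<M>)" "fg_projective R (C2 \<M>)" "fg_projective R (C3 \<M>)"
    and g: "g1 \<in> carrier R" "g2 \<in> carrier R" "g3 \<in> carrier R"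
  defines "J \<equiv> comp_module R \<M>"
  obtains N' D' sh' where
    "scalar_extension R S \<phi> J (comp_norm R \<M> (g1, g2, g3)) (comp_norm_deriv R \<M> (g1, g2, g3)) (comp_sharp R \<M> (g1, g2, g3)) N' D' sh'"
    "cubic_norm_identities S (tens J) (inc J (comp_base R \<M>)) N' D' sh'"
    "\<And>w1 w2 w3. field S \<Longrightarrow> \<phi> g1 \<noteq> \<zero>\<^bsub>S\<^esub> \<Longrightarrow> \<phi> g2 \<noteq> \<zero>\<^bsub>S\<^esub> \<Longrightarrow> \<phi> g3 \<noteq> \<zero>\<^bsub>S\<^esub> \<Longrightarrow>
      w1 \<in> carrier (C1 \<M>) \<Longrightarrow> \<phi> (q1 \<M> w1) \<noteq> \<zero>\<^bsub>S\<^esub> \<Longrightarrow> w2 \<in> carrier (C2 \<M>) \<Longrightarrow> \<phi> (q2 \<M> w2) \<noteq> \<zero>\<^bsub>S\<^esub> \<Longrightarrow>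
      w3 \<in> carrier (C3 \<M>) \<Longrightarrow> \<phi> (q3 \<M> w3) \<noteq> \<zero>\<^bsub>S\<^esub> \<Longrightarrow>
      simple_jordan S (tens J) (cubic_U S (tens J) (inc J (comp_base R \<M>)) D' sh')"
proof -
  interpret X0: cubic_construction R \<M> g1 g2 g3
    using comp g by (intro cubic_construction.intro cubic_construction_axioms.intro)
  interpret T1: tensor_product R S \<phi> "C1 \<M>" by (rule tensor_product_intro) (rule X0.A.module_axioms)
  interpret T2: tensor_product R S \<phi> "C2 \<M>" by (rule tensor_product_intro) (rule X0.B.module_axioms)
  interpret T3: tensor_product R S \<phi> "C3 \<M>" by (rule tensor_product_intro) (rule X0.D.module_axioms)
  interpret TJ: tensor_product R S \<phi> J unfolding J_def by (rule tensor_product_intro) (rule X0.module_J)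
  obtain \<M>' where full: "full_composition S \<M>'"
    and C [simp]: "C1 \<M>' = T1.T" "C2 \<M>' = T2.T" "C3 \<M>' = T3.T"
    and q1: "\<And>x. x \<in> carrier (C1 \<M>) \<Longrightarrow> q1 \<M>' (T1.\<iota> x) = \<phi> (q1 \<M> x)"
    and q2: "\<And>x. x \<in> carrier (C2 \<M>) \<Longrightarrow> q2 \<M>' (T2.\<iota> x) = \<phi> (q2 \<M> x)"
    and q3: "\<And>x. x \<in> carrier (C3 \<M>) \<Longrightarrow> q3 \<M>' (T3.\<iota> x) = \<phi> (q3 \<M> x)"
    and m: "\<And>x y. x \<in> carrier (C3 \<M>) \<Longrightarrow> y \<in> carrier (C2 \<M>) \<Longrightarrow>
      composition.mul \<M>' (T3.\<iota> x) (T2.\<iota> y) = T1.\<iota> (composition.mul \<M> x y)"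
    and m2: "\<And>x y. x \<in> carrier (C1 \<M>) \<Longrightarrow> y \<in> carrier (C3 \<M>) \<Longrightarrow>
      mul2 S \<M>' (T1.\<iota> x) (T3.\<iota> y) = T2.\<iota> (mul2 R \<M> x y)"
    and m3: "\<And>x y. x \<in> carrier (C2 \<M>) \<Longrightarrow> y \<in> carrier (C1 \<M>) \<Longrightarrow>
      mul3 S \<M>' (T2.\<iota> x) (T1.\<iota> y) = T3.\<iota> (mul3 R \<M> x y)"
    by (rule composition_lift[OF comp proj]) (rule that; assumption)
  have g': "\<phi> g1 \<in> carrier S" "\<phi> g2 \<in> carrier S" "\<phi> g3 \<in> carrier S" using g by simp_all
  interpret E: cubic_construction S \<M>' "\<phi> g1" "\<phi> g2" "\<phi> g3"
    using full g' by (intro cubic_construction.intro cubic_construction_axioms.intro)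
  obtain \<Theta> where iso0: "module_iso S (tens X0.J) (comp_module S \<M>') \<Theta>"
    and \<Theta>0: "\<And>a1 a2 a3 u1 u2 u3. a1 \<in> carrier R \<Longrightarrow> a2 \<in> carrier R \<Longrightarrow> a3 \<in> carrier R \<Longrightarrow>
      u1 \<in> carrier (C1 \<M>) \<Longrightarrow> u2 \<in> carrier (C2 \<M>) \<Longrightarrow> u3 \<in> carrier (C3 \<M>) \<Longrightarrow>
      \<Theta> (inc X0.J (a1, a2, a3, u1, u2, u3)) = (\<phi> a1, \<phi> a2, \<phi> a3, T1.\<iota> u1, T2.\<iota> u2, T3.\<iota> u3)"
    by (rule comp_module_lift[OF X0.A.module_axioms X0.B.module_axioms X0.D.module_axioms C]) (rule that; assumption)
  note iso = iso0[folded J_def] and \<Theta> = \<Theta>0[folded J_def]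
  obtain \<Psi> where \<Psi>: "\<Psi> \<in> linear_maps S (comp_module S \<M>') TJ.T" "\<And>x. x \<in> carrier TJ.T \<Longrightarrow> \<Psi> (\<Theta> x) = x"
    "\<And>y. y \<in> carrier (comp_module S \<M>') \<Longrightarrow> \<Theta> (\<Psi> y) = y"
    by (rule module_iso_inverse[OF TJ.module_T iso]) (rule that; assumption)
  interpret I: module_isomorphism S TJ.T "comp_module S \<M>'" \<Theta> \<Psi>
    using iso \<Psi> by (intro module_isomorphism.intro module_isomorphism_axioms.intro ring_module.intro TJ.module_T E.module_J)
      (simp_all add: module_iso_def)
  have b1: "bil1 S \<M>' (T1.\<iota> x) (T1.\<iota> y) = \<phi> (bil1 R \<M> x y)" if "x \<in> carrier (C1 \<M>)" "y \<in> carrier (C1 \<M>)" for x y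
    using that by (simp add: bil1_def polar_def q1 flip: T1.\<iota>_add)
  have b2: "bil2 S \<M>' (T2.\<iota> x) (T2.\<iota> y) = \<phi> (bil2 R \<M> x y)" if "x \<in> carrier (C2 \<M>)" "y \<in> carrier (C2 \<M>)" for x y
    using that by (simp add: bil2_def polar_def q2 flip: T2.\<iota>_add)
  have b3: "bil3 S \<M>' (T3.\<iota> x) (T3.\<iota> y) = \<phi> (bil3 R \<M> x y)" if "x \<in> carrier (C3 \<M>)" "y \<in> carrier (C3 \<M>)" for x y
    using that by (simp add: bil3_def polar_def q3 flip: T3.\<iota>_add)
  have bil_closed: "bil1 R \<M> x y \<in> carrier R" if "x \<in> carrier (C1 \<M>)" "y \<in> carrier (C1 \<M>)" for x y
    using that by (simp add: bil1_def)
  have bil_closed': "bil2 R \<M> x y \<in> carrier R" if "x \<in> carrier (C2 \<M>)" "y \<in> carrier (C2 \<M>)" for x y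
    using that by (simp add: bil2_def)
  have bil_closed'': "bil3 R \<M> x y \<in> carrier R" if "x \<in> carrier (C3 \<M>)" "y \<in> carrier (C3 \<M>)" for x y
    using that by (simp add: bil3_def)
  have \<Theta>_N: "E.N (\<Theta> (TJ.\<iota> x)) = \<phi> (X0.N x)" if "x \<in> carrier J" for x
    using that[unfolded J_def] by (rule X0.J_cases) (simp add: \<Theta> q1 q2 q3 m b1 bil_closed)
  have \<Theta>_D: "E.N' (\<Theta> (TJ.\<iota> x)) (\<Theta> (TJ.\<iota> y)) = \<phi> (X0.N' x y)" if "x \<in> carrier J" "y \<in> carrier J" for x y
  proof (rule X0.J_cases[OF that(1)[unfolded J_def]])
    fix a1 a2 a3 u1 u2 u3
    assume x: "x = (a1, a2, a3, u1, u2, u3)" "a1 \<in> carrier R" "a2 \<in> carrier R" "a3 \<in> carrier R"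
      "u1 \<in> carrier (C1 \<M>)" "u2 \<in> carrier (C2 \<M>)" "u3 \<in> carrier (C3 \<M>)"
    show ?thesis
      by (rule X0.J_cases[OF that(2)[unfolded J_def]])
        (use x in \<open>simp add: \<Theta> q1 q2 q3 m b1 b2 b3 bil_closed bil_closed' bil_closed''\<close>)
  qed
  have \<Theta>_sharp: "E.sharp (\<Theta> (TJ.\<iota> x)) = \<Theta> (TJ.\<iota> (X0.sharp x))" if "x \<in> carrier J" for x
    using that[unfolded J_def]
    by (rule X0.J_cases) (simp add: \<Theta> q1 q2 q3 m m2 m3 T1.\<iota>_diff T1.\<iota>_smult T2.\<iota>_diff T2.\<iota>_smult T3.\<iota>_diff T3.\<iota>_smult)
  have \<Theta>_base: "\<Theta> (TJ.\<iota> X0.e) = E.e"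
    by (simp add: comp_base_def \<Theta> T1.\<iota>_zero T2.\<iota>_zero T3.\<iota>_zero)
  have e: "TJ.\<iota> X0.e \<in> carrier TJ.T" using X0.e_closed[folded J_def] by (rule TJ.\<iota>_closed)
  define N' where "N' x = E.N (\<Theta> x)" for x
  define D' where "D' x y = E.N' (\<Theta> x) (\<Theta> y)" for x y
  define sh' where "sh' x = \<Psi> (E.sharp (\<Theta> x))" for x
  note fold = N'_def[abs_def, symmetric] D'_def[abs_def, symmetric] sh'_def[abs_def, symmetric]
  show thesis
  proof (rule that[of N' D' sh'])
    show "scalar_extension R S \<phi> J X0.N X0.N' X0.sharp N' D' sh'"
      unfolding scalar_extension_def Let_def
    proof (intro conjI ballI)
      show "cubic_form S TJ.T N' D'" using I.transport_cubic_form[OF E.cubic_form_N] by (simp only: fold)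
      show "quadratic_map S TJ.T TJ.T sh'" using I.transport_quadratic_map[OF E.sharp_quadratic] by (simp only: fold)
      show "N' (TJ.\<iota> x) = \<phi> (X0.N x)" if "x \<in> carrier J" for x using \<Theta>_N[OF that] by (simp only: N'_def)
      show "D' (TJ.\<iota> x) (TJ.\<iota> y) = \<phi> (X0.N' x y)" if "x \<in> carrier J" "y \<in> carrier J" for x y
        using \<Theta>_D[OF that] by (simp only: D'_def)
      show "sh' (TJ.\<iota> x) = TJ.\<iota> (X0.sharp x)" if "x \<in> carrier J" for x
        unfolding sh'_def \<Theta>_sharp[OF that] by (intro \<Psi>(2) TJ.\<iota>_closed X0.sharp_closed[folded J_def] that)
    qed
    show "cubic_norm_identities S TJ.T (TJ.\<iota> X0.e) N' D' sh'"
      using I.transport_cubic_norm_identities[OF _ e E.cubic_form_N E.sharp_quadratic] E.cubic_norm_identities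
      by (simp only: \<Theta>_base fold)
    fix w1 w2 w3
    assume field: "field S" "\<phi> g1 \<noteq> \<zero>\<^bsub>S\<^esub>" "\<phi> g2 \<noteq> \<zero>\<^bsub>S\<^esub>" "\<phi> g3 \<noteq> \<zero>\<^bsub>S\<^esub>"
      and w: "w1 \<in> carrier (C1 \<M>)" "\<phi> (q1 \<M> w1) \<noteq> \<zero>\<^bsub>S\<^esub>" "w2 \<in> carrier (C2 \<M>)" "\<phi> (q2 \<M> w2) \<noteq> \<zero>\<^bsub>S\<^esub>"
        "w3 \<in> carrier (C3 \<M>)" "\<phi> (q3 \<M> w3) \<noteq> \<zero>\<^bsub>S\<^esub>"
    have nz: "T1.\<iota> w1 \<noteq> \<zero>\<^bsub>T1.T\<^esub>" "T2.\<iota> w2 \<noteq> \<zero>\<^bsub>T2.T\<^esub>" "T3.\<iota> w3 \<noteq> \<zero>\<^bsub>T3.T\<^esub>"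
      using w q1[OF w(1)] q2[OF w(3)] q3[OF w(5)] E.A.q_zero E.B.q_zero E.D.q_zero by auto
    have "simple_jordan S E.J E.U"
      by (rule E.simple_over_field[OF field, of "T1.\<iota> w1" "T2.\<iota> w2" "T3.\<iota> w3"]) (use w nz in simp_all)
    moreover have "E.U x y \<in> carrier E.J" if "x \<in> carrier E.J" "y \<in> carrier E.J" for x y
      unfolding cubic_U_def
      by (intro E.J.M.minus_closed E.J.smult_closed E.T_closed E.cross_closed E.sharp_closed that)
    moreover have "cubic_U S TJ.T (TJ.\<iota> X0.e) D' sh' x y = \<Psi> (E.U (\<Theta> x) (\<Theta> y))" if "x \<in> carrier TJ.T" "y \<in> carrier TJ.T" for x y
      using I.transport_U[OF e E.cubic_form_N E.sharp_quadratic that] by (simp only: \<Theta>_base fold)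
    ultimately show "simple_jordan S TJ.T (cubic_U S TJ.T (TJ.\<iota> X0.e) D' sh')"
      by (rule I.transport_simple)
  qed
qed

lemma comp_module_fg_projective:
  assumes "cring R" "composition_of_rank8 R \<M>"
  shows "fg_projective R (comp_module R \<M>)"
  unfolding comp_module_eq_prod
  by (intro fg_projective_prod fg_projective_self assms(1)) (use assms(2) in \<open>simp_all add: composition_of_rank8_def\<close>)

lemma comp_module_constant_rank:
  assumes R: "cring R" and \<M>: "composition_of_rank8 R \<M>"
  shows "constant_rank R (comp_module R \<M>) 27"
proof -
  have M: "module R (C1 \<M>)" "module R (C2 \<M>)" "module R (C3 \<M>)"
    "constant_rank R (C1 \<M>) 8" "constant_rank R (C2 \<M>) 8" "constant_rank R (C3 \<M>) 8"
    using \<M> by (simp_all add: composition_of_rank8_def fg_projective_def)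
  have "constant_rank R (comp_module R \<M>) (1 + (1 + (1 + (8 + (8 + 8)))))"
    unfolding comp_module_eq_prod
    by (intro constant_rank_prod module_prod_module module_self_module constant_rank_self R M)
  then show ?thesis by simp
qed

theorem proposition3p8:
  fixes R :: "'r ring"
    and \<M> :: "('r, 'c1, 'c2, 'c3) composition"
    and \<gamma>1 \<gamma>2 \<gamma>3 :: 'r
  assumes "cring R"
    and "composition_of_rank8 R \<M>"
    and "\<gamma>1 \<in> Units R" and "\<gamma>2 \<in> Units R" and "\<gamma>3 \<in> Units R"
  shows "cubic_norm_structure TYPE('s) R (comp_module R \<M>) (comp_base R \<M>)
           (comp_norm R \<M> (\<gamma>1, \<gamma>2, \<gamma>3)) (comp_norm_deriv R \<M> (\<gamma>1, \<gamma>2, \<gamma>3))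
           (comp_sharp R \<M> (\<gamma>1, \<gamma>2, \<gamma>3))
       \<and> (\<forall>\<alpha>1\<in>carrier R. \<forall>\<alpha>2\<in>carrier R. \<forall>\<alpha>3\<in>carrier R.
          \<forall>u1\<in>carrier (C1 \<M>). \<forall>u2\<in>carrier (C2 \<M>). \<forall>u3\<in>carrier (C3 \<M>).
          \<forall>\<beta>1\<in>carrier R. \<forall>\<beta>2\<in>carrier R. \<forall>\<beta>3\<in>carrier R.
          \<forall>v1\<in>carrier (C1 \<M>). \<forall>v2\<in>carrier (C2 \<M>). \<forall>v3\<in>carrier (C3 \<M>).
            bilinear_trace R (comp_module R \<M>) (comp_base R \<M>)
              (comp_norm_deriv R \<M> (\<gamma>1, \<gamma>2, \<gamma>3))
              (\<alpha>1, \<alpha>2, \<alpha>3, u1, u2, u3) (\<beta>1, \<beta>2, \<beta>3, v1, v2, v3)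
            = (\<alpha>1 \<otimes>\<^bsub>R\<^esub> \<beta>1 \<oplus>\<^bsub>R\<^esub> \<alpha>2 \<otimes>\<^bsub>R\<^esub> \<beta>2 \<oplus>\<^bsub>R\<^esub> \<alpha>3 \<otimes>\<^bsub>R\<^esub> \<beta>3)
              \<oplus>\<^bsub>R\<^esub> (\<gamma>2 \<otimes>\<^bsub>R\<^esub> \<gamma>3 \<otimes>\<^bsub>R\<^esub> bil1 R \<M> u1 v1
                \<oplus>\<^bsub>R\<^esub> \<gamma>3 \<otimes>\<^bsub>R\<^esub> \<gamma>1 \<otimes>\<^bsub>R\<^esub> bil2 R \<M> u2 v2
                \<oplus>\<^bsub>R\<^esub> \<gamma>1 \<otimes>\<^bsub>R\<^esub> \<gamma>2 \<otimes>\<^bsub>R\<^esub> bil3 R \<M> u3 v3))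
       \<and> albert_algebra TYPE('s) TYPE('k) R (comp_module R \<M>) (comp_base R \<M>)
           (comp_norm R \<M> (\<gamma>1, \<gamma>2, \<gamma>3)) (comp_norm_deriv R \<M> (\<gamma>1, \<gamma>2, \<gamma>3))
           (comp_sharp R \<M> (\<gamma>1, \<gamma>2, \<gamma>3))"
proof -
  have full: "full_composition R \<M>" by (rule full_composition_of_rank8) fact+
  have proj: "fg_projective R (C1 \<M>)" "fg_projective R (C2 \<M>)" "fg_projective R (C3 \<M>)"
    and rank: "constant_rank R (C1 \<M>) 8" "constant_rank R (C2 \<M>) 8" "constant_rank R (C3 \<M>) 8"
    using assms(2) by (simp_all add: composition_of_rank8_def)
  interpret R: cring R by fact
  have \<gamma>: "\<gamma>1 \<in> carrier R" "\<gamma>2 \<in> carrier R" "\<gamma>3 \<in> carrier R" using assms(3-5) by (auto intro: R.Units_closed)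
  interpret X0: cubic_construction R \<M> \<gamma>1 \<gamma>2 \<gamma>3
    using full \<gamma> by (intro cubic_construction.intro cubic_construction_axioms.intro)
  have lift: "\<exists>N' D' sh'. scalar_extension R S \<phi> X0.J X0.N X0.N' X0.sharp N' D' sh' \<and>
      cubic_norm_identities S (tensor R S \<phi> X0.J) (pure_tensor R S \<phi> X0.J X0.e \<one>\<^bsub>S\<^esub>) N' D' sh'"
    if S: "cring S" "\<phi> \<in> ring_hom R S" for S :: "'s ring" and \<phi>
  proof -
    interpret base_change R S \<phi> by (intro base_change.intro base_change_axioms.intro assms(1) S)
    show ?thesis by (rule comp_construction_lift[OF full proj \<gamma>]) blast
  qed
  have norm_structure: "cubic_norm_structure TYPE('s) R X0.J X0.e X0.N X0.N' X0.sharp"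
    unfolding cubic_norm_structure_def
    by (intro conjI allI impI X0.module_J X0.e_closed X0.cubic_form_N X0.sharp_quadratic X0.cubic_norm_identities lift) simp_all
  have simple: "\<exists>N' D' sh'. scalar_extension R K \<phi> X0.J X0.N X0.N' X0.sharp N' D' sh' \<and>
      simple_jordan K (tensor R K \<phi> X0.J) (cubic_U K (tensor R K \<phi> X0.J) (pure_tensor R K \<phi> X0.J X0.e \<one>\<^bsub>K\<^esub>) D' sh')"
    if K: "field K" "\<phi> \<in> ring_hom R K" for K :: "'k ring" and \<phi>
  proof -
    interpret K: field K by fact
    interpret base_change R K \<phi> by (intro base_change.intro base_change_axioms.intro assms(1) K K.cring_axioms)
    let ?P = "{r \<in> carrier R. \<phi> r \<in> {\<zero>\<^bsub>K\<^esub>}}"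
    have "\<phi> r \<noteq> \<zero>\<^bsub>K\<^esub>" if r: "r \<in> Units R" for r
    proof
      assume "\<phi> r = \<zero>\<^bsub>K\<^esub>"
      then have "\<phi> (r \<otimes>\<^bsub>R\<^esub> inv\<^bsub>R\<^esub> r) = \<zero>\<^bsub>K\<^esub>"
        using r by (subst \<phi>_mult) (simp_all add: R.Units_closed)
      then show False using r by (simp add: R.Units_r_inv)
    qed
    note units = this[OF assms(3)] this[OF assms(4)] this[OF assms(5)]
    have prime: "primeideal ?P R" by (rule ring_hom_ring.primeideal_vimage[OF ring_hom_ringI2[OF R.ring_axioms K.ring_axioms K(2)] assms(1) K.zeroprimeideal])
    obtain w1 where w1: "w1 \<in> carrier (C1 \<M>)" "q1 \<M> w1 \<notin> ?P"
      by (rule X0.A.ex_not_in_prime[OF proj(1) rank(1) _ prime]) simp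
    obtain w2 where w2: "w2 \<in> carrier (C2 \<M>)" "q2 \<M> w2 \<notin> ?P"
      by (rule X0.B.ex_not_in_prime[OF proj(2) rank(2) _ prime]) simp
    obtain w3 where w3: "w3 \<in> carrier (C3 \<M>)" "q3 \<M> w3 \<notin> ?P"
      by (rule X0.D.ex_not_in_prime[OF proj(3) rank(3) _ prime]) simp
    have w: "\<phi> (q1 \<M> w1) \<noteq> \<zero>\<^bsub>K\<^esub>" "\<phi> (q2 \<M> w2) \<noteq> \<zero>\<^bsub>K\<^esub>" "\<phi> (q3 \<M> w3) \<noteq> \<zero>\<^bsub>K\<^esub>"
      using w1 w2 w3 by simp_all
    obtain N' D' sh' where ext: "scalar_extension R K \<phi> X0.J X0.N X0.N' X0.sharp N' D' sh'"
      and "\<And>w1 w2 w3. field K \<Longrightarrow> \<phi> \<gamma>1 \<noteq> \<zero>\<^bsub>K\<^esub> \<Longrightarrow> \<phi> \<gamma>2 \<noteq> \<zero>\<^bsub>K\<^esub> \<Longrightarrow> \<phi> \<gamma>3 \<noteq> \<zero>\<^bsub>K\<^esub> \<Longrightarrow>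
        w1 \<in> carrier (C1 \<M>) \<Longrightarrow> \<phi> (q1 \<M> w1) \<noteq> \<zero>\<^bsub>K\<^esub> \<Longrightarrow> w2 \<in> carrier (C2 \<M>) \<Longrightarrow> \<phi> (q2 \<M> w2) \<noteq> \<zero>\<^bsub>K\<^esub> \<Longrightarrow>
        w3 \<in> carrier (C3 \<M>) \<Longrightarrow> \<phi> (q3 \<M> w3) \<noteq> \<zero>\<^bsub>K\<^esub> \<Longrightarrow>
        simple_jordan K (tens X0.J) (cubic_U K (tens X0.J) (inc X0.J X0.e) D' sh')"
      by (rule comp_construction_lift[OF full proj \<gamma>]) (rule that; assumption)
    from this(2)[OF K(1) units w1(1) w(1) w2(1) w(2) w3(1) w(3)] ext show ?thesis by blast
  qed
  have "albert_algebra TYPE('s) TYPE('k) R X0.J X0.e X0.N X0.N' X0.sharp"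
    unfolding albert_algebra_def
    by (intro conjI allI impI norm_structure comp_module_fg_projective comp_module_constant_rank assms(1,2) simple) simp_all
  with norm_structure show ?thesis by (intro conjI ballI; (assumption | (subst X0.trace_formula; simp add: bil_defs))?)
qed

end
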